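(* The sequence $a_n:=2^n\operatorname{Vol}(\mathcal{H}_{3,n})$ satisfies, for all $n\ge1$, $$-4(n+1)^2(n+2)(2n+1)(n^2-n-7)\,a_n+2(n+2)^2(2n+5)(9n^3-90n-77)\,a_{n+1}$$ $$-(n+3)(2n+5)(2n+7)(13n^3+2n^2-164n-169)\,a_{n+2}+3(n+4)(2n+5)(2n+7)(2n+9)(n^2-3n-5)\,a_{n+3}=0,$$ and the sequence $b_n:=2^n\operatorname{Vol}(\mathcal{P}_{3,n}\cap \mathcal{D}_{3,n})$ satisfies, for all $n\ge1$, $$4(n+1)^2(n+2)(2n+1)(2n+3)\,b_n-20(n+2)^2(2n+3)(2n+5)^2\,b_{n+1}+5(n+3)(2n+5)^2(2n+7)(14n+43)\,b_{n+2}$$ $$-2(n+4)(2n+5)(2n+7)(2n+9)(50n+181)\,b_{n+3}+24(n+5)(2n+5)(2n+7)(2n+9)(2n+11)\,b_{n+4}=0.$$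
   Context: For integers $m\ge2$, $n\ge1$, let $\mathcal{P}_{m,n}$ be the set of $(x,y)\in\mathbb{R}^{m\times n}\times\mathbb{R}^m$ with $0\le x_{ij}\le y_i$ for all $1\le i\le m$, $1\le j\le n$, and $y_i\le 1$ for all $i$. Let $\mathcal{D}_{m,n}=\{(x,y)\in\mathbb{R}^{m\times n}\times\mathbb{R}^m:\ \sum_{i=1}^m x_{ij}=1\ \text{for all } 1\le j\le n\}$, an affine subspace of dimension $d=(m-1)n+m$. The integer hull is $\mathcal{H}_{m,n}:=\operatorname{conv}\{(x,y)\in \mathcal{P}_{m,n}\cap \mathcal{D}_{m,n}:\ y\in\{0,1\}^m\}$. For $K\subset\mathcal{D}_{m,n}$, $\operatorname{Vol}(K)$ denotes the $d$-dimensional Lebesgue measure of the image of $K$ under the coordinate projection $\mathcal{D}_{m,n}\to\mathbb{R}^d$ that deletes the variables $x_{mj}$, $1\le j\le n$ (an affine bijection). *)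

theory Defs
  imports "HOL-Analysis.Analysis" "HOL-Library.Function_Algebras"
begin

text \<open>Pointwise scalar multiplication makes function spaces real vector spaces, so that
  the library's convex hull is available for vectors indexed by \<^typ>\<open>nat\<close>.\<close>

instantiation "fun" :: (type, real_vector) real_vector
begin

definition "scaleR c f = (\<lambda>i. c *\<^sub>R f i)"

instance
  by standard (simp_all add: scaleR_fun_def fun_eq_iff scaleR_add_right scaleR_add_left)

end

lemma scaleR_fun_apply [simp]: "(c *\<^sub>R f) i = c *\<^sub>R f i"
  by (simp add: scaleR_fun_def)

text \<open>A point is a pair \<open>(x, y)\<close> of a matrix \<open>x\<close> and a vector \<open>y\<close>, both with 1-based indices.
  Since \<open>m\<close> and \<open>n\<close> vary, \<open>\<real>\<^sup>m\<^sup>\<times>\<^sup>n \<times> \<real>\<^sup>m\<close> is represented by the pairs that vanish at all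
  indices out of range.\<close>

type_synonym point = "(nat \<Rightarrow> nat \<Rightarrow> real) \<times> (nat \<Rightarrow> real)"

definition ambient :: "nat \<Rightarrow> nat \<Rightarrow> point set" where
  "ambient m n = {(x, y).
     (\<forall>i j. \<not> (i \<in> {1..m} \<and> j \<in> {1..n}) \<longrightarrow> x i j = 0) \<and>
     (\<forall>i. i \<notin> {1..m} \<longrightarrow> y i = 0)}"

definition P_poly :: "nat \<Rightarrow> nat \<Rightarrow> point set" where
  "P_poly m n = {(x, y) \<in> ambient m n.
     (\<forall>i\<in>{1..m}. \<forall>j\<in>{1..n}. 0 \<le> x i j \<and> x i j \<le> y i) \<and>
     (\<forall>i\<in>{1..m}. y i \<le> 1)}"

definition D_aff :: "nat \<Rightarrow> nat \<Rightarrow> point set" where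
  "D_aff m n = {(x, y) \<in> ambient m n. \<forall>j\<in>{1..n}. (\<Sum>i=1..m. x i j) = 1}"

definition int_hull :: "nat \<Rightarrow> nat \<Rightarrow> point set" where
  "int_hull m n =
     convex hull {(x, y) \<in> P_poly m n \<inter> D_aff m n. \<forall>i\<in>{1..m}. y i \<in> {0, 1}}"

text \<open>Coordinates kept by the projection: \<open>Inl (i, j)\<close> stands for \<open>x\<^sub>i\<^sub>j\<close> with \<open>i < m\<close>,
  and \<open>Inr i\<close> for \<open>y\<^sub>i\<close>.\<close>

definition coords :: "nat \<Rightarrow> nat \<Rightarrow> (nat \<times> nat + nat) set" where
  "coords m n = ({1..<m} \<times> {1..n}) <+> {1..m}"

definition coord_proj :: "nat \<Rightarrow> nat \<Rightarrow> point \<Rightarrow> (nat \<times> nat + nat \<Rightarrow> real)" where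
  "coord_proj m n = (\<lambda>(x, y). restrict (case_sum (\<lambda>(i, j). x i j) y) (coords m n))"

text \<open>Lebesgue measure on \<open>\<real>\<^sup>d\<close>, \<open>d = (m - 1) n + m\<close>, is the completion of the product of
  \<open>d\<close> copies of \<^term>\<open>lborel\<close>, indexed here by \<^term>\<open>coords m n\<close>.\<close>

definition Vol :: "nat \<Rightarrow> nat \<Rightarrow> point set \<Rightarrow> real" where
  "Vol m n K = measure (completion (\<Pi>\<^sub>M c\<in>coords m n. lborel)) (coord_proj m n ` K)"

definition a_seq :: "nat \<Rightarrow> real" where
  "a_seq n = 2 ^ n * Vol 3 n (int_hull 3 n)"

definition b_seq :: "nat \<Rightarrow> real" where
  "b_seq n = 2 ^ n * Vol 3 n (P_poly 3 n \<inter> D_aff 3 n)"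

end

theory Submission imports Defs begin

text \<open>For fixed \<open>y\<close> the columns of \<open>x\<close> vary independently, so \<open>2 ^ n\<close> times the fibre volume of the
  relaxation is the \<open>n\<close>-th power of twice the area of a polygon. The integer hull is cut out of the
  relaxation by the inequalities \<open>x 1 j1 + x 2 j2 + x 3 j3 + y 1 + y 2 + y 3 \<ge> 2\<close>, which only involve the
  coordinatewise minimum of the columns; the law of this minimum has the density
  \<open>- \<partial>\<^sub>u \<partial>\<^sub>v \<partial>\<^sub>w (s\<^sup>2 - u\<^sup>2 - v\<^sup>2 - w\<^sup>2) ^ n\<close> up to boundary terms. Integrating over \<open>y\<close>
  expresses both volumes by moments of quadratic forms on simplices and cones. Integrating a total
  derivative along rays gives first-order recurrences for these moments, and eliminating the moments
  leaves the two stated recurrences.\<close>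

section \<open>Volumes as iterated integrals\<close>

text \<open>The cut couples all columns, so the fibre of the hull over \<open>y\<close> is not a
  power of a polygon. With \<open>s = y1 + y2 + y3 - 1\<close>, the columns whose entries lie at
  least \<open>b1\<close>, \<open>b2\<close>, \<open>b3\<close> above \<open>y1 - s\<close>,
  \<open>y2 - s\<close>, \<open>y3 - s\<close> fill a triangle of size \<open>s\<close> with corners
  of sizes \<open>b1\<close>, \<open>b2\<close>, \<open>b3\<close> removed; while these corners are
  disjoint, twice its area is \<open>s^2 - b1^2 - b2^2 - b3^2\<close>. This tail is used only below
  the plane \<open>b1 + b2 + b3 = s\<close>, whereas the cut keeps what lies above it. Hence the
  fibre is total mass minus mass below, which leaves terms on a facet, an edge and a vertex. For
  \<open>s \<ge> 1\<close> the cut is void. The orders of the recurrences come from two triangular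
  systems of first-order recurrences. Over the rational functions of \<open>n\<close>,
  \<open>a_seq\<close> lies in the span of \<open>d3_seq\<close>, \<open>f_seq\<close>,
  \<open>h_seq\<close>, each driven by the next: order three. Likewise \<open>b_seq\<close> lies in
  the span of \<open>k_seq\<close>, \<open>c_seq\<close>, \<open>e_seq\<close> and
  \<open>(1/4)^n\<close>: order four. All integrals take values in \<open>ennreal\<close>, so every
  integration by parts is an equation between sums of nonnegative terms.\<close>

definition col_measure :: "nat \<Rightarrow> (nat \<Rightarrow> real \<times> real) measure" where
  "col_measure n = (\<Pi>\<^sub>M j\<in>{1..n}. lborel \<Otimes>\<^sub>M lborel)"

abbreviation lborel3 :: "(real \<times> real \<times> real) measure" where
  "lborel3 \<equiv> lborel \<Otimes>\<^sub>M (lborel \<Otimes>\<^sub>M lborel)"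

definition to_coords :: "nat \<Rightarrow> (nat \<Rightarrow> real \<times> real) \<times> (real \<times> real \<times> real) \<Rightarrow> (nat \<times> nat + nat \<Rightarrow> real)" where
  "to_coords n = (\<lambda>p. \<lambda>k\<in>coords 3 n. case k of
      Inl (i, j) \<Rightarrow> if i = 1 then fst (fst p j) else snd (fst p j)
    | Inr i \<Rightarrow> if i = 1 then fst (snd p) else if i = 2 then fst (snd (snd p)) else snd (snd (snd p)))"

text \<open>Inverse to \<open>to_coords\<close> on the underlying spaces. It pulls a predicate on
  columns and \<open>y\<close> back to the coordinates, which makes the projected set
  measurable.\<close>

definition of_coords :: "nat \<Rightarrow> (nat \<times> nat + nat \<Rightarrow> real) \<Rightarrow> (nat \<Rightarrow> real \<times> real) \<times> (real \<times> real \<times> real)" where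
  "of_coords n = (\<lambda>g. (\<lambda>j\<in>{1..n}. (g (Inl (1, j)), g (Inl (2, j))), (g (Inr 1), g (Inr 2), g (Inr 3))))"

lemma finite_coords: "finite (coords m n)"
  by (simp add: coords_def)

lemma Inl_in_coords [simp]: "Inl (i, j) \<in> coords 3 n \<longleftrightarrow> i \<in> {1, 2} \<and> j \<in> {1..n}"
  by (auto simp: coords_def)

lemma Inr_in_coords [simp]: "Inr i \<in> coords 3 n \<longleftrightarrow> i \<in> {1, 2, 3}"
  by (auto simp: coords_def)

lemma coords_cases:
  assumes "k \<in> coords 3 n"
  obtains j where "k = Inl (1, j)" "j \<in> {1..n}" | j where "k = Inl (2, j)" "j \<in> {1..n}"
    | "k = Inr 1" | "k = Inr 2" | "k = Inr 3"
proof -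
  have "(\<exists>j\<in>{1..n}. k = Inl (1, j)) \<or> (\<exists>j\<in>{1..n}. k = Inl (2, j)) \<or> k = Inr 1 \<or> k = Inr 2 \<or> k = Inr 3"
    using assms by (auto simp: coords_def)
  then show thesis using that by blast
qed

lemma ball_coords:
  "(\<forall>k\<in>coords 3 n. P k) \<longleftrightarrow>
    (\<forall>j\<in>{1..n}. P (Inl (1, j)) \<and> P (Inl (2, j))) \<and> P (Inr 1) \<and> P (Inr 2) \<and> P (Inr 3)"
proof safe
  fix k assume "\<forall>j\<in>{1..n}. P (Inl (1, j)) \<and> P (Inl (2, j))" "P (Inr 1)" "P (Inr 2)" "P (Inr 3)" "k \<in> coords 3 n"
  then show "P k" by (auto elim!: coords_cases)
qed simp_all

lemma sum_three: "(\<Sum>i=1..3. h i) = h 1 + h 2 + h 3" for h :: "nat \<Rightarrow> real"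
  by (simp add: numeral_3_eq_3 numeral_2_eq_2)

lemma sigma_finite_plane: "sigma_finite_measure (lborel \<Otimes>\<^sub>M lborel :: (real \<times> real) measure)"
  by (simp add: lborel_prod lborel.sigma_finite_measure_axioms)

lemma sigma_finite_space3: "sigma_finite_measure lborel3"
  by (simp add: lborel_prod lborel.sigma_finite_measure_axioms)

interpretation columns: product_sigma_finite "\<lambda>_::nat. lborel \<Otimes>\<^sub>M lborel :: (real \<times> real) measure"
  by (intro product_sigma_finite.intro sigma_finite_plane)

interpretation lines: product_sigma_finite "\<lambda>_::nat\<times>nat+nat. lborel :: real measure"
  by (standard)

interpretation space3: sigma_finite_measure lborel3
  by (rule sigma_finite_space3)

lemma sigma_finite_col_measure: "sigma_finite_measure (col_measure n)"
  unfolding col_measure_def by (rule columns.sigma_finite) simp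

interpretation cols_y: pair_sigma_finite "col_measure n" lborel3 for n
  by (intro pair_sigma_finite.intro sigma_finite_col_measure sigma_finite_space3)

lemma space_col_measure: "space (col_measure n) = {1..n} \<rightarrow>\<^sub>E UNIV"
  by (simp add: col_measure_def space_PiM space_pair_measure)

lemma to_coords_measurable [measurable]:
  "to_coords n \<in> measurable (col_measure n \<Otimes>\<^sub>M lborel3) (\<Pi>\<^sub>M k\<in>coords 3 n. lborel)"
  unfolding to_coords_def col_measure_def
proof (rule measurable_restrict)
  fix k assume "k \<in> coords 3 n"
  then show "(\<lambda>p. case k of Inl (i, j) \<Rightarrow> if i = 1 then fst (fst p j) else snd (fst p j)
        | Inr i \<Rightarrow> if i = 1 then fst (snd p) else if i = 2 then fst (snd (snd p)) else snd (snd (snd p)))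
      \<in> measurable ((\<Pi>\<^sub>M j\<in>{1..n}. lborel \<Otimes>\<^sub>M lborel) \<Otimes>\<^sub>M lborel3) lborel"
  proof (cases k rule: coords_cases)
    case (1 j)
    have [measurable]: "(\<lambda>p. fst p j) \<in> measurable ((\<Pi>\<^sub>M j\<in>{1..n}. lborel \<Otimes>\<^sub>M lborel) \<Otimes>\<^sub>M lborel3) (lborel \<Otimes>\<^sub>M lborel :: (real \<times> real) measure)"
      using 1(2) by (intro measurable_compose[OF measurable_fst] measurable_component_singleton)
    have "(\<lambda>p. fst (fst p j)) \<in> measurable ((\<Pi>\<^sub>M j\<in>{1..n}. lborel \<Otimes>\<^sub>M lborel) \<Otimes>\<^sub>M lborel3) (lborel :: real measure)"
      using 1(2) by measurable
    then show ?thesis using 1 by simp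
  next
    case (2 j)
    have [measurable]: "(\<lambda>p. fst p j) \<in> measurable ((\<Pi>\<^sub>M j\<in>{1..n}. lborel \<Otimes>\<^sub>M lborel) \<Otimes>\<^sub>M lborel3) (lborel \<Otimes>\<^sub>M lborel :: (real \<times> real) measure)"
      using 2(2) by (intro measurable_compose[OF measurable_fst] measurable_component_singleton)
    have "(\<lambda>p. snd (fst p j)) \<in> measurable ((\<Pi>\<^sub>M j\<in>{1..n}. lborel \<Otimes>\<^sub>M lborel) \<Otimes>\<^sub>M lborel3) (lborel :: real measure)"
      using 2(2) by measurable
    then show ?thesis using 2 by simp
  qed simp_all
qed

lemma of_coords_measurable [measurable]:
  "of_coords n \<in> measurable (\<Pi>\<^sub>M k\<in>coords 3 n. lborel) (col_measure n \<Otimes>\<^sub>M lborel3)"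
proof -
  have [measurable]: "(\<lambda>g. g (Inl (1, j))) \<in> measurable (\<Pi>\<^sub>M k\<in>coords 3 n. lborel) (lborel :: real measure)"
       "(\<lambda>g. g (Inl (2, j))) \<in> measurable (\<Pi>\<^sub>M k\<in>coords 3 n. lborel) (lborel :: real measure)" if "j \<in> {1..n}" for j
    using that by (auto intro!: measurable_component_singleton)
  have [measurable]: "(\<lambda>g. g (Inr i)) \<in> measurable (\<Pi>\<^sub>M k\<in>coords 3 n. lborel) (lborel :: real measure)" if "i \<in> {1,2,3}" for i
    using that by (auto intro!: measurable_component_singleton)
  show ?thesis
    unfolding of_coords_def col_measure_def
    by (intro measurable_Pair measurable_restrict) (simp_all del: One_nat_def)
qed

lemma of_to_coords:
  assumes "p \<in> space (col_measure n \<Otimes>\<^sub>M lborel3)"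
  shows "of_coords n (to_coords n p) = p"
proof -
  obtain c y1 y2 y3 where p: "p = (c, y1, y2, y3)" by (metis prod.exhaust)
  have "c \<in> extensional {1..n}"
    using assms by (simp add: p space_pair_measure space_col_measure PiE_def)
  then have "(\<lambda>j\<in>{1..n}. (fst (c j), snd (c j))) = c"
    by (simp add: extensional_restrict)
  moreover have "of_coords n (to_coords n p) = ((\<lambda>j\<in>{1..n}. (fst (c j), snd (c j))), y1, y2, y3)"
    by (auto simp: of_coords_def to_coords_def p intro!: restrict_ext)
  ultimately show ?thesis by (simp add: p)
qed

text \<open>Both sides multiply the same \<open>2 n + 3\<close> copies of \<open>lborel\<close>,
  bracketed differently. The product measure is determined by its values on boxes, and a box in the
  coordinates is a product of \<open>n\<close> rectangles, one per column, and a box for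
  \<open>y\<close>.\<close>

lemma distr_to_coords:
  "distr (col_measure n \<Otimes>\<^sub>M lborel3) (\<Pi>\<^sub>M k\<in>coords 3 n. lborel) (to_coords n) = (\<Pi>\<^sub>M k\<in>coords 3 n. lborel)"
    (is "?D = ?P")
proof (rule lines.PiM_eqI[OF finite_coords])
  show "sets ?D = sets ?P" by simp
next
  fix A :: "nat \<times> nat + nat \<Rightarrow> real set"
  assume A: "\<And>k. k \<in> coords 3 n \<Longrightarrow> A k \<in> sets lborel"
  let ?B = "\<lambda>j. A (Inl (1, j)) \<times> A (Inl (2, j))"
  let ?C = "A (Inr 1) \<times> A (Inr 2) \<times> A (Inr 3)"
  have pre: "to_coords n -` Pi\<^sub>E (coords 3 n) A \<inter> space (col_measure n \<Otimes>\<^sub>M lborel3) = Pi\<^sub>E {1..n} ?B \<times> ?C"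
    (is "?L = ?R")
  proof (rule set_eqI)
    fix p :: "(nat \<Rightarrow> real \<times> real) \<times> (real \<times> real \<times> real)"
    have "to_coords n p \<in> extensional (coords 3 n)"
      by (simp add: to_coords_def split_def)
    then have "to_coords n p \<in> Pi\<^sub>E (coords 3 n) A \<longleftrightarrow> (\<forall>k\<in>coords 3 n. to_coords n p k \<in> A k)"
      by (simp add: PiE_iff)
    also have "\<dots> \<longleftrightarrow> (\<forall>j\<in>{1..n}. to_coords n p (Inl (1, j)) \<in> A (Inl (1, j)) \<and> to_coords n p (Inl (2, j)) \<in> A (Inl (2, j)))
         \<and> to_coords n p (Inr 1) \<in> A (Inr 1) \<and> to_coords n p (Inr 2) \<in> A (Inr 2) \<and> to_coords n p (Inr 3) \<in> A (Inr 3)"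
      by (rule ball_coords)
    also have "\<dots> \<longleftrightarrow> (\<forall>j\<in>{1..n}. fst p j \<in> ?B j) \<and> snd p \<in> ?C"
      by (cases p) (auto simp: to_coords_def mem_Times_iff)
    finally show "p \<in> ?L \<longleftrightarrow> p \<in> ?R"
      by (cases p) (auto simp: space_pair_measure space_col_measure PiE_iff)
  qed
  have B: "?B j \<in> sets (lborel \<Otimes>\<^sub>M lborel)" if "j \<in> {1..n}" for j
    using that by (intro pair_measureI A) auto
  have C2: "A (Inr 2) \<times> A (Inr 3) \<in> sets (lborel \<Otimes>\<^sub>M lborel)"
    by (intro pair_measureI A) auto
  have C: "?C \<in> sets lborel3"
    by (intro pair_measureI A C2) auto
  have PB: "Pi\<^sub>E {1..n} ?B \<in> sets (col_measure n)"
    unfolding col_measure_def using B by (intro sets_PiM_I_finite) auto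
  have box: "Pi\<^sub>E (coords 3 n) A \<in> sets ?P"
    using A by (intro sets_PiM_I_finite finite_coords) auto
  have two: "emeasure (lborel \<Otimes>\<^sub>M lborel) (S \<times> T) = emeasure lborel S * emeasure lborel T"
    if "S \<in> sets lborel" "T \<in> sets lborel" for S T :: "real set"
    using that by (rule lborel.emeasure_pair_measure_Times)
  have "emeasure ?D (Pi\<^sub>E (coords 3 n) A) = emeasure (col_measure n \<Otimes>\<^sub>M lborel3) (Pi\<^sub>E {1..n} ?B \<times> ?C)"
    by (subst emeasure_distr[OF to_coords_measurable box]) (simp only: pre)
  also have "\<dots> = emeasure (col_measure n) (Pi\<^sub>E {1..n} ?B) * emeasure lborel3 ?C"
    by (rule space3.emeasure_pair_measure_Times[OF PB C])
  also have "emeasure (col_measure n) (Pi\<^sub>E {1..n} ?B) = (\<Prod>j\<in>{1..n}. emeasure (lborel \<Otimes>\<^sub>M lborel) (?B j))"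
    unfolding col_measure_def using B by (intro columns.emeasure_PiM) auto
  also have "\<dots> = (\<Prod>j\<in>{1..n}. emeasure lborel (A (Inl (1, j))) * emeasure lborel (A (Inl (2, j))))"
    using A by (intro prod.cong refl two) auto
  also have "emeasure lborel3 ?C = emeasure lborel (A (Inr 1)) * (emeasure lborel (A (Inr 2)) * emeasure lborel (A (Inr 3)))"
  proof -
    show ?thesis
      using A C2 by (subst sigma_finite_measure.emeasure_pair_measure_Times[OF sigma_finite_plane]) (simp_all add: two)
  qed
  also have "(\<Prod>j\<in>{1..n}. emeasure lborel (A (Inl (1, j))) * emeasure lborel (A (Inl (2, j)))) *
      (emeasure lborel (A (Inr 1)) * (emeasure lborel (A (Inr 2)) * emeasure lborel (A (Inr 3))))
      = (\<Prod>k\<in>coords 3 n. emeasure lborel (A k))"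
  proof -
    have 1: "{1..<3::nat} = {1,2}" "{1..3::nat} = {1,2,3}" by auto
    have "(\<Prod>k\<in>coords 3 n. emeasure lborel (A k)) =
        (\<Prod>k\<in>{1,2} \<times> {1..n}. emeasure lborel (A (Inl k))) * (\<Prod>i\<in>{1,2,3}. emeasure lborel (A (Inr i)))"
      unfolding coords_def 1 by (subst prod.Plus) auto
    also have "(\<Prod>k\<in>{1,2} \<times> {1..n}. emeasure lborel (A (Inl k))) =
        (\<Prod>i\<in>{1,2}. \<Prod>j\<in>{1..n}. emeasure lborel (A (Inl (i, j))))"
      by (simp only: prod.cartesian_product split_def prod.collapse)
    finally show ?thesis by (simp add: prod.distrib mult_ac)
  qed
  finally show "emeasure ?D (Pi\<^sub>E (coords 3 n) A) = (\<Prod>k\<in>coords 3 n. emeasure lborel (A k))" .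
qed

text \<open>The predicate sees only the first two rows because the projection deletes the third,
  which the column sums in \<open>D_aff\<close> restore. Tonelli then puts \<open>y\<close> outside
  and the columns inside. The projected set is measurable for the product measure itself, so the
  completion in \<open>Vol\<close> does not change its measure.\<close>

lemma Vol_eq_iterated:
  fixes \<Phi> :: "(nat \<Rightarrow> real \<times> real) \<Rightarrow> real \<Rightarrow> real \<Rightarrow> real \<Rightarrow> bool"
  assumes meas: "{p \<in> space (col_measure n \<Otimes>\<^sub>M lborel3). case p of (c, y1, y2, y3) \<Rightarrow> \<Phi> c y1 y2 y3}
      \<in> sets (col_measure n \<Otimes>\<^sub>M lborel3)"
  shows "Vol 3 n {(x, y) \<in> D_aff 3 n. \<Phi> (\<lambda>j\<in>{1..n}. (x 1 j, x 2 j)) (y 1) (y 2) (y 3)} =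
    enn2real (\<integral>\<^sup>+ y1. \<integral>\<^sup>+ y2. \<integral>\<^sup>+ y3. emeasure (col_measure n) {c \<in> space (col_measure n). \<Phi> c y1 y2 y3} \<partial>lborel \<partial>lborel \<partial>lborel)"
proof -
  let ?M = "col_measure n \<Otimes>\<^sub>M lborel3"
  let ?P = "\<Pi>\<^sub>M k\<in>coords 3 n. lborel :: real measure"
  let ?\<Phi> = "\<lambda>p. case p of (c, y1, y2, y3) \<Rightarrow> \<Phi> c y1 y2 y3"
  let ?S = "{p \<in> space ?M. ?\<Phi> p}"
  let ?K = "{(x, y) \<in> D_aff 3 n. \<Phi> (\<lambda>j\<in>{1..n}. (x 1 j, x 2 j)) (y 1) (y 2) (y 3)}"
  let ?I = "{g \<in> space ?P. ?\<Phi> (of_coords n g)}"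
  have im: "coord_proj 3 n ` ?K = ?I"
  proof (rule set_eqI, rule iffI)
    fix g assume "g \<in> coord_proj 3 n ` ?K"
    then obtain x y where xy: "(x, y) \<in> ?K" and g: "g = coord_proj 3 n (x, y)" by auto
    have "of_coords n g = (\<lambda>j\<in>{1..n}. (x 1 j, x 2 j), y 1, y 2, y 3)"
      by (auto simp: g of_coords_def coord_proj_def restrict_def fun_eq_iff)
    moreover have "g \<in> space ?P"
      by (auto simp: g coord_proj_def space_PiM)
    ultimately show "g \<in> ?I" using xy by simp
  next
    fix g assume g: "g \<in> ?I"
    \<comment> \<open>The preimage of \<open>g\<close>: the third row is forced by the column sums,
      and the zeros outside the index range place the point in \<open>ambient\<close>.\<close>
    define x :: "nat \<Rightarrow> nat \<Rightarrow> real" where "x = (\<lambda>i j. if j \<in> {1..n} then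
        if i = 1 \<or> i = 2 then g (Inl (i, j)) else if i = 3 then 1 - g (Inl (1, j)) - g (Inl (2, j)) else 0 else 0)"
    define y :: "nat \<Rightarrow> real" where "y = (\<lambda>i. if i \<in> {1..3} then g (Inr i) else 0)"
    have "(x, y) \<in> D_aff 3 n"
      unfolding D_aff_def by (auto simp: ambient_def sum_three[simplified] x_def y_def)
    moreover have "of_coords n g = (\<lambda>j\<in>{1..n}. (x 1 j, x 2 j), y 1, y 2, y 3)"
      by (auto simp: of_coords_def x_def y_def fun_eq_iff)
    ultimately have "(x, y) \<in> ?K" using g by simp
    moreover have "g = coord_proj 3 n (x, y)"
    proof
      fix k show "g k = coord_proj 3 n (x, y) k"
      proof (cases "k \<in> coords 3 n")
        case True then show ?thesis
          by (cases k rule: coords_cases) (simp_all add: coord_proj_def x_def y_def)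
      next
        case False then show ?thesis
          using extensional_arb[of g "coords 3 n" k] g by (simp add: coord_proj_def space_PiM PiE_def)
      qed
    qed
    ultimately show "g \<in> coord_proj 3 n ` ?K" by blast
  qed
  have I: "?I \<in> sets ?P"
  proof -
    have "of_coords n -` ?S \<inter> space ?P \<in> sets ?P"
      by (rule measurable_sets[OF of_coords_measurable meas])
    moreover have "of_coords n -` ?S \<inter> space ?P = ?I"
      using measurable_space[OF of_coords_measurable] by (auto simp: vimage_def Int_def)
    ultimately show ?thesis by simp
  qed
  have "emeasure ?P ?I = emeasure (distr ?M ?P (to_coords n)) ?I"
    by (simp only: distr_to_coords)
  also have "\<dots> = emeasure ?M (to_coords n -` ?I \<inter> space ?M)"
    by (rule emeasure_distr[OF to_coords_measurable I])
  also have "to_coords n -` ?I \<inter> space ?M = ?S"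
    using measurable_space[OF to_coords_measurable] by (auto simp: of_to_coords)
  also have "emeasure ?M ?S = (\<integral>\<^sup>+ y. emeasure (col_measure n) ((\<lambda>c. (c, y)) -` ?S) \<partial>lborel3)"
    using meas by (rule cols_y.emeasure_pair_measure_alt2)
  also have "\<dots> = (\<integral>\<^sup>+ y. (case y of (y1, y2, y3) \<Rightarrow> emeasure (col_measure n) {c \<in> space (col_measure n). \<Phi> c y1 y2 y3}) \<partial>lborel3)"
    by (intro nn_integral_cong arg_cong2[where f = emeasure] refl)
       (auto simp: space_pair_measure intro!: arg_cong2[where f = emeasure])
  also have "\<dots> = (\<integral>\<^sup>+ y1. \<integral>\<^sup>+ y2. \<integral>\<^sup>+ y3. emeasure (col_measure n) {c \<in> space (col_measure n). \<Phi> c y1 y2 y3} \<partial>lborel \<partial>lborel \<partial>lborel)"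
  proof -
    have [measurable]: "(\<lambda>y. case y of (y1, y2, y3) \<Rightarrow> emeasure (col_measure n) {c \<in> space (col_measure n). \<Phi> c y1 y2 y3}) \<in> borel_measurable lborel3"
      (is "?f \<in> _")
    proof -
      have "?f = (\<lambda>y. emeasure (col_measure n) ((\<lambda>c. (c, y)) -` ?S))"
        by (auto simp: fun_eq_iff space_pair_measure intro!: arg_cong2[where f = emeasure])
      also have "\<dots> \<in> borel_measurable lborel3"
        using meas by (rule cols_y.measurable_emeasure_Pair2)
      finally show ?thesis .
    qed
    have [measurable]: "(\<lambda>(y2, y3). emeasure (col_measure n) {c \<in> space (col_measure n). \<Phi> c y1 y2 y3}) \<in> borel_measurable (lborel \<Otimes>\<^sub>M lborel)" for y1
      using measurable_compose[of "\<lambda>q. (y1, q)" "lborel \<Otimes>\<^sub>M lborel" lborel3 ?f borel] by simp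
    show ?thesis
      by (subst sigma_finite_measure.nn_integral_fst[OF sigma_finite_plane, symmetric], measurable)
         (simp add: lborel.nn_integral_fst[symmetric])
  qed
  finally have "emeasure ?P ?I = (\<integral>\<^sup>+ y1. \<integral>\<^sup>+ y2. \<integral>\<^sup>+ y3. emeasure (col_measure n) {c \<in> space (col_measure n). \<Phi> c y1 y2 y3} \<partial>lborel \<partial>lborel \<partial>lborel)" .
  then show ?thesis
    unfolding Vol_def im measure_def using I by simp
qed

section \<open>Areas of column polygons\<close>

definition cell :: "real \<Rightarrow> real \<Rightarrow> real \<Rightarrow> real \<Rightarrow> real \<Rightarrow> real \<Rightarrow> (real \<times> real) set" where
  "cell a1 a2 a3 y1 y2 y3 = {(u, v). a1 \<le> u \<and> u \<le> y1 \<and> a2 \<le> v \<and> v \<le> y2 \<and> a3 \<le> 1 - u - v \<and> 1 - u - v \<le> y3}"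

text \<open>Lower bounds on all three entries of a column cut out a right isosceles triangle whose
  legs have length \<open>1 - p - q - r\<close>.\<close>

definition corner :: "real \<Rightarrow> real \<Rightarrow> real \<Rightarrow> (real \<times> real) set" where
  "corner p q r = {(u, v). p \<le> u \<and> q \<le> v \<and> r \<le> 1 - u - v}"

text \<open>Twice the area of a right isosceles triangle with leg \<open>x\<close>; a negative
  \<open>x\<close> stands for an empty triangle.\<close>

definition posq :: "real \<Rightarrow> real" where
  "posq x = (max 0 x)\<^sup>2"

lemma cell_measurable [measurable]: "cell a1 a2 a3 y1 y2 y3 \<in> sets (lborel \<Otimes>\<^sub>M lborel)"
proof -
  have *: "cell a1 a2 a3 y1 y2 y3 = {p \<in> space (lborel \<Otimes>\<^sub>M lborel). a1 \<le> fst p \<and> fst p \<le> y1 \<and> a2 \<le> snd p \<and> snd p \<le> y2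
      \<and> a3 \<le> 1 - fst p - snd p \<and> 1 - fst p - snd p \<le> y3}"
    by (auto simp: cell_def space_pair_measure)
  show ?thesis unfolding * by measurable
qed

lemma corner_measurable [measurable]: "corner p q r \<in> sets (lborel \<Otimes>\<^sub>M lborel)"
proof -
  have *: "corner p q r = {x \<in> space (lborel \<Otimes>\<^sub>M lborel). p \<le> fst x \<and> q \<le> snd x \<and> r \<le> 1 - fst x - snd x}"
    by (auto simp: corner_def space_pair_measure)
  show ?thesis unfolding * by measurable
qed

lemma emeasure_corner: "emeasure (lborel \<Otimes>\<^sub>M lborel) (corner p q r) = ennreal (posq (1 - p - q - r) / 2)"
proof -
  let ?m = "1 - q - r"
  have "emeasure (lborel \<Otimes>\<^sub>M lborel) (corner p q r) = (\<integral>\<^sup>+ u. emeasure lborel (Pair u -` corner p q r) \<partial>lborel)"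
    by (rule lborel.emeasure_pair_measure_alt[OF corner_measurable])
  also have "\<dots> = (\<integral>\<^sup>+ u. ennreal (?m - u) * indicator {p..?m} u \<partial>lborel)"
  proof (intro nn_integral_cong)
    fix u :: real
    have "Pair u -` corner p q r = (if p \<le> u then {q..1 - r - u} else {})"
      by (auto simp: corner_def)
    then show "emeasure lborel (Pair u -` corner p q r) = ennreal (?m - u) * indicator {p..?m} u"
      by (auto simp: indicator_def algebra_simps)
  qed
  also have "\<dots> = ennreal (posq (1 - p - q - r) / 2)"
  proof (cases "p \<le> ?m")
    case True
    have "(\<integral>\<^sup>+ u. ennreal (?m - u) * indicator {p..?m} u \<partial>lborel) = ennreal (- ((?m - ?m)\<^sup>2) / 2 - (- ((?m - p)\<^sup>2) / 2))"
      by (rule nn_integral_FTC_Icc) (use True in \<open>auto intro!: derivative_eq_intros simp: field_simps\<close>)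
    also have "\<dots> = ennreal (posq (1 - p - q - r) / 2)"
      using True by (auto simp: posq_def max_def algebra_simps)
    finally show ?thesis .
  next
    case False
    then show ?thesis by (auto simp: posq_def max_def)
  qed
  finally show ?thesis .
qed

lemma emeasure_corner_finite: "emeasure (lborel \<Otimes>\<^sub>M lborel) (corner p q r) < \<infinity>"
  by (simp add: emeasure_corner)

lemma measure_corner: "measure (lborel \<Otimes>\<^sub>M lborel) (corner p q r) = posq (1 - p - q - r) / 2"
  by (simp add: measure_def emeasure_corner posq_def)

text \<open>Twice the area of \<open>cell\<close>, by inclusion-exclusion over corner triangles:
  violating an upper bound \<open>y1\<close> means obeying it as a lower bound.\<close>

definition cell_area :: "real \<Rightarrow> real \<Rightarrow> real \<Rightarrow> real \<Rightarrow> real \<Rightarrow> real \<Rightarrow> real" where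
  "cell_area a1 a2 a3 y1 y2 y3 =
     (posq (1 - a1 - a2 - a3) - posq (1 - y1 - a2 - a3) - posq (1 - a1 - y2 - a3) - posq (1 - a1 - a2 - y3)
      + posq (1 - y1 - y2 - a3) + posq (1 - y1 - a2 - y3) + posq (1 - a1 - y2 - y3) - posq (1 - y1 - y2 - y3))"

text \<open>The three lines carry the upper boundary of a cell, the only place where a difference of
  closed half-plane indicators differs from the indicator of a closed strip.\<close>

lemma AE_off_line:
  "AE p in lborel \<Otimes>\<^sub>M lborel. fst p \<noteq> (c1::real) \<and> snd p \<noteq> (c2::real) \<and> snd p \<noteq> 1 - fst p - c3"
proof (rule lborel_pair.AE_pair_measure)
  show "{p \<in> space (lborel \<Otimes>\<^sub>M lborel). fst p \<noteq> c1 \<and> snd p \<noteq> c2 \<and> snd p \<noteq> 1 - fst p - c3} \<in> sets (lborel \<Otimes>\<^sub>M lborel)"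
    by measurable
  show "AE u in lborel. AE v in lborel. fst (u, v) \<noteq> c1 \<and> snd (u, v) \<noteq> c2 \<and> snd (u, v) \<noteq> 1 - fst (u, v) - c3"
    using AE_lborel_singleton[of c1]
  proof eventually_elim
    case (elim u)
    show ?case
      using AE_lborel_singleton[of c2] AE_lborel_singleton[of "1 - u - c3"]
      by eventually_elim (simp add: elim)
  qed
qed

text \<open>Up to a null set the indicator of the cell is the product of three differences of half-plane
  indicators; expanding the product leaves a signed sum of triangles.\<close>

lemma emeasure_cell:
  assumes "a1 \<le> y1" "a2 \<le> y2" "a3 \<le> y3"
  shows "emeasure (lborel \<Otimes>\<^sub>M lborel) (cell a1 a2 a3 y1 y2 y3) = ennreal (cell_area a1 a2 a3 y1 y2 y3 / 2)"
    and "0 \<le> cell_area a1 a2 a3 y1 y2 y3"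
proof -
  let ?L = "lborel \<Otimes>\<^sub>M lborel :: (real \<times> real) measure"
  let ?i = "\<lambda>p q r x. indicator (corner p q r) x :: real"
  let ?f = "\<lambda>x. ?i a1 a2 a3 x - ?i y1 a2 a3 x - ?i a1 y2 a3 x - ?i a1 a2 y3 x
      + ?i y1 y2 a3 x + ?i y1 a2 y3 x + ?i a1 y2 y3 x - ?i y1 y2 y3 x"
  have int: "has_bochner_integral ?L (?i p q r) (posq (1 - p - q - r) / 2)" for p q r
    using has_bochner_integral_real_indicator[OF corner_measurable emeasure_corner_finite, of p q r]
    by (simp only: measure_corner)
  have "has_bochner_integral ?L ?f
     (posq (1 - a1 - a2 - a3) / 2 - posq (1 - y1 - a2 - a3) / 2 - posq (1 - a1 - y2 - a3) / 2 - posq (1 - a1 - a2 - y3) / 2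
      + posq (1 - y1 - y2 - a3) / 2 + posq (1 - y1 - a2 - y3) / 2 + posq (1 - a1 - y2 - y3) / 2 - posq (1 - y1 - y2 - y3) / 2)"
    by (intro has_bochner_integral_add has_bochner_integral_diff int)
  then have f: "has_bochner_integral ?L ?f (cell_area a1 a2 a3 y1 y2 y3 / 2)"
    by (simp add: cell_area_def diff_divide_distrib add_divide_distrib)
  have "AE x in ?L. ?f x = indicator (cell a1 a2 a3 y1 y2 y3) x"
    using AE_off_line[of y1 y2 y3]
  proof eventually_elim
    case (elim x)
    have *: "?i p q r x = (if p \<le> fst x then 1 else 0) * (if q \<le> snd x then 1 else 0) * (if r \<le> 1 - fst x - snd x then 1 else 0)" for p q r
      by (cases x) (auto simp: corner_def)
    have **: "indicator (cell a1 a2 a3 y1 y2 y3) x =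
       ((if a1 \<le> fst x then 1 else 0) - (if y1 \<le> fst x then 1 else 0)) *
       ((if a2 \<le> snd x then 1 else 0) - (if y2 \<le> snd x then 1 else 0)) *
       ((if a3 \<le> 1 - fst x - snd x then 1 else 0) - (if y3 \<le> 1 - fst x - snd x then 1 else (0::real)))"
    proof -
      have 1: "(if a \<le> t then 1 else 0) - (if y \<le> t then 1 else 0) = (if a \<le> t \<and> t \<le> y then 1 else (0::real))"
        if "a \<le> y" "t \<noteq> y" for a y t :: real
        using that by auto
      have "x \<in> cell a1 a2 a3 y1 y2 y3 \<longleftrightarrow> (a1 \<le> fst x \<and> fst x \<le> y1) \<and> (a2 \<le> snd x \<and> snd x \<le> y2) \<and>
          (a3 \<le> 1 - fst x - snd x \<and> 1 - fst x - snd x \<le> y3)"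
        by (cases x) (simp add: cell_def)
      moreover have "1 - fst x - snd x \<noteq> y3"
        using elim by linarith
      ultimately show ?thesis
        using elim by (simp add: 1[OF assms(1)] 1[OF assms(2)] 1[OF assms(3)] indicator_def)
    qed
    have "p1 * p2 * p3 - q1 * p2 * p3 - p1 * q2 * p3 - p1 * p2 * q3 + q1 * q2 * p3 + q1 * p2 * q3 + p1 * q2 * q3 - q1 * q2 * q3
        = (p1 - q1) * (p2 - q2) * (p3 - q3)" for p1 p2 p3 q1 q2 q3 :: real
      by (simp add: algebra_simps)
    then show ?case unfolding * ** .
  qed
  then have g: "has_bochner_integral ?L (indicator (cell a1 a2 a3 y1 y2 y3)) (cell_area a1 a2 a3 y1 y2 y3 / 2)"
    by (subst has_bochner_integral_cong_AE[THEN iffD1, OF _ _ _ f]) auto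
  have "cell a1 a2 a3 y1 y2 y3 \<subseteq> corner a1 a2 a3"
    by (auto simp: cell_def corner_def)
  then have fin: "emeasure ?L (cell a1 a2 a3 y1 y2 y3) < \<infinity>"
    using emeasure_mono[OF _ corner_measurable] emeasure_corner_finite le_less_trans by blast
  have m: "measure ?L (cell a1 a2 a3 y1 y2 y3) = cell_area a1 a2 a3 y1 y2 y3 / 2"
    using has_bochner_integral_integral_eq[OF g] by (simp add: space_pair_measure)
  then show "emeasure ?L (cell a1 a2 a3 y1 y2 y3) = ennreal (cell_area a1 a2 a3 y1 y2 y3 / 2)"
    using fin by (subst emeasure_eq_ennreal_measure) (simp_all only: m infinity_ennreal_def less_irrefl not_False_eq_True less_top)
  have "0 \<le> measure ?L (cell a1 a2 a3 y1 y2 y3)" by (rule measure_nonneg)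
  then show "0 \<le> cell_area a1 a2 a3 y1 y2 y3"
    by (simp add: m)
qed

lemma emeasure_col_power:
  assumes "Q \<in> sets (lborel \<Otimes>\<^sub>M lborel)"
  shows "emeasure (col_measure n) {c \<in> space (col_measure n). \<forall>j\<in>{1..n}. c j \<in> Q} = emeasure (lborel \<Otimes>\<^sub>M lborel) Q ^ n"
proof -
  have "{c \<in> space (col_measure n). \<forall>j\<in>{1..n}. c j \<in> Q} = Pi\<^sub>E {1..n} (\<lambda>_. Q)"
    by (auto simp: space_col_measure PiE_iff extensional_def)
  then show ?thesis
    using assms by (simp add: col_measure_def columns.emeasure_PiM)
qed

text \<open>This is the origin of the normalisation \<open>2 ^ n\<close>: each column contributes
  half of \<open>cell_area\<close>.\<close>

lemma emeasure_col_cells: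
  assumes "a1 \<le> y1" "a2 \<le> y2" "a3 \<le> y3"
  shows "2 ^ n * emeasure (col_measure n) {c \<in> space (col_measure n). \<forall>j\<in>{1..n}. c j \<in> cell a1 a2 a3 y1 y2 y3}
    = ennreal (cell_area a1 a2 a3 y1 y2 y3 ^ n)"
proof -
  have "2 ^ n * ennreal (x / 2) ^ n = ennreal (x ^ n)" if "0 \<le> x" for x
  proof -
    have "2 * ennreal (x / 2) = ennreal x"
      using that by (subst ennreal_numeral[symmetric], subst ennreal_mult[symmetric]) auto
    then have "(2 * ennreal (x / 2)) ^ n = ennreal (x ^ n)" using that by (simp only: ennreal_power)
    then show ?thesis by (simp only: power_mult_distrib)
  qed
  then show ?thesis
    using emeasure_cell(2)[OF assms] by (simp only: emeasure_col_power[OF cell_measurable] emeasure_cell(1)[OF assms])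
qed

section \<open>Measures on a half-open tetrahedron, compared on boxes\<close>

definition hbox :: "real \<Rightarrow> real \<Rightarrow> real \<Rightarrow> real \<Rightarrow> real \<Rightarrow> real \<Rightarrow> (real \<times> real \<times> real) set" where
  "hbox a1 a2 a3 b1 b2 b3 = {a1..<b1} \<times> {a2..<b2} \<times> {a3..<b3}"

text \<open>Closed below like \<open>hbox\<close>, but strict at the top: a half-open box whose
  excluded upper corner satisfies \<open>b1 + b2 + b3 \<le> s\<close> lies inside, and such boxes
  exhaust the set.\<close>

definition tetra :: "real \<Rightarrow> real \<Rightarrow> real \<Rightarrow> real \<Rightarrow> (real \<times> real \<times> real) set" where
  "tetra o1 o2 o3 s = {(u1, u2, u3). o1 \<le> u1 \<and> o2 \<le> u2 \<and> o3 \<le> u3 \<and> u1 + u2 + u3 < s}"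

lemma hbox_borel [measurable]: "hbox a1 a2 a3 b1 b2 b3 \<in> sets borel"
  unfolding hbox_def borel_prod[symmetric] by (intro pair_measureI) auto

lemma tetra_borel [measurable]: "tetra o1 o2 o3 s \<in> sets borel"
proof -
  have *: "tetra o1 o2 o3 s = {u \<in> space borel. o1 \<le> fst u \<and> o2 \<le> fst (snd u) \<and> o3 \<le> snd (snd u)
      \<and> fst u + fst (snd u) + snd (snd u) < s}"
    by (auto simp: tetra_def)
  show ?thesis unfolding * borel_prod[symmetric] by measurable
qed

lemma dist_pair_le: "dist (a, b) (c, d) \<le> dist a c + dist b d"
  by (simp add: dist_Pair_Pair sqrt_sum_squares_le_sum)

text \<open>Half-open boxes inside the tetrahedron form an intersection-stable generator of its Borel sets.\<close>

lemma emeasure_tetra_eqI: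
  fixes M N :: "(real \<times> real \<times> real) measure"
  assumes sets: "sets M = sets borel" "sets N = sets borel"
    and eq: "\<And>a1 a2 a3 b1 b2 b3. \<lbrakk>o1 \<le> a1; a1 \<le> b1; o2 \<le> a2; a2 \<le> b2; o3 \<le> a3; a3 \<le> b3; b1 + b2 + b3 \<le> s\<rbrakk> \<Longrightarrow>
        emeasure M (hbox a1 a2 a3 b1 b2 b3) = emeasure N (hbox a1 a2 a3 b1 b2 b3)"
    and fin: "\<And>a1 a2 a3 b1 b2 b3. \<lbrakk>o1 \<le> a1; o2 \<le> a2; o3 \<le> a3; b1 + b2 + b3 \<le> s\<rbrakk> \<Longrightarrow>
        emeasure M (hbox a1 a2 a3 b1 b2 b3) \<noteq> \<infinity>"
  shows "emeasure M (tetra o1 o2 o3 s) = emeasure N (tetra o1 o2 o3 s)"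
proof -
  let ?\<Omega> = "tetra o1 o2 o3 s"
  define E where "E = {hbox a1 a2 a3 b1 b2 b3 | a1 a2 a3 b1 b2 b3. o1 \<le> a1 \<and> o2 \<le> a2 \<and> o3 \<le> a3 \<and> b1 + b2 + b3 \<le> s}"
  \<comment> \<open>A countable subfamily that still covers. The corners are rational, and the lower
    ones are clamped at \<open>o1\<close>, \<open>o2\<close>, \<open>o3\<close>, so that points on
    the lower faces are reached although the bounds need not be rational.\<close>
  define A where "A = (\<lambda>(p1, p2, p3, q1, q2, q3). hbox (max o1 p1) (max o2 p2) (max o3 p3) q1 q2 q3) `
     {(p1, p2, p3, q1, q2, q3) \<in> \<rat> \<times> \<rat> \<times> \<rat> \<times> \<rat> \<times> \<rat> \<times> \<rat>. q1 + q2 + q3 \<le> s}"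
  have countable_A: "countable A"
    unfolding A_def by (intro countable_image countable_subset[OF _ countable_SIGMA[OF countable_rat countable_SIGMA[OF countable_rat countable_SIGMA[OF countable_rat countable_SIGMA[OF countable_rat countable_SIGMA[OF countable_rat countable_rat]]]]]]) auto
  have AE: "A \<subseteq> E"
  proof
    fix B assume "B \<in> A"
    then obtain p1 p2 p3 q1 q2 q3 where B: "B = hbox (max o1 p1) (max o2 p2) (max o3 p3) q1 q2 q3" "q1 + q2 + q3 \<le> s"
      unfolding A_def by auto
    show "B \<in> E"
      unfolding E_def mem_Collect_eq
      by (rule exI[of _ "max o1 p1"], rule exI[of _ "max o2 p2"], rule exI[of _ "max o3 p3"], rule exI[of _ q1], rule exI[of _ q2], rule exI[of _ q3])
         (simp add: B)
  qed
  have E_sub: "B \<subseteq> ?\<Omega>" if "B \<in> E" for B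
    using that unfolding E_def hbox_def tetra_def by auto
  have open_cover: "?\<Omega> \<inter> V = \<Union>{B \<in> A. B \<subseteq> V}" if oV: "open V" for V
  proof (intro equalityI subsetI)
    fix u assume u: "u \<in> ?\<Omega> \<inter> V"
    obtain u1 u2 u3 where [simp]: "u = (u1, u2, u3)" by (metis prod.exhaust)
    have \<Omega>: "o1 \<le> u1" "o2 \<le> u2" "o3 \<le> u3" "u1 + u2 + u3 < s"
      using u by (auto simp: tetra_def)
    obtain d where d: "0 < d" "ball u d \<subseteq> V"
      using open_contains_ball_eq[OF oV, of u] u by auto
    \<comment> \<open>One third of \<open>d\<close> keeps the box in the ball, since the distance of
      triples is at most the sum of three coordinate distances. One third of the slack keeps the
      upper corner on or below the plane.\<close>
    define e where "e = min (d / 3) ((s - (u1 + u2 + u3)) / 3)"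
    have e: "0 < e" "e \<le> d / 3" "3 * e \<le> s - (u1 + u2 + u3)"
    proof -
      show "0 < e" "e \<le> d / 3" using d \<Omega> by (auto simp: e_def)
      have "e \<le> (s - (u1 + u2 + u3)) / 3" unfolding e_def by (rule min.cobounded2)
      then show "3 * e \<le> s - (u1 + u2 + u3)" by simp
    qed
    have near: "(v1, v2, v3) \<in> V" if "\<bar>v1 - u1\<bar> < e" "\<bar>v2 - u2\<bar> < e" "\<bar>v3 - u3\<bar> < e" for v1 v2 v3
    proof -
      have "dist u (v1, v2, v3) \<le> dist u1 v1 + (dist u2 v2 + dist u3 v3)"
        using dist_pair_le[of u1 "(u2, u3)" v1 "(v2, v3)"] dist_pair_le[of u2 u3 v2 v3] by simp
      then have "dist u (v1, v2, v3) < d"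
        using that e by (simp add: dist_real_def)
      then show ?thesis using d by auto
    qed
    obtain p1 p2 p3 where p: "p1 \<in> \<rat>" "u1 - e < p1" "p1 < u1" "p2 \<in> \<rat>" "u2 - e < p2" "p2 < u2" "p3 \<in> \<rat>" "u3 - e < p3" "p3 < u3"
      using Rats_dense_in_real[of "u1 - e" u1] Rats_dense_in_real[of "u2 - e" u2] Rats_dense_in_real[of "u3 - e" u3] e by auto
    obtain q1 q2 q3 where q: "q1 \<in> \<rat>" "u1 < q1" "q1 < u1 + e" "q2 \<in> \<rat>" "u2 < q2" "q2 < u2 + e" "q3 \<in> \<rat>" "u3 < q3" "q3 < u3 + e"
      using Rats_dense_in_real[of u1 "u1 + e"] Rats_dense_in_real[of u2 "u2 + e"] Rats_dense_in_real[of u3 "u3 + e"] e by auto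
    let ?B = "hbox (max o1 p1) (max o2 p2) (max o3 p3) q1 q2 q3"
    have "q1 + q2 + q3 \<le> s" using q e by linarith
    then have "?B \<in> A" unfolding A_def using p q by (intro image_eqI[of _ _ "(p1, p2, p3, q1, q2, q3)"]) auto
    moreover have "?B \<subseteq> V"
      using p q by (auto simp: hbox_def intro!: near)
    moreover have "u \<in> ?B"
      using p q \<Omega> by (auto simp: hbox_def)
    ultimately show "u \<in> \<Union>{B \<in> A. B \<subseteq> V}" by blast
  next
    fix u assume "u \<in> \<Union>{B \<in> A. B \<subseteq> V}"
    then show "u \<in> ?\<Omega> \<inter> V" using AE E_sub by blast
  qed
  have gen: "sets (restrict_space K ?\<Omega>) = sigma_sets ?\<Omega> E" if K: "sets K = sets borel" for K
  proof -
    have "sets (restrict_space K ?\<Omega>) = (\<inter>) ?\<Omega> ` sigma_sets UNIV {S. open S}"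
      by (simp add: sets_restrict_space K borel_def)
    also have "\<dots> = sigma_sets ?\<Omega> ((\<inter>) ?\<Omega> ` {S. open S})"
      using tetra_borel by (intro sigma_sets_Int) (auto simp: borel_def)
    also have "\<dots> = sigma_sets ?\<Omega> E"
    proof (rule sigma_sets_eqI)
      fix B assume "B \<in> (\<inter>) ?\<Omega> ` {S. open S}"
      then obtain V where V: "open V" "B = ?\<Omega> \<inter> V" by auto
      have "countable {B \<in> A. B \<subseteq> V}" using countable_A by (rule countable_subset[rotated]) auto
      then have "\<Union>{B \<in> A. B \<subseteq> V} \<in> sigma_sets ?\<Omega> E"
        using AE by (intro sigma_sets_UNION) (auto intro: sigma_sets.Basic)
      then show "B \<in> sigma_sets ?\<Omega> E" using V open_cover by simp
    next
      fix B assume B: "B \<in> E"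
      have "B \<in> sigma_sets UNIV {S. open S}"
        using B hbox_borel unfolding E_def by (auto simp: borel_def)
      moreover have "B = ?\<Omega> \<inter> B" using E_sub[OF B] by auto
      ultimately have "B \<in> (\<inter>) ?\<Omega> ` sigma_sets UNIV {S. open S}" by blast
      also have "\<dots> = sigma_sets ?\<Omega> ((\<inter>) ?\<Omega> ` {S. open S})"
        using tetra_borel by (intro sigma_sets_Int) (auto simp: borel_def)
      finally show "B \<in> sigma_sets ?\<Omega> ((\<inter>) ?\<Omega> ` {S. open S})" .
    qed
    finally show ?thesis .
  qed
  have space: "space M = UNIV" "space N = UNIV"
    using sets_eq_imp_space_eq[OF sets(1)] sets_eq_imp_space_eq[OF sets(2)] by auto
  have restr: "emeasure (restrict_space M ?\<Omega>) B = emeasure M B" "emeasure (restrict_space N ?\<Omega>) B = emeasure N B"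
    if "B \<subseteq> ?\<Omega>" for B
    using that sets tetra_borel[of o1 o2 o3 s] by (auto intro!: emeasure_restrict_space simp: space)
  have "restrict_space M ?\<Omega> = restrict_space N ?\<Omega>"
  proof (rule measure_eqI_generator_eq_countable[where E = E and A = A and \<Omega> = ?\<Omega>])
    show "Int_stable E"
    proof (rule Int_stableI)
      fix B C assume "B \<in> E" "C \<in> E"
      then obtain a1 a2 a3 b1 b2 b3 a1' a2' a3' b1' b2' b3' where
        B: "B = hbox a1 a2 a3 b1 b2 b3" "o1 \<le> a1" "o2 \<le> a2" "o3 \<le> a3" "b1 + b2 + b3 \<le> s" and
        C: "C = hbox a1' a2' a3' b1' b2' b3'" "o1 \<le> a1'" "o2 \<le> a2'" "o3 \<le> a3'" "b1' + b2' + b3' \<le> s"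
        unfolding E_def by blast
      have "B \<inter> C = hbox (max a1 a1') (max a2 a2') (max a3 a3') (min b1 b1') (min b2 b2') (min b3 b3')"
        unfolding B C hbox_def by (auto simp: max_def min_def)
      moreover have "min b1 b1' + min b2 b2' + min b3 b3' \<le> s"
        using B(5) by linarith
      moreover have "o1 \<le> max a1 a1'" "o2 \<le> max a2 a2'" "o3 \<le> max a3 a3'"
        using B C by auto
      ultimately show "B \<inter> C \<in> E"
        unfolding E_def by blast
    qed
    show "E \<subseteq> Pow ?\<Omega>" using E_sub by blast
    show "emeasure (restrict_space M ?\<Omega>) X = emeasure (restrict_space N ?\<Omega>) X" if X: "X \<in> E" for X
    proof -
      obtain a1 a2 a3 b1 b2 b3 where X': "X = hbox a1 a2 a3 b1 b2 b3" "o1 \<le> a1" "o2 \<le> a2" "o3 \<le> a3" "b1 + b2 + b3 \<le> s"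
        using X unfolding E_def by blast
      have "emeasure M X = emeasure N X"
      proof (cases "a1 \<le> b1 \<and> a2 \<le> b2 \<and> a3 \<le> b3")
        case True then show ?thesis unfolding X' by (intro eq) (use X' in auto)
      next
        case False
        then have "X = {}" by (auto simp: X' hbox_def)
        then show ?thesis by simp
      qed
      then show ?thesis using restr E_sub[OF X] by simp
    qed
    show "\<Union> A = ?\<Omega>" using open_cover[of UNIV] by simp
    show "emeasure (restrict_space M ?\<Omega>) X \<noteq> \<infinity>" if "X \<in> A" for X
    proof -
      have X: "X \<in> E" using that AE by blast
      then obtain a1 a2 a3 b1 b2 b3 where X': "X = hbox a1 a2 a3 b1 b2 b3" "o1 \<le> a1" "o2 \<le> a2" "o3 \<le> a3" "b1 + b2 + b3 \<le> s"
        unfolding E_def by blast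
      show ?thesis using restr(1)[OF E_sub[OF X]] fin[OF X'(2-5)] X'(1) by simp
    qed
  qed (use gen[OF sets(1)] gen[OF sets(2)] AE countable_A in auto)
  then show ?thesis using restr[OF order_refl] by simp
qed

section \<open>The quadratic form and the density of the minimum\<close>

definition Xq :: "real \<Rightarrow> real \<Rightarrow> real \<Rightarrow> real \<Rightarrow> real" where
  "Xq s u v w = s\<^sup>2 - u\<^sup>2 - v\<^sup>2 - w\<^sup>2"

text \<open>\<open>Ep = - \<partial>\<^sub>u Xq ^ n\<close>, \<open>Gp = - \<partial>\<^sub>v Ep\<close>, \<open>Rp = - \<partial>\<^sub>w Gp\<close>.\<close>

definition Ep :: "nat \<Rightarrow> real \<Rightarrow> real \<Rightarrow> real \<Rightarrow> real \<Rightarrow> real" where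
  "Ep n s u v w = 2 * real n * u * Xq s u v w ^ (n - 1)"

definition Gp :: "nat \<Rightarrow> real \<Rightarrow> real \<Rightarrow> real \<Rightarrow> real \<Rightarrow> real" where
  "Gp n s u v w = 4 * real n * real (n - 1) * u * v * Xq s u v w ^ (n - 2)"

definition Rp :: "nat \<Rightarrow> real \<Rightarrow> real \<Rightarrow> real \<Rightarrow> real \<Rightarrow> real" where
  "Rp n s u v w = 8 * real n * real (n - 1) * real (n - 2) * u * v * w * Xq s u v w ^ (n - 3)"

lemma Xq_deriv [derivative_intros]:
  "((\<lambda>t. Xq s t v w) has_field_derivative - 2 * t) (at t within S)"
  "((\<lambda>t. Xq s u t w) has_field_derivative - 2 * t) (at t within S)"
  "((\<lambda>t. Xq s u v t) has_field_derivative - 2 * t) (at t within S)"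
  unfolding Xq_def by (auto intro!: derivative_eq_intros)

text \<open>The truncated exponents \<open>n - 1\<close>, \<open>n - 2\<close>, \<open>n - 3\<close>
  in \<open>Ep\<close>, \<open>Gp\<close>, \<open>Rp\<close> do no harm for small \<open>n\<close>:
  whenever truncation occurs, one of the factors \<open>real n\<close>, \<open>real (n - 1)\<close>,
  \<open>real (n - 2)\<close> is zero.\<close>

lemma Fp_deriv: "((\<lambda>t. Xq s t v w ^ n) has_field_derivative - Ep n s t v w) (at t)"
  unfolding Ep_def by (auto intro!: derivative_eq_intros)

lemma Ep_deriv: "((\<lambda>t. Ep n s u t w) has_field_derivative - Gp n s u t w) (at t)"
  unfolding Ep_def Gp_def by (auto intro!: derivative_eq_intros simp: numeral_2_eq_2)

lemma Gp_deriv: "((\<lambda>t. Gp n s u v t) has_field_derivative - Rp n s u v t) (at t)"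
  unfolding Gp_def Rp_def by (auto intro!: derivative_eq_intros simp: numeral_3_eq_3 numeral_2_eq_2)

lemma Xq_nonneg:
  assumes "0 \<le> u" "0 \<le> v" "0 \<le> w" "u + v + w \<le> s"
  shows "0 \<le> Xq s u v w"
proof -
  have "0 \<le> u * v + u * w + v * w" using assms by simp
  then have "u\<^sup>2 + v\<^sup>2 + w\<^sup>2 \<le> (u + v + w)\<^sup>2"
    by (simp add: power2_eq_square algebra_simps)
  also have "\<dots> \<le> s\<^sup>2" using assms by (intro power_mono) auto
  finally show ?thesis by (simp add: Xq_def)
qed

lemma Ep_nonneg: "\<lbrakk>0 \<le> u; 0 \<le> v; 0 \<le> w; u + v + w \<le> s\<rbrakk> \<Longrightarrow> 0 \<le> Ep n s u v w"
  by (simp add: Ep_def Xq_nonneg)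

lemma Gp_nonneg: "\<lbrakk>0 \<le> u; 0 \<le> v; 0 \<le> w; u + v + w \<le> s\<rbrakk> \<Longrightarrow> 0 \<le> Gp n s u v w"
  by (simp add: Gp_def Xq_nonneg)

lemma Rp_nonneg: "\<lbrakk>0 \<le> u; 0 \<le> v; 0 \<le> w; u + v + w \<le> s\<rbrakk> \<Longrightarrow> 0 \<le> Rp n s u v w"
  by (simp add: Rp_def Xq_nonneg)

lemma Xq_measurable [measurable]:
  assumes [measurable]: "f \<in> borel_measurable M" "g \<in> borel_measurable M" "h \<in> borel_measurable M" "s \<in> borel_measurable M"
  shows "(\<lambda>x. Xq (s x) (f x) (g x) (h x)) \<in> borel_measurable M"
    "(\<lambda>x. Ep n (s x) (f x) (g x) (h x)) \<in> borel_measurable M"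
    "(\<lambda>x. Gp n (s x) (f x) (g x) (h x)) \<in> borel_measurable M"
    "(\<lambda>x. Rp n (s x) (f x) (g x) (h x)) \<in> borel_measurable M"
  unfolding Xq_def Ep_def Gp_def Rp_def by measurable

lemma nn_integral_half_open:
  fixes h :: "real \<Rightarrow> ennreal"
  shows "(\<integral>\<^sup>+ t. (if a \<le> t \<and> t < c then h t else 0) \<partial>lborel) = (\<integral>\<^sup>+ t. (if a \<le> t \<and> t \<le> c then h t else 0) \<partial>lborel)"
proof (rule nn_integral_cong_AE)
  show "AE t in lborel. (if a \<le> t \<and> t < c then h t else 0) = (if a \<le> t \<and> t \<le> c then h t else 0)"
    using AE_lborel_singleton[of c] by eventually_elim auto
qed

text \<open>The antiderivative is taken with derivative \<open>- h\<close> because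
  \<open>Ep\<close>, \<open>Gp\<close>, \<open>Rp\<close> are negated derivatives and nonnegative on
  the tetrahedron. The second conclusion supplies the nonnegativity of the integrand for the next
  integration.\<close>

lemma nn_integral_FTC_neg:
  fixes H h :: "real \<Rightarrow> real"
  assumes "a \<le> c" and [measurable]: "h \<in> borel_measurable borel"
    and deriv: "\<And>t. a \<le> t \<Longrightarrow> t \<le> c \<Longrightarrow> (H has_field_derivative - h t) (at t)"
    and nonneg: "\<And>t. a \<le> t \<Longrightarrow> t \<le> c \<Longrightarrow> 0 \<le> h t"
  shows "(\<integral>\<^sup>+ t. (if a \<le> t \<and> t \<le> c then ennreal (h t) else 0) \<partial>lborel) = ennreal (H a - H c)"
    and "H c \<le> H a"
proof -
  have "(\<integral>\<^sup>+ t. (if a \<le> t \<and> t \<le> c then ennreal (h t) else 0) \<partial>lborel) = (\<integral>\<^sup>+ t. ennreal (h t) * indicator {a..c} t \<partial>lborel)"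
    by (intro nn_integral_cong) (auto simp: indicator_def)
  also have "\<dots> = ennreal ((- H c) - (- H a))"
  proof (rule nn_integral_FTC_Icc)
    show "DERIV (\<lambda>t. - H t) t :> h t" if "t \<in> {a..c}" for t
      using DERIV_minus[OF deriv[of t]] that by simp
  qed (use assms(1) nonneg in auto)
  finally show "(\<integral>\<^sup>+ t. (if a \<le> t \<and> t \<le> c then ennreal (h t) else 0) \<partial>lborel) = ennreal (H a - H c)"
    by simp
  show "H c \<le> H a"
  proof (rule DERIV_nonpos_imp_nonincreasing[OF \<open>a \<le> c\<close>])
    fix t assume "a \<le> t" "t \<le> c"
    then show "\<exists>y. (H has_real_derivative y) (at t) \<and> y \<le> 0"
      using deriv[of t] nonneg[of t] by (intro exI[of _ "- h t"]) simp
  qed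
qed

lemma nn_integral_FTC_neg_add:
  fixes H h :: "real \<Rightarrow> real"
  assumes "a \<le> c" and "h \<in> borel_measurable borel"
    and "\<And>t. a \<le> t \<Longrightarrow> t \<le> c \<Longrightarrow> (H has_field_derivative - h t) (at t)"
    and "\<And>t. a \<le> t \<Longrightarrow> t \<le> c \<Longrightarrow> 0 \<le> h t" and "0 \<le> H c"
  shows "(\<integral>\<^sup>+ t. (if a \<le> t \<and> t \<le> c then ennreal (h t) else 0) \<partial>lborel) + ennreal (H c) = ennreal (H a)"
  using nn_integral_FTC_neg[OF assms(1-4)] assms(5) by (simp add: ennreal_plus[symmetric] del: ennreal_plus)

lemma nn_integral_lborel_triple:
  fixes f :: "real \<times> real \<times> real \<Rightarrow> ennreal"
  assumes [measurable]: "f \<in> borel_measurable lborel3"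
  shows "(\<integral>\<^sup>+ p. f p \<partial>lborel) = (\<integral>\<^sup>+ u. \<integral>\<^sup>+ v. \<integral>\<^sup>+ w. f (u, v, w) \<partial>lborel \<partial>lborel \<partial>lborel)"
proof -
  have "(\<integral>\<^sup>+ p. f p \<partial>lborel) = (\<integral>\<^sup>+ p. f p \<partial>lborel3)"
    by (simp add: lborel_prod)
  also have "\<dots> = (\<integral>\<^sup>+ u. \<integral>\<^sup>+ q. f (u, q) \<partial>(lborel \<Otimes>\<^sub>M lborel) \<partial>lborel)"
    by (subst sigma_finite_measure.nn_integral_fst[OF sigma_finite_plane, symmetric]) simp_all
  also have "\<dots> = (\<integral>\<^sup>+ u. \<integral>\<^sup>+ v. \<integral>\<^sup>+ w. f (u, v, w) \<partial>lborel \<partial>lborel \<partial>lborel)"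
    by (intro nn_integral_cong lborel.nn_integral_fst[symmetric]) measurable
  finally show ?thesis .
qed

definition Rmeas :: "nat \<Rightarrow> real \<Rightarrow> (real \<times> real \<times> real) measure" where
  "Rmeas n s = density lborel (\<lambda>(u, v, w). ennreal (Rp n s u v w))"

lemma Rp_case_measurable: "(\<lambda>(u, v, w). ennreal (Rp n s u v w)) \<in> borel_measurable lborel3"
  by measurable

lemma sets_Rmeas [simp]: "sets (Rmeas n s) = sets borel"
  by (simp add: Rmeas_def)

lemma emeasure_Rmeas:
  assumes "S \<in> sets borel"
  shows "emeasure (Rmeas n s) S = (\<integral>\<^sup>+ u. \<integral>\<^sup>+ v. \<integral>\<^sup>+ w. (if (u, v, w) \<in> S then ennreal (Rp n s u v w) else 0) \<partial>lborel \<partial>lborel \<partial>lborel)"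
proof -
  have S [measurable]: "S \<in> sets lborel3" using assms unfolding lborel_prod by simp
  have [measurable]: "(\<lambda>(u, v, w). ennreal (Rp n s u v w)) \<in> borel_measurable lborel"
    using Rp_case_measurable by (simp add: lborel_prod)
  have "emeasure (Rmeas n s) S = (\<integral>\<^sup>+ p. (case p of (u, v, w) \<Rightarrow> ennreal (Rp n s u v w)) * indicator S p \<partial>lborel)"
    unfolding Rmeas_def using assms by (subst emeasure_density) auto
  also have "\<dots> = (\<integral>\<^sup>+ u. \<integral>\<^sup>+ v. \<integral>\<^sup>+ w. (case (u, v, w) of (u, v, w) \<Rightarrow> ennreal (Rp n s u v w)) * indicator S (u, v, w) \<partial>lborel \<partial>lborel \<partial>lborel)"
    using Rp_case_measurable by (intro nn_integral_lborel_triple) measurable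
  also have "\<dots> = (\<integral>\<^sup>+ u. \<integral>\<^sup>+ v. \<integral>\<^sup>+ w. (if (u, v, w) \<in> S then ennreal (Rp n s u v w) else 0) \<partial>lborel \<partial>lborel \<partial>lborel)"
    by (intro nn_integral_cong) (auto simp: indicator_def)
  finally show ?thesis .
qed

lemma nn_integral_if_const: "(\<integral>\<^sup>+ x. (if P then f x else 0) \<partial>M) = (if P then (\<integral>\<^sup>+ x. f x \<partial>M) else 0)"
  by simp

text \<open>Integrating a mixed third derivative over a box leaves the alternating sum of
  \<open>Xq ^ n\<close> over its eight vertices. The same sum arises by inclusion-exclusion for any
  law whose tail function is \<open>Xq ^ n\<close>. The bound on \<open>b1 + b2 + b3\<close> keeps
  the box where the successive densities are nonnegative.\<close>

lemma emeasure_Rmeas_hbox: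
  fixes n :: nat and a1 a2 a3 b1 b2 b3 s :: real
  assumes a: "0 \<le> a1" "a1 \<le> b1" "0 \<le> a2" "a2 \<le> b2" "0 \<le> a3" "a3 \<le> b3" and b: "b1 + b2 + b3 \<le> s"
  defines "D \<equiv> \<lambda>u v. Xq s u v a3 ^ n - Xq s u v b3 ^ n"
  shows "emeasure (Rmeas n s) (hbox a1 a2 a3 b1 b2 b3) = ennreal ((D a1 a2 - D a1 b2) - (D b1 a2 - D b1 b2))"
proof -
  have w: "(\<integral>\<^sup>+ w. (if a3 \<le> w \<and> w \<le> b3 then ennreal (Rp n s u v w) else 0) \<partial>lborel) = ennreal (Gp n s u v a3 - Gp n s u v b3)"
      "Gp n s u v b3 \<le> Gp n s u v a3"
    if uv: "a1 \<le> u" "u \<le> b1" "a2 \<le> v" "v \<le> b2" for u v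
  proof -
    have "0 \<le> Rp n s u v w" if "a3 \<le> w" "w \<le> b3" for w
      by (rule Rp_nonneg) (use a b uv that in linarith)+
    note * = nn_integral_FTC_neg[where H = "Gp n s u v" and h = "Rp n s u v", OF a(6) _ Gp_deriv this]
    show "(\<integral>\<^sup>+ w. (if a3 \<le> w \<and> w \<le> b3 then ennreal (Rp n s u v w) else 0) \<partial>lborel) = ennreal (Gp n s u v a3 - Gp n s u v b3)"
      by (rule *(1)) simp_all
    show "Gp n s u v b3 \<le> Gp n s u v a3"
      by (rule *(2)) simp_all
  qed
  have v: "(\<integral>\<^sup>+ v. (if a2 \<le> v \<and> v \<le> b2 then ennreal (Gp n s u v a3 - Gp n s u v b3) else 0) \<partial>lborel) =
        ennreal ((Ep n s u a2 a3 - Ep n s u a2 b3) - (Ep n s u b2 a3 - Ep n s u b2 b3))"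
     "Ep n s u b2 a3 - Ep n s u b2 b3 \<le> Ep n s u a2 a3 - Ep n s u a2 b3"
    if u: "a1 \<le> u" "u \<le> b1" for u
  proof -
    have nonneg: "0 \<le> Gp n s u v a3 - Gp n s u v b3" if "a2 \<le> v" "v \<le> b2" for v
      using w(2)[OF u that] by simp
    have deriv: "((\<lambda>v. Ep n s u v a3 - Ep n s u v b3) has_field_derivative - (Gp n s u v a3 - Gp n s u v b3)) (at v)" for v
      using DERIV_diff[OF Ep_deriv[of n s u a3 v] Ep_deriv[of n s u b3 v]] by simp
    note * = nn_integral_FTC_neg[where H = "\<lambda>v. Ep n s u v a3 - Ep n s u v b3" and h = "\<lambda>v. Gp n s u v a3 - Gp n s u v b3", OF a(4) _ deriv nonneg]
    show "(\<integral>\<^sup>+ v. (if a2 \<le> v \<and> v \<le> b2 then ennreal (Gp n s u v a3 - Gp n s u v b3) else 0) \<partial>lborel) =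
        ennreal ((Ep n s u a2 a3 - Ep n s u a2 b3) - (Ep n s u b2 a3 - Ep n s u b2 b3))"
      by (rule *(1)) simp_all
    show "Ep n s u b2 a3 - Ep n s u b2 b3 \<le> Ep n s u a2 a3 - Ep n s u a2 b3"
      by (rule *(2)) simp_all
  qed
  have u: "(\<integral>\<^sup>+ u. (if a1 \<le> u \<and> u \<le> b1 then ennreal ((Ep n s u a2 a3 - Ep n s u a2 b3) - (Ep n s u b2 a3 - Ep n s u b2 b3)) else 0) \<partial>lborel) =
        ennreal ((D a1 a2 - D a1 b2) - (D b1 a2 - D b1 b2))"
  proof -
    have nonneg: "0 \<le> (Ep n s u a2 a3 - Ep n s u a2 b3) - (Ep n s u b2 a3 - Ep n s u b2 b3)" if "a1 \<le> u" "u \<le> b1" for u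
      using v(2)[OF that] by simp
    have deriv: "((\<lambda>u. D u a2 - D u b2) has_field_derivative - ((Ep n s u a2 a3 - Ep n s u a2 b3) - (Ep n s u b2 a3 - Ep n s u b2 b3))) (at u)" for u
      unfolding D_def
      using DERIV_diff[OF DERIV_diff[OF Fp_deriv[of s a2 a3 n u] Fp_deriv[of s a2 b3 n u]] DERIV_diff[OF Fp_deriv[of s b2 a3 n u] Fp_deriv[of s b2 b3 n u]]] by (simp add: algebra_simps)
    show ?thesis
      by (rule nn_integral_FTC_neg(1)[where H = "\<lambda>u. D u a2 - D u b2", OF a(2) _ deriv nonneg]) simp_all
  qed
  have "emeasure (Rmeas n s) (hbox a1 a2 a3 b1 b2 b3) =
     (\<integral>\<^sup>+ u. (if a1 \<le> u \<and> u < b1 then \<integral>\<^sup>+ v. (if a2 \<le> v \<and> v < b2 then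
         \<integral>\<^sup>+ w. (if a3 \<le> w \<and> w < b3 then ennreal (Rp n s u v w) else 0) \<partial>lborel else 0) \<partial>lborel else 0) \<partial>lborel)"
    by (subst emeasure_Rmeas[OF hbox_borel], simp only: nn_integral_if_const[symmetric], intro nn_integral_cong) (auto simp: hbox_def)
  also have "\<dots> = (\<integral>\<^sup>+ u. (if a1 \<le> u \<and> u \<le> b1 then \<integral>\<^sup>+ v. (if a2 \<le> v \<and> v \<le> b2 then
         \<integral>\<^sup>+ w. (if a3 \<le> w \<and> w \<le> b3 then ennreal (Rp n s u v w) else 0) \<partial>lborel else 0) \<partial>lborel else 0) \<partial>lborel)"
    by (simp only: nn_integral_half_open)
  also have "\<dots> = (\<integral>\<^sup>+ u. (if a1 \<le> u \<and> u \<le> b1 then \<integral>\<^sup>+ v. (if a2 \<le> v \<and> v \<le> b2 then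
         ennreal (Gp n s u v a3 - Gp n s u v b3) else 0) \<partial>lborel else 0) \<partial>lborel)"
    by (intro nn_integral_cong if_cong refl) (simp_all only: w)
  also have "\<dots> = (\<integral>\<^sup>+ u. (if a1 \<le> u \<and> u \<le> b1 then ennreal ((Ep n s u a2 a3 - Ep n s u a2 b3) - (Ep n s u b2 a3 - Ep n s u b2 b3)) else 0) \<partial>lborel)"
    by (intro nn_integral_cong if_cong refl) (simp_all only: v)
  finally show ?thesis using u by simp
qed

text \<open>Integrating the density \<open>Rp\<close> over the tetrahedron one variable at a time leaves, at each
  stage, the boundary term on the face \<open>u + v + w = s\<close>.\<close>

lemma emeasure_Rmeas_tetra:
  fixes n :: nat
  assumes o: "0 \<le> o1" "0 \<le> o2" "0 \<le> o3" "o1 + o2 + o3 \<le> s"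
  shows "emeasure (Rmeas n s) (tetra o1 o2 o3 s)
      + ((\<integral>\<^sup>+ u. \<integral>\<^sup>+ v. (if o1 \<le> u \<and> o2 \<le> v \<and> u + v \<le> s - o3 then ennreal (Gp n s u v (s - u - v)) else 0) \<partial>lborel \<partial>lborel)
      + ((\<integral>\<^sup>+ u. (if o1 \<le> u \<and> u \<le> s - o2 - o3 then ennreal (Ep n s u (s - u - o3) o3) else 0) \<partial>lborel)
      + ennreal (Xq s (s - o2 - o3) o2 o3 ^ n))) = ennreal (Xq s o1 o2 o3 ^ n)"
proof -
  let ?w = "\<lambda>u v. \<integral>\<^sup>+ w. (if o3 \<le> w \<and> w \<le> s - u - v then ennreal (Rp n s u v w) else 0) \<partial>lborel"
  have 1: "emeasure (Rmeas n s) (tetra o1 o2 o3 s) =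
     (\<integral>\<^sup>+ u. \<integral>\<^sup>+ v. (if o1 \<le> u \<and> o2 \<le> v \<and> u + v \<le> s - o3 then ?w u v else 0) \<partial>lborel \<partial>lborel)"
  proof -
    have "emeasure (Rmeas n s) (tetra o1 o2 o3 s) =
      (\<integral>\<^sup>+ u. \<integral>\<^sup>+ v. \<integral>\<^sup>+ w. (if (u, v, w) \<in> tetra o1 o2 o3 s then ennreal (Rp n s u v w) else 0) \<partial>lborel \<partial>lborel \<partial>lborel)"
      by (rule emeasure_Rmeas[OF tetra_borel])
    also have "\<dots> = (\<integral>\<^sup>+ u. \<integral>\<^sup>+ v. (if o1 \<le> u \<and> o2 \<le> v \<and> u + v \<le> s - o3 then
        \<integral>\<^sup>+ w. (if o3 \<le> w \<and> w < s - u - v then ennreal (Rp n s u v w) else 0) \<partial>lborel else 0) \<partial>lborel \<partial>lborel)"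
      by (simp only: nn_integral_if_const[symmetric], intro nn_integral_cong) (auto simp: tetra_def)
    finally show ?thesis by (simp only: nn_integral_half_open)
  qed
  have 2: "?w u v + ennreal (Gp n s u v (s - u - v)) = ennreal (Gp n s u v o3)"
    if uv: "o1 \<le> u \<and> o2 \<le> v \<and> u + v \<le> s - o3" for u v
  proof (rule nn_integral_FTC_neg_add)
    show "o3 \<le> s - u - v" using uv by linarith
    show "(Gp n s u v has_field_derivative - Rp n s u v w) (at w)" for w by (rule Gp_deriv)
    show "0 \<le> Rp n s u v w" if "o3 \<le> w" "w \<le> s - u - v" for w
      by (rule Rp_nonneg) (use o uv that in linarith)+
    show "0 \<le> Gp n s u v (s - u - v)"
      by (rule Gp_nonneg) (use o uv in linarith)+
  qed simp
  let ?v = "\<lambda>u. \<integral>\<^sup>+ v. (if o2 \<le> v \<and> v \<le> s - u - o3 then ennreal (Gp n s u v o3) else 0) \<partial>lborel"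
  have 3: "?v u + ennreal (Ep n s u (s - u - o3) o3) = ennreal (Ep n s u o2 o3)"
    if u: "o1 \<le> u \<and> u \<le> s - o2 - o3" for u
  proof (rule nn_integral_FTC_neg_add)
    show "o2 \<le> s - u - o3" using u by linarith
    show "((\<lambda>v. Ep n s u v o3) has_field_derivative - Gp n s u v o3) (at v)" for v by (rule Ep_deriv)
    show "0 \<le> Gp n s u v o3" if "o2 \<le> v" "v \<le> s - u - o3" for v
      by (rule Gp_nonneg) (use o u that in linarith)+
    show "0 \<le> Ep n s u (s - u - o3) o3"
      by (rule Ep_nonneg) (use o u in linarith)+
  qed simp
  have 4: "(\<integral>\<^sup>+ u. (if o1 \<le> u \<and> u \<le> s - o2 - o3 then ennreal (Ep n s u o2 o3) else 0) \<partial>lborel)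
      + ennreal (Xq s (s - o2 - o3) o2 o3 ^ n) = ennreal (Xq s o1 o2 o3 ^ n)"
  proof (rule nn_integral_FTC_neg_add)
    show "o1 \<le> s - o2 - o3" using o by linarith
    show "((\<lambda>u. Xq s u o2 o3 ^ n) has_field_derivative - Ep n s u o2 o3) (at u)" for u by (rule Fp_deriv)
    show "0 \<le> Ep n s u o2 o3" if "o1 \<le> u" "u \<le> s - o2 - o3" for u
      by (rule Ep_nonneg) (use o that in linarith)+
    show "0 \<le> Xq s (s - o2 - o3) o2 o3 ^ n"
      by (rule zero_le_power, rule Xq_nonneg) (use o in linarith)+
  qed simp
  have "emeasure (Rmeas n s) (tetra o1 o2 o3 s)
      + (\<integral>\<^sup>+ u. \<integral>\<^sup>+ v. (if o1 \<le> u \<and> o2 \<le> v \<and> u + v \<le> s - o3 then ennreal (Gp n s u v (s - u - v)) else 0) \<partial>lborel \<partial>lborel)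
     = (\<integral>\<^sup>+ u. \<integral>\<^sup>+ v. (if o1 \<le> u \<and> o2 \<le> v \<and> u + v \<le> s - o3 then ?w u v else 0)
        + (if o1 \<le> u \<and> o2 \<le> v \<and> u + v \<le> s - o3 then ennreal (Gp n s u v (s - u - v)) else 0) \<partial>lborel \<partial>lborel)"
    unfolding 1 by (subst nn_integral_add[symmetric], measurable, subst nn_integral_add[symmetric], measurable)
  also have "\<dots> = (\<integral>\<^sup>+ u. \<integral>\<^sup>+ v. (if o1 \<le> u \<and> o2 \<le> v \<and> u + v \<le> s - o3 then ennreal (Gp n s u v o3) else 0) \<partial>lborel \<partial>lborel)"
    using 2 by (intro nn_integral_cong) auto
  also have "\<dots> = (\<integral>\<^sup>+ u. (if o1 \<le> u \<and> u \<le> s - o2 - o3 then ?v u else 0) \<partial>lborel)"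
    by (simp only: nn_integral_if_const[symmetric], intro nn_integral_cong) auto
  finally have A: "emeasure (Rmeas n s) (tetra o1 o2 o3 s)
      + (\<integral>\<^sup>+ u. \<integral>\<^sup>+ v. (if o1 \<le> u \<and> o2 \<le> v \<and> u + v \<le> s - o3 then ennreal (Gp n s u v (s - u - v)) else 0) \<partial>lborel \<partial>lborel)
     = (\<integral>\<^sup>+ u. (if o1 \<le> u \<and> u \<le> s - o2 - o3 then ?v u else 0) \<partial>lborel)" .
  have "(\<integral>\<^sup>+ u. (if o1 \<le> u \<and> u \<le> s - o2 - o3 then ?v u else 0) \<partial>lborel)
      + (\<integral>\<^sup>+ u. (if o1 \<le> u \<and> u \<le> s - o2 - o3 then ennreal (Ep n s u (s - u - o3) o3) else 0) \<partial>lborel)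
      = (\<integral>\<^sup>+ u. (if o1 \<le> u \<and> u \<le> s - o2 - o3 then ?v u else 0)
        + (if o1 \<le> u \<and> u \<le> s - o2 - o3 then ennreal (Ep n s u (s - u - o3) o3) else 0) \<partial>lborel)"
    by (subst nn_integral_add[symmetric]) measurable
  also have "\<dots> = (\<integral>\<^sup>+ u. (if o1 \<le> u \<and> u \<le> s - o2 - o3 then ennreal (Ep n s u o2 o3) else 0) \<partial>lborel)"
    using 3 by (intro nn_integral_cong) auto
  finally show ?thesis
    using A 4 by (simp only: add.assoc[symmetric])
qed

text \<open>The tails determine the law of \<open>(U1, U2, U3)\<close> on boxes below the plane,
  where it agrees with \<open>Rmeas\<close>; hence it agrees on the tetrahedron. The mass above the
  plane is then the total mass minus that of the tetrahedron. By \<open>emeasure_Rmeas_tetra\<close>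
  the difference consists of an integral over the facet on the plane, one over the edge of this
  facet with third coordinate \<open>o3\<close>, and the value at the vertex with last coordinates
  \<open>o2\<close>, \<open>o3\<close>.\<close>

lemma emeasure_tail_sum:
  fixes M :: "'a measure" and U1 U2 U3 :: "'a \<Rightarrow> real" and n :: nat
  assumes "finite_measure M"
    and U [measurable]: "U1 \<in> borel_measurable M" "U2 \<in> borel_measurable M" "U3 \<in> borel_measurable M"
    and o: "0 \<le> o1" "0 \<le> o2" "0 \<le> o3" "o1 + o2 + o3 \<le> s"
    and lower: "\<And>\<omega>. \<omega> \<in> space M \<Longrightarrow> o1 \<le> U1 \<omega> \<and> o2 \<le> U2 \<omega> \<and> o3 \<le> U3 \<omega>"
    and tail: "\<And>b1 b2 b3. \<lbrakk>o1 \<le> b1; o2 \<le> b2; o3 \<le> b3; b1 + b2 + b3 \<le> s\<rbrakk> \<Longrightarrow>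
      emeasure M {\<omega> \<in> space M. b1 \<le> U1 \<omega> \<and> b2 \<le> U2 \<omega> \<and> b3 \<le> U3 \<omega>} = ennreal (Xq s b1 b2 b3 ^ n)"
  shows "emeasure M {\<omega> \<in> space M. s \<le> U1 \<omega> + U2 \<omega> + U3 \<omega>} =
      (\<integral>\<^sup>+ u. \<integral>\<^sup>+ v. (if o1 \<le> u \<and> o2 \<le> v \<and> u + v \<le> s - o3 then ennreal (Gp n s u v (s - u - v)) else 0) \<partial>lborel \<partial>lborel)
      + ((\<integral>\<^sup>+ u. (if o1 \<le> u \<and> u \<le> s - o2 - o3 then ennreal (Ep n s u (s - u - o3) o3) else 0) \<partial>lborel)
      + ennreal (Xq s (s - o2 - o3) o2 o3 ^ n))"
proof -
  interpret finite_measure M by fact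
  define T where "T = (\<lambda>\<omega>. (U1 \<omega>, U2 \<omega>, U3 \<omega>))"
  have T [measurable]: "T \<in> borel_measurable M"
    unfolding T_def borel_prod[symmetric] by measurable
  define F where "F = (\<lambda>b1 b2 b3. Xq s b1 b2 b3 ^ n)"
  have F_nonneg: "0 \<le> F b1 b2 b3" if "o1 \<le> b1" "o2 \<le> b2" "o3 \<le> b3" "b1 + b2 + b3 \<le> s" for b1 b2 b3
    unfolding F_def by (rule zero_le_power, rule Xq_nonneg) (use o that in linarith)+
  \<comment> \<open>From tails to boxes: \<open>m1\<close>, \<open>m2\<close>, \<open>m3\<close>
    bound one more coordinate from above at a time, each by subtracting two sets of the preceding
    kind.\<close>
  have m0: "measure M {\<omega> \<in> space M. b1 \<le> U1 \<omega> \<and> b2 \<le> U2 \<omega> \<and> b3 \<le> U3 \<omega>} = F b1 b2 b3"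
    if "o1 \<le> b1" "o2 \<le> b2" "o3 \<le> b3" "b1 + b2 + b3 \<le> s" for b1 b2 b3
    unfolding measure_def tail[OF that] using F_nonneg[OF that] by (simp add: F_def)
  have m1: "measure M {\<omega> \<in> space M. b1 \<le> U1 \<omega> \<and> b2 \<le> U2 \<omega> \<and> a3 \<le> U3 \<omega> \<and> U3 \<omega> < b3} = F b1 b2 a3 - F b1 b2 b3"
    if "o1 \<le> b1" "o2 \<le> b2" "o3 \<le> a3" "a3 \<le> b3" "b1 + b2 + b3 \<le> s" for b1 b2 a3 b3
  proof -
    have "{\<omega> \<in> space M. b1 \<le> U1 \<omega> \<and> b2 \<le> U2 \<omega> \<and> a3 \<le> U3 \<omega> \<and> U3 \<omega> < b3} =
       {\<omega> \<in> space M. b1 \<le> U1 \<omega> \<and> b2 \<le> U2 \<omega> \<and> a3 \<le> U3 \<omega>} - {\<omega> \<in> space M. b1 \<le> U1 \<omega> \<and> b2 \<le> U2 \<omega> \<and> b3 \<le> U3 \<omega>}"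
      by auto
    also have "measure M \<dots> = F b1 b2 a3 - F b1 b2 b3"
      by (subst finite_measure_Diff, measurable, use that in force, subst (1 2) m0) (use that in auto)
    finally show ?thesis .
  qed
  have m2: "measure M {\<omega> \<in> space M. b1 \<le> U1 \<omega> \<and> a2 \<le> U2 \<omega> \<and> U2 \<omega> < b2 \<and> a3 \<le> U3 \<omega> \<and> U3 \<omega> < b3} =
      (F b1 a2 a3 - F b1 a2 b3) - (F b1 b2 a3 - F b1 b2 b3)"
    if "o1 \<le> b1" "o2 \<le> a2" "a2 \<le> b2" "o3 \<le> a3" "a3 \<le> b3" "b1 + b2 + b3 \<le> s" for b1 a2 b2 a3 b3
  proof -
    have "{\<omega> \<in> space M. b1 \<le> U1 \<omega> \<and> a2 \<le> U2 \<omega> \<and> U2 \<omega> < b2 \<and> a3 \<le> U3 \<omega> \<and> U3 \<omega> < b3} =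
       {\<omega> \<in> space M. b1 \<le> U1 \<omega> \<and> a2 \<le> U2 \<omega> \<and> a3 \<le> U3 \<omega> \<and> U3 \<omega> < b3} -
       {\<omega> \<in> space M. b1 \<le> U1 \<omega> \<and> b2 \<le> U2 \<omega> \<and> a3 \<le> U3 \<omega> \<and> U3 \<omega> < b3}"
      by auto
    also have "measure M \<dots> = (F b1 a2 a3 - F b1 a2 b3) - (F b1 b2 a3 - F b1 b2 b3)"
      by (subst finite_measure_Diff, measurable, use that in force, subst (1 2) m1) (use that in auto)
    finally show ?thesis .
  qed
  have m3: "measure M {\<omega> \<in> space M. a1 \<le> U1 \<omega> \<and> U1 \<omega> < b1 \<and> a2 \<le> U2 \<omega> \<and> U2 \<omega> < b2 \<and> a3 \<le> U3 \<omega> \<and> U3 \<omega> < b3} =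
      ((F a1 a2 a3 - F a1 a2 b3) - (F a1 b2 a3 - F a1 b2 b3)) - ((F b1 a2 a3 - F b1 a2 b3) - (F b1 b2 a3 - F b1 b2 b3))"
    if "o1 \<le> a1" "a1 \<le> b1" "o2 \<le> a2" "a2 \<le> b2" "o3 \<le> a3" "a3 \<le> b3" "b1 + b2 + b3 \<le> s" for a1 b1 a2 b2 a3 b3
  proof -
    have "{\<omega> \<in> space M. a1 \<le> U1 \<omega> \<and> U1 \<omega> < b1 \<and> a2 \<le> U2 \<omega> \<and> U2 \<omega> < b2 \<and> a3 \<le> U3 \<omega> \<and> U3 \<omega> < b3} =
       {\<omega> \<in> space M. a1 \<le> U1 \<omega> \<and> a2 \<le> U2 \<omega> \<and> U2 \<omega> < b2 \<and> a3 \<le> U3 \<omega> \<and> U3 \<omega> < b3} -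
       {\<omega> \<in> space M. b1 \<le> U1 \<omega> \<and> a2 \<le> U2 \<omega> \<and> U2 \<omega> < b2 \<and> a3 \<le> U3 \<omega> \<and> U3 \<omega> < b3}"
      by auto
    also have "measure M \<dots> = ((F a1 a2 a3 - F a1 a2 b3) - (F a1 b2 a3 - F a1 b2 b3)) - ((F b1 a2 a3 - F b1 a2 b3) - (F b1 b2 a3 - F b1 b2 b3))"
      by (subst finite_measure_Diff, measurable, use that in force, subst (1 2) m2) (use that in auto)
    finally show ?thesis .
  qed
  have vimage: "emeasure (distr M borel T) S = emeasure M {\<omega> \<in> space M. T \<omega> \<in> S}" if "S \<in> sets borel" for S
    using that by (subst emeasure_distr[OF T]) (auto intro!: arg_cong2[where f = emeasure])
  have "emeasure (distr M borel T) (tetra o1 o2 o3 s) = emeasure (Rmeas n s) (tetra o1 o2 o3 s)"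
  proof (rule emeasure_tetra_eqI)
    fix a1 a2 a3 b1 b2 b3 :: real
    assume *: "o1 \<le> a1" "a1 \<le> b1" "o2 \<le> a2" "a2 \<le> b2" "o3 \<le> a3" "a3 \<le> b3" "b1 + b2 + b3 \<le> s"
    have "emeasure (distr M borel T) (hbox a1 a2 a3 b1 b2 b3) =
       ennreal (measure M {\<omega> \<in> space M. a1 \<le> U1 \<omega> \<and> U1 \<omega> < b1 \<and> a2 \<le> U2 \<omega> \<and> U2 \<omega> < b2 \<and> a3 \<le> U3 \<omega> \<and> U3 \<omega> < b3})"
      unfolding vimage[OF hbox_borel]
      by (auto simp: T_def hbox_def emeasure_eq_measure intro!: arg_cong2[where f = measure])
    also have "\<dots> = emeasure (Rmeas n s) (hbox a1 a2 a3 b1 b2 b3)"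
      unfolding m3[OF *] F_def by (rule emeasure_Rmeas_hbox[symmetric]) (use o * in linarith)+
    finally show "emeasure (distr M borel T) (hbox a1 a2 a3 b1 b2 b3) = emeasure (Rmeas n s) (hbox a1 a2 a3 b1 b2 b3)" .
  next
    show "emeasure (distr M borel T) (hbox a1 a2 a3 b1 b2 b3) \<noteq> \<infinity>" for a1 a2 a3 b1 b2 b3
      unfolding vimage[OF hbox_borel] by (simp add: emeasure_eq_measure)
  qed simp_all
  then have below: "emeasure (Rmeas n s) (tetra o1 o2 o3 s) = emeasure M {\<omega> \<in> space M. U1 \<omega> + U2 \<omega> + U3 \<omega> < s}"
  proof -
    assume *: "emeasure (distr M borel T) (tetra o1 o2 o3 s) = emeasure (Rmeas n s) (tetra o1 o2 o3 s)"
    have "{\<omega> \<in> space M. T \<omega> \<in> tetra o1 o2 o3 s} = {\<omega> \<in> space M. U1 \<omega> + U2 \<omega> + U3 \<omega> < s}"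
      using lower by (auto simp: T_def tetra_def)
    then show ?thesis
      using * unfolding vimage[OF tetra_borel] by simp
  qed
  have "emeasure M {\<omega> \<in> space M. U1 \<omega> + U2 \<omega> + U3 \<omega> < s} + emeasure M {\<omega> \<in> space M. s \<le> U1 \<omega> + U2 \<omega> + U3 \<omega>} = emeasure M (space M)"
    by (subst plus_emeasure) (auto intro!: arg_cong2[where f = emeasure])
  also have "emeasure M (space M) = emeasure M {\<omega> \<in> space M. o1 \<le> U1 \<omega> \<and> o2 \<le> U2 \<omega> \<and> o3 \<le> U3 \<omega>}"
    using lower by (intro arg_cong2[where f = emeasure]) auto
  also have "\<dots> = ennreal (Xq s o1 o2 o3 ^ n)"
    using o by (intro tail) auto
  also have "\<dots> = emeasure M {\<omega> \<in> space M. U1 \<omega> + U2 \<omega> + U3 \<omega> < s} +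
     ((\<integral>\<^sup>+ u. \<integral>\<^sup>+ v. (if o1 \<le> u \<and> o2 \<le> v \<and> u + v \<le> s - o3 then ennreal (Gp n s u v (s - u - v)) else 0) \<partial>lborel \<partial>lborel)
      + ((\<integral>\<^sup>+ u. (if o1 \<le> u \<and> u \<le> s - o2 - o3 then ennreal (Ep n s u (s - u - o3) o3) else 0) \<partial>lborel)
      + ennreal (Xq s (s - o2 - o3) o2 o3 ^ n)))"
    unfolding below[symmetric] by (rule emeasure_Rmeas_tetra[OF o, symmetric])
  \<comment> \<open>The common summand, the mass below the plane, is finite, so it may be cancelled
    in \<open>ennreal\<close>.\<close>
  finally show ?thesis
    by (simp add: ennreal_add_left_cancel)
qed

section \<open>The fibre of the integer hull over a fixed y\<close>

definition hull_tail :: "nat \<Rightarrow> real \<Rightarrow> real \<Rightarrow> real \<Rightarrow> real \<Rightarrow> ennreal" where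
  "hull_tail n s o1 o2 o3 =
      (\<integral>\<^sup>+ u. \<integral>\<^sup>+ v. (if o1 \<le> u \<and> o2 \<le> v \<and> u + v \<le> s - o3 then ennreal (Gp n s u v (s - u - v)) else 0) \<partial>lborel \<partial>lborel)
      + ((\<integral>\<^sup>+ u. (if o1 \<le> u \<and> u \<le> s - o2 - o3 then ennreal (Ep n s u (s - u - o3) o3) else 0) \<partial>lborel)
      + ennreal (Xq s (s - o2 - o3) o2 o3 ^ n))"

text \<open>The polygon \<open>cell a y\<close> is the downward triangle of size \<open>s\<close> cut off at its corners.\<close>

lemma cell_area_hexagon:
  assumes "y1 + y2 + y3 = 1 + s" "0 \<le> b1" "0 \<le> b2" "0 \<le> b3" "b1 + b2 + b3 \<le> s"
  shows "cell_area (y1 - s + b1) (y2 - s + b2) (y3 - s + b3) y1 y2 y3 = Xq s b1 b2 b3"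
proof -
  have y3: "y3 = 1 + s - y1 - y2" using assms(1) by simp
  have "posq (1 - (y1 - s + b1) - (y2 - s + b2) - (y3 - s + b3)) = (2 * s - b1 - b2 - b3)\<^sup>2"
    using assms by (simp add: posq_def y3)
  moreover have "posq (1 - y1 - (y2 - s + b2) - (y3 - s + b3)) = (s - b2 - b3)\<^sup>2"
    "posq (1 - (y1 - s + b1) - y2 - (y3 - s + b3)) = (s - b1 - b3)\<^sup>2"
    "posq (1 - (y1 - s + b1) - (y2 - s + b2) - y3) = (s - b1 - b2)\<^sup>2"
    using assms by (simp_all add: posq_def y3)
  \<comment> \<open>Two violated upper bounds leave a triangle of size \<open>- b1\<close>,
    \<open>- b2\<close> or \<open>- b3\<close>, and three leave one of size \<open>- s\<close>; all
    of these are empty.\<close>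
  moreover have "posq (1 - y1 - y2 - (y3 - s + b3)) = 0" "posq (1 - y1 - (y2 - s + b2) - y3) = 0"
    "posq (1 - (y1 - s + b1) - y2 - y3) = 0" "posq (1 - y1 - y2 - y3) = 0"
    using assms by (simp_all add: posq_def y3)
  ultimately show ?thesis
    unfolding cell_area_def Xq_def by (simp add: power2_eq_square algebra_simps)
qed

definition col_third :: "real \<times> real \<Rightarrow> real" where
  "col_third p = 1 - fst p - snd p"

lemma mem_cell: "p \<in> cell a1 a2 a3 y1 y2 y3 \<longleftrightarrow> a1 \<le> fst p \<and> fst p \<le> y1 \<and> a2 \<le> snd p \<and> snd p \<le> y2
    \<and> a3 \<le> col_third p \<and> col_third p \<le> y3"
  by (cases p) (simp add: cell_def col_third_def)

definition hull_slice :: "nat \<Rightarrow> (nat \<Rightarrow> real \<times> real) \<Rightarrow> real \<Rightarrow> real \<Rightarrow> real \<Rightarrow> bool" where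
  "hull_slice n c y1 y2 y3 \<longleftrightarrow> (\<forall>j\<in>{1..n}. c j \<in> cell 0 0 0 y1 y2 y3) \<and>
     (\<forall>j1\<in>{1..n}. \<forall>j2\<in>{1..n}. \<forall>j3\<in>{1..n}. 2 \<le> fst (c j1) + snd (c j2) + col_third (c j3) + (y1 + y2 + y3))"

text \<open>The cuts range over all triples of columns, so they constrain only the three row minima.
  \<open>U1\<close> is the height of the first row minimum above \<open>y1 - s\<close>, the least
  value that the upper bounds on the other two rows permit. In these heights the cuts say
  \<open>s \<le> U1 + U2 + U3\<close>, and lower bounds on the heights say that every column lies in
  one truncated triangle.\<close>

lemma emeasure_hull_slice:
  assumes n: "1 \<le> n" and y0: "0 \<le> y1" "0 \<le> y2" "0 \<le> y3" and y: "y1 \<le> 1" "y2 \<le> 1" "y3 \<le> 1" and s: "y1 + y2 + y3 = 1 + s" and s01: "0 \<le> s" "s \<le> 1"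
  shows "2 ^ n * emeasure (col_measure n) {c \<in> space (col_measure n). hull_slice n c y1 y2 y3}
    = hull_tail n s (max 0 (s - y1)) (max 0 (s - y2)) (max 0 (s - y3))"
proof -
  define C where "C = {c \<in> space (col_measure n). \<forall>j\<in>{1..n}. c j \<in> cell 0 0 0 y1 y2 y3}"
  have comp: "(\<lambda>c. c j) \<in> measurable (col_measure n) (lborel \<Otimes>\<^sub>M lborel)" if "j \<in> {1..n}" for j
    unfolding col_measure_def using that by (rule measurable_component_singleton)
  have cells: "{c \<in> space (col_measure n). \<forall>j\<in>{1..n}. c j \<in> cell a1 a2 a3 y1 y2 y3} \<in> sets (col_measure n)" for a1 a2 a3
  proof -
    have "{c \<in> space (col_measure n). \<forall>j\<in>{1..n}. c j \<in> cell a1 a2 a3 y1 y2 y3} = {1..n} \<rightarrow>\<^sub>E cell a1 a2 a3 y1 y2 y3"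
      by (auto simp: space_col_measure PiE_iff extensional_def)
    then show ?thesis
      unfolding col_measure_def by (auto intro!: sets_PiM_I_finite)
  qed
  have C: "C \<in> sets (col_measure n)"
    unfolding C_def by (rule cells)
  \<comment> \<open>The scaling makes the tails equal to \<open>Xq ^ n\<close> with no constant in
    front.\<close>
  let ?M = "scale_measure (2 ^ n) (restrict_space (col_measure n) C)"
  have space: "space ?M = C"
    using sets.sets_into_space[OF C] by (auto simp: space_restrict_space space_scale_measure)
  have em: "emeasure ?M {c \<in> space ?M. P c} = 2 ^ n * emeasure (col_measure n) {c \<in> C. P c}" for P
    unfolding space using C by (subst emeasure_scale_measure, subst emeasure_restrict_space) auto
  have total: "2 ^ n * emeasure (col_measure n) {c \<in> C. True} = ennreal (cell_area 0 0 0 y1 y2 y3 ^ n)"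
    using emeasure_col_cells[OF y0, of n] unfolding C_def by simp
  let ?m = "\<lambda>f c. Min ((\<lambda>j. f (c j)) ` {1..n})"
  define U1 :: "(nat \<Rightarrow> real \<times> real) \<Rightarrow> real" where "U1 = (\<lambda>c. ?m fst c - (y1 - s))"
  define U2 :: "(nat \<Rightarrow> real \<times> real) \<Rightarrow> real" where "U2 = (\<lambda>c. ?m snd c - (y2 - s))"
  define U3 :: "(nat \<Rightarrow> real \<times> real) \<Rightarrow> real" where "U3 = (\<lambda>c. ?m col_third c - (y3 - s))"
  have [measurable]: "(\<lambda>c. ?m f c) \<in> borel_measurable ?M" if "f \<in> borel_measurable (lborel \<Otimes>\<^sub>M lborel)" for f :: "real \<times> real \<Rightarrow> real"
  proof -
    have "(\<lambda>c. ?m f c) \<in> borel_measurable (col_measure n)"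
      by (intro borel_measurable_Min measurable_compose[OF comp that]) auto
    then have "(\<lambda>c. ?m f c) \<in> borel_measurable (restrict_space (col_measure n) C)"
      by (rule measurable_restrict_space1)
    then show ?thesis by (simp cong: measurable_cong_sets)
  qed
  have [measurable]: "col_third \<in> borel_measurable (lborel \<Otimes>\<^sub>M lborel)"
    unfolding col_third_def by measurable
  have ge_Min: "x \<le> ?m f c \<longleftrightarrow> (\<forall>j\<in>{1..n}. x \<le> f (c j))" for x and f :: "real \<times> real \<Rightarrow> real" and c :: "nat \<Rightarrow> real \<times> real"
    using n by (subst Min_ge_iff) auto
  have cell: "0 \<le> fst (c j)" "0 \<le> snd (c j)" "0 \<le> col_third (c j)" "fst (c j) \<le> y1" "snd (c j) \<le> y2" "col_third (c j) \<le> y3"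
    if "c \<in> C" "j \<in> {1..n}" for c j
    using that by (auto simp: C_def mem_cell)
  have "emeasure ?M {c \<in> space ?M. s \<le> U1 c + U2 c + U3 c} = hull_tail n s (max 0 (s - y1)) (max 0 (s - y2)) (max 0 (s - y3))"
    unfolding hull_tail_def
  proof (rule emeasure_tail_sum)
    show "finite_measure ?M"
      using em[of "\<lambda>_. True"] total by (intro finite_measureI) simp
    show "U1 \<in> borel_measurable ?M" "U2 \<in> borel_measurable ?M" "U3 \<in> borel_measurable ?M"
      unfolding U1_def U2_def U3_def by measurable
    \<comment> \<open>If all three maxima are positive their sum is \<open>2 * s - 1\<close>, which
      is where \<open>s \<le> 1\<close> enters. If only the first two are, it is
      \<open>s - 1 + y3\<close>, which needs \<open>y3 \<le> 1\<close>.\<close>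
    show "max 0 (s - y1) + max 0 (s - y2) + max 0 (s - y3) \<le> s"
      using y0 y s s01 by (auto simp: max_def)
    show "max 0 (s - y1) \<le> U1 c \<and> max 0 (s - y2) \<le> U2 c \<and> max 0 (s - y3) \<le> U3 c" if "c \<in> space ?M" for c
    proof -
      have c: "c \<in> C" using that space by simp
      \<comment> \<open>Two lower bounds per entry: it is nonnegative, and it equals one minus the
        other two entries, which gives at least \<open>y1 - s\<close> in row one.\<close>
      have "max 0 (s - y1) + (y1 - s) \<le> fst (c j)" "max 0 (s - y2) + (y2 - s) \<le> snd (c j)"
         "max 0 (s - y3) + (y3 - s) \<le> col_third (c j)" if "j \<in> {1..n}" for j
        using cell[OF c that] s by (auto simp: max_def col_third_def)
      then have "max 0 (s - y1) + (y1 - s) \<le> ?m fst c" "max 0 (s - y2) + (y2 - s) \<le> ?m snd c"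
         "max 0 (s - y3) + (y3 - s) \<le> ?m col_third c"
        by (simp_all only: ge_Min) auto
      then show ?thesis unfolding U1_def U2_def U3_def by linarith
    qed
    fix b1 b2 b3
    assume b: "max 0 (s - y1) \<le> b1" "max 0 (s - y2) \<le> b2" "max 0 (s - y3) \<le> b3" "b1 + b2 + b3 \<le> s"
    have b': "0 \<le> b1" "0 \<le> b2" "0 \<le> b3" "0 \<le> y1 - s + b1" "0 \<le> y2 - s + b2" "0 \<le> y3 - s + b3"
      using b by auto
    have "{c \<in> C. b1 \<le> U1 c \<and> b2 \<le> U2 c \<and> b3 \<le> U3 c} =
       {c \<in> space (col_measure n). \<forall>j\<in>{1..n}. c j \<in> cell (y1 - s + b1) (y2 - s + b2) (y3 - s + b3) y1 y2 y3}"
    proof -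
      have "b1 \<le> U1 c \<longleftrightarrow> (\<forall>j\<in>{1..n}. y1 - s + b1 \<le> fst (c j))" for c
        unfolding ge_Min[symmetric] U1_def by linarith
      moreover have "b2 \<le> U2 c \<longleftrightarrow> (\<forall>j\<in>{1..n}. y2 - s + b2 \<le> snd (c j))" for c
        unfolding ge_Min[symmetric] U2_def by linarith
      moreover have "b3 \<le> U3 c \<longleftrightarrow> (\<forall>j\<in>{1..n}. y3 - s + b3 \<le> col_third (c j))" for c
        unfolding ge_Min[symmetric] U3_def by linarith
      moreover have "p \<in> cell 0 0 0 y1 y2 y3 \<and> y1 - s + b1 \<le> fst p \<and> y2 - s + b2 \<le> snd p \<and> y3 - s + b3 \<le> col_third p \<longleftrightarrow>
          p \<in> cell (y1 - s + b1) (y2 - s + b2) (y3 - s + b3) y1 y2 y3" for p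
        using b' by (auto simp: mem_cell)
      ultimately show ?thesis unfolding C_def by blast
    qed
    then have "emeasure ?M {c \<in> space ?M. b1 \<le> U1 c \<and> b2 \<le> U2 c \<and> b3 \<le> U3 c} =
       ennreal (cell_area (y1 - s + b1) (y2 - s + b2) (y3 - s + b3) y1 y2 y3 ^ n)"
      unfolding em by (simp only:) (rule emeasure_col_cells; use b b' in linarith)
    then show "emeasure ?M {c \<in> space ?M. b1 \<le> U1 c \<and> b2 \<le> U2 c \<and> b3 \<le> U3 c} = ennreal (Xq s b1 b2 b3 ^ n)"
      using cell_area_hexagon[OF s b'(1-3) b(4)] by simp
  qed simp_all
  also have "emeasure ?M {c \<in> space ?M. s \<le> U1 c + U2 c + U3 c} = 2 ^ n * emeasure (col_measure n) {c \<in> C. s \<le> U1 c + U2 c + U3 c}"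
    by (rule em)
  also have "{c \<in> C. s \<le> U1 c + U2 c + U3 c} = {c \<in> space (col_measure n). hull_slice n c y1 y2 y3}"
  proof -
    have "s \<le> U1 c + U2 c + U3 c \<longleftrightarrow>
      (\<forall>j1\<in>{1..n}. \<forall>j2\<in>{1..n}. \<forall>j3\<in>{1..n}. 2 \<le> fst (c j1) + snd (c j2) + col_third (c j3) + (y1 + y2 + y3))" for c
    proof -
      have "s \<le> U1 c + U2 c + U3 c \<longleftrightarrow> 2 - (y1 + y2 + y3) - ?m snd c - ?m col_third c \<le> ?m fst c"
        unfolding U1_def U2_def U3_def using s by linarith
      also have "\<dots> \<longleftrightarrow> (\<forall>j1\<in>{1..n}. 2 - (y1 + y2 + y3) - fst (c j1) - ?m col_third c \<le> ?m snd c)"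
        by (subst ge_Min, intro ball_cong refl, linarith)
      also have "\<dots> \<longleftrightarrow> (\<forall>j1\<in>{1..n}. \<forall>j2\<in>{1..n}. 2 - (y1 + y2 + y3) - fst (c j1) - snd (c j2) \<le> ?m col_third c)"
        by (intro ball_cong refl, subst ge_Min, intro ball_cong refl, linarith)
      also have "\<dots> \<longleftrightarrow> (\<forall>j1\<in>{1..n}. \<forall>j2\<in>{1..n}. \<forall>j3\<in>{1..n}. 2 \<le> fst (c j1) + snd (c j2) + col_third (c j3) + (y1 + y2 + y3))"
        by (intro ball_cong refl, subst ge_Min, intro ball_cong refl, linarith)
      finally show ?thesis .
    qed
    then show ?thesis unfolding C_def hull_slice_def by blast
  qed
  finally show ?thesis .
qed

section \<open>The integer hull by inequalities\<close>

definition hull_ineq :: "nat \<Rightarrow> point set" where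
  "hull_ineq n = {(x, y) \<in> P_poly 3 n \<inter> D_aff 3 n.
     \<forall>j1\<in>{1..n}. \<forall>j2\<in>{1..n}. \<forall>j3\<in>{1..n}. 2 \<le> x 1 j1 + x 2 j2 + x 3 j3 + (y 1 + y 2 + y 3)}"

lemma ball_three: "(\<forall>i\<in>{1..3::nat}. P i) \<longleftrightarrow> P 1 \<and> P 2 \<and> P 3"
proof -
  have "{1..3::nat} = {1, 2, 3}" by auto
  then show ?thesis by simp
qed

lemma hull_ineq_iff:
  "(x, y) \<in> hull_ineq n \<longleftrightarrow> (x, y) \<in> ambient 3 n \<and>
    (\<forall>j\<in>{1..n}. 0 \<le> x 1 j \<and> x 1 j \<le> y 1 \<and> 0 \<le> x 2 j \<and> x 2 j \<le> y 2 \<and> 0 \<le> x 3 j \<and> x 3 j \<le> y 3 \<and> x 1 j + x 2 j + x 3 j = 1) \<and>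
    y 1 \<le> 1 \<and> y 2 \<le> 1 \<and> y 3 \<le> 1 \<and>
    (\<forall>j1\<in>{1..n}. \<forall>j2\<in>{1..n}. \<forall>j3\<in>{1..n}. 2 \<le> x 1 j1 + x 2 j2 + x 3 j3 + (y 1 + y 2 + y 3))"
  unfolding hull_ineq_def P_poly_def D_aff_def Int_iff mem_Collect_eq case_prod_conv ball_three sum_three by blast

lemma convex_hull_ineq: "convex (hull_ineq n)"
proof (rule convexI)
  fix p q :: point and u v :: real
  assume p: "p \<in> hull_ineq n" and q: "q \<in> hull_ineq n" and uv: "0 \<le> u" "0 \<le> v" "u + v = 1"
  obtain x y x' y' where pq: "p = (x, y)" "q = (x', y')" by (metis prod.exhaust)
  have comb_le: "u * a + v * a' \<le> u * b + v * b'" if "a \<le> b" "a' \<le> b'" for a a' b b' :: real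
    using that uv by (intro add_mono mult_left_mono)
  have uv_const: "u * a + v * a = a" for a
    using uv by (metis distrib_right mult_1)
  note P = p[unfolded pq hull_ineq_iff] and Q = q[unfolded pq hull_ineq_iff]
  have "u *\<^sub>R p + v *\<^sub>R q = (\<lambda>i j. u * x i j + v * x' i j, \<lambda>i. u * y i + v * y' i)"
    by (simp add: pq fun_eq_iff)
  also have "\<dots> \<in> hull_ineq n"
    unfolding hull_ineq_iff
  proof (intro conjI ballI)
    show "(\<lambda>i j. u * x i j + v * x' i j, \<lambda>i. u * y i + v * y' i) \<in> ambient 3 n"
      using P Q by (simp add: ambient_def)
  next
    fix j assume j: "j \<in> {1..n}"
    show "0 \<le> u * x 1 j + v * x' 1 j" "0 \<le> u * x 2 j + v * x' 2 j" "0 \<le> u * x 3 j + v * x' 3 j"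
      using P Q j uv by simp_all
    show "u * x 1 j + v * x' 1 j \<le> u * y 1 + v * y' 1" "u * x 2 j + v * x' 2 j \<le> u * y 2 + v * y' 2"
      "u * x 3 j + v * x' 3 j \<le> u * y 3 + v * y' 3"
      using P Q j by (blast intro: comb_le)+
    have "u * x 1 j + v * x' 1 j + (u * x 2 j + v * x' 2 j) + (u * x 3 j + v * x' 3 j) =
       u * (x 1 j + x 2 j + x 3 j) + v * (x' 1 j + x' 2 j + x' 3 j)" by (simp add: algebra_simps)
    also have "\<dots> = 1" using P Q j uv by simp
    finally show "u * x 1 j + v * x' 1 j + (u * x 2 j + v * x' 2 j) + (u * x 3 j + v * x' 3 j) = 1" .
  next
    show "u * y 1 + v * y' 1 \<le> 1" "u * y 2 + v * y' 2 \<le> 1" "u * y 3 + v * y' 3 \<le> 1"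
      using P Q comb_le[of _ 1 _ 1] uv by simp_all
  next
    fix j1 j2 j3 assume j: "j1 \<in> {1..n}" "j2 \<in> {1..n}" "j3 \<in> {1..n}"
    have "u * 2 + v * 2 \<le> u * (x 1 j1 + x 2 j2 + x 3 j3 + (y 1 + y 2 + y 3)) + v * (x' 1 j1 + x' 2 j2 + x' 3 j3 + (y' 1 + y' 2 + y' 3))"
      by (rule comb_le) (use P Q j in blast)+
    then show "2 \<le> u * x 1 j1 + v * x' 1 j1 + (u * x 2 j2 + v * x' 2 j2) + (u * x 3 j3 + v * x' 3 j3)
         + (u * y 1 + v * y' 1 + (u * y 2 + v * y' 2) + (u * y 3 + v * y' 3))"
      unfolding uv_const by (simp add: algebra_simps)
  qed
  finally show "u *\<^sub>R p + v *\<^sub>R q \<in> hull_ineq n" .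
qed

definition int_points :: "nat \<Rightarrow> point set" where
  "int_points n = {(x, y) \<in> P_poly 3 n \<inter> D_aff 3 n. \<forall>i\<in>{1..3}. y i \<in> {0, 1}}"

lemma int_hull_eq: "int_hull 3 n = convex hull (int_points n)"
  unfolding int_hull_def int_points_def by (rule refl)

lemma int_points_iff:
  "(x, y) \<in> int_points n \<longleftrightarrow> (x, y) \<in> ambient 3 n \<and>
    (\<forall>j\<in>{1..n}. 0 \<le> x 1 j \<and> x 1 j \<le> y 1 \<and> 0 \<le> x 2 j \<and> x 2 j \<le> y 2 \<and> 0 \<le> x 3 j \<and> x 3 j \<le> y 3 \<and> x 1 j + x 2 j + x 3 j = 1) \<and>
    (y 1 \<le> 1 \<and> y 2 \<le> 1 \<and> y 3 \<le> 1) \<and> y 1 \<in> {0, 1} \<and> y 2 \<in> {0, 1} \<and> y 3 \<in> {0, 1}"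
  unfolding int_points_def P_poly_def D_aff_def Int_iff mem_Collect_eq case_prod_conv ball_three sum_three by blast

text \<open>If two or three entries of \<open>y\<close> are 1, the sum of \<open>y\<close> alone
  reaches 2. If only one is, every column puts its whole mass 1 into that row. Once \<open>y\<close>
  is fixed to 0 or 1, both cases follow linearly from the bounds \<open>lower\<close>.\<close>

lemma int_points_subset:
  assumes "1 \<le> n"
  shows "int_points n \<subseteq> hull_ineq n"
proof
  fix p assume p: "p \<in> int_points n"
  obtain x y where xy: "p = (x, y)" by (metis prod.exhaust)
  note H = p[unfolded xy int_points_iff]
  have col: "\<forall>j\<in>{1..n}. 0 \<le> x 1 j \<and> x 1 j \<le> y 1 \<and> 0 \<le> x 2 j \<and> x 2 j \<le> y 2 \<and> 0 \<le> x 3 j \<and> x 3 j \<le> y 3 \<and> x 1 j + x 2 j + x 3 j = 1"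
    using H by blast
  have y: "y 1 = 0 \<or> y 1 = 1" "y 2 = 0 \<or> y 2 = 1" "y 3 = 0 \<or> y 3 = 1"
    using H by blast+
  have "2 \<le> x 1 j1 + x 2 j2 + x 3 j3 + (y 1 + y 2 + y 3)"
    if j: "j1 \<in> {1..n}" "j2 \<in> {1..n}" "j3 \<in> {1..n}" for j1 j2 j3
  proof -
    have 1: "0 \<le> x 1 j1" "x 2 j1 \<le> y 2" "x 3 j1 \<le> y 3" "x 1 j1 \<le> y 1" "x 1 j1 + x 2 j1 + x 3 j1 = 1"
      using bspec[OF col j(1)] by blast+
    have 2: "0 \<le> x 2 j2" "x 1 j2 \<le> y 1" "x 3 j2 \<le> y 3" "x 1 j2 + x 2 j2 + x 3 j2 = 1"
      using bspec[OF col j(2)] by blast+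
    have 3: "0 \<le> x 3 j3" "x 1 j3 \<le> y 1" "x 2 j3 \<le> y 2" "x 1 j3 + x 2 j3 + x 3 j3 = 1"
      using bspec[OF col j(3)] by blast+
    have lower: "1 - y 2 - y 3 \<le> x 1 j1" "1 - y 1 - y 3 \<le> x 2 j2" "1 - y 1 - y 2 \<le> x 3 j3" "1 \<le> y 1 + y 2 + y 3"
      using 1 2 3 by linarith+
    show ?thesis
      using y(1)
    proof
      assume y1: "y 1 = 0"
      show ?thesis using y(2)
        by (rule disjE; use y(3) in \<open>rule disjE; use lower 1(1) 2(1) 3(1) y1 in linarith\<close>)
    next
      assume y1: "y 1 = 1"
      show ?thesis using y(2)
        by (rule disjE; use y(3) in \<open>rule disjE; use lower 1(1) 2(1) 3(1) y1 in linarith\<close>)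
    qed
  qed
  then show "p \<in> hull_ineq n"
    unfolding xy hull_ineq_iff using H by blast
qed

text \<open>The homogenised hull. A point is assembled as a sum of unnormalised pieces, one per
  support, whose weights add up to 1; a weight may be zero.\<close>

definition in_cone :: "nat \<Rightarrow> real \<Rightarrow> point \<Rightarrow> bool" where
  "in_cone n t p \<longleftrightarrow> 0 \<le> t \<and> (\<exists>q\<in>convex hull (int_points n). p = t *\<^sub>R q)"

lemma in_coneI: "q \<in> int_points n \<Longrightarrow> 0 \<le> t \<Longrightarrow> p = t *\<^sub>R q \<Longrightarrow> in_cone n t p"
  unfolding in_cone_def by (intro conjI bexI[of _ q] hull_inc)

lemma in_cone_add:
  assumes "in_cone n s p" "in_cone n t q"
  shows "in_cone n (s + t) (p + q)"
proof -
  obtain p' q' where p: "p' \<in> convex hull (int_points n)" "p = s *\<^sub>R p'" "0 \<le> s"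
    and q: "q' \<in> convex hull (int_points n)" "q = t *\<^sub>R q'" "0 \<le> t"
    using assms unfolding in_cone_def by blast
  show ?thesis
  proof (cases "s + t = 0")
    case True
    then have "s = 0" "t = 0" using p q by auto
    then show ?thesis using p q unfolding in_cone_def by (intro conjI bexI[of _ p']) simp_all
  next
    case False
    have "(s / (s + t)) *\<^sub>R p' + (t / (s + t)) *\<^sub>R q' \<in> convex hull (int_points n)"
    proof (rule convexD[OF convex_convex_hull p(1) q(1)])
      show "0 \<le> s / (s + t)" "0 \<le> t / (s + t)" using p(3) q(3) by simp_all
      show "s / (s + t) + t / (s + t) = 1" using False by (simp only: add_divide_distrib[symmetric]) simp
    qed
    moreover have "p + q = (s + t) *\<^sub>R ((s / (s + t)) *\<^sub>R p' + (t / (s + t)) *\<^sub>R q')"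
      using False by (simp add: p q scaleR_add_right)
    ultimately show ?thesis using p(3) q(3) unfolding in_cone_def by (intro conjI bexI) simp_all
  qed
qed

text \<open>The piece of one support: \<open>e1\<close>, \<open>e2\<close>, \<open>e3\<close>
  indicate the rows in it, \<open>t\<close> is its weight, and each column distributes the mass
  \<open>t\<close> freely among these rows.\<close>

lemma in_cone_piece:
  fixes f1 f2 f3 :: "nat \<Rightarrow> real" and e1 e2 e3 t :: real
  assumes t: "0 \<le> t" and e: "e1 \<in> {0, 1}" "e2 \<in> {0, 1}" "e3 \<in> {0, 1}" "e1 + e2 + e3 > 0"
    and f: "\<And>j. j \<in> {1..n} \<Longrightarrow> 0 \<le> f1 j \<and> f1 j \<le> e1 * t \<and> 0 \<le> f2 j \<and> f2 j \<le> e2 * t \<and> 0 \<le> f3 j \<and> f3 j \<le> e3 * t \<and> f1 j + f2 j + f3 j = t"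
  shows "in_cone n t (\<lambda>i j. if j \<in> {1..n} then if i = 1 then f1 j else if i = 2 then f2 j else if i = 3 then f3 j else 0 else 0,
     \<lambda>i. if i = 1 then e1 * t else if i = 2 then e2 * t else if i = 3 then e3 * t else 0)" (is "in_cone n t (?x f1 f2 f3, ?y t)")
proof -
  have f': "0 \<le> f1 j" "f1 j \<le> e1 * t" "0 \<le> f2 j" "f2 j \<le> e2 * t" "0 \<le> f3 j" "f3 j \<le> e3 * t" "f1 j + f2 j + f3 j = t"
    if "j \<in> {1..n}" for j
    using f[OF that] by blast+
  have e1: "e1 \<le> 1" "e2 \<le> 1" "e3 \<le> 1" using e by auto
  show ?thesis
  proof (cases "t = 0")
    case False
    then have pos: "0 < t" using t by simp
    let ?g = "\<lambda>f j. f j / t"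
    have A: "(?x (?g f1) (?g f2) (?g f3), ?y 1) \<in> int_points n"
      unfolding int_points_iff
    proof (intro conjI ballI)
      show "(?x (?g f1) (?g f2) (?g f3), ?y 1) \<in> ambient 3 n"
        by (simp add: ambient_def)
    next
      fix j assume j: "j \<in> {1..n}"
      have "f1 j / t + f2 j / t + f3 j / t = (f1 j + f2 j + f3 j) / t"
        by (simp only: add_divide_distrib)
      also have "\<dots> = 1" unfolding f'(7)[OF j] using pos by simp
      finally show "?x (?g f1) (?g f2) (?g f3) 1 j + ?x (?g f1) (?g f2) (?g f3) 2 j + ?x (?g f1) (?g f2) (?g f3) 3 j = 1"
        using j by simp
      show "0 \<le> ?x (?g f1) (?g f2) (?g f3) 1 j" using f'(1)[OF j] pos by simp
      show "0 \<le> ?x (?g f1) (?g f2) (?g f3) 2 j" using f'(3)[OF j] pos by simp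
      show "0 \<le> ?x (?g f1) (?g f2) (?g f3) 3 j" using f'(5)[OF j] pos by simp
      show "?x (?g f1) (?g f2) (?g f3) 1 j \<le> ?y 1 1" using f'(2)[OF j] pos j by (simp add: pos_divide_le_eq)
      show "?x (?g f1) (?g f2) (?g f3) 2 j \<le> ?y 1 2" using f'(4)[OF j] pos j by (simp add: pos_divide_le_eq)
      show "?x (?g f1) (?g f2) (?g f3) 3 j \<le> ?y 1 3" using f'(6)[OF j] pos j by (simp add: pos_divide_le_eq)
    qed (use e e1 in simp_all)
    have B: "(?x f1 f2 f3, ?y t) = t *\<^sub>R (?x (?g f1) (?g f2) (?g f3), ?y 1)"
      using False by (simp add: fun_eq_iff)
    show ?thesis
      by (rule in_coneI[OF A t B])
  next
    case True
    have f0: "f1 j = 0" "f2 j = 0" "f3 j = 0" if "j \<in> {1..n}" for j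
      using f'(1-6)[OF that] unfolding True by simp_all
    \<comment> \<open>A piece of weight zero is the zero vector, which is 0 times any integer point;
      this one has full support and all its mass in row one.\<close>
    let ?p = "(?x (\<lambda>_. 1) (\<lambda>_. 0) (\<lambda>_. 0), \<lambda>i. if i = 1 \<or> i = 2 \<or> i = (3::nat) then 1 else (0::real))"
    have A: "?p \<in> int_points n"
      unfolding int_points_iff by (simp add: ambient_def)
    have B: "(?x f1 f2 f3, ?y t) = t *\<^sub>R ?p"
      using f0 by (simp add: fun_eq_iff True)
    show ?thesis
      by (rule in_coneI[OF A t B])
  qed
qed

text \<open>Greedy choice: the first summand is as large as the lower bounds of the others permit,
  then the second, and the third takes the rest.\<close>

lemma split_three:
  fixes t :: real
  assumes "lo1 \<le> hi1" "lo2 \<le> hi2" "lo3 \<le> hi3" "lo1 + lo2 + lo3 \<le> t" "t \<le> hi1 + hi2 + hi3"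
  obtains a1 a2 a3 where "lo1 \<le> a1" "a1 \<le> hi1" "lo2 \<le> a2" "a2 \<le> hi2" "lo3 \<le> a3" "a3 \<le> hi3" "a1 + a2 + a3 = t"
proof -
  define a1 where "a1 = min hi1 (t - lo2 - lo3)"
  define a2 where "a2 = min hi2 (t - a1 - lo3)"
  show thesis
    by (rule that[of a1 a2 "t - a1 - a2"]) (use assms in \<open>auto simp: a1_def a2_def min_def\<close>)
qed

text \<open>\<open>c3\<close>, \<open>c2\<close>, \<open>c1\<close> are the capacities of the
  supports {1,2}, {1,3}, {2,3}, and \<open>x1 - a1 - r1\<close> is the demand of row one after the
  singletons and the full support have been served. The part \<open>p\<close> of \<open>c3\<close>
  sent to row one fixes everything else: row one takes the rest of its demand from
  \<open>c2\<close>, row two takes \<open>c3 - p\<close> and then draws on \<open>c1\<close>. Each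
  lower bound on \<open>p\<close> stays below each upper bound because the demands add up to the
  capacities and none exceeds the two capacities serving it.\<close>

lemma routing_exists:
  fixes x1 x2 x3 r1 r2 r3 a1 a2 a3 c1 c2 c3 t :: real
  assumes r: "x1 + x2 + x3 = (1::real)" "0 \<le> r1 \<and> 0 \<le> r2 \<and> 0 \<le> r3 \<and> r1 + r2 + r3 = t \<and>
        0 \<le> x1 - a1 - r1 \<and> x1 - a1 - r1 \<le> c2 + c3 \<and> 0 \<le> x2 - a2 - r2 \<and> x2 - a2 - r2 \<le> c1 + c3 \<and>
        0 \<le> x3 - a3 - r3 \<and> x3 - a3 - r3 \<le> c1 + c2"
    and w: "0 \<le> a1" "0 \<le> a2" "0 \<le> a3" "0 \<le> c1" "0 \<le> c2" "0 \<le> c3" "0 \<le> t" "a1 + a2 + a3 + c1 + c2 + c3 + t = 1"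
  shows "\<exists>p. 0 \<le> p \<and> p \<le> c3 \<and> 0 \<le> x1 - a1 - r1 - p \<and> x1 - a1 - r1 - p \<le> c2 \<and>
      0 \<le> x2 - a2 - r2 - c3 + p \<and> x2 - a2 - r2 - c3 + p \<le> c1"
proof -
    have r': "0 \<le> r1" "0 \<le> r2" "0 \<le> r3" "r1 + r2 + r3 = t" "0 \<le> x1 - a1 - r1" "x1 - a1 - r1 \<le> c2 + c3"
      "0 \<le> x2 - a2 - r2" "x2 - a2 - r2 \<le> c1 + c3" "0 \<le> x3 - a3 - r3" "x3 - a3 - r3 \<le> c1 + c2"
      using r(2) by simp_all
    define p where "p = max 0 (max (x1 - a1 - r1 - c2) (c3 - (x2 - a2 - r2)))"
    have p: "0 \<le> p" "x1 - a1 - r1 - c2 \<le> p" "c3 - (x2 - a2 - r2) \<le> p"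
      by (simp_all add: p_def le_max_iff_disj)
    have a: "p \<le> c3" "p \<le> x1 - a1 - r1" "p \<le> c1 + c3 - (x2 - a2 - r2)"
      unfolding p_def using r(1) r' w by (intro max.boundedI; linarith)+
    show ?thesis using p a by (intro exI[of _ p] conjI; linarith)
qed

text \<open>Here the pair supports have weights \<open>1 - y1\<close>, \<open>1 - y2\<close>,
  \<open>1 - y3\<close> and the full support has the excess of the sum over 2 as weight
  \<open>t\<close>. The condition on the remaining demand of row one reads
  \<open>x1 - y1 + t \<le> r1\<close>, so each share \<open>r1\<close> ranges over an interval and
  \<open>split_three\<close> applies.\<close>

lemma route_large:
  fixes x1 x2 x3 y1 y2 y3 :: real
  assumes x: "0 \<le> x1" "x1 \<le> y1" "0 \<le> x2" "x2 \<le> y2" "0 \<le> x3" "x3 \<le> y3" "x1 + x2 + x3 = 1"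
    and y: "y1 \<le> 1" "y2 \<le> 1" "y3 \<le> 1" "2 \<le> y1 + y2 + y3"
  shows "\<exists>r1 r2 r3. 0 \<le> r1 \<and> 0 \<le> r2 \<and> 0 \<le> r3 \<and> r1 + r2 + r3 = y1 + y2 + y3 - 2 \<and>
        0 \<le> x1 - 0 - r1 \<and> x1 - 0 - r1 \<le> 1 - y2 + (1 - y3) \<and> 0 \<le> x2 - 0 - r2 \<and> x2 - 0 - r2 \<le> 1 - y1 + (1 - y3) \<and>
        0 \<le> x3 - 0 - r3 \<and> x3 - 0 - r3 \<le> 1 - y1 + (1 - y2)"
proof -
  let ?t = "y1 + y2 + y3 - 2"
  obtain r1 r2 r3 where r: "max 0 (x1 - y1 + ?t) \<le> r1" "r1 \<le> x1" "max 0 (x2 - y2 + ?t) \<le> r2" "r2 \<le> x2"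
      "max 0 (x3 - y3 + ?t) \<le> r3" "r3 \<le> x3" "r1 + r2 + r3 = ?t"
  proof (rule split_three[of "max 0 (x1 - y1 + ?t)" x1 "max 0 (x2 - y2 + ?t)" x2 "max 0 (x3 - y3 + ?t)" x3 ?t])
    show "max 0 (x1 - y1 + ?t) \<le> x1" "max 0 (x2 - y2 + ?t) \<le> x2" "max 0 (x3 - y3 + ?t) \<le> x3"
      using x y by (intro max.boundedI; linarith)+
    show "max 0 (x1 - y1 + ?t) + max 0 (x2 - y2 + ?t) + max 0 (x3 - y3 + ?t) \<le> ?t"
      using x y by linarith
    show "?t \<le> x1 + x2 + x3" using x y by linarith
  qed
  have r': "0 \<le> r1" "x1 - y1 + ?t \<le> r1" "0 \<le> r2" "x2 - y2 + ?t \<le> r2" "0 \<le> r3" "x3 - y3 + ?t \<le> r3"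
    using max.boundedE[OF r(1)] max.boundedE[OF r(3)] max.boundedE[OF r(5)] by blast+
  have "0 \<le> r1 \<and> 0 \<le> r2 \<and> 0 \<le> r3 \<and> r1 + r2 + r3 = ?t \<and>
        0 \<le> x1 - 0 - r1 \<and> x1 - 0 - r1 \<le> 1 - y2 + (1 - y3) \<and> 0 \<le> x2 - 0 - r2 \<and> x2 - 0 - r2 \<le> 1 - y1 + (1 - y3) \<and>
        0 \<le> x3 - 0 - r3 \<and> x3 - 0 - r3 \<le> 1 - y1 + (1 - y2)"
    using r(2,4,6,7) r' by (intro conjI; linarith)
  then show ?thesis by blast
qed

text \<open>A singleton support puts its weight into every column of its row, so \<open>a1\<close>
  is at most the row minimum \<open>m1\<close>. Given the sum of the three weights,
  \<open>1 - y2 - y3 \<le> a1\<close> says that the weight \<open>1 - y1 - a2 - a3\<close> left for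
  the support {2,3} is nonnegative. The cut says exactly that the upper bounds add up to
  enough.\<close>

lemma singles_small:
  fixes m1 m2 m3 y1 y2 y3 :: real
  assumes m: "0 \<le> m1" "1 - y2 - y3 \<le> m1" "0 \<le> m2" "1 - y1 - y3 \<le> m2" "0 \<le> m3" "1 - y1 - y2 \<le> m3"
    and y: "0 \<le> y1" "0 \<le> y2" "0 \<le> y3" "y1 \<le> 1" "y2 \<le> 1" "y3 \<le> 1" "1 \<le> y1 + y2 + y3" "y1 + y2 + y3 \<le> 2"
    and cut: "2 \<le> m1 + m2 + m3 + (y1 + y2 + y3)"
  obtains a1 a2 a3 where "0 \<le> a1" "1 - y2 - y3 \<le> a1" "a1 \<le> m1" "0 \<le> a2" "1 - y1 - y3 \<le> a2" "a2 \<le> m2"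
    "0 \<le> a3" "1 - y1 - y2 \<le> a3" "a3 \<le> m3" "a1 + a2 + a3 = 2 - (y1 + y2 + y3)"
proof -
  obtain a1 a2 a3 where a: "max 0 (1 - y2 - y3) \<le> a1" "a1 \<le> m1" "max 0 (1 - y1 - y3) \<le> a2" "a2 \<le> m2"
      "max 0 (1 - y1 - y2) \<le> a3" "a3 \<le> m3" "a1 + a2 + a3 = 2 - (y1 + y2 + y3)"
  proof (rule split_three[of "max 0 (1 - y2 - y3)" m1 "max 0 (1 - y1 - y3)" m2 "max 0 (1 - y1 - y2)" m3 "2 - (y1 + y2 + y3)"])
    show "max 0 (1 - y2 - y3) \<le> m1" "max 0 (1 - y1 - y3) \<le> m2" "max 0 (1 - y1 - y2) \<le> m3"
      using m by (intro max.boundedI; linarith)+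
    show "max 0 (1 - y2 - y3) + max 0 (1 - y1 - y3) + max 0 (1 - y1 - y2) \<le> 2 - (y1 + y2 + y3)"
      using y by linarith
    show "2 - (y1 + y2 + y3) \<le> m1 + m2 + m3" using cut by linarith
  qed
  have "0 \<le> a1" "1 - y2 - y3 \<le> a1" "0 \<le> a2" "1 - y1 - y3 \<le> a2" "0 \<le> a3" "1 - y1 - y2 \<le> a3"
    using max.boundedE[OF a(1)] max.boundedE[OF a(3)] max.boundedE[OF a(5)] by blast+
  then show thesis using that a by blast
qed

text \<open>A point is a convex combination of integer points as soon as its columns can be routed through
  the supports: \<open>a\<^sub>i\<close>, \<open>c\<^sub>i\<close> and \<open>t\<close> are the weights of the supports \<open>{i}\<close>, \<open>{1,2,3} - {i}\<close> and \<open>{1,2,3}\<close>.\<close>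

lemma in_int_hull_if_routed:
  fixes x :: "nat \<Rightarrow> nat \<Rightarrow> real" and y :: "nat \<Rightarrow> real"
  assumes amb: "(x, y) \<in> ambient 3 n"
    and w: "0 \<le> a1" "0 \<le> a2" "0 \<le> a3" "0 \<le> c1" "0 \<le> c2" "0 \<le> c3" "0 \<le> t" "a1 + a2 + a3 + c1 + c2 + c3 + t = 1"
    and y: "y 1 = a1 + c2 + c3 + t" "y 2 = a2 + c1 + c3 + t" "y 3 = a3 + c1 + c2 + t"
    and route: "\<And>j. j \<in> {1..n} \<Longrightarrow> x 1 j + x 2 j + x 3 j = 1 \<and> (\<exists>r1 r2 r3. 0 \<le> r1 \<and> 0 \<le> r2 \<and> 0 \<le> r3 \<and> r1 + r2 + r3 = t \<and>
        0 \<le> x 1 j - a1 - r1 \<and> x 1 j - a1 - r1 \<le> c2 + c3 \<and> 0 \<le> x 2 j - a2 - r2 \<and> x 2 j - a2 - r2 \<le> c1 + c3 \<and>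
        0 \<le> x 3 j - a3 - r3 \<and> x 3 j - a3 - r3 \<le> c1 + c2)"
  shows "(x, y) \<in> convex hull (int_points n)"
proof -
  have "\<forall>j\<in>{1..n}. \<exists>q. case q of (r1, r2, r3, p) \<Rightarrow> 0 \<le> r1 \<and> 0 \<le> r2 \<and> 0 \<le> r3 \<and> r1 + r2 + r3 = t \<and>
      0 \<le> p \<and> p \<le> c3 \<and> 0 \<le> x 1 j - a1 - r1 - p \<and> x 1 j - a1 - r1 - p \<le> c2 \<and>
      0 \<le> x 2 j - a2 - r2 - c3 + p \<and> x 2 j - a2 - r2 - c3 + p \<le> c1" (is "\<forall>j\<in>_. \<exists>q. ?P j q")
  proof
    fix j assume "j \<in> {1..n}"
    from route[OF this] obtain r1 r2 r3 where r: "x 1 j + x 2 j + x 3 j = 1" "0 \<le> r1 \<and> 0 \<le> r2 \<and> 0 \<le> r3 \<and> r1 + r2 + r3 = t \<and>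
        0 \<le> x 1 j - a1 - r1 \<and> x 1 j - a1 - r1 \<le> c2 + c3 \<and> 0 \<le> x 2 j - a2 - r2 \<and> x 2 j - a2 - r2 \<le> c1 + c3 \<and>
        0 \<le> x 3 j - a3 - r3 \<and> x 3 j - a3 - r3 \<le> c1 + c2" by blast
    obtain p where "0 \<le> p \<and> p \<le> c3 \<and> 0 \<le> x 1 j - a1 - r1 - p \<and> x 1 j - a1 - r1 - p \<le> c2 \<and>
      0 \<le> x 2 j - a2 - r2 - c3 + p \<and> x 2 j - a2 - r2 - c3 + p \<le> c1"
      using routing_exists[OF r w] by blast
    then have "?P j (r1, r2, r3, p)"
      using r(2) unfolding case_prod_conv by blast
    then show "\<exists>q. ?P j q" by blast
  qed
  from bchoice[OF this] obtain q where q: "\<forall>j\<in>{1..n}. ?P j (q j)" by (rule exE)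
  define r1 where "r1 = (\<lambda>j. fst (q j))"
  define r2 where "r2 = (\<lambda>j. fst (snd (q j)))"
  define r3 where "r3 = (\<lambda>j. fst (snd (snd (q j))))"
  define p where "p = (\<lambda>j. snd (snd (snd (q j))))"
  have q': "0 \<le> r1 j" "0 \<le> r2 j" "0 \<le> r3 j" "r1 j + r2 j + r3 j = t" "0 \<le> p j" "p j \<le> c3"
      "0 \<le> x 1 j - a1 - r1 j - p j" "x 1 j - a1 - r1 j - p j \<le> c2"
      "0 \<le> x 2 j - a2 - r2 j - c3 + p j" "x 2 j - a2 - r2 j - c3 + p j \<le> c1" "x 1 j + x 2 j + x 3 j = 1" if "j \<in> {1..n}" for j
    using bspec[OF q that] route[OF that] unfolding r1_def r2_def r3_def p_def split_def by blast+
  let ?q = "\<lambda>f1 f2 f3 e1 e2 e3 t. (\<lambda>i j. if j \<in> {1..n} then if i = 1 then f1 j else if i = 2 then f2 j else if i = 3 then f3 j else (0::real) else 0,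
     \<lambda>i. if i = 1 then e1 * t else if i = 2 then e2 * t else if i = 3 then e3 * t else (0::real)) :: point"
  have "in_cone n a1 (?q (\<lambda>_. a1) (\<lambda>_. 0) (\<lambda>_. 0) 1 0 0 a1)" "in_cone n a2 (?q (\<lambda>_. 0) (\<lambda>_. a2) (\<lambda>_. 0) 0 1 0 a2)"
    "in_cone n a3 (?q (\<lambda>_. 0) (\<lambda>_. 0) (\<lambda>_. a3) 0 0 1 a3)"
    using w by (intro in_cone_piece; simp)+
  \<comment> \<open>Support {1,2}; the next two pieces belong to {1,3} and {2,3}. Each divides its
    capacity as found by \<open>routing_exists\<close>.\<close>
  moreover have "in_cone n c3 (?q p (\<lambda>j. c3 - p j) (\<lambda>_. 0) 1 1 0 c3)"
  proof (rule in_cone_piece)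
    fix j assume "j \<in> {1..n}"
    from q'[OF this] w show "0 \<le> p j \<and> p j \<le> 1 * c3 \<and> 0 \<le> (c3 - p j) \<and> (c3 - p j) \<le> 1 * c3 \<and> (0::real) \<le> 0 \<and> 0 \<le> 0 * c3 \<and> p j + (c3 - p j) + 0 = c3"
      by (intro conjI; linarith)
  qed (use w in simp_all)
  moreover have "in_cone n c2 (?q (\<lambda>j. x 1 j - a1 - r1 j - p j) (\<lambda>_. 0) (\<lambda>j. c2 - (x 1 j - a1 - r1 j - p j)) 1 0 1 c2)"
  proof (rule in_cone_piece)
    fix j assume "j \<in> {1..n}"
    from q'[OF this] w show "0 \<le> (x 1 j - a1 - r1 j - p j) \<and> (x 1 j - a1 - r1 j - p j) \<le> 1 * c2 \<and> (0::real) \<le> 0 \<and> 0 \<le> 0 * c2 \<and> 0 \<le> (c2 - (x 1 j - a1 - r1 j - p j)) \<and> (c2 - (x 1 j - a1 - r1 j - p j)) \<le> 1 * c2 \<and> (x 1 j - a1 - r1 j - p j) + 0 + (c2 - (x 1 j - a1 - r1 j - p j)) = c2"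
      by (intro conjI; linarith)
  qed (use w in simp_all)
  moreover have "in_cone n c1 (?q (\<lambda>_. 0) (\<lambda>j. x 2 j - a2 - r2 j - c3 + p j) (\<lambda>j. c1 - (x 2 j - a2 - r2 j - c3 + p j)) 0 1 1 c1)"
  proof (rule in_cone_piece)
    fix j assume "j \<in> {1..n}"
    from q'[OF this] w show "(0::real) \<le> 0 \<and> 0 \<le> 0 * c1 \<and> 0 \<le> (x 2 j - a2 - r2 j - c3 + p j) \<and> (x 2 j - a2 - r2 j - c3 + p j) \<le> 1 * c1 \<and> 0 \<le> (c1 - (x 2 j - a2 - r2 j - c3 + p j)) \<and> (c1 - (x 2 j - a2 - r2 j - c3 + p j)) \<le> 1 * c1 \<and> 0 + (x 2 j - a2 - r2 j - c3 + p j) + (c1 - (x 2 j - a2 - r2 j - c3 + p j)) = c1"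
      by (intro conjI; linarith)
  qed (use w in simp_all)
  moreover have "in_cone n t (?q r1 r2 r3 1 1 1 t)"
  proof (rule in_cone_piece)
    fix j assume "j \<in> {1..n}"
    from q'[OF this] w show "0 \<le> r1 j \<and> r1 j \<le> 1 * t \<and> 0 \<le> r2 j \<and> r2 j \<le> 1 * t \<and> 0 \<le> r3 j \<and> r3 j \<le> 1 * t \<and> r1 j + r2 j + r3 j = t"
      by (intro conjI; linarith)
  qed (use w in simp_all)
  ultimately have "in_cone n (a1 + a2 + a3 + c3 + c2 + c1 + t)
     (?q (\<lambda>_. a1) (\<lambda>_. 0) (\<lambda>_. 0) 1 0 0 a1 + ?q (\<lambda>_. 0) (\<lambda>_. a2) (\<lambda>_. 0) 0 1 0 a2 + ?q (\<lambda>_. 0) (\<lambda>_. 0) (\<lambda>_. a3) 0 0 1 a3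
     + ?q p (\<lambda>j. c3 - p j) (\<lambda>_. 0) 1 1 0 c3
     + ?q (\<lambda>j. x 1 j - a1 - r1 j - p j) (\<lambda>_. 0) (\<lambda>j. c2 - (x 1 j - a1 - r1 j - p j)) 1 0 1 c2
     + ?q (\<lambda>_. 0) (\<lambda>j. x 2 j - a2 - r2 j - c3 + p j) (\<lambda>j. c1 - (x 2 j - a2 - r2 j - c3 + p j)) 0 1 1 c1
     + ?q r1 r2 r3 1 1 1 t)" (is "in_cone n _ ?sum")
    by (intro in_cone_add)
  also have "?sum = (x, y)"
  proof (rule prod_eqI)
    show "fst ?sum = fst (x, y)"
    proof (intro ext)
      fix i j
      show "fst ?sum i j = fst (x, y) i j"
      proof (cases "i \<in> {1..3} \<and> j \<in> {1..n}")
        case True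
        have *: "r1 j + r2 j + r3 j = t" "x 1 j + x 2 j + x 3 j = 1" and j: "j \<in> {1..n}"
          using q'(4,11)[of j] True by blast+
        have "i = 1 \<or> i = 2 \<or> i = 3" using True by auto
        then show ?thesis
        proof (elim disjE)
          assume i: "i = 3"
          have "fst ?sum i j = a3 + (c2 - (x 1 j - a1 - r1 j - p j)) + (c1 - (x 2 j - a2 - r2 j - c3 + p j)) + r3 j"
            using j by (simp add: i)
          also have "\<dots> = x 3 j" using * w(8) by linarith
          finally show ?thesis by (simp add: i)
        qed (use j in simp_all)
      next
        case False
        then have "x i j = 0"
          using amb unfolding ambient_def by blast
        then show ?thesis using False by auto
      qed
    qed
    show "snd ?sum = snd (x, y)"
    proof (intro ext)
      fix i
      show "snd ?sum i = snd (x, y) i"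
      proof (cases "i \<in> {1..3}")
        case True
        then have "i = 1 \<or> i = 2 \<or> i = 3" by auto
        then show ?thesis using y by (elim disjE) simp_all
      next
        case False
        then have "y i = 0"
          using amb unfolding ambient_def by blast
        then show ?thesis using False by auto
      qed
    qed
  qed
  also have "a1 + a2 + a3 + c3 + c2 + c1 + t = 1" using w by simp
  finally have "in_cone n 1 (x, y)" .
  then show ?thesis by (simp add: in_cone_def)
qed

lemma hull_ineq_subset:
  assumes n: "1 \<le> n"
  shows "hull_ineq n \<subseteq> convex hull (int_points n)"
proof
  fix q assume "q \<in> hull_ineq n"
  moreover obtain x y where q: "q = (x, y)" by (metis prod.exhaust)
  ultimately have H: "(x, y) \<in> hull_ineq n" by simp
  have amb: "(x, y) \<in> ambient 3 n" and y1: "y 1 \<le> 1" "y 2 \<le> 1" "y 3 \<le> 1"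
    using H unfolding hull_ineq_iff by blast+
  have col: "0 \<le> x 1 j \<and> x 1 j \<le> y 1 \<and> 0 \<le> x 2 j \<and> x 2 j \<le> y 2 \<and> 0 \<le> x 3 j \<and> x 3 j \<le> y 3 \<and> x 1 j + x 2 j + x 3 j = 1"
    if "j \<in> {1..n}" for j
    using H that unfolding hull_ineq_iff by blast
  have cut: "2 \<le> x 1 j1 + x 2 j2 + x 3 j3 + (y 1 + y 2 + y 3)"
    if "j1 \<in> {1..n}" "j2 \<in> {1..n}" "j3 \<in> {1..n}" for j1 j2 j3
    using H that unfolding hull_ineq_iff by blast
  have y0: "0 \<le> y 1" "0 \<le> y 2" "0 \<le> y 3" "1 \<le> y 1 + y 2 + y 3"
  proof -
    have "1 \<in> {1..n}" using n by simp
    note col[OF this]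
    then show "0 \<le> y 1" "0 \<le> y 2" "0 \<le> y 3" "1 \<le> y 1 + y 2 + y 3" by linarith+
  qed
  show "q \<in> convex hull (int_points n)"
    unfolding q
  proof (cases "2 \<le> y 1 + y 2 + y 3")
    case True
    \<comment> \<open>Only pairs and the full support occur. The points with \<open>y 1 = 0\<close>
      are then those of support {2,3}, which forces the weight \<open>1 - y 1\<close> for
      it.\<close>
    show "(x, y) \<in> convex hull (int_points n)"
    proof (rule in_int_hull_if_routed[OF amb, where ?a1.0 = 0 and ?a2.0 = 0 and ?a3.0 = 0 and ?c1.0 = "1 - y 1" and ?c2.0 = "1 - y 2" and ?c3.0 = "1 - y 3" and t = "y 1 + y 2 + y 3 - 2"])
      fix j assume j: "j \<in> {1..n}"
      have cj: "0 \<le> x 1 j" "x 1 j \<le> y 1" "0 \<le> x 2 j" "x 2 j \<le> y 2" "0 \<le> x 3 j" "x 3 j \<le> y 3" "x 1 j + x 2 j + x 3 j = 1"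
        using col[OF j] by blast+
      show "x 1 j + x 2 j + x 3 j = 1 \<and> (\<exists>r1 r2 r3. 0 \<le> r1 \<and> 0 \<le> r2 \<and> 0 \<le> r3 \<and> r1 + r2 + r3 = y 1 + y 2 + y 3 - 2 \<and>
        0 \<le> x 1 j - 0 - r1 \<and> x 1 j - 0 - r1 \<le> 1 - y 2 + (1 - y 3) \<and> 0 \<le> x 2 j - 0 - r2 \<and> x 2 j - 0 - r2 \<le> 1 - y 1 + (1 - y 3) \<and>
        0 \<le> x 3 j - 0 - r3 \<and> x 3 j - 0 - r3 \<le> 1 - y 1 + (1 - y 2))"
        using cj(7) route_large[OF cj y1 True] by (rule conjI)
    qed (use y1 True in linarith)+
  next
    case False
    define \<mu> where "\<mu> = (\<lambda>i. Min (x i ` {1..n}))"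
    have \<mu>_le: "\<mu> i \<le> x i j" if "j \<in> {1..n}" for i j
      unfolding \<mu>_def by (intro Min_le finite_imageI finite_atLeastAtMost imageI that)
    have \<mu>_in: "\<mu> i \<in> x i ` {1..n}" for i
      unfolding \<mu>_def using n by (intro Min_in) auto
    obtain i1 where k1: "i1 \<in> {1..n}" and \<mu>1: "\<mu> 1 = x 1 i1" using \<mu>_in[of 1] by (rule imageE)
    obtain i2 where k2: "i2 \<in> {1..n}" and \<mu>2: "\<mu> 2 = x 2 i2" using \<mu>_in[of 2] by (rule imageE)
    obtain i3 where k3: "i3 \<in> {1..n}" and \<mu>3: "\<mu> 3 = x 3 i3" using \<mu>_in[of 3] by (rule imageE)
    have m: "0 \<le> \<mu> 1" "1 - y 2 - y 3 \<le> \<mu> 1" "0 \<le> \<mu> 2" "1 - y 1 - y 3 \<le> \<mu> 2" "0 \<le> \<mu> 3" "1 - y 1 - y 2 \<le> \<mu> 3"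
      unfolding \<mu>1 \<mu>2 \<mu>3 using col[OF k1] col[OF k2] col[OF k3] by linarith+
    have cut': "2 \<le> \<mu> 1 + \<mu> 2 + \<mu> 3 + (y 1 + y 2 + y 3)"
      unfolding \<mu>1 \<mu>2 \<mu>3 by (rule cut[OF k1 k2 k3])
    have S2: "y 1 + y 2 + y 3 \<le> 2" using False by linarith
    obtain a1 a2 a3 where a: "0 \<le> a1" "1 - y 2 - y 3 \<le> a1" "a1 \<le> \<mu> 1" "0 \<le> a2" "1 - y 1 - y 3 \<le> a2" "a2 \<le> \<mu> 2"
      "0 \<le> a3" "1 - y 1 - y 2 \<le> a3" "a3 \<le> \<mu> 3" "a1 + a2 + a3 = 2 - (y 1 + y 2 + y 3)"
      by (rule singles_small[OF m y0(1-3) y1 y0(4) S2 cut'])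
    \<comment> \<open>The full support is absent. The total weight \<open>1 - y 1\<close> of points
      avoiding row one is shared by the singletons {2}, {3} and the pair {2,3}.\<close>
    show "(x, y) \<in> convex hull (int_points n)"
    proof (rule in_int_hull_if_routed[OF amb, where ?a1.0 = a1 and ?a2.0 = a2 and ?a3.0 = a3 and ?c1.0 = "1 - y 1 - a2 - a3" and ?c2.0 = "1 - y 2 - a1 - a3" and ?c3.0 = "1 - y 3 - a1 - a2" and t = 0])
      fix j assume j: "j \<in> {1..n}"
      have cj: "x 1 j \<le> y 1" "x 2 j \<le> y 2" "x 3 j \<le> y 3" "x 1 j + x 2 j + x 3 j = 1"
        using col[OF j] by blast+
      have "(0::real) \<le> 0 \<and> (0::real) \<le> 0 \<and> (0::real) \<le> 0 \<and> (0::real) + 0 + 0 = 0 \<and>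
        0 \<le> x 1 j - a1 - 0 \<and> x 1 j - a1 - 0 \<le> 1 - y 2 - a1 - a3 + (1 - y 3 - a1 - a2) \<and>
        0 \<le> x 2 j - a2 - 0 \<and> x 2 j - a2 - 0 \<le> 1 - y 1 - a2 - a3 + (1 - y 3 - a1 - a2) \<and>
        0 \<le> x 3 j - a3 - 0 \<and> x 3 j - a3 - 0 \<le> 1 - y 1 - a2 - a3 + (1 - y 2 - a1 - a3)"
        using cj(1-3) a(3,6,9,10) \<mu>_le[OF j, of 1] \<mu>_le[OF j, of 2] \<mu>_le[OF j, of 3]
        by (intro conjI; linarith)
      then show "x 1 j + x 2 j + x 3 j = 1 \<and> (\<exists>r1 r2 r3. 0 \<le> r1 \<and> 0 \<le> r2 \<and> 0 \<le> r3 \<and> r1 + r2 + r3 = 0 \<and>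
        0 \<le> x 1 j - a1 - r1 \<and> x 1 j - a1 - r1 \<le> 1 - y 2 - a1 - a3 + (1 - y 3 - a1 - a2) \<and>
        0 \<le> x 2 j - a2 - r2 \<and> x 2 j - a2 - r2 \<le> 1 - y 1 - a2 - a3 + (1 - y 3 - a1 - a2) \<and>
        0 \<le> x 3 j - a3 - r3 \<and> x 3 j - a3 - r3 \<le> 1 - y 1 - a2 - a3 + (1 - y 2 - a1 - a3))"
        by (intro conjI[OF cj(4)]) (rule exI[of _ 0], rule exI[of _ 0], rule exI[of _ 0])
    qed (use a in linarith)+
  qed
qed

lemma int_hull_eq_ineq:
  assumes "1 \<le> n"
  shows "int_hull 3 n = hull_ineq n"
  unfolding int_hull_eq
  using hull_minimal[of "int_points n" "hull_ineq n" convex] int_points_subset[OF assms] convex_hull_ineq hull_ineq_subset[OF assms] by blast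

section \<open>Moments of the simplex\<close>

text \<open>The positive and negative parts of the derivative stand on different sides, so that all
  four terms make sense in \<open>ennreal\<close>. \<open>F\<close> may change sign inside the
  interval; only its end values enter.\<close>

lemma nn_integral_FTC_balance:
  fixes F g1 g2 :: "real \<Rightarrow> real"
  assumes ac: "a \<le> c"
    and deriv: "\<And>t. (F has_field_derivative g1 t - g2 t) (at t)"
    and cont: "continuous_on {a..c} g1" "continuous_on {a..c} g2"
    and nonneg: "\<And>t. a \<le> t \<Longrightarrow> t \<le> c \<Longrightarrow> 0 \<le> g1 t" "\<And>t. a \<le> t \<Longrightarrow> t \<le> c \<Longrightarrow> 0 \<le> g2 t"
    and F: "0 \<le> F a" "0 \<le> F c"
  shows "(\<integral>\<^sup>+ t. (if a \<le> t \<and> t \<le> c then ennreal (g1 t) else 0) \<partial>lborel) + ennreal (F a) =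
    (\<integral>\<^sup>+ t. (if a \<le> t \<and> t \<le> c then ennreal (g2 t) else 0) \<partial>lborel) + ennreal (F c)"
proof -
  have int: "integrable lborel (\<lambda>t. indicator {a..c} t *\<^sub>R g t)"
    and nn: "(\<integral>\<^sup>+ t. (if a \<le> t \<and> t \<le> c then ennreal (g t) else 0) \<partial>lborel) = ennreal (\<integral>t. indicator {a..c} t *\<^sub>R g t \<partial>lborel)"
    and ge: "0 \<le> (\<integral>t. indicator {a..c} t *\<^sub>R g t \<partial>lborel)"
    if "continuous_on {a..c} g" "\<And>t. a \<le> t \<Longrightarrow> t \<le> c \<Longrightarrow> 0 \<le> g t" for g :: "real \<Rightarrow> real"
  proof -
    show int: "integrable lborel (\<lambda>t. indicator {a..c} t *\<^sub>R g t)"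
      using borel_integrable_atLeastAtMost'[OF that(1)] by (simp add: set_integrable_def)
    have "(\<integral>\<^sup>+ t. (if a \<le> t \<and> t \<le> c then ennreal (g t) else 0) \<partial>lborel) = (\<integral>\<^sup>+ t. ennreal (indicator {a..c} t *\<^sub>R g t) \<partial>lborel)"
      by (intro nn_integral_cong) (auto simp: indicator_def)
    also have "\<dots> = ennreal (\<integral>t. indicator {a..c} t *\<^sub>R g t \<partial>lborel)"
      using that(2) by (intro nn_integral_eq_integral[OF int] AE_I2) (auto simp: indicator_def)
    finally show "(\<integral>\<^sup>+ t. (if a \<le> t \<and> t \<le> c then ennreal (g t) else 0) \<partial>lborel) = ennreal (\<integral>t. indicator {a..c} t *\<^sub>R g t \<partial>lborel)" .
    show "0 \<le> (\<integral>t. indicator {a..c} t *\<^sub>R g t \<partial>lborel)"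
      using that(2) by (intro Bochner_Integration.integral_nonneg) (auto simp: indicator_def)
  qed
  have "has_bochner_integral lborel (\<lambda>t. indicator {a..c} t *\<^sub>R (g1 t - g2 t)) (F c - F a)"
    using ac deriv cont
    by (intro has_bochner_integral_FTC_Icc continuous_on_diff)
       (auto simp: has_real_derivative_iff_has_vector_derivative intro: has_vector_derivative_at_within)
  then have "F c - F a = (\<integral>t. indicator {a..c} t *\<^sub>R (g1 t - g2 t) \<partial>lborel)"
    by (simp add: has_bochner_integral_iff)
  also have "\<dots> = (\<integral>t. indicator {a..c} t *\<^sub>R g1 t \<partial>lborel) - (\<integral>t. indicator {a..c} t *\<^sub>R g2 t \<partial>lborel)"
    using int[OF cont(1) nonneg(1)] int[OF cont(2) nonneg(2)]
    by (subst Bochner_Integration.integral_diff[symmetric]) (auto simp: algebra_simps)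
  finally have "(\<integral>t. indicator {a..c} t *\<^sub>R g1 t \<partial>lborel) + F a = (\<integral>t. indicator {a..c} t *\<^sub>R g2 t \<partial>lborel) + F c"
    by simp
  then show ?thesis
    using nn[OF cont(1) nonneg(1)] nn[OF cont(2) nonneg(2)] ge[OF cont(1) nonneg(1)] ge[OF cont(2) nonneg(2)] F
    by (simp add: ennreal_plus[symmetric] del: ennreal_plus)
qed

section \<open>Integrals over an edge, a face and the solid simplex\<close>

definition I1 :: "(real \<Rightarrow> real) \<Rightarrow> ennreal" where
  "I1 g = (\<integral>\<^sup>+ t. (if 0 \<le> t \<and> t \<le> 1 then ennreal (g t) else 0) \<partial>lborel)"

text \<open>The face \<open>u + v + w = 1\<close> in its first two coordinates. The integrand still
  receives all three, so that permutations of the coordinates act on it.\<close>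

definition I2 :: "(real \<Rightarrow> real \<Rightarrow> real \<Rightarrow> real) \<Rightarrow> ennreal" where
  "I2 g = (\<integral>\<^sup>+ u. \<integral>\<^sup>+ v. (if 0 \<le> u \<and> 0 \<le> v \<and> u + v \<le> 1 then ennreal (g u v (1 - u - v)) else 0) \<partial>lborel \<partial>lborel)"

definition I3 :: "(real \<Rightarrow> real \<Rightarrow> real \<Rightarrow> real) \<Rightarrow> ennreal" where
  "I3 g = (\<integral>\<^sup>+ u. \<integral>\<^sup>+ v. \<integral>\<^sup>+ w. (if 0 \<le> u \<and> 0 \<le> v \<and> 0 \<le> w \<and> u + v + w \<le> 1 then ennreal (g u v w) else 0) \<partial>lborel \<partial>lborel \<partial>lborel)"

lemma I1_cong: "(\<And>t. 0 \<le> t \<Longrightarrow> t \<le> 1 \<Longrightarrow> f t = g t) \<Longrightarrow> I1 f = I1 g"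
  unfolding I1_def by (intro nn_integral_cong) auto

lemma I2_cong: "(\<And>u v w. 0 \<le> u \<Longrightarrow> 0 \<le> v \<Longrightarrow> 0 \<le> w \<Longrightarrow> u + v + w = 1 \<Longrightarrow> f u v w = g u v w) \<Longrightarrow> I2 f = I2 g"
  unfolding I2_def by (intro nn_integral_cong if_cong refl arg_cong[where f = ennreal]) simp

lemma I3_cong: "(\<And>u v w. 0 \<le> u \<Longrightarrow> 0 \<le> v \<Longrightarrow> 0 \<le> w \<Longrightarrow> u + v + w \<le> 1 \<Longrightarrow> f u v w = g u v w) \<Longrightarrow> I3 f = I3 g"
  unfolding I3_def by (intro nn_integral_cong if_cong refl arg_cong[where f = ennreal]) simp

abbreviation meas3 :: "(real \<Rightarrow> real \<Rightarrow> real \<Rightarrow> real) \<Rightarrow> bool" where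
  "meas3 g \<equiv> (\<lambda>(u, v, w). g u v w) \<in> borel_measurable lborel3"

lemma meas3_comp:
  assumes "meas3 g" and [measurable]: "a \<in> borel_measurable M" "b \<in> borel_measurable M" "c \<in> borel_measurable M"
  shows "(\<lambda>x. g (a x) (b x) (c x)) \<in> borel_measurable M"
proof -
  have "(\<lambda>x. (a x, b x, c x)) \<in> measurable M lborel3"
    by measurable
  from measurable_compose[OF this assms(1)] show ?thesis by simp
qed

lemma I1_add:
  assumes [measurable]: "f \<in> borel_measurable borel" "g \<in> borel_measurable borel"
    and "\<And>t. 0 \<le> t \<Longrightarrow> t \<le> 1 \<Longrightarrow> 0 \<le> f t" "\<And>t. 0 \<le> t \<Longrightarrow> t \<le> 1 \<Longrightarrow> 0 \<le> g t"
  shows "I1 (\<lambda>t. f t + g t) = I1 f + I1 g"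
  unfolding I1_def using assms by (subst nn_integral_add[symmetric]) (auto intro!: nn_integral_cong)

lemma I2_add:
  assumes m: "meas3 f" "meas3 g"
    and "\<And>u v w. 0 \<le> u \<Longrightarrow> 0 \<le> v \<Longrightarrow> 0 \<le> w \<Longrightarrow> u + v + w = 1 \<Longrightarrow> 0 \<le> f u v w" "\<And>u v w. 0 \<le> u \<Longrightarrow> 0 \<le> v \<Longrightarrow> 0 \<le> w \<Longrightarrow> u + v + w = 1 \<Longrightarrow> 0 \<le> g u v w"
  shows "I2 (\<lambda>u v w. f u v w + g u v w) = I2 f + I2 g"
proof -
  note [measurable] = meas3_comp[OF m(1)] meas3_comp[OF m(2)]
  show ?thesis
    unfolding I2_def
    by (subst nn_integral_add[symmetric], measurable, subst nn_integral_add[symmetric], measurable)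
       (intro nn_integral_cong; use assms(3,4) in auto)
qed

lemma I3_add:
  assumes m: "meas3 f" "meas3 g"
    and "\<And>u v w. 0 \<le> u \<Longrightarrow> 0 \<le> v \<Longrightarrow> 0 \<le> w \<Longrightarrow> u + v + w \<le> 1 \<Longrightarrow> 0 \<le> f u v w"
    "\<And>u v w. 0 \<le> u \<Longrightarrow> 0 \<le> v \<Longrightarrow> 0 \<le> w \<Longrightarrow> u + v + w \<le> 1 \<Longrightarrow> 0 \<le> g u v w"
  shows "I3 (\<lambda>u v w. f u v w + g u v w) = I3 f + I3 g"
proof -
  note [measurable] = meas3_comp[OF m(1)] meas3_comp[OF m(2)]
  show ?thesis
    unfolding I3_def
    by (subst nn_integral_add[symmetric], measurable, subst nn_integral_add[symmetric], measurable, subst nn_integral_add[symmetric], measurable)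
       (intro nn_integral_cong; use assms(3,4) in auto)
qed

lemma I1_cmult:
  assumes [measurable]: "g \<in> borel_measurable borel" and "0 \<le> c"
  shows "I1 (\<lambda>t. c * g t) = ennreal c * I1 g"
  unfolding I1_def by (subst nn_integral_cmult[symmetric], measurable) (intro nn_integral_cong, simp add: ennreal_mult'[OF \<open>0 \<le> c\<close>])

lemma I2_cmult:
  assumes m: "meas3 g" and "0 \<le> c"
  shows "I2 (\<lambda>u v w. c * g u v w) = ennreal c * I2 g"
proof -
  note [measurable] = meas3_comp[OF m]
  show ?thesis
    unfolding I2_def
    by (subst nn_integral_cmult[symmetric], measurable, subst nn_integral_cmult[symmetric], measurable)
       (intro nn_integral_cong, simp add: ennreal_mult'[OF \<open>0 \<le> c\<close>])
qed

lemma I3_cmult: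
  assumes m: "meas3 g" and "0 \<le> c"
  shows "I3 (\<lambda>u v w. c * g u v w) = ennreal c * I3 g"
proof -
  note [measurable] = meas3_comp[OF m]
  show ?thesis
    unfolding I3_def
    by (subst nn_integral_cmult[symmetric], measurable, subst nn_integral_cmult[symmetric], measurable, subst nn_integral_cmult[symmetric], measurable)
       (intro nn_integral_cong, simp add: ennreal_mult'[OF \<open>0 \<le> c\<close>])
qed

lemma I1_reflect:
  assumes [measurable]: "g \<in> borel_measurable borel"
  shows "I1 (\<lambda>t. g (1 - t)) = I1 g"
  unfolding I1_def
  by (subst (2) nn_integral_real_affine[where c = "-1" and t = 1], measurable)
     (auto intro!: nn_integral_cong)

lemma I2_swap12:
  assumes m: "meas3 g"
  shows "I2 (\<lambda>u v w. g v u w) = I2 g"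
proof -
  note [measurable] = meas3_comp[OF m]
  have "I2 (\<lambda>u v w. g v u w) = (\<integral>\<^sup>+ v. \<integral>\<^sup>+ u. (if 0 \<le> u \<and> 0 \<le> v \<and> u + v \<le> 1 then ennreal (g v u (1 - u - v)) else 0) \<partial>lborel \<partial>lborel)"
    unfolding I2_def by (rule lborel_pair.Fubini'[symmetric]) measurable
  also have "\<dots> = I2 g"
    unfolding I2_def by (intro nn_integral_cong if_cong refl arg_cong[where f = ennreal]) (auto simp: algebra_simps)
  finally show ?thesis .
qed

lemma I2_swap23:
  assumes m: "meas3 g"
  shows "I2 (\<lambda>u v w. g u w v) = I2 g"
  unfolding I2_def
proof (rule nn_integral_cong)
  note [measurable] = meas3_comp[OF m]
  fix u :: real
  show "(\<integral>\<^sup>+ v. (if 0 \<le> u \<and> 0 \<le> v \<and> u + v \<le> 1 then ennreal (g u (1 - u - v) v) else 0) \<partial>lborel) =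
    (\<integral>\<^sup>+ v. (if 0 \<le> u \<and> 0 \<le> v \<and> u + v \<le> 1 then ennreal (g u v (1 - u - v)) else 0) \<partial>lborel)"
    by (subst (2) nn_integral_real_affine[where c = "-1" and t = "1 - u"], measurable)
       (auto intro!: nn_integral_cong)
qed

lemma I3_swap23:
  assumes m: "meas3 g"
  shows "I3 (\<lambda>u v w. g u w v) = I3 g"
  unfolding I3_def
proof (rule nn_integral_cong)
  note [measurable] = meas3_comp[OF m]
  fix u :: real
  have "(\<integral>\<^sup>+ v. \<integral>\<^sup>+ w. (if 0 \<le> u \<and> 0 \<le> v \<and> 0 \<le> w \<and> u + v + w \<le> 1 then ennreal (g u w v) else 0) \<partial>lborel \<partial>lborel) =
    (\<integral>\<^sup>+ w. \<integral>\<^sup>+ v. (if 0 \<le> u \<and> 0 \<le> v \<and> 0 \<le> w \<and> u + v + w \<le> 1 then ennreal (g u w v) else 0) \<partial>lborel \<partial>lborel)"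
    by (rule lborel_pair.Fubini'[symmetric]) measurable
  also have "\<dots> = (\<integral>\<^sup>+ v. \<integral>\<^sup>+ w. (if 0 \<le> u \<and> 0 \<le> v \<and> 0 \<le> w \<and> u + v + w \<le> 1 then ennreal (g u v w) else 0) \<partial>lborel \<partial>lborel)"
    by (intro nn_integral_cong) (auto simp: algebra_simps)
  finally show "(\<integral>\<^sup>+ v. \<integral>\<^sup>+ w. (if 0 \<le> u \<and> 0 \<le> v \<and> 0 \<le> w \<and> u + v + w \<le> 1 then ennreal (g u w v) else 0) \<partial>lborel \<partial>lborel) =
    (\<integral>\<^sup>+ v. \<integral>\<^sup>+ w. (if 0 \<le> u \<and> 0 \<le> v \<and> 0 \<le> w \<and> u + v + w \<le> 1 then ennreal (g u v w) else 0) \<partial>lborel \<partial>lborel)" .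
qed

lemma I3_swap12:
  assumes m: "meas3 g"
  shows "I3 (\<lambda>u v w. g v u w) = I3 g"
proof -
  note [measurable] = meas3_comp[OF m]
  have "I3 (\<lambda>u v w. g v u w) = (\<integral>\<^sup>+ v. \<integral>\<^sup>+ u. \<integral>\<^sup>+ w. (if 0 \<le> u \<and> 0 \<le> v \<and> 0 \<le> w \<and> u + v + w \<le> 1 then ennreal (g v u w) else 0) \<partial>lborel \<partial>lborel \<partial>lborel)"
    unfolding I3_def by (rule lborel_pair.Fubini'[symmetric]) measurable
  also have "\<dots> = I3 g"
    unfolding I3_def by (intro nn_integral_cong) (auto simp: algebra_simps)
  finally show ?thesis .
qed

lemma nn_integral_Icc_le_1:
  assumes "\<And>t. 0 \<le> t \<Longrightarrow> t \<le> (1::real) \<Longrightarrow> f t \<le> 1" "\<And>t. \<not> (0 \<le> t \<and> t \<le> 1) \<Longrightarrow> f t = 0"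
  shows "(\<integral>\<^sup>+ t. f t \<partial>lborel) \<le> (1::ennreal)"
proof -
  have "(\<integral>\<^sup>+ t. f t \<partial>lborel) \<le> (\<integral>\<^sup>+ t. indicator {0..1::real} t \<partial>lborel)"
  proof (rule nn_integral_mono)
    fix t :: real
    show "f t \<le> indicator {0..1} t"
      using assms[of t] by (cases "0 \<le> t \<and> t \<le> 1") (auto simp: indicator_def)
  qed
  also have "\<dots> = 1" by simp
  finally show ?thesis .
qed

lemma I1_le_1: "(\<And>t. 0 \<le> t \<Longrightarrow> t \<le> 1 \<Longrightarrow> g t \<le> 1) \<Longrightarrow> I1 g \<le> 1"
  unfolding I1_def by (intro nn_integral_Icc_le_1) auto

lemma I2_le_1:
  assumes "\<And>u v w. 0 \<le> u \<Longrightarrow> 0 \<le> v \<Longrightarrow> 0 \<le> w \<Longrightarrow> u + v + w = 1 \<Longrightarrow> g u v w \<le> 1"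
  shows "I2 g \<le> 1"
  unfolding I2_def
proof (rule nn_integral_Icc_le_1)
  fix u :: real assume u: "0 \<le> u" "u \<le> 1"
  show "(\<integral>\<^sup>+ v. (if 0 \<le> u \<and> 0 \<le> v \<and> u + v \<le> 1 then ennreal (g u v (1 - u - v)) else 0) \<partial>lborel) \<le> 1"
    by (rule nn_integral_Icc_le_1) (use u assms in auto)
next
  fix u :: real assume u: "\<not> (0 \<le> u \<and> u \<le> 1)"
  have "(\<integral>\<^sup>+ v. (if 0 \<le> u \<and> 0 \<le> v \<and> u + v \<le> 1 then ennreal (g u v (1 - u - v)) else 0) \<partial>lborel) = (\<integral>\<^sup>+ v. 0 \<partial>(lborel :: real measure))"
    by (rule nn_integral_cong) (use u in auto)
  then show "(\<integral>\<^sup>+ v. (if 0 \<le> u \<and> 0 \<le> v \<and> u + v \<le> 1 then ennreal (g u v (1 - u - v)) else 0) \<partial>lborel) = 0"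
    by simp
qed

lemma I3_le_1:
  assumes "\<And>u v w. 0 \<le> u \<Longrightarrow> 0 \<le> v \<Longrightarrow> 0 \<le> w \<Longrightarrow> u + v + w \<le> 1 \<Longrightarrow> g u v w \<le> 1"
  shows "I3 g \<le> 1"
  unfolding I3_def
proof (rule nn_integral_Icc_le_1)
  fix u :: real assume u: "0 \<le> u" "u \<le> 1"
  show "(\<integral>\<^sup>+ v. \<integral>\<^sup>+ w. (if 0 \<le> u \<and> 0 \<le> v \<and> 0 \<le> w \<and> u + v + w \<le> 1 then ennreal (g u v w) else 0) \<partial>lborel \<partial>lborel) \<le> 1"
  proof (rule nn_integral_Icc_le_1)
    fix v :: real assume v: "0 \<le> v" "v \<le> 1"
    show "(\<integral>\<^sup>+ w. (if 0 \<le> u \<and> 0 \<le> v \<and> 0 \<le> w \<and> u + v + w \<le> 1 then ennreal (g u v w) else 0) \<partial>lborel) \<le> 1"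
      by (rule nn_integral_Icc_le_1) (use u v assms in auto)
  next
    fix v :: real assume v: "\<not> (0 \<le> v \<and> v \<le> 1)"
    have "(\<integral>\<^sup>+ w. (if 0 \<le> u \<and> 0 \<le> v \<and> 0 \<le> w \<and> u + v + w \<le> 1 then ennreal (g u v w) else 0) \<partial>lborel) = (\<integral>\<^sup>+ w. 0 \<partial>(lborel :: real measure))"
      by (rule nn_integral_cong) (use u v in auto)
    then show "(\<integral>\<^sup>+ w. (if 0 \<le> u \<and> 0 \<le> v \<and> 0 \<le> w \<and> u + v + w \<le> 1 then ennreal (g u v w) else 0) \<partial>lborel) = 0"
      by simp
  qed
next
  fix u :: real assume u: "\<not> (0 \<le> u \<and> u \<le> 1)"
  have "(\<integral>\<^sup>+ v. \<integral>\<^sup>+ w. (if 0 \<le> u \<and> 0 \<le> v \<and> 0 \<le> w \<and> u + v + w \<le> 1 then ennreal (g u v w) else 0) \<partial>lborel \<partial>lborel) = (\<integral>\<^sup>+ v. \<integral>\<^sup>+ w. 0 \<partial>(lborel :: real measure) \<partial>(lborel :: real measure))"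
    by (intro nn_integral_cong) (use u in auto)
  then show "(\<integral>\<^sup>+ v. \<integral>\<^sup>+ w. (if 0 \<le> u \<and> 0 \<le> v \<and> 0 \<le> w \<and> u + v + w \<le> 1 then ennreal (g u v w) else 0) \<partial>lborel \<partial>lborel) = 0"
    by simp
qed

lemma Xq_le_1: "Xq 1 u v w \<le> 1"
  using zero_le_power2[of u] zero_le_power2[of v] zero_le_power2[of w] unfolding Xq_def power_one by linarith

section \<open>Moments of the quadratic form and their recurrences\<close>

definition h_seq :: "nat \<Rightarrow> real" where
  "h_seq n = enn2real (I1 (\<lambda>t. (2 * t * (1 - t)) ^ n))"

definition f_seq :: "nat \<Rightarrow> real" where
  "f_seq n = enn2real (I2 (\<lambda>u v w. Xq 1 u v w ^ n))"

definition d3_seq :: "nat \<Rightarrow> real" where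
  "d3_seq n = enn2real (I3 (\<lambda>u v w. Xq 1 u v w ^ n))"

lemma edge_quad_bounds:
  assumes "0 \<le> t" "t \<le> (1::real)"
  shows "0 \<le> 2 * t * (1 - t)" "2 * t * (1 - t) \<le> 1"
proof -
  have "2 * t * (1 - t) = 1 - t\<^sup>2 - (1 - t)\<^sup>2" by (simp add: power2_eq_square algebra_simps)
  also have "\<dots> \<le> 1" by simp
  finally show "2 * t * (1 - t) \<le> 1" .
qed (use assms in simp)

lemma I1_h: "I1 (\<lambda>t. (2 * t * (1 - t)) ^ n) = ennreal (h_seq n)"
proof -
  have "I1 (\<lambda>t. (2 * t * (1 - t)) ^ n) \<le> 1"
    by (intro I1_le_1 power_le_one edge_quad_bounds)
  then have "I1 (\<lambda>t. (2 * t * (1 - t)) ^ n) < top" using ennreal_one_less_top le_less_trans by blast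
  then show ?thesis unfolding h_seq_def by (simp add: ennreal_enn2real)
qed

lemma I2_f: "I2 (\<lambda>u v w. Xq 1 u v w ^ n) = ennreal (f_seq n)"
proof -
  have "I2 (\<lambda>u v w. Xq 1 u v w ^ n) \<le> 1"
    by (intro I2_le_1 power_le_one Xq_le_1 Xq_nonneg) auto
  then have "I2 (\<lambda>u v w. Xq 1 u v w ^ n) < top" using ennreal_one_less_top le_less_trans by blast
  then show ?thesis unfolding f_seq_def by (simp add: ennreal_enn2real)
qed

lemma I3_d: "I3 (\<lambda>u v w. Xq 1 u v w ^ n) = ennreal (d3_seq n)"
proof -
  have "I3 (\<lambda>u v w. Xq 1 u v w ^ n) \<le> 1"
    by (intro I3_le_1 power_le_one Xq_le_1 Xq_nonneg) auto
  then have "I3 (\<lambda>u v w. Xq 1 u v w ^ n) < top" using ennreal_one_less_top le_less_trans by blast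
  then show ?thesis unfolding d3_seq_def by (simp add: ennreal_enn2real)
qed

lemma seq_nonneg [simp]: "0 \<le> h_seq n" "0 \<le> f_seq n" "0 \<le> d3_seq n"
  by (simp_all add: h_seq_def f_seq_def d3_seq_def)

lemma I2_rot:
  assumes m: "meas3 g"
  shows "I2 (\<lambda>u v w. g v w u) = I2 g" "I2 (\<lambda>u v w. g w u v) = I2 g"
proof -
  have rot: "I2 (\<lambda>u v w. g v w u) = I2 g" if "meas3 g" for g
  proof -
    have "meas3 (\<lambda>u v w. g u w v)"
      using meas3_comp[OF that, of "\<lambda>p. fst p" lborel3 "\<lambda>p. snd (snd p)" "\<lambda>p. fst (snd p)"] by (simp add: split_def)
    from I2_swap12[OF this] I2_swap23[OF that] show ?thesis by simp
  qed
  show "I2 (\<lambda>u v w. g v w u) = I2 g" by (rule rot[OF m])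
  have "meas3 (\<lambda>u v w. g v w u)"
    using meas3_comp[OF m, of "\<lambda>p. fst (snd p)" lborel3 "\<lambda>p. snd (snd p)" "\<lambda>p. fst p"] by (simp add: split_def)
  from rot[OF this] rot[OF m] show "I2 (\<lambda>u v w. g w u v) = I2 g" by simp
qed

lemma I3_rot:
  assumes m: "meas3 g"
  shows "I3 (\<lambda>u v w. g v w u) = I3 g" "I3 (\<lambda>u v w. g w u v) = I3 g"
proof -
  have rot: "I3 (\<lambda>u v w. g v w u) = I3 g" if "meas3 g" for g
  proof -
    have "meas3 (\<lambda>u v w. g u w v)"
      using meas3_comp[OF that, of "\<lambda>p. fst p" lborel3 "\<lambda>p. snd (snd p)" "\<lambda>p. fst (snd p)"] by (simp add: split_def)
    from I3_swap12[OF this] I3_swap23[OF that] show ?thesis by simp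
  qed
  show "I3 (\<lambda>u v w. g v w u) = I3 g" by (rule rot[OF m])
  have "meas3 (\<lambda>u v w. g v w u)"
    using meas3_comp[OF m, of "\<lambda>p. fst (snd p)" lborel3 "\<lambda>p. snd (snd p)" "\<lambda>p. fst p"] by (simp add: split_def)
  from rot[OF this] rot[OF m] show "I3 (\<lambda>u v w. g w u v) = I3 g" by simp
qed

lemma I2_cyclic_sum:
  assumes m: "meas3 g" and nonneg: "\<And>u v w. 0 \<le> u \<Longrightarrow> 0 \<le> v \<Longrightarrow> 0 \<le> w \<Longrightarrow> u + v + w = 1 \<Longrightarrow> 0 \<le> g u v w"
  shows "I2 (\<lambda>u v w. g u v w + g v w u + g w u v) = I2 g + I2 g + I2 g"
proof -
  have m1: "meas3 (\<lambda>u v w. g v w u)"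
    using meas3_comp[OF m, of "\<lambda>p. fst (snd p)" lborel3 "\<lambda>p. snd (snd p)" "\<lambda>p. fst p"] by (simp add: split_def)
  have m2: "meas3 (\<lambda>u v w. g w u v)"
    using meas3_comp[OF m, of "\<lambda>p. snd (snd p)" lborel3 "\<lambda>p. fst p" "\<lambda>p. fst (snd p)"] by (simp add: split_def)
  have m12: "meas3 (\<lambda>u v w. g u v w + g v w u)"
    using borel_measurable_add[OF m m1] by (simp add: split_def)
  have "I2 (\<lambda>u v w. (g u v w + g v w u) + g w u v) = I2 (\<lambda>u v w. g u v w + g v w u) + I2 (\<lambda>u v w. g w u v)"
    by (rule I2_add[OF m12 m2]) (simp_all add: nonneg add_ac)
  also have "I2 (\<lambda>u v w. g u v w + g v w u) = I2 g + I2 (\<lambda>u v w. g v w u)"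
    by (rule I2_add[OF m m1]) (simp_all add: nonneg add_ac)
  finally show ?thesis by (simp add: I2_rot[OF m])
qed

lemma I3_cyclic_sum:
  assumes m: "meas3 g" and nonneg: "\<And>u v w. 0 \<le> u \<Longrightarrow> 0 \<le> v \<Longrightarrow> 0 \<le> w \<Longrightarrow> u + v + w \<le> 1 \<Longrightarrow> 0 \<le> g u v w"
  shows "I3 (\<lambda>u v w. g u v w + g v w u + g w u v) = I3 g + I3 g + I3 g"
proof -
  have m1: "meas3 (\<lambda>u v w. g v w u)"
    using meas3_comp[OF m, of "\<lambda>p. fst (snd p)" lborel3 "\<lambda>p. snd (snd p)" "\<lambda>p. fst p"] by (simp add: split_def)
  have m2: "meas3 (\<lambda>u v w. g w u v)"
    using meas3_comp[OF m, of "\<lambda>p. snd (snd p)" lborel3 "\<lambda>p. fst p" "\<lambda>p. fst (snd p)"] by (simp add: split_def)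
  have m12: "meas3 (\<lambda>u v w. g u v w + g v w u)"
    using borel_measurable_add[OF m m1] by (simp add: split_def)
  have "I3 (\<lambda>u v w. (g u v w + g v w u) + g w u v) = I3 (\<lambda>u v w. g u v w + g v w u) + I3 (\<lambda>u v w. g w u v)"
    by (rule I3_add[OF m12 m2]) (simp_all add: nonneg add_ac)
  also have "I3 (\<lambda>u v w. g u v w + g v w u) = I3 g + I3 (\<lambda>u v w. g v w u)"
    by (rule I3_add[OF m m1]) (simp_all add: nonneg add_ac)
  finally show ?thesis by (simp add: I3_rot[OF m])
qed

lemma meas3_Xq: "meas3 (\<lambda>u v w. Xq 1 u v w ^ n)"
  "meas3 (\<lambda>u v w. u * Xq 1 u v w ^ n)" "meas3 (\<lambda>u v w. v * Xq 1 u v w ^ n)" "meas3 (\<lambda>u v w. w * Xq 1 u v w ^ n)"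
  "meas3 (\<lambda>u v w. u * v * Xq 1 u v w ^ n)" "meas3 (\<lambda>u v w. v * w * Xq 1 u v w ^ n)"
  "meas3 (\<lambda>u v w. u\<^sup>2 * Xq 1 u v w ^ n)" "meas3 (\<lambda>u v w. v\<^sup>2 * Xq 1 u v w ^ n)" "meas3 (\<lambda>u v w. w\<^sup>2 * Xq 1 u v w ^ n)"
  by measurable

lemma Xq_rot: "Xq s v w u = Xq s u v w" "Xq s w u v = Xq s u v w"
  by (simp_all add: Xq_def)

text \<open>Averages over cyclic shifts arrive as a threefold sum of one unknown integral;
  finiteness of the unknown follows from that of the sum.\<close>

lemma ennreal_third:
  assumes "A + A + A = ennreal b" "0 \<le> b"
  shows "A = ennreal (b / 3)"
proof -
  have "A \<le> A + (A + A)" using add_left_mono[of 0 "A + A" A] by simp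
  also have "\<dots> = ennreal b" using assms(1) by (simp only: add.assoc)
  finally have "A \<le> ennreal b" .
  then have "A < top" using ennreal_less_top le_less_trans by blast
  then obtain a where a: "A = ennreal a" "0 \<le> a" by (cases A) auto
  then have "a + a + a = b" using assms by (simp add: ennreal_plus[symmetric] del: ennreal_plus)
  then have a3: "a = b / 3" by simp
  show ?thesis unfolding a(1) a3 by (rule refl)
qed

lemma I2_linear: "I2 (\<lambda>u v w. u * Xq 1 u v w ^ n) = ennreal (f_seq n / 3)"
proof (rule ennreal_third)
  let ?g = "\<lambda>u v w. u * Xq 1 u v w ^ n"
  have "I2 ?g + I2 ?g + I2 ?g = I2 (\<lambda>u v w. ?g u v w + ?g v w u + ?g w u v)"
    by (rule I2_cyclic_sum[OF meas3_Xq(2), symmetric]) (simp add: Xq_nonneg)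
  also have "\<dots> = I2 (\<lambda>u v w. Xq 1 u v w ^ n)"
    by (rule I2_cong) (simp only: Xq_rot distrib_right[symmetric] mult_1_left)
  finally show "I2 ?g + I2 ?g + I2 ?g = ennreal (f_seq n)" by (simp only: I2_f)
qed simp

text \<open>On the face, \<open>(u + v + w)^2 = 1\<close> gives
  \<open>u * v + v * w + w * u = Xq 1 u v w / 2\<close>, and the three products have equal moments
  by symmetry.\<close>

lemma I2_product: "I2 (\<lambda>u v w. u * v * Xq 1 u v w ^ n) = ennreal (f_seq (Suc n) / 2 / 3)"
proof (rule ennreal_third)
  let ?g = "\<lambda>u v w. u * v * Xq 1 u v w ^ n"
  have "I2 ?g + I2 ?g + I2 ?g = I2 (\<lambda>u v w. ?g u v w + ?g v w u + ?g w u v)"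
    by (rule I2_cyclic_sum[OF meas3_Xq(5), symmetric]) (simp add: Xq_nonneg)
  also have "\<dots> = I2 (\<lambda>u v w. (1 / 2) * Xq 1 u v w ^ Suc n)"
  proof (rule I2_cong)
    fix u v w :: real assume "u + v + w = 1"
    then have w: "w = 1 - u - v" by simp
    have "u * v + v * w + w * u = (1 / 2) * Xq 1 u v w"
      unfolding Xq_def w by (simp add: power2_eq_square algebra_simps)
    then show "?g u v w + ?g v w u + ?g w u v = (1 / 2) * Xq 1 u v w ^ Suc n"
      by (simp only: Xq_rot distrib_right[symmetric] power_Suc mult.assoc[symmetric])
  qed
  also have "\<dots> = ennreal (1 / 2) * I2 (\<lambda>u v w. Xq 1 u v w ^ Suc n)"
    by (rule I2_cmult[OF meas3_Xq(1)]) simp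
  also have "\<dots> = ennreal (1 / 2 * f_seq (Suc n))"
    unfolding I2_f by (rule ennreal_mult'[symmetric]) simp
  finally show "I2 ?g + I2 ?g + I2 ?g = ennreal (f_seq (Suc n) / 2)" by simp
qed simp

text \<open>Everywhere \<open>u^2 + v^2 + w^2 = 1 - Xq 1 u v w\<close>, and the three squares have
  equal moments. The monotonicity shows that the difference inside \<open>ennreal\<close> is
  nonnegative.\<close>

lemma I2_square:
  "f_seq (Suc n) \<le> f_seq n"
  "I2 (\<lambda>u v w. u\<^sup>2 * Xq 1 u v w ^ n) = ennreal ((f_seq n - f_seq (Suc n)) / 3)"
proof -
  let ?g = "\<lambda>u v w. u\<^sup>2 * Xq 1 u v w ^ n"
  let ?s = "\<lambda>u v w. ?g u v w + ?g v w u + ?g w u v"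
  have ms: "meas3 ?s" by measurable
  have eq: "I2 ?s + ennreal (f_seq (Suc n)) = ennreal (f_seq n)"
  proof -
    have "I2 ?s + I2 (\<lambda>u v w. Xq 1 u v w ^ Suc n) = I2 (\<lambda>u v w. ?s u v w + Xq 1 u v w ^ Suc n)"
      by (rule I2_add[OF ms meas3_Xq(1), symmetric]) (simp_all add: Xq_nonneg del: power_Suc)
    also have "\<dots> = I2 (\<lambda>u v w. Xq 1 u v w ^ n)"
    proof (rule I2_cong)
      fix u v w :: real
      have "u\<^sup>2 + v\<^sup>2 + w\<^sup>2 + Xq 1 u v w = 1" by (simp add: Xq_def)
      then have "(u\<^sup>2 + v\<^sup>2 + w\<^sup>2 + Xq 1 u v w) * Xq 1 u v w ^ n = Xq 1 u v w ^ n" by simp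
      then show "?s u v w + Xq 1 u v w ^ Suc n = Xq 1 u v w ^ n"
        by (simp only: Xq_rot distrib_right power_Suc)
    qed
    finally show ?thesis by (simp only: I2_f)
  qed
  have "I2 ?s \<le> ennreal (f_seq n)" unfolding eq[symmetric] by simp
  then have "I2 ?s < top" using ennreal_less_top le_less_trans by blast
  then obtain a where a: "I2 ?s = ennreal a" "0 \<le> a" by (cases "I2 ?s") auto
  have "a + f_seq (Suc n) = f_seq n"
    using eq a by (simp add: ennreal_plus[symmetric] del: ennreal_plus)
  then have a': "a = f_seq n - f_seq (Suc n)" by simp
  show "f_seq (Suc n) \<le> f_seq n" using a' a by simp
  show "I2 ?g = ennreal ((f_seq n - f_seq (Suc n)) / 3)"
  proof (rule ennreal_third)
    have "I2 ?g + I2 ?g + I2 ?g = I2 ?s"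
      by (rule I2_cyclic_sum[OF meas3_Xq(7), symmetric]) (simp add: Xq_nonneg)
    then show "I2 ?g + I2 ?g + I2 ?g = ennreal (f_seq n - f_seq (Suc n))" using a a' by simp
  qed (use a a' in simp)
qed

lemma I3_square:
  "d3_seq (Suc n) \<le> d3_seq n"
  "I3 (\<lambda>u v w. u\<^sup>2 * Xq 1 u v w ^ n) = ennreal ((d3_seq n - d3_seq (Suc n)) / 3)"
proof -
  let ?g = "\<lambda>u v w. u\<^sup>2 * Xq 1 u v w ^ n"
  let ?s = "\<lambda>u v w. ?g u v w + ?g v w u + ?g w u v"
  have ms: "meas3 ?s" by measurable
  have eq: "I3 ?s + ennreal (d3_seq (Suc n)) = ennreal (d3_seq n)"
  proof -
    have "I3 ?s + I3 (\<lambda>u v w. Xq 1 u v w ^ Suc n) = I3 (\<lambda>u v w. ?s u v w + Xq 1 u v w ^ Suc n)"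
      by (rule I3_add[OF ms meas3_Xq(1), symmetric]) (simp_all add: Xq_nonneg add_ac del: power_Suc)
    also have "\<dots> = I3 (\<lambda>u v w. Xq 1 u v w ^ n)"
    proof (rule I3_cong)
      fix u v w :: real
      have "u\<^sup>2 + v\<^sup>2 + w\<^sup>2 + Xq 1 u v w = 1" by (simp add: Xq_def)
      then have "(u\<^sup>2 + v\<^sup>2 + w\<^sup>2 + Xq 1 u v w) * Xq 1 u v w ^ n = Xq 1 u v w ^ n" by simp
      then show "?s u v w + Xq 1 u v w ^ Suc n = Xq 1 u v w ^ n"
        by (simp only: Xq_rot distrib_right power_Suc)
    qed
    finally show ?thesis by (simp only: I3_d)
  qed
  have "I3 ?s \<le> ennreal (d3_seq n)" unfolding eq[symmetric] by simp
  then have "I3 ?s < top" using ennreal_less_top le_less_trans by blast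
  then obtain a where a: "I3 ?s = ennreal a" "0 \<le> a" by (cases "I3 ?s") auto
  have "a + d3_seq (Suc n) = d3_seq n"
    using eq a by (simp add: ennreal_plus[symmetric] del: ennreal_plus)
  then have a': "a = d3_seq n - d3_seq (Suc n)" by simp
  show "d3_seq (Suc n) \<le> d3_seq n" using a' a by simp
  show "I3 ?g = ennreal ((d3_seq n - d3_seq (Suc n)) / 3)"
  proof (rule ennreal_third)
    have "I3 ?g + I3 ?g + I3 ?g = I3 ?s"
      by (rule I3_cyclic_sum[OF meas3_Xq(7), symmetric]) (simp add: Xq_nonneg)
    then show "I3 ?g + I3 ?g + I3 ?g = ennreal (d3_seq n - d3_seq (Suc n))" using a a' by simp
  qed (use a a' in simp)
qed

text \<open>Rays start at 1/2, the centre of the parabola \<open>Y = 2 * t * (1 - t)\<close>: there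
  \<open>(t - 1 / 2) * Y' = 2 * Y - 1\<close>, so the derivative of
  \<open>(t - 1 / 2) * Y ^ (n + 1)\<close> involves only powers of \<open>Y\<close>. The boundary
  terms vanish with \<open>Y\<close> at both ends.\<close>

lemma h_rec: "(2 * real n + 3) * h_seq (Suc n) = (real n + 1) * h_seq n"
proof -
  let ?Y = "\<lambda>t::real. 2 * t * (1 - t)"
  have bal: "(\<integral>\<^sup>+ t. (if 0 \<le> t \<and> t \<le> 1 then ennreal ((2 * real n + 3) * ?Y t ^ Suc n) else 0) \<partial>lborel) + ennreal ((0 - 1 / 2) * ?Y 0 ^ Suc n) =
     (\<integral>\<^sup>+ t. (if 0 \<le> t \<and> t \<le> 1 then ennreal ((real n + 1) * ?Y t ^ n) else 0) \<partial>lborel) + ennreal ((1 - 1 / 2) * ?Y 1 ^ Suc n)"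
  proof (rule nn_integral_FTC_balance[where F = "\<lambda>t. (t - 1 / 2) * ?Y t ^ Suc n"])
    fix t :: real
    have Y: "((\<lambda>t. ?Y t) has_field_derivative 2 - 4 * t) (at t)"
      by (auto intro!: derivative_eq_intros simp: algebra_simps)
    have "((\<lambda>t. (t - 1 / 2) * ?Y t ^ Suc n) has_field_derivative
        1 * ?Y t ^ Suc n + (real (Suc n) * ((2 - 4 * t) * ?Y t ^ (Suc n - 1))) * (t - 1 / 2)) (at t)"
      by (rule DERIV_mult'[THEN DERIV_cong, OF _ DERIV_power[OF Y]]) (auto intro!: derivative_eq_intros simp: algebra_simps)
    also have "1 * ?Y t ^ Suc n + (real (Suc n) * ((2 - 4 * t) * ?Y t ^ (Suc n - 1))) * (t - 1 / 2)
       = (2 * real n + 3) * ?Y t ^ Suc n - (real n + 1) * ?Y t ^ n"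
    proof -
      have "(2 - 4 * t) * (t - 1 / 2) = 2 * ?Y t - 1" by (simp add: algebra_simps)
      then have "1 * ?Y t ^ Suc n + (real (Suc n) * ((2 - 4 * t) * ?Y t ^ (Suc n - 1))) * (t - 1 / 2)
        = ?Y t * ?Y t ^ n + (real n + 1) * (2 * ?Y t - 1) * ?Y t ^ n"
        by (simp add: mult_ac)
      also have "\<dots> = (2 * real n + 3) * (?Y t * ?Y t ^ n) - (real n + 1) * ?Y t ^ n"
      proof -
        have "Y * P + (r + 1) * (2 * Y - 1) * P = (2 * r + 3) * (Y * P) - (r + 1) * P" for Y P r :: real
          by (simp add: algebra_simps)
        then show ?thesis .
      qed
      finally show ?thesis by simp
    qed
    finally show "((\<lambda>t. (t - 1 / 2) * ?Y t ^ Suc n) has_field_derivative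
       (2 * real n + 3) * ?Y t ^ Suc n - (real n + 1) * ?Y t ^ n) (at t)" .
  qed (auto intro!: continuous_intros mult_nonneg_nonneg)
  then have "I1 (\<lambda>t. (2 * real n + 3) * ?Y t ^ Suc n) = I1 (\<lambda>t. (real n + 1) * ?Y t ^ n)"
    unfolding I1_def by simp
  then have "ennreal (2 * real n + 3) * ennreal (h_seq (Suc n)) = ennreal (real n + 1) * ennreal (h_seq n)"
    unfolding I1_h[symmetric] by (subst (asm) (1 2) I1_cmult) auto
  then show ?thesis
    by (subst (asm) (1 2) ennreal_mult[symmetric]) simp_all
qed

lemma I1_h_linear:
  "I1 (\<lambda>t. (1 - t) * (2 * t * (1 - t)) ^ n) = ennreal (h_seq n / 2)"
  "I1 (\<lambda>t. t * (2 * t * (1 - t)) ^ n) = ennreal (h_seq n / 2)"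
proof -
  let ?A = "I1 (\<lambda>t. t * (2 * t * (1 - t)) ^ n)"
  have sym: "I1 (\<lambda>t. (1 - t) * (2 * t * (1 - t)) ^ n) = ?A"
    using I1_reflect[of "\<lambda>t. t * (2 * t * (1 - t)) ^ n"] by (simp add: mult_ac)
  have "?A + ?A = I1 (\<lambda>t. t * (2 * t * (1 - t)) ^ n + (1 - t) * (2 * t * (1 - t)) ^ n)"
    unfolding sym[symmetric] by (subst I1_add) (auto simp: sym)
  also have "\<dots> = I1 (\<lambda>t. (2 * t * (1 - t)) ^ n)"
    by (rule I1_cong) (simp only: distrib_right[symmetric], simp)
  finally have AA: "?A + ?A = ennreal (h_seq n)" by (simp only: I1_h)
  have "?A \<le> ennreal (h_seq n)" unfolding AA[symmetric] using add_left_mono[of 0 ?A ?A] by simp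
  then have "?A < top" using ennreal_less_top le_less_trans by blast
  then obtain a where a: "?A = ennreal a" "0 \<le> a" by (cases ?A) auto
  then have "a + a = h_seq n" using AA by (simp add: ennreal_plus[symmetric] del: ennreal_plus)
  then have "a = h_seq n / 2" by simp
  then show "?A = ennreal (h_seq n / 2)" using a by simp
  then show "I1 (\<lambda>t. (1 - t) * (2 * t * (1 - t)) ^ n) = ennreal (h_seq n / 2)" using sym by simp
qed

lemma I2_iter:
  "I2 g = (\<integral>\<^sup>+ u. (if 0 \<le> u \<and> u \<le> 1 then \<integral>\<^sup>+ v. (if 0 \<le> v \<and> v \<le> 1 - u then ennreal (g u v (1 - u - v)) else 0) \<partial>lborel else 0) \<partial>lborel)"
  unfolding I2_def by (simp only: nn_integral_if_const[symmetric], intro nn_integral_cong) auto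

lemma I3_iter:
  "I3 g = (\<integral>\<^sup>+ u. \<integral>\<^sup>+ v. (if 0 \<le> u \<and> 0 \<le> v \<and> u + v \<le> 1 then \<integral>\<^sup>+ w. (if 0 \<le> w \<and> w \<le> 1 - u - v then ennreal (g u v w) else 0) \<partial>lborel else 0) \<partial>lborel \<partial>lborel)"
  unfolding I3_def by (simp only: nn_integral_if_const[symmetric], intro nn_integral_cong) auto

text \<open>For fixed \<open>u\<close> the total derivative is that of
  \<open>v * Xq ^ (n + 1)\<close> along the segment on which \<open>v\<close> grows and
  \<open>w\<close> shrinks. Its terms in \<open>v * w\<close> and \<open>v^2\<close> are reduced to
  \<open>f_seq\<close> by \<open>I2_product\<close> and \<open>I2_square\<close>. At the end
  \<open>w = 0\<close> the form is \<open>2 * u * (1 - u)\<close>, and the factor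
  \<open>1 - u\<close> contributes half of \<open>h_seq\<close> by reflection.\<close>

lemma f_rec: "(real n + 2) * f_seq (Suc n) = h_seq (Suc n) / 2 + 2 * (real n + 1) / 3 * f_seq n"
proof -
  define c where "c = 2 * (real n + 1)"
  have c: "0 \<le> c" by (simp add: c_def)
  let ?X = "\<lambda>u v. Xq 1 u v (1 - u - v)"
  let ?g1 = "\<lambda>u v w. Xq 1 u v w ^ Suc n + c * (v * w * Xq 1 u v w ^ n)"
  let ?g2 = "\<lambda>u v w. c * (v\<^sup>2 * Xq 1 u v w ^ n)"
  have m: "meas3 ?g1" "meas3 ?g2" "meas3 (\<lambda>u v w. c * (v * w * Xq 1 u v w ^ n))" by measurable
  note [measurable] = meas3_comp[OF m(1)] meas3_comp[OF m(2)]
  have inner: "(\<integral>\<^sup>+ v. (if 0 \<le> v \<and> v \<le> 1 - u then ennreal (?g1 u v (1 - u - v)) else 0) \<partial>lborel) =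
     (\<integral>\<^sup>+ v. (if 0 \<le> v \<and> v \<le> 1 - u then ennreal (?g2 u v (1 - u - v)) else 0) \<partial>lborel) + ennreal ((1 - u) * (2 * u * (1 - u)) ^ Suc n)"
    if u: "0 \<le> u \<and> u \<le> 1" for u
  proof -
    have X: "((\<lambda>v. ?X u v) has_field_derivative 2 * (1 - u - v) - 2 * v) (at v)" for v
      unfolding Xq_def by (auto intro!: derivative_eq_intros simp: algebra_simps)
    have X1: "?X u (1 - u) = 2 * u * (1 - u)"
      unfolding Xq_def by (simp add: power2_eq_square algebra_simps)
    have "(\<integral>\<^sup>+ v. (if 0 \<le> v \<and> v \<le> 1 - u then ennreal (?g1 u v (1 - u - v)) else 0) \<partial>lborel) + ennreal (0 * ?X u 0 ^ Suc n) =
     (\<integral>\<^sup>+ v. (if 0 \<le> v \<and> v \<le> 1 - u then ennreal (?g2 u v (1 - u - v)) else 0) \<partial>lborel) + ennreal ((1 - u) * ?X u (1 - u) ^ Suc n)"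
    proof (rule nn_integral_FTC_balance[where F = "\<lambda>v. v * ?X u v ^ Suc n"])
      fix v :: real
      have "((\<lambda>v. v * ?X u v ^ Suc n) has_field_derivative
          1 * ?X u v ^ Suc n + (real (Suc n) * ((2 * (1 - u - v) - 2 * v) * ?X u v ^ (Suc n - 1))) * v) (at v)"
        by (rule DERIV_mult'[THEN DERIV_cong, OF _ DERIV_power[OF X]]) (auto intro!: derivative_eq_intros simp: algebra_simps)
      also have "1 * ?X u v ^ Suc n + (real (Suc n) * ((2 * (1 - u - v) - 2 * v) * ?X u v ^ (Suc n - 1))) * v
          = ?g1 u v (1 - u - v) - ?g2 u v (1 - u - v)"
      proof -
        have "1 * P + (r + 1) * ((2 * w - 2 * v) * Q) * v = P + 2 * (r + 1) * (v * w * Q) - 2 * (r + 1) * (v\<^sup>2 * Q)" for P Q r w :: real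
          by (simp add: algebra_simps power2_eq_square)
        from this[of "?X u v ^ Suc n" "real n" "1 - u - v" "?X u v ^ n"] show ?thesis
          by (simp add: c_def add.commute)
      qed
      finally show "((\<lambda>v. v * ?X u v ^ Suc n) has_field_derivative ?g1 u v (1 - u - v) - ?g2 u v (1 - u - v)) (at v)" .
    next
      show "0 \<le> ?g1 u v (1 - u - v)" if "0 \<le> v" "v \<le> 1 - u" for v
        using u that c by (intro add_nonneg_nonneg mult_nonneg_nonneg zero_le_power Xq_nonneg) auto
      show "0 \<le> ?g2 u v (1 - u - v)" if "0 \<le> v" "v \<le> 1 - u" for v
        using u that c by (intro mult_nonneg_nonneg zero_le_power Xq_nonneg) auto
      show "0 \<le> (1 - u) * ?X u (1 - u) ^ Suc n"
        unfolding X1 using u by (intro mult_nonneg_nonneg zero_le_power) auto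
      show "continuous_on {0..1 - u} (\<lambda>v. ?g1 u v (1 - u - v))" "continuous_on {0..1 - u} (\<lambda>v. ?g2 u v (1 - u - v))"
        unfolding Xq_def by (intro continuous_intros)+
    qed (use u in simp_all)
    then show ?thesis unfolding X1 by (simp only: mult_zero_left ennreal_0 add_0_right)
  qed
  have "I2 ?g1 = I2 ?g2 + I1 (\<lambda>u. (1 - u) * (2 * u * (1 - u)) ^ Suc n)"
    unfolding I2_iter I1_def
  proof (subst nn_integral_add[symmetric], measurable, rule nn_integral_cong)
    fix u :: real
    show "(if 0 \<le> u \<and> u \<le> 1 then \<integral>\<^sup>+ v. (if 0 \<le> v \<and> v \<le> 1 - u then ennreal (?g1 u v (1 - u - v)) else 0) \<partial>lborel else 0) =
      (if 0 \<le> u \<and> u \<le> 1 then \<integral>\<^sup>+ v. (if 0 \<le> v \<and> v \<le> 1 - u then ennreal (?g2 u v (1 - u - v)) else 0) \<partial>lborel else 0)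
      + (if 0 \<le> u \<and> u \<le> 1 then ennreal ((1 - u) * (2 * u * (1 - u)) ^ Suc n) else 0)"
      using inner[of u] by (cases "0 \<le> u \<and> u \<le> 1") (simp_all only: simp_thms if_True if_False add_0_left)
  qed
  moreover have "I2 ?g1 = ennreal (f_seq (Suc n)) + ennreal c * ennreal (f_seq (Suc n) / 2 / 3)"
  proof -
    have vw: "I2 (\<lambda>u v w. v * w * Xq 1 u v w ^ n) = ennreal (f_seq (Suc n) / 2 / 3)"
      using I2_rot(1)[OF meas3_Xq(5), of n] by (simp only: Xq_rot I2_product)
    have "I2 ?g1 = I2 (\<lambda>u v w. Xq 1 u v w ^ Suc n) + I2 (\<lambda>u v w. c * (v * w * Xq 1 u v w ^ n))"
      using c by (intro I2_add meas3_Xq m(3)) (auto simp: Xq_nonneg simp del: power_Suc)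
    then show ?thesis
      by (simp only: I2_cmult[OF meas3_Xq(6) c] vw I2_f)
  qed
  moreover have "I2 ?g2 = ennreal c * ennreal ((f_seq n - f_seq (Suc n)) / 3)"
  proof -
    have "I2 (\<lambda>u v w. v\<^sup>2 * Xq 1 u v w ^ n) = ennreal ((f_seq n - f_seq (Suc n)) / 3)"
      using I2_rot(1)[OF meas3_Xq(7), of n] by (simp only: Xq_rot I2_square)
    then show ?thesis by (simp only: I2_cmult[OF meas3_Xq(8) c])
  qed
  ultimately have "ennreal (f_seq (Suc n)) + ennreal c * ennreal (f_seq (Suc n) / 2 / 3) =
      ennreal c * ennreal ((f_seq n - f_seq (Suc n)) / 3) + ennreal (h_seq (Suc n) / 2)"
    by (simp only: I1_h_linear)
  then have "f_seq (Suc n) + c * (f_seq (Suc n) / 2 / 3) = c * ((f_seq n - f_seq (Suc n)) / 3) + h_seq (Suc n) / 2"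
    using c I2_square(1)[of n] by (simp add: ennreal_mult'[symmetric] ennreal_plus[symmetric] del: ennreal_plus)
  then show ?thesis unfolding c_def by (simp add: field_simps)
qed

text \<open>The total derivative of \<open>w * Xq ^ (n + 1)\<close> in \<open>w\<close> alone
  suffices: symmetry turns \<open>w^2\<close> into a third of \<open>1 - Xq\<close>, and on the
  boundary face the factor \<open>w\<close> averages to 1/3. The common denominator 3 then
  cancels.\<close>

lemma d3_rec: "(2 * real n + 5) * d3_seq (Suc n) = f_seq (Suc n) + 2 * (real n + 1) * d3_seq n"
proof -
  define c where "c = 2 * (real n + 1)"
  have c: "0 \<le> c" by (simp add: c_def)
  let ?g1 = "\<lambda>u v w. Xq 1 u v w ^ Suc n"
  let ?g2 = "\<lambda>u v w. c * (w\<^sup>2 * Xq 1 u v w ^ n)"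
  have m: "meas3 ?g1" "meas3 ?g2" by measurable
  note [measurable] = meas3_comp[OF m(1)] meas3_comp[OF m(2)]
  have inner: "(\<integral>\<^sup>+ w. (if 0 \<le> w \<and> w \<le> 1 - u - v then ennreal (?g1 u v w) else 0) \<partial>lborel) =
     (\<integral>\<^sup>+ w. (if 0 \<le> w \<and> w \<le> 1 - u - v then ennreal (?g2 u v w) else 0) \<partial>lborel) + ennreal ((1 - u - v) * Xq 1 u v (1 - u - v) ^ Suc n)"
    if u: "0 \<le> u \<and> 0 \<le> v \<and> u + v \<le> 1" for u v
  proof -
    have "(\<integral>\<^sup>+ w. (if 0 \<le> w \<and> w \<le> 1 - u - v then ennreal (?g1 u v w) else 0) \<partial>lborel) + ennreal (0 * Xq 1 u v 0 ^ Suc n) =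
     (\<integral>\<^sup>+ w. (if 0 \<le> w \<and> w \<le> 1 - u - v then ennreal (?g2 u v w) else 0) \<partial>lborel) + ennreal ((1 - u - v) * Xq 1 u v (1 - u - v) ^ Suc n)"
    proof (rule nn_integral_FTC_balance[where F = "\<lambda>w. w * Xq 1 u v w ^ Suc n"])
      fix w :: real
      have "((\<lambda>w. w * Xq 1 u v w ^ Suc n) has_field_derivative
          1 * Xq 1 u v w ^ Suc n + (real (Suc n) * (- 2 * w * Xq 1 u v w ^ (Suc n - 1))) * w) (at w)"
        by (rule DERIV_mult'[THEN DERIV_cong, OF _ DERIV_power[OF Xq_deriv(3)]]) (auto intro!: derivative_eq_intros simp: algebra_simps)
      also have "1 * Xq 1 u v w ^ Suc n + (real (Suc n) * (- 2 * w * Xq 1 u v w ^ (Suc n - 1))) * w = ?g1 u v w - ?g2 u v w"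
        by (simp add: c_def algebra_simps power2_eq_square)
      finally show "((\<lambda>w. w * Xq 1 u v w ^ Suc n) has_field_derivative ?g1 u v w - ?g2 u v w) (at w)" .
    next
      show "0 \<le> ?g1 u v w" if "0 \<le> w" "w \<le> 1 - u - v" for w
        using u that by (intro zero_le_power Xq_nonneg) auto
      show "0 \<le> ?g2 u v w" if "0 \<le> w" "w \<le> 1 - u - v" for w
        using u that c by (intro mult_nonneg_nonneg zero_le_power Xq_nonneg) auto
      show "0 \<le> (1 - u - v) * Xq 1 u v (1 - u - v) ^ Suc n"
        using u by (intro mult_nonneg_nonneg zero_le_power Xq_nonneg) auto
      show "continuous_on {0..1 - u - v} (?g1 u v)" "continuous_on {0..1 - u - v} (?g2 u v)"
        unfolding Xq_def by (intro continuous_intros)+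
    qed (use u in simp_all)
    then show ?thesis by (simp only: mult_zero_left ennreal_0 add_0_right)
  qed
  have "I3 ?g1 = I3 ?g2 + I2 (\<lambda>u v w. w * Xq 1 u v w ^ Suc n)"
    unfolding I3_iter I2_def
  proof (subst nn_integral_add[symmetric], measurable, subst nn_integral_add[symmetric], measurable, intro nn_integral_cong)
    fix u v :: real
    show "(if 0 \<le> u \<and> 0 \<le> v \<and> u + v \<le> 1 then \<integral>\<^sup>+ w. (if 0 \<le> w \<and> w \<le> 1 - u - v then ennreal (?g1 u v w) else 0) \<partial>lborel else 0) =
      (if 0 \<le> u \<and> 0 \<le> v \<and> u + v \<le> 1 then \<integral>\<^sup>+ w. (if 0 \<le> w \<and> w \<le> 1 - u - v then ennreal (?g2 u v w) else 0) \<partial>lborel else 0)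
      + (if 0 \<le> u \<and> 0 \<le> v \<and> u + v \<le> 1 then ennreal ((1 - u - v) * Xq 1 u v (1 - u - v) ^ Suc n) else 0)"
      using inner[of u v] by (cases "0 \<le> u \<and> 0 \<le> v \<and> u + v \<le> 1") (simp_all only: simp_thms if_True if_False add_0_left)
  qed
  moreover have "I3 ?g2 = ennreal c * ennreal ((d3_seq n - d3_seq (Suc n)) / 3)"
  proof -
    have "I3 (\<lambda>u v w. w\<^sup>2 * Xq 1 u v w ^ n) = ennreal ((d3_seq n - d3_seq (Suc n)) / 3)"
      using I3_rot(2)[OF meas3_Xq(7), of n] by (simp only: Xq_rot I3_square)
    then show ?thesis by (simp only: I3_cmult[OF meas3_Xq(9) c])
  qed
  moreover have "I2 (\<lambda>u v w. w * Xq 1 u v w ^ Suc n) = ennreal (f_seq (Suc n) / 3)"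
    using I2_rot(2)[OF meas3_Xq(2), of "Suc n"] by (simp only: Xq_rot I2_linear)
  ultimately have "ennreal (d3_seq (Suc n)) = ennreal c * ennreal ((d3_seq n - d3_seq (Suc n)) / 3) + ennreal (f_seq (Suc n) / 3)"
    by (simp only: I3_d)
  then have "d3_seq (Suc n) = c * ((d3_seq n - d3_seq (Suc n)) / 3) + f_seq (Suc n) / 3"
    using c I3_square(1)[of n] by (simp add: ennreal_mult'[symmetric] ennreal_plus[symmetric] del: ennreal_plus)
  then show ?thesis unfolding c_def by (simp add: field_simps)
qed

section \<open>The volume of the integer hull\<close>

lemma triple_comp:
  fixes f :: "real \<Rightarrow> real \<Rightarrow> real \<Rightarrow> ennreal"
  assumes f: "(\<lambda>(x, y, z). f x y z) \<in> borel_measurable lborel3"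
    and [measurable]: "a \<in> borel_measurable M" "b \<in> borel_measurable M" "c \<in> borel_measurable M"
  shows "(\<lambda>x. f (a x) (b x) (c x)) \<in> borel_measurable M"
proof -
  have "(\<lambda>x. (a x, b x, c x)) \<in> measurable M lborel3" by measurable
  from measurable_compose[OF this f] show ?thesis by simp
qed

abbreviation meas2 :: "(real \<Rightarrow> real \<Rightarrow> ennreal) \<Rightarrow> bool" where
  "meas2 h \<equiv> (\<lambda>(t, z). h t z) \<in> borel_measurable (lborel \<Otimes>\<^sub>M lborel)"

lemma meas2_comp:
  assumes "meas2 h" and [measurable]: "a \<in> borel_measurable M" "b \<in> borel_measurable M"
  shows "(\<lambda>x. h (a x) (b x)) \<in> borel_measurable M"
proof -
  have "(\<lambda>x. (a x, b x)) \<in> measurable M (lborel \<Otimes>\<^sub>M lborel)" by measurable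
  from measurable_compose[OF this assms(1)] show ?thesis by simp
qed

lemma nn_integral_positive:
  fixes f :: "real \<Rightarrow> ennreal"
  shows "(\<integral>\<^sup>+ t. (if 0 < t \<and> P t then f t else 0) \<partial>lborel) = (\<integral>\<^sup>+ t. (if 0 \<le> t \<and> P t then f t else 0) \<partial>lborel)"
proof (rule nn_integral_cong_AE)
  show "AE t in lborel. (if 0 < t \<and> P t then f t else 0) = (if 0 \<le> t \<and> P t then f t else 0)"
    using AE_lborel_singleton[of 0] by eventually_elim auto
qed

text \<open>\<open>s\<close> replaces \<open>y1\<close> as the excess of the sum over 1, with
  \<open>q\<close> in the place of \<open>y2\<close> and \<open>p\<close> in that of
  \<open>y3\<close>. The substitution is a translation for fixed \<open>p\<close> and
  \<open>q\<close>, so it has no Jacobian factor.\<close>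

lemma nn_integral_slice_sum:
  fixes f :: "real \<Rightarrow> real \<Rightarrow> real \<Rightarrow> ennreal"
  assumes f: "(\<lambda>(x, y, z). f x y z) \<in> borel_measurable lborel3"
  shows "(\<integral>\<^sup>+ y1. \<integral>\<^sup>+ y2. \<integral>\<^sup>+ y3. f y1 y2 y3 \<partial>lborel \<partial>lborel \<partial>lborel) =
    (\<integral>\<^sup>+ s. \<integral>\<^sup>+ p. \<integral>\<^sup>+ q. f (1 + s - p - q) q p \<partial>lborel \<partial>lborel \<partial>lborel)"
proof -
  note [measurable] = triple_comp[OF f]
  have "(\<integral>\<^sup>+ y1. \<integral>\<^sup>+ y2. \<integral>\<^sup>+ y3. f y1 y2 y3 \<partial>lborel \<partial>lborel \<partial>lborel) =
     (\<integral>\<^sup>+ y2. \<integral>\<^sup>+ y1. \<integral>\<^sup>+ y3. f y1 y2 y3 \<partial>lborel \<partial>lborel \<partial>lborel)"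
    by (rule lborel_pair.Fubini'[symmetric]) measurable
  also have "\<dots> = (\<integral>\<^sup>+ y2. \<integral>\<^sup>+ y3. \<integral>\<^sup>+ y1. f y1 y2 y3 \<partial>lborel \<partial>lborel \<partial>lborel)"
    by (intro nn_integral_cong lborel_pair.Fubini'[symmetric]) measurable
  also have "\<dots> = (\<integral>\<^sup>+ y3. \<integral>\<^sup>+ y2. \<integral>\<^sup>+ y1. f y1 y2 y3 \<partial>lborel \<partial>lborel \<partial>lborel)"
    by (rule lborel_pair.Fubini'[symmetric]) measurable
  also have "\<dots> = (\<integral>\<^sup>+ p. \<integral>\<^sup>+ q. \<integral>\<^sup>+ s. f (1 + s - p - q) q p \<partial>lborel \<partial>lborel \<partial>lborel)"
  proof (rule nn_integral_cong, rule nn_integral_cong)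
    fix p q :: real
    have "(\<integral>\<^sup>+ y1. f y1 q p \<partial>lborel) = ennreal \<bar>1\<bar> * (\<integral>\<^sup>+ s. f ((1 - p - q) + 1 * s) q p \<partial>lborel)"
      by (rule nn_integral_real_affine) auto
    also have "(\<lambda>s. f ((1 - p - q) + 1 * s) q p) = (\<lambda>s. f (1 + s - p - q) q p)"
      by (intro ext arg_cong[where f = "\<lambda>x. f x q p"]) simp
    finally show "(\<integral>\<^sup>+ y1. f y1 q p \<partial>lborel) = (\<integral>\<^sup>+ s. f (1 + s - p - q) q p \<partial>lborel)" by simp
  qed
  also have "\<dots> = (\<integral>\<^sup>+ p. \<integral>\<^sup>+ s. \<integral>\<^sup>+ q. f (1 + s - p - q) q p \<partial>lborel \<partial>lborel \<partial>lborel)"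
    by (intro nn_integral_cong lborel_pair.Fubini'[symmetric]) measurable
  also have "\<dots> = (\<integral>\<^sup>+ s. \<integral>\<^sup>+ p. \<integral>\<^sup>+ q. f (1 + s - p - q) q p \<partial>lborel \<partial>lborel \<partial>lborel)"
    by (rule lborel_pair.Fubini'[symmetric]) measurable
  finally show ?thesis .
qed

lemma nn_integral_triangle:
  "(\<integral>\<^sup>+ x. \<integral>\<^sup>+ y. (if p \<le> x \<and> q \<le> y \<and> x + y \<le> r then 1 else 0) \<partial>lborel \<partial>lborel) = ennreal (posq (r - p - q) / 2)"
proof -
  have "emeasure (lborel \<Otimes>\<^sub>M lborel) (corner p q (1 - r)) = (\<integral>\<^sup>+ x. emeasure lborel (Pair x -` corner p q (1 - r)) \<partial>lborel)"
    by (rule lborel.emeasure_pair_measure_alt[OF corner_measurable])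
  also have "\<dots> = (\<integral>\<^sup>+ x. \<integral>\<^sup>+ y. (if p \<le> x \<and> q \<le> y \<and> x + y \<le> r then 1 else 0) \<partial>lborel \<partial>lborel)"
  proof (rule nn_integral_cong)
    fix x :: real
    have "Pair x -` corner p q (1 - r) \<in> sets lborel"
      by (rule sets_Pair1[OF corner_measurable])
    then have "emeasure lborel (Pair x -` corner p q (1 - r)) = (\<integral>\<^sup>+ y. indicator (Pair x -` corner p q (1 - r)) y \<partial>lborel)"
      by simp
    also have "\<dots> = (\<integral>\<^sup>+ y. (if p \<le> x \<and> q \<le> y \<and> x + y \<le> r then 1 else 0) \<partial>lborel)"
      by (intro nn_integral_cong) (auto simp: indicator_def corner_def)
    finally show "emeasure lborel (Pair x -` corner p q (1 - r)) = (\<integral>\<^sup>+ y. (if p \<le> x \<and> q \<le> y \<and> x + y \<le> r then 1 else 0) \<partial>lborel)" .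
  qed
  finally show ?thesis by (simp add: emeasure_corner algebra_simps)
qed

lemma nn_integral_interval:
  "a \<le> b \<Longrightarrow> (\<integral>\<^sup>+ x. (if a \<le> x \<and> x \<le> b then c else 0) \<partial>lborel) = c * ennreal (b - a)"
proof -
  assume "a \<le> b"
  have "(\<integral>\<^sup>+ x. (if a \<le> x \<and> x \<le> b then c else 0) \<partial>lborel) = (\<integral>\<^sup>+ x. c * indicator {a..b} x \<partial>lborel)"
    by (intro nn_integral_cong) (auto simp: indicator_def)
  also have "\<dots> = c * ennreal (b - a)" using \<open>a \<le> b\<close> by (subst nn_integral_cmult_indicator) auto
  finally show ?thesis .
qed

section \<open>Homogeneity, scaling and Beta integrals\<close>

lemma Xq_scale: "Xq s (s * u) (s * v) (s * w) = s\<^sup>2 * Xq 1 u v w"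
  by (simp add: Xq_def power_mult_distrib algebra_simps)

lemma Ep_scale:
  assumes "1 \<le> n"
  shows "Ep n s (s * u) (s * v) (s * w) = s ^ (2 * n - 1) * Ep n 1 u v w"
proof -
  obtain m where n: "n = Suc m" using assms by (cases n) auto
  show ?thesis
    unfolding Ep_def Xq_scale n by (simp add: power_mult_distrib power_mult[symmetric])
qed

lemma Gp_scale:
  assumes "1 \<le> n"
  shows "Gp n s (s * u) (s * v) (s * w) = s ^ (2 * n - 2) * Gp n 1 u v w"
proof (cases "n = 1")
  case False
  then obtain m where n: "n = Suc (Suc m)" using assms by (metis One_nat_def Suc_le_D not0_implies_Suc)
  have "2 * n - 2 = 2 + 2 * m" by (simp add: n)
  then show ?thesis
    unfolding Gp_def Xq_scale by (simp add: n power_mult_distrib power_mult[symmetric] power_add power2_eq_square mult_2)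
qed (simp add: Gp_def)

lemma nn_integral_scale1:
  assumes [measurable]: "f \<in> borel_measurable borel" and s: "0 < s"
  shows "(\<integral>\<^sup>+ t. (if 0 \<le> t \<and> t \<le> s then f t else 0) \<partial>lborel) = ennreal s * (\<integral>\<^sup>+ t. (if 0 \<le> t \<and> t \<le> 1 then f (s * t) else 0) \<partial>lborel)"
proof -
  have "(\<integral>\<^sup>+ t. (if 0 \<le> t \<and> t \<le> s then f t else 0) \<partial>lborel) = ennreal \<bar>s\<bar> * (\<integral>\<^sup>+ t. (if 0 \<le> 0 + s * t \<and> 0 + s * t \<le> s then f (0 + s * t) else 0) \<partial>lborel)"
    using s by (intro nn_integral_real_affine) auto
  then show ?thesis using s unfolding add_0_left by (simp add: zero_le_mult_iff)
qed

lemma nn_integral_scale2: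
  fixes f :: "real \<Rightarrow> real \<Rightarrow> ennreal"
  assumes f: "(\<lambda>(x, y). f x y) \<in> borel_measurable (lborel \<Otimes>\<^sub>M lborel)" and s: "0 < s"
  shows "(\<integral>\<^sup>+ u. \<integral>\<^sup>+ v. (if 0 \<le> u \<and> 0 \<le> v \<and> u + v \<le> s then f u v else 0) \<partial>lborel \<partial>lborel) =
    ennreal (s\<^sup>2) * (\<integral>\<^sup>+ u. \<integral>\<^sup>+ v. (if 0 \<le> u \<and> 0 \<le> v \<and> u + v \<le> 1 then f (s * u) (s * v) else 0) \<partial>lborel \<partial>lborel)"
proof -
  note [measurable] = meas2_comp[OF f]
  have iff: "s * u + s * v \<le> s \<longleftrightarrow> u + v \<le> 1" "0 \<le> s * u \<longleftrightarrow> 0 \<le> u" for u v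
    using s by (simp_all add: distrib_left[symmetric] zero_le_mult_iff)
  have inner: "(\<integral>\<^sup>+ v. (if 0 \<le> s * u \<and> 0 \<le> v \<and> s * u + v \<le> s then f (s * u) v else 0) \<partial>lborel) =
     ennreal s * (\<integral>\<^sup>+ v. (if 0 \<le> u \<and> 0 \<le> v \<and> u + v \<le> 1 then f (s * u) (s * v) else 0) \<partial>lborel)" for u
  proof -
    have "(\<integral>\<^sup>+ v. (if 0 \<le> s * u \<and> 0 \<le> v \<and> s * u + v \<le> s then f (s * u) v else 0) \<partial>lborel) =
      ennreal \<bar>s\<bar> * (\<integral>\<^sup>+ v. (if 0 \<le> s * u \<and> 0 \<le> 0 + s * v \<and> s * u + (0 + s * v) \<le> s then f (s * u) (0 + s * v) else 0) \<partial>lborel)"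
      using s by (intro nn_integral_real_affine) auto
    then show ?thesis unfolding add_0_left iff using s by (simp only: abs_of_pos)
  qed
  have "(\<integral>\<^sup>+ u. \<integral>\<^sup>+ v. (if 0 \<le> u \<and> 0 \<le> v \<and> u + v \<le> s then f u v else 0) \<partial>lborel \<partial>lborel) =
     ennreal \<bar>s\<bar> * (\<integral>\<^sup>+ u. \<integral>\<^sup>+ v. (if 0 \<le> 0 + s * u \<and> 0 \<le> v \<and> 0 + s * u + v \<le> s then f (0 + s * u) v else 0) \<partial>lborel \<partial>lborel)"
    using s by (intro nn_integral_real_affine) auto
  also have "\<dots> = ennreal s * (\<integral>\<^sup>+ u. ennreal s * (\<integral>\<^sup>+ v. (if 0 \<le> u \<and> 0 \<le> v \<and> u + v \<le> 1 then f (s * u) (s * v) else 0) \<partial>lborel) \<partial>lborel)"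
    using s unfolding add_0_left inner by (simp only: abs_of_pos)
  also have "\<dots> = ennreal s * (ennreal s * (\<integral>\<^sup>+ u. \<integral>\<^sup>+ v. (if 0 \<le> u \<and> 0 \<le> v \<and> u + v \<le> 1 then f (s * u) (s * v) else 0) \<partial>lborel \<partial>lborel))"
    by (subst nn_integral_cmult) measurable
  also have "\<dots> = ennreal (s\<^sup>2) * (\<integral>\<^sup>+ u. \<integral>\<^sup>+ v. (if 0 \<le> u \<and> 0 \<le> v \<and> u + v \<le> 1 then f (s * u) (s * v) else 0) \<partial>lborel \<partial>lborel)"
    using s by (simp add: power2_eq_square ennreal_mult mult.assoc)
  finally show ?thesis .
qed

lemma power_deriv_div: "((\<lambda>s. s ^ Suc k / (real k + 1)) has_field_derivative s ^ k) (at s)"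
proof -
  have "((\<lambda>s. s ^ Suc k / (real k + 1)) has_field_derivative (real (Suc k) * s ^ (Suc k - Suc 0)) / (real k + 1)) (at s)"
    by (rule DERIV_cdivide[OF DERIV_pow])
  moreover have "(real (Suc k) * s ^ (Suc k - Suc 0)) / (real k + 1) = s ^ k"
    by (simp add: add.commute)
  ultimately show ?thesis by simp
qed

text \<open>\<open>beta0\<close>, \<open>beta1\<close>, \<open>beta2\<close> carry the weights 1,
  \<open>1 - s\<close> and \<open>(1 - s)^2 / 2\<close>: the volumes of simplices of size
  \<open>1 - s\<close> and dimension 0, 1, 2, over which the parameters not seen by the integrand
  range.\<close>

lemma beta0: "(\<integral>\<^sup>+ s. (if 0 \<le> s \<and> s \<le> 1 then ennreal (s ^ k) else 0) \<partial>lborel) = ennreal (1 / (real k + 1))"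
proof -
  have "(\<integral>\<^sup>+ s. (if 0 \<le> s \<and> s \<le> 1 then ennreal (s ^ k) else 0) \<partial>lborel) = ennreal (- (0 ^ Suc k / (real k + 1)) - (- (1 ^ Suc k / (real k + 1))))"
    by (rule nn_integral_FTC_neg(1)[where H = "\<lambda>s. - (s ^ Suc k / (real k + 1))", OF _ _ DERIV_minus[OF power_deriv_div]]) auto
  then show ?thesis by simp
qed

lemma beta1: "(\<integral>\<^sup>+ s. (if 0 \<le> s \<and> s \<le> 1 then ennreal ((1 - s) * s ^ k) else 0) \<partial>lborel) = ennreal (1 / ((real k + 1) * (real k + 2)))"
proof -
  let ?H = "\<lambda>s. s ^ Suc (Suc k) / (real (Suc k) + 1) - s ^ Suc k / (real k + 1)"
  have "(\<integral>\<^sup>+ s. (if 0 \<le> s \<and> s \<le> 1 then ennreal ((1 - s) * s ^ k) else 0) \<partial>lborel) = ennreal (?H 0 - ?H 1)"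
  proof (rule nn_integral_FTC_neg(1))
    show "(?H has_field_derivative - ((1 - t) * t ^ k)) (at t)" for t :: real
      using DERIV_diff[OF power_deriv_div[of "Suc k" t] power_deriv_div[of k t]] by (simp add: algebra_simps)
  qed auto
  also have "?H 0 - ?H 1 = 1 / ((real k + 1) * (real k + 2))"
    by (simp add: field_simps)
  finally show ?thesis .
qed

lemma beta2: "(\<integral>\<^sup>+ s. (if 0 \<le> s \<and> s \<le> 1 then ennreal ((1 - s)\<^sup>2 / 2 * s ^ k) else 0) \<partial>lborel) = ennreal (1 / ((real k + 1) * (real k + 2) * (real k + 3)))"
proof -
  let ?H = "\<lambda>s. s ^ Suc (Suc k) / (real (Suc k) + 1) - (s ^ Suc k / (real k + 1) / 2 + s ^ Suc (Suc (Suc k)) / (real (Suc (Suc k)) + 1) / 2)"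
  have "(\<integral>\<^sup>+ s. (if 0 \<le> s \<and> s \<le> 1 then ennreal ((1 - s)\<^sup>2 / 2 * s ^ k) else 0) \<partial>lborel) = ennreal (?H 0 - ?H 1)"
  proof (rule nn_integral_FTC_neg(1))
    fix t :: real
    have "(?H has_field_derivative t ^ Suc k - (t ^ k / 2 + t ^ Suc (Suc k) / 2)) (at t)"
      by (intro DERIV_diff DERIV_add DERIV_cdivide power_deriv_div)
    also have "t ^ Suc k - (t ^ k / 2 + t ^ Suc (Suc k) / 2) = - ((1 - t)\<^sup>2 / 2 * t ^ k)"
      by (simp add: power2_eq_square field_simps)
    finally show "(?H has_field_derivative - ((1 - t)\<^sup>2 / 2 * t ^ k)) (at t)" .
  qed auto
  also have "?H 0 - ?H 1 = 1 / ((real k + 1) * (real k + 2) * (real k + 3))"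
  proof -
    have "0 - (1 / (x + 2) - (1 / (x + 1) / 2 + 1 / (x + 3) / 2)) = 1 / ((x + 1) * (x + 2) * (x + 3))" if "0 \<le> x" for x :: real
    proof -
      have "x + 1 \<noteq> 0" "x + 2 \<noteq> 0" "x + 3 \<noteq> 0" using that by auto
      then show ?thesis by (simp add: divide_simps) (simp add: algebra_simps)
    qed
    from this[of "real k"] show ?thesis by (simp add: add.commute)
  qed
  finally show ?thesis .
qed

text \<open>The triple \<open>(1 + s - p - q, q, p)\<close> lies in the unit cube.\<close>

definition tail_cond :: "real \<Rightarrow> real \<Rightarrow> real \<Rightarrow> bool" where
  "tail_cond s p q \<longleftrightarrow> 0 \<le> p \<and> p \<le> 1 \<and> 0 \<le> q \<and> q \<le> 1 \<and> s \<le> p + q \<and> p + q \<le> 1 + s"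

lemma I2_Gp: "1 \<le> n \<Longrightarrow> I2 (Gp n 1) = ennreal (2 / 3 * real n * real (n - 1) * f_seq (n - 1))"
proof (cases "n = 1")
  case False
  assume "1 \<le> n"
  then obtain m where n: "n = Suc (Suc m)" using False by (metis One_nat_def Suc_le_D not0_implies_Suc)
  have "I2 (Gp n 1) = I2 (\<lambda>u v w. (4 * real n * real (n - 1)) * (u * v * Xq 1 u v w ^ m))"
    by (rule I2_cong) (simp add: Gp_def n mult_ac)
  also have "\<dots> = ennreal (4 * real n * real (n - 1)) * ennreal (f_seq (Suc m) / 2 / 3)"
    by (subst I2_cmult[OF meas3_Xq(5)]) (simp_all add: I2_product)
  also have "\<dots> = ennreal (4 * real n * real (n - 1) * (f_seq (Suc m) / 2 / 3))"
    by (rule ennreal_mult[symmetric]) simp_all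
  also have "4 * real n * real (n - 1) * (f_seq (Suc m) / 2 / 3) = 2 / 3 * real n * real (n - 1) * f_seq (n - 1)"
    unfolding n diff_Suc_1 by linarith
  finally show ?thesis .
next
  case True
  have "I2 (Gp n 1) = I2 (\<lambda>u v w. 0 * Xq 1 u v w ^ 0)"
    by (rule I2_cong) (simp add: Gp_def True)
  also have "\<dots> = ennreal 0 * I2 (\<lambda>u v w. Xq 1 u v w ^ 0)"
    by (rule I2_cmult[OF meas3_Xq(1)]) simp
  finally show ?thesis by (simp add: True)
qed

lemma I2_Ep: "1 \<le> n \<Longrightarrow> I2 (Ep n 1) = ennreal (2 / 3 * real n * f_seq (n - 1))"
proof -
  assume "1 \<le> n"
  have "I2 (Ep n 1) = I2 (\<lambda>u v w. (2 * real n) * (u * Xq 1 u v w ^ (n - 1)))"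
    by (rule I2_cong) (simp add: Ep_def mult_ac)
  also have "\<dots> = ennreal (2 * real n) * ennreal (f_seq (n - 1) / 3)"
    by (subst I2_cmult[OF meas3_Xq(2)]) (simp_all add: I2_linear)
  also have "\<dots> = ennreal (2 / 3 * real n * f_seq (n - 1))"
    by (subst ennreal_mult[symmetric]) simp_all
  finally show ?thesis .
qed

lemma Xq_edge: "Xq 1 t (1 - t) 0 = 2 * t * (1 - t)"
  by (simp add: Xq_def power2_eq_square algebra_simps)

lemma I1_Ep: "I1 (\<lambda>t. Ep n 1 t (1 - t) 0) = ennreal (real n * h_seq (n - 1))"
proof -
  have "I1 (\<lambda>t. Ep n 1 t (1 - t) 0) = I1 (\<lambda>t. (2 * real n) * (t * (2 * t * (1 - t)) ^ (n - 1)))"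
    by (rule I1_cong) (simp add: Ep_def Xq_edge mult_ac)
  also have "\<dots> = ennreal (2 * real n) * ennreal (h_seq (n - 1) / 2)"
    by (subst I1_cmult) (simp_all add: I1_h_linear)
  also have "\<dots> = ennreal (real n * h_seq (n - 1))"
    by (subst ennreal_mult[symmetric]) simp_all
  finally show ?thesis .
qed

section \<open>Facet, edge and vertex contributions\<close>

lemma nn_integral_swap4:
  fixes h :: "real \<Rightarrow> real \<Rightarrow> real \<Rightarrow> real \<Rightarrow> ennreal"
  assumes h: "(\<lambda>(p, q, u, v). h p q u v) \<in> borel_measurable (lborel \<Otimes>\<^sub>M lborel3)"
  shows "(\<integral>\<^sup>+ p. \<integral>\<^sup>+ q. \<integral>\<^sup>+ u. \<integral>\<^sup>+ v. h p q u v \<partial>lborel \<partial>lborel \<partial>lborel \<partial>lborel) =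
    (\<integral>\<^sup>+ u. \<integral>\<^sup>+ v. \<integral>\<^sup>+ p. \<integral>\<^sup>+ q. h p q u v \<partial>lborel \<partial>lborel \<partial>lborel \<partial>lborel)"
proof -
  have comp [measurable]: "(\<lambda>x. h (a x) (b x) (c x) (d x)) \<in> borel_measurable M"
    if [measurable]: "a \<in> borel_measurable M" "b \<in> borel_measurable M" "c \<in> borel_measurable M" "d \<in> borel_measurable M" for a b c d :: "'z \<Rightarrow> real" and M
  proof -
    have "(\<lambda>x. (a x, b x, c x, d x)) \<in> measurable M (lborel \<Otimes>\<^sub>M lborel3)" by measurable
    from measurable_compose[OF this h] show ?thesis by simp
  qed
  have "(\<integral>\<^sup>+ p. \<integral>\<^sup>+ q. \<integral>\<^sup>+ u. \<integral>\<^sup>+ v. h p q u v \<partial>lborel \<partial>lborel \<partial>lborel \<partial>lborel) =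
     (\<integral>\<^sup>+ p. \<integral>\<^sup>+ u. \<integral>\<^sup>+ q. \<integral>\<^sup>+ v. h p q u v \<partial>lborel \<partial>lborel \<partial>lborel \<partial>lborel)"
    by (rule nn_integral_cong, rule lborel_pair.Fubini'[symmetric]) measurable
  also have "\<dots> = (\<integral>\<^sup>+ u. \<integral>\<^sup>+ p. \<integral>\<^sup>+ q. \<integral>\<^sup>+ v. h p q u v \<partial>lborel \<partial>lborel \<partial>lborel \<partial>lborel)"
    by (rule lborel_pair.Fubini'[symmetric]) measurable
  also have "\<dots> = (\<integral>\<^sup>+ u. \<integral>\<^sup>+ p. \<integral>\<^sup>+ v. \<integral>\<^sup>+ q. h p q u v \<partial>lborel \<partial>lborel \<partial>lborel \<partial>lborel)"
    by (rule nn_integral_cong, rule nn_integral_cong, rule lborel_pair.Fubini'[symmetric]) measurable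
  also have "\<dots> = (\<integral>\<^sup>+ u. \<integral>\<^sup>+ v. \<integral>\<^sup>+ p. \<integral>\<^sup>+ q. h p q u v \<partial>lborel \<partial>lborel \<partial>lborel \<partial>lborel)"
    by (rule nn_integral_cong, rule lborel_pair.Fubini'[symmetric]) measurable
  finally show ?thesis .
qed

lemma nn_integral_triangle_const:
  "(\<integral>\<^sup>+ x. \<integral>\<^sup>+ y. (if p \<le> x \<and> q \<le> y \<and> x + y \<le> r then c else 0) \<partial>lborel \<partial>lborel) = c * ennreal (posq (r - p - q) / 2)"
proof -
  have "(\<integral>\<^sup>+ x. \<integral>\<^sup>+ y. (if p \<le> x \<and> q \<le> y \<and> x + y \<le> r then c else 0) \<partial>lborel \<partial>lborel) =
     (\<integral>\<^sup>+ x. \<integral>\<^sup>+ y. c * (if p \<le> x \<and> q \<le> y \<and> x + y \<le> r then 1 else 0) \<partial>lborel \<partial>lborel)"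
    by (intro nn_integral_cong) simp
  also have "\<dots> = c * (\<integral>\<^sup>+ x. \<integral>\<^sup>+ y. (if p \<le> x \<and> q \<le> y \<and> x + y \<le> r then 1 else 0) \<partial>lborel \<partial>lborel)"
    by (subst nn_integral_cmult, measurable, subst nn_integral_cmult, measurable)
  finally show ?thesis by (simp only: nn_integral_triangle)
qed

text \<open>With the order of integration reversed, each facet point \<open>(u, v)\<close> sees a
  triangle of pairs \<open>(p, q)\<close> of the same size \<open>1 - s\<close>; its area is the
  Beta weight. Scaling the facet by \<open>s\<close> turns degree \<open>2 * n - 2\<close> into the
  exponent \<open>2 * n\<close>.\<close>

lemma facet_total:
  assumes n: "1 \<le> n" and s: "0 < s" "s \<le> 1"
  shows "(\<integral>\<^sup>+ p. \<integral>\<^sup>+ q. (if tail_cond s p q then \<integral>\<^sup>+ u. \<integral>\<^sup>+ v. (if max 0 (p + q - 1) \<le> u \<and> max 0 (s - q) \<le> v \<and> u + v \<le> s - max 0 (s - p)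
        then ennreal (Gp n s u v (s - u - v)) else 0) \<partial>lborel \<partial>lborel else 0) \<partial>lborel \<partial>lborel)
    = ennreal ((1 - s)\<^sup>2 / 2 * s ^ (2 * n)) * I2 (Gp n 1)" (is "?L = _")
proof -
  \<comment> \<open>Resolving the maxima separates the facet condition on \<open>(u, v)\<close> from
    the triangle \<open>u + v \<le> p\<close>, \<open>s - v \<le> q\<close>,
    \<open>p + q \<le> 1 + u\<close>, whose size is
    \<open>(1 + u) - (u + v) - (s - v) = 1 - s\<close>.\<close>
  let ?C = "\<lambda>p q u v. (0 \<le> u \<and> 0 \<le> v \<and> u + v \<le> s) \<and> (u + v \<le> p \<and> s - v \<le> q \<and> p + q \<le> 1 + u)"
  have iff: "tail_cond s p q \<and> (max 0 (p + q - 1) \<le> u \<and> max 0 (s - q) \<le> v \<and> u + v \<le> s - max 0 (s - p)) \<longleftrightarrow> ?C p q u v" for p q u v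
  proof
    assume *: "?C p q u v"
    have "s - max 0 (s - p) = min s p" by simp
    moreover have "u + v \<le> min s p" using * by simp
    moreover have "tail_cond s p q" unfolding tail_cond_def using * s by (intro conjI; linarith)
    ultimately show "tail_cond s p q \<and> (max 0 (p + q - 1) \<le> u \<and> max 0 (s - q) \<le> v \<and> u + v \<le> s - max 0 (s - p))"
      using * by simp
  next
    assume *: "tail_cond s p q \<and> (max 0 (p + q - 1) \<le> u \<and> max 0 (s - q) \<le> v \<and> u + v \<le> s - max 0 (s - p))"
    then have "0 \<le> u" "p + q - 1 \<le> u" "0 \<le> v" "s - q \<le> v" "u + v \<le> s" "u + v \<le> p" by (auto simp: max_def split: if_splits)
    then show "?C p q u v" by simp
  qed
  have "?L = (\<integral>\<^sup>+ p. \<integral>\<^sup>+ q. \<integral>\<^sup>+ u. \<integral>\<^sup>+ v. (if ?C p q u v then ennreal (Gp n s u v (s - u - v)) else 0) \<partial>lborel \<partial>lborel \<partial>lborel \<partial>lborel)"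
    unfolding nn_integral_if_const[symmetric] iff[symmetric] by (intro nn_integral_cong) simp
  also have "\<dots> = (\<integral>\<^sup>+ u. \<integral>\<^sup>+ v. \<integral>\<^sup>+ p. \<integral>\<^sup>+ q. (if ?C p q u v then ennreal (Gp n s u v (s - u - v)) else 0) \<partial>lborel \<partial>lborel \<partial>lborel \<partial>lborel)"
    by (rule nn_integral_swap4) measurable
  also have "\<dots> = (\<integral>\<^sup>+ u. \<integral>\<^sup>+ v. (if 0 \<le> u \<and> 0 \<le> v \<and> u + v \<le> s then
      \<integral>\<^sup>+ p. \<integral>\<^sup>+ q. (if u + v \<le> p \<and> s - v \<le> q \<and> p + q \<le> 1 + u then ennreal (Gp n s u v (s - u - v)) else 0) \<partial>lborel \<partial>lborel else 0) \<partial>lborel \<partial>lborel)"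
    unfolding nn_integral_if_const[symmetric] by (intro nn_integral_cong) simp
  also have "\<dots> = (\<integral>\<^sup>+ u. \<integral>\<^sup>+ v. (if 0 \<le> u \<and> 0 \<le> v \<and> u + v \<le> s then ennreal (Gp n s u v (s - u - v)) * ennreal (posq (1 - s) / 2) else 0) \<partial>lborel \<partial>lborel)"
    unfolding nn_integral_triangle_const by (intro nn_integral_cong) (simp add: algebra_simps)
  also have "\<dots> = ennreal (s\<^sup>2) * (\<integral>\<^sup>+ u. \<integral>\<^sup>+ v. (if 0 \<le> u \<and> 0 \<le> v \<and> u + v \<le> 1 then ennreal (Gp n s (s * u) (s * v) (s - s * u - s * v)) * ennreal (posq (1 - s) / 2) else 0) \<partial>lborel \<partial>lborel)"
    by (rule nn_integral_scale2[OF _ s(1)]) measurable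
  also have "\<dots> = ennreal (s\<^sup>2) * I2 (\<lambda>u v w. (posq (1 - s) / 2 * s ^ (2 * n - 2)) * Gp n 1 u v w)"
    unfolding I2_def
  proof (intro arg_cong[where f = "\<lambda>x. ennreal (s\<^sup>2) * x"] nn_integral_cong if_cong refl)
    fix u v :: real
    have "s - s * u - s * v = s * (1 - u - v)" by (simp add: algebra_simps)
    then have "Gp n s (s * u) (s * v) (s - s * u - s * v) = s ^ (2 * n - 2) * Gp n 1 u v (1 - u - v)"
      by (simp only: Gp_scale[OF n])
    then show "ennreal (Gp n s (s * u) (s * v) (s - s * u - s * v)) * ennreal (posq (1 - s) / 2) = ennreal (posq (1 - s) / 2 * s ^ (2 * n - 2) * Gp n 1 u v (1 - u - v))"
      by (subst ennreal_mult''[symmetric]) (simp_all add: posq_def mult_ac)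
  qed
  also have "\<dots> = ennreal (s\<^sup>2) * (ennreal (posq (1 - s) / 2 * s ^ (2 * n - 2)) * I2 (Gp n 1))"
    using s by (subst I2_cmult) (measurable, simp_all add: posq_def)
  also have "\<dots> = ennreal (s\<^sup>2 * (posq (1 - s) / 2 * s ^ (2 * n - 2))) * I2 (Gp n 1)"
    using s by (subst ennreal_mult) (simp_all add: posq_def mult.assoc)
  also have "s\<^sup>2 * (posq (1 - s) / 2 * s ^ (2 * n - 2)) = (1 - s)\<^sup>2 / 2 * s ^ (2 * n)"
  proof -
    have "2 * n = 2 + (2 * n - 2)" using n by simp
    then have "s ^ (2 * n) = s\<^sup>2 * s ^ (2 * n - 2)" by (metis power_add)
    then show ?thesis using s by (simp add: posq_def)
  qed
  finally show ?thesis .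
qed

lemma nn_integral_if_less:
  fixes f :: "real \<Rightarrow> ennreal"
  shows "(\<integral>\<^sup>+ t. (if t < s \<and> P t then f t else 0) \<partial>lborel) = (\<integral>\<^sup>+ t. (if t \<le> s \<and> P t then f t else 0) \<partial>lborel)"
proof (rule nn_integral_cong_AE)
  show "AE t in lborel. (if t < s \<and> P t then f t else 0) = (if t \<le> s \<and> P t then f t else 0)"
    using AE_lborel_singleton[of s] by eventually_elim auto
qed

lemma nn_integral_reflect:
  fixes f :: "real \<Rightarrow> ennreal"
  assumes [measurable]: "f \<in> borel_measurable borel"
  shows "(\<integral>\<^sup>+ t. f t \<partial>lborel) = (\<integral>\<^sup>+ t. f (s - t) \<partial>lborel)"
  using nn_integral_real_affine[OF assms, of "-1" s] by simp

lemma power_shift: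
  fixes s :: real
  assumes "1 \<le> n"
  shows "s\<^sup>2 * s ^ (2 * n - 1) = s ^ (2 * n + 1)" "s * s ^ (2 * n - 1) = s ^ (2 * n)"
proof -
  have "2 * n + 1 = 2 + (2 * n - 1)" "2 * n = 1 + (2 * n - 1)" using assms by simp_all
  then show "s\<^sup>2 * s ^ (2 * n - 1) = s ^ (2 * n + 1)" "s * s ^ (2 * n - 1) = s ^ (2 * n)"
    by (metis power_add, metis power_add power_one_right)
qed

text \<open>The edge with third coordinate \<open>s - p\<close> moves with \<open>p\<close> and
  sweeps the whole facet, with coordinates \<open>u\<close>, \<open>p - u\<close>,
  \<open>s - p\<close>. Only \<open>q\<close> remains free, over an interval of length
  \<open>1 - s\<close>, so this part carries the weight of \<open>beta1\<close> and a face
  moment.\<close>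

lemma edge_total_low:
  assumes n: "1 \<le> n" and s: "0 < s" "s \<le> 1"
  shows "(\<integral>\<^sup>+ p. \<integral>\<^sup>+ q. \<integral>\<^sup>+ u. (if (0 \<le> p \<and> p < s \<and> 0 \<le> u \<and> u \<le> p) \<and> (s - p + u \<le> q \<and> q \<le> 1 + u - p)
        then ennreal (Ep n s u (p - u) (s - p)) else 0) \<partial>lborel \<partial>lborel \<partial>lborel)
    = ennreal ((1 - s) * s ^ (2 * n + 1)) * I2 (Ep n 1)" (is "?L = _")
proof -
  have "?L = (\<integral>\<^sup>+ p. \<integral>\<^sup>+ u. \<integral>\<^sup>+ q. (if (0 \<le> p \<and> p < s \<and> 0 \<le> u \<and> u \<le> p) \<and> (s - p + u \<le> q \<and> q \<le> 1 + u - p)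
        then ennreal (Ep n s u (p - u) (s - p)) else 0) \<partial>lborel \<partial>lborel \<partial>lborel)"
    by (rule nn_integral_cong, rule lborel_pair.Fubini'[symmetric]) measurable
  also have "\<dots> = (\<integral>\<^sup>+ p. \<integral>\<^sup>+ u. (if 0 \<le> p \<and> p < s \<and> 0 \<le> u \<and> u \<le> p then
       \<integral>\<^sup>+ q. (if s - p + u \<le> q \<and> q \<le> 1 + u - p then ennreal (Ep n s u (p - u) (s - p)) else 0) \<partial>lborel else 0) \<partial>lborel \<partial>lborel)"
    unfolding nn_integral_if_const[symmetric] by (intro nn_integral_cong) simp
  also have "\<dots> = (\<integral>\<^sup>+ p. \<integral>\<^sup>+ u. (if 0 \<le> p \<and> p < s \<and> 0 \<le> u \<and> u \<le> p then
       ennreal (Ep n s u (p - u) (s - p)) * ennreal (1 - s) else 0) \<partial>lborel \<partial>lborel)"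
  proof (rule nn_integral_cong, rule nn_integral_cong)
    fix p u :: real
    have "(\<integral>\<^sup>+ q. (if s - p + u \<le> q \<and> q \<le> 1 + u - p then ennreal (Ep n s u (p - u) (s - p)) else 0) \<partial>lborel) =
        ennreal (Ep n s u (p - u) (s - p)) * ennreal ((1 + u - p) - (s - p + u))"
      by (rule nn_integral_interval) (use s in simp)
    also have "(1 + u - p) - (s - p + u) = 1 - s" by simp
    finally show "(if 0 \<le> p \<and> p < s \<and> 0 \<le> u \<and> u \<le> p then
       \<integral>\<^sup>+ q. (if s - p + u \<le> q \<and> q \<le> 1 + u - p then ennreal (Ep n s u (p - u) (s - p)) else 0) \<partial>lborel else 0) =
      (if 0 \<le> p \<and> p < s \<and> 0 \<le> u \<and> u \<le> p then ennreal (Ep n s u (p - u) (s - p)) * ennreal (1 - s) else 0)"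
      by (simp only:)
  qed
  also have "\<dots> = (\<integral>\<^sup>+ p. (if p < s \<and> 0 \<le> p then \<integral>\<^sup>+ u. (if 0 \<le> u \<and> u \<le> p then
       ennreal (Ep n s u (p - u) (s - p)) * ennreal (1 - s) else 0) \<partial>lborel else 0) \<partial>lborel)"
    unfolding nn_integral_if_const[symmetric] by (intro nn_integral_cong) simp
  also have "\<dots> = (\<integral>\<^sup>+ p. (if p \<le> s \<and> 0 \<le> p then \<integral>\<^sup>+ u. (if 0 \<le> u \<and> u \<le> p then
       ennreal (Ep n s u (p - u) (s - p)) * ennreal (1 - s) else 0) \<partial>lborel else 0) \<partial>lborel)"
    by (rule nn_integral_if_less)
  also have "\<dots> = (\<integral>\<^sup>+ p. (if s - p \<le> s \<and> 0 \<le> s - p then \<integral>\<^sup>+ u. (if 0 \<le> u \<and> u \<le> s - p then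
       ennreal (Ep n s u (s - p - u) (s - (s - p))) * ennreal (1 - s) else 0) \<partial>lborel else 0) \<partial>lborel)"
    by (rule nn_integral_reflect) measurable
  also have "\<dots> = (\<integral>\<^sup>+ p. \<integral>\<^sup>+ u. (if 0 \<le> p \<and> 0 \<le> u \<and> p + u \<le> s then
       ennreal (Ep n s u (s - p - u) (s - (s - p))) * ennreal (1 - s) else 0) \<partial>lborel \<partial>lborel)"
    unfolding nn_integral_if_const[symmetric] by (intro nn_integral_cong) auto
  also have "\<dots> = ennreal (s\<^sup>2) * (\<integral>\<^sup>+ p. \<integral>\<^sup>+ u. (if 0 \<le> p \<and> 0 \<le> u \<and> p + u \<le> 1 then
       ennreal (Ep n s (s * u) (s - s * p - s * u) (s - (s - s * p))) * ennreal (1 - s) else 0) \<partial>lborel \<partial>lborel)"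
    by (rule nn_integral_scale2[OF _ s(1)]) measurable
  also have "\<dots> = ennreal (s\<^sup>2) * I2 (\<lambda>p u v. ((1 - s) * s ^ (2 * n - 1)) * Ep n 1 u v p)"
    unfolding I2_def
  proof (intro arg_cong[where f = "\<lambda>x. ennreal (s\<^sup>2) * x"] nn_integral_cong if_cong refl)
    fix p u :: real
    have "s - s * p - s * u = s * (1 - p - u)" "s - (s - s * p) = s * p" by (simp_all add: algebra_simps)
    then have "Ep n s (s * u) (s - s * p - s * u) (s - (s - s * p)) = s ^ (2 * n - 1) * Ep n 1 u (1 - p - u) p"
      by (simp only: Ep_scale[OF n])
    then show "ennreal (Ep n s (s * u) (s - s * p - s * u) (s - (s - s * p))) * ennreal (1 - s) = ennreal ((1 - s) * s ^ (2 * n - 1) * Ep n 1 u (1 - p - u) p)"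
      using s by (subst ennreal_mult''[symmetric]) (simp_all add: mult_ac)
  qed
  also have "I2 (\<lambda>p u v. ((1 - s) * s ^ (2 * n - 1)) * Ep n 1 u v p) = ennreal ((1 - s) * s ^ (2 * n - 1)) * I2 (\<lambda>p u v. Ep n 1 u v p)"
  proof (rule I2_cmult)
    show "meas3 (\<lambda>p u v. Ep n 1 u v p)" by measurable
  qed (use s in simp)
  also have "I2 (\<lambda>p u v. Ep n 1 u v p) = I2 (Ep n 1)"
    by (rule I2_rot) measurable
  also have "ennreal (s\<^sup>2) * (ennreal ((1 - s) * s ^ (2 * n - 1)) * I2 (Ep n 1)) = ennreal (s\<^sup>2 * ((1 - s) * s ^ (2 * n - 1))) * I2 (Ep n 1)"
    using s by (subst ennreal_mult) (simp_all add: mult.assoc)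
  also have "s\<^sup>2 * ((1 - s) * s ^ (2 * n - 1)) = (1 - s) * s ^ (2 * n + 1)"
    unfolding power_shift(1)[OF n, symmetric] by (rule mult.left_commute)
  finally show ?thesis .
qed

text \<open>The edge is fixed at third coordinate 0, so the pair \<open>(p, q)\<close> remains free
  over a triangle of size \<open>1 - s\<close>. This part carries the weight of \<open>beta2\<close>
  and an edge moment.\<close>

lemma edge_total_high:
  assumes n: "1 \<le> n" and s: "0 < s" "s \<le> 1"
  shows "(\<integral>\<^sup>+ p. \<integral>\<^sup>+ q. \<integral>\<^sup>+ u. (if (0 \<le> u \<and> u \<le> s) \<and> (s \<le> p \<and> u \<le> q \<and> p + q \<le> 1 + u)
        then ennreal (Ep n s u (s - u) 0) else 0) \<partial>lborel \<partial>lborel \<partial>lborel)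
    = ennreal ((1 - s)\<^sup>2 / 2 * s ^ (2 * n)) * I1 (\<lambda>t. Ep n 1 t (1 - t) 0)" (is "?L = _")
proof -
  have "?L = (\<integral>\<^sup>+ p. \<integral>\<^sup>+ u. \<integral>\<^sup>+ q. (if (0 \<le> u \<and> u \<le> s) \<and> (s \<le> p \<and> u \<le> q \<and> p + q \<le> 1 + u)
        then ennreal (Ep n s u (s - u) 0) else 0) \<partial>lborel \<partial>lborel \<partial>lborel)"
    by (rule nn_integral_cong, rule lborel_pair.Fubini'[symmetric]) measurable
  also have "\<dots> = (\<integral>\<^sup>+ u. \<integral>\<^sup>+ p. \<integral>\<^sup>+ q. (if (0 \<le> u \<and> u \<le> s) \<and> (s \<le> p \<and> u \<le> q \<and> p + q \<le> 1 + u)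
        then ennreal (Ep n s u (s - u) 0) else 0) \<partial>lborel \<partial>lborel \<partial>lborel)"
    by (rule lborel_pair.Fubini'[symmetric]) measurable
  also have "\<dots> = (\<integral>\<^sup>+ u. (if 0 \<le> u \<and> u \<le> s then \<integral>\<^sup>+ p. \<integral>\<^sup>+ q. (if s \<le> p \<and> u \<le> q \<and> p + q \<le> 1 + u
        then ennreal (Ep n s u (s - u) 0) else 0) \<partial>lborel \<partial>lborel else 0) \<partial>lborel)"
    unfolding nn_integral_if_const[symmetric] by (intro nn_integral_cong) simp
  also have "\<dots> = (\<integral>\<^sup>+ u. (if 0 \<le> u \<and> u \<le> s then ennreal (Ep n s u (s - u) 0) * ennreal (posq (1 - s) / 2) else 0) \<partial>lborel)"
    unfolding nn_integral_triangle_const by (intro nn_integral_cong) (simp add: algebra_simps)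
  also have "\<dots> = ennreal s * (\<integral>\<^sup>+ u. (if 0 \<le> u \<and> u \<le> 1 then ennreal (Ep n s (s * u) (s - s * u) 0) * ennreal (posq (1 - s) / 2) else 0) \<partial>lborel)"
    by (rule nn_integral_scale1[OF _ s(1)]) measurable
  also have "\<dots> = ennreal s * I1 (\<lambda>u. (posq (1 - s) / 2 * s ^ (2 * n - 1)) * Ep n 1 u (1 - u) 0)"
    unfolding I1_def
  proof (intro arg_cong[where f = "\<lambda>x. ennreal s * x"] nn_integral_cong if_cong refl)
    fix u :: real
    have "s - s * u = s * (1 - u)" "0 = s * 0" by (simp_all add: algebra_simps)
    then have "Ep n s (s * u) (s - s * u) 0 = s ^ (2 * n - 1) * Ep n 1 u (1 - u) 0"
      by (metis Ep_scale[OF n])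
    then show "ennreal (Ep n s (s * u) (s - s * u) 0) * ennreal (posq (1 - s) / 2) = ennreal (posq (1 - s) / 2 * s ^ (2 * n - 1) * Ep n 1 u (1 - u) 0)"
      by (subst ennreal_mult''[symmetric]) (simp_all add: posq_def mult_ac)
  qed
  also have "I1 (\<lambda>u. (posq (1 - s) / 2 * s ^ (2 * n - 1)) * Ep n 1 u (1 - u) 0) = ennreal (posq (1 - s) / 2 * s ^ (2 * n - 1)) * I1 (\<lambda>u. Ep n 1 u (1 - u) 0)"
    using s by (intro I1_cmult) (measurable, simp add: posq_def)
  also have "ennreal s * (ennreal (posq (1 - s) / 2 * s ^ (2 * n - 1)) * I1 (\<lambda>u. Ep n 1 u (1 - u) 0)) = ennreal (s * (posq (1 - s) / 2 * s ^ (2 * n - 1))) * I1 (\<lambda>u. Ep n 1 u (1 - u) 0)"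
    using s by (subst ennreal_mult) (simp_all add: posq_def mult.assoc)
  also have "s * (posq (1 - s) / 2 * s ^ (2 * n - 1)) = (1 - s)\<^sup>2 / 2 * s ^ (2 * n)"
    unfolding power_shift(2)[OF n, symmetric] using s by (simp add: posq_def)
  finally show ?thesis .
qed

text \<open>The split at \<open>p < s\<close> is whether the lower bound on the third coordinate
  exceeds zero.\<close>

lemma edge_total:
  assumes n: "1 \<le> n" and s: "0 < s" "s \<le> 1"
  shows "(\<integral>\<^sup>+ p. \<integral>\<^sup>+ q. (if tail_cond s p q then \<integral>\<^sup>+ u. (if max 0 (p + q - 1) \<le> u \<and> u \<le> s - max 0 (s - q) - max 0 (s - p)
        then ennreal (Ep n s u (s - u - max 0 (s - p)) (max 0 (s - p))) else 0) \<partial>lborel else 0) \<partial>lborel \<partial>lborel)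
    = ennreal ((1 - s) * s ^ (2 * n + 1)) * I2 (Ep n 1) + ennreal ((1 - s)\<^sup>2 / 2 * s ^ (2 * n)) * I1 (\<lambda>t. Ep n 1 t (1 - t) 0)" (is "?L = _")
proof -
  let ?A = "\<lambda>p q u. (0 \<le> p \<and> p < s \<and> 0 \<le> u \<and> u \<le> p) \<and> (s - p + u \<le> q \<and> q \<le> 1 + u - p)"
  let ?B = "\<lambda>p q u. (0 \<le> u \<and> u \<le> s) \<and> (s \<le> p \<and> u \<le> q \<and> p + q \<le> 1 + u)"
  let ?T = "\<lambda>p q u. tail_cond s p q \<and> (max 0 (p + q - 1) \<le> u \<and> u \<le> s - max 0 (s - q) - max 0 (s - p))"
  have A: "?T p q u \<longleftrightarrow> ?A p q u" if "p < s" for p q u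
  proof
    assume *: "?T p q u"
    then have "0 \<le> u" "p + q - 1 \<le> u" "u \<le> p - max 0 (s - q)" "0 \<le> p" using that by (auto simp: tail_cond_def max_def split: if_splits)
    then show "?A p q u" using that by (auto simp: max_def split: if_splits)
  next
    assume *: "?A p q u"
    have "tail_cond s p q" unfolding tail_cond_def using * s that by (intro conjI; linarith)
    moreover have "max 0 (s - p) = s - p" using that by simp
    moreover have "u \<le> p - max 0 (s - q)"
    proof -
      have "max 0 (s - q) \<le> p - u" using * s by (intro max.boundedI; linarith)
      then show ?thesis by linarith
    qed
    ultimately show "?T p q u" using * s by simp
  qed
  have B: "?T p q u \<longleftrightarrow> ?B p q u" if "\<not> p < s" for p q u
  proof -
    have m: "max 0 (s - p) = 0" using that by simp
    show ?thesis
    proof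
      assume *: "?T p q u"
      then have "0 \<le> u" "p + q - 1 \<le> u" "u \<le> s" "u \<le> q" unfolding m by (auto simp: max_def split: if_splits)
      then show "?B p q u" using that by simp
    next
      assume *: "?B p q u"
      have "tail_cond s p q" unfolding tail_cond_def using * s that by (intro conjI; linarith)
      moreover have "u \<le> s - max 0 (s - q)"
      proof -
        have "max 0 (s - q) \<le> s - u" using * by (intro max.boundedI; linarith)
        then show ?thesis by linarith
      qed
      ultimately show "?T p q u" unfolding m using * by simp
    qed
  qed
  have "?L = (\<integral>\<^sup>+ p. \<integral>\<^sup>+ q. \<integral>\<^sup>+ u. (if ?A p q u then ennreal (Ep n s u (p - u) (s - p)) else 0)
     + (if ?B p q u then ennreal (Ep n s u (s - u) 0) else 0) \<partial>lborel \<partial>lborel \<partial>lborel)"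
    unfolding nn_integral_if_const[symmetric]
  proof (rule nn_integral_cong, rule nn_integral_cong, rule nn_integral_cong)
    fix p q u :: real
    show "(if tail_cond s p q then if max 0 (p + q - 1) \<le> u \<and> u \<le> s - max 0 (s - q) - max 0 (s - p)
        then ennreal (Ep n s u (s - u - max 0 (s - p)) (max 0 (s - p))) else 0 else 0) =
      (if ?A p q u then ennreal (Ep n s u (p - u) (s - p)) else 0) + (if ?B p q u then ennreal (Ep n s u (s - u) 0) else 0)"
    proof -
      have nest: "(if t then if c then x else 0 else 0) = (if t \<and> c then x else (0::ennreal))" for t c x by simp
      show ?thesis
      proof (cases "p < s")
        case True
        have nB: "\<not> ?B p q u" using True by simp
        have m: "max 0 (s - p) = s - p" and e: "s - u - (s - p) = p - u" using True by simp_all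
        show ?thesis
          unfolding nest unfolding A[OF True, of q u] unfolding m e if_not_P[OF nB] add_0_right by (rule refl)
      next
        case False
        have nA: "\<not> ?A p q u" using False by simp
        have m: "max 0 (s - p) = 0" using False by simp
        show ?thesis
          unfolding nest unfolding B[OF False, of q u] unfolding m diff_zero if_not_P[OF nA] add_0_left by (rule refl)
      qed
    qed
  qed
  also have "\<dots> = (\<integral>\<^sup>+ p. \<integral>\<^sup>+ q. \<integral>\<^sup>+ u. (if ?A p q u then ennreal (Ep n s u (p - u) (s - p)) else 0) \<partial>lborel \<partial>lborel \<partial>lborel)
     + (\<integral>\<^sup>+ p. \<integral>\<^sup>+ q. \<integral>\<^sup>+ u. (if ?B p q u then ennreal (Ep n s u (s - u) 0) else 0) \<partial>lborel \<partial>lborel \<partial>lborel)"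
    by (subst nn_integral_add[symmetric], measurable, subst nn_integral_add[symmetric], measurable, subst nn_integral_add[symmetric], measurable)
  finally show ?thesis by (simp only: edge_total_low[OF assms] edge_total_high[OF assms])
qed

text \<open>When both lower bounds are positive the vertex is
  \<open>(p + q - s, s - q, s - p)\<close>, and it runs over the whole facet of size
  \<open>s\<close>. No parameter remains free, hence the weight 1.\<close>

lemma vertex_low_low:
  assumes s: "0 < s" "s \<le> 1"
  shows "(\<integral>\<^sup>+ p. \<integral>\<^sup>+ q. (if p < s \<and> q < s \<and> 0 \<le> p \<and> 0 \<le> q \<and> s \<le> p + q then ennreal (Xq s (p + q - s) (s - q) (s - p) ^ n) else 0) \<partial>lborel \<partial>lborel)
    = ennreal (s ^ (2 * n + 2)) * ennreal (f_seq n)" (is "?L = _")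
proof -
  let ?g = "\<lambda>p q. ennreal (Xq s (p + q - s) (s - q) (s - p) ^ n)"
  have "?L = (\<integral>\<^sup>+ p. \<integral>\<^sup>+ q. (if q < s \<and> p < s \<and> 0 \<le> p \<and> 0 \<le> q \<and> s \<le> p + q then ?g p q else 0) \<partial>lborel \<partial>lborel)"
    by (intro nn_integral_cong) auto
  also have "\<dots> = (\<integral>\<^sup>+ p. \<integral>\<^sup>+ q. (if q \<le> s \<and> p < s \<and> 0 \<le> p \<and> 0 \<le> q \<and> s \<le> p + q then ?g p q else 0) \<partial>lborel \<partial>lborel)"
    by (rule nn_integral_cong, rule nn_integral_if_less)
  also have "\<dots> = (\<integral>\<^sup>+ p. (if p < s \<and> 0 \<le> p then \<integral>\<^sup>+ q. (if q \<le> s \<and> 0 \<le> q \<and> s \<le> p + q then ?g p q else 0) \<partial>lborel else 0) \<partial>lborel)"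
    unfolding nn_integral_if_const[symmetric] by (intro nn_integral_cong) simp
  also have "\<dots> = (\<integral>\<^sup>+ p. (if p \<le> s \<and> 0 \<le> p then \<integral>\<^sup>+ q. (if q \<le> s \<and> 0 \<le> q \<and> s \<le> p + q then ?g p q else 0) \<partial>lborel else 0) \<partial>lborel)"
    by (rule nn_integral_if_less)
  also have "\<dots> = (\<integral>\<^sup>+ p. (if s - p \<le> s \<and> 0 \<le> s - p then \<integral>\<^sup>+ q. (if q \<le> s \<and> 0 \<le> q \<and> s \<le> s - p + q then ?g (s - p) q else 0) \<partial>lborel else 0) \<partial>lborel)"
    by (rule nn_integral_reflect) measurable
  also have "\<dots> = (\<integral>\<^sup>+ p. (if s - p \<le> s \<and> 0 \<le> s - p then \<integral>\<^sup>+ q. (if s - q \<le> s \<and> 0 \<le> s - q \<and> s \<le> s - p + (s - q) then ?g (s - p) (s - q) else 0) \<partial>lborel else 0) \<partial>lborel)"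
    by (intro nn_integral_cong if_cong refl nn_integral_reflect) measurable
  also have "\<dots> = (\<integral>\<^sup>+ p. \<integral>\<^sup>+ q. (if 0 \<le> p \<and> 0 \<le> q \<and> p + q \<le> s then ?g (s - p) (s - q) else 0) \<partial>lborel \<partial>lborel)"
    unfolding nn_integral_if_const[symmetric] by (intro nn_integral_cong) auto
  also have "\<dots> = ennreal (s\<^sup>2) * (\<integral>\<^sup>+ p. \<integral>\<^sup>+ q. (if 0 \<le> p \<and> 0 \<le> q \<and> p + q \<le> 1 then ?g (s - s * p) (s - s * q) else 0) \<partial>lborel \<partial>lborel)"
    by (rule nn_integral_scale2[OF _ s(1)]) measurable
  also have "\<dots> = ennreal (s\<^sup>2) * I2 (\<lambda>u v w. s ^ (2 * n) * Xq 1 u v w ^ n)"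
    unfolding I2_def
  proof (intro arg_cong[where f = "\<lambda>x. ennreal (s\<^sup>2) * x"] nn_integral_cong if_cong refl arg_cong[where f = ennreal])
    fix p q :: real
    have "s - s * p + (s - s * q) - s = s * (1 - p - q)" "s - (s - s * q) = s * q" "s - (s - s * p) = s * p" by (simp_all add: algebra_simps)
    then have "Xq s (s - s * p + (s - s * q) - s) (s - (s - s * q)) (s - (s - s * p)) = s\<^sup>2 * Xq 1 (1 - p - q) q p"
      by (simp only: Xq_scale)
    also have "Xq 1 (1 - p - q) q p = Xq 1 p q (1 - p - q)" by (simp add: Xq_def)
    finally show "Xq s (s - s * p + (s - s * q) - s) (s - (s - s * q)) (s - (s - s * p)) ^ n = s ^ (2 * n) * Xq 1 p q (1 - p - q) ^ n"
      by (simp add: power_mult_distrib power_mult)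
  qed
  also have "I2 (\<lambda>u v w. s ^ (2 * n) * Xq 1 u v w ^ n) = ennreal (s ^ (2 * n)) * ennreal (f_seq n)"
    using s by (subst I2_cmult[OF meas3_Xq(1)]) (simp_all add: I2_f)
  also have "ennreal (s\<^sup>2) * (ennreal (s ^ (2 * n)) * ennreal (f_seq n)) = ennreal (s\<^sup>2 * s ^ (2 * n)) * ennreal (f_seq n)"
    using s by (subst ennreal_mult) (simp_all add: mult.assoc)
  also have "s\<^sup>2 * s ^ (2 * n) = s ^ (2 * n + 2)" by (simp only: power_add mult.commute)
  finally show ?thesis .
qed

lemma vertex_edge:
  assumes s: "0 < s" "s \<le> 1"
  shows "(\<integral>\<^sup>+ q. (if q < s \<and> 0 \<le> q then ennreal (Xq s q (s - q) 0 ^ n) else 0) \<partial>lborel) = ennreal (s ^ (2 * n + 1)) * ennreal (h_seq n)" (is "?L = _")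
proof -
  have "?L = (\<integral>\<^sup>+ q. (if q \<le> s \<and> 0 \<le> q then ennreal (Xq s q (s - q) 0 ^ n) else 0) \<partial>lborel)"
    by (rule nn_integral_if_less)
  also have "\<dots> = (\<integral>\<^sup>+ q. (if 0 \<le> q \<and> q \<le> s then ennreal (Xq s q (s - q) 0 ^ n) else 0) \<partial>lborel)"
    by (intro nn_integral_cong) auto
  also have "\<dots> = ennreal s * (\<integral>\<^sup>+ q. (if 0 \<le> q \<and> q \<le> 1 then ennreal (Xq s (s * q) (s - s * q) 0 ^ n) else 0) \<partial>lborel)"
    by (rule nn_integral_scale1[OF _ s(1)]) measurable
  also have "\<dots> = ennreal s * I1 (\<lambda>t. s ^ (2 * n) * (2 * t * (1 - t)) ^ n)"
    unfolding I1_def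
  proof (intro arg_cong[where f = "\<lambda>x. ennreal s * x"] nn_integral_cong if_cong refl arg_cong[where f = ennreal])
    fix t :: real
    have "s - s * t = s * (1 - t)" "0 = s * 0" by (simp_all add: algebra_simps)
    then have "Xq s (s * t) (s - s * t) 0 = s\<^sup>2 * (2 * t * (1 - t))"
      by (metis Xq_scale Xq_edge)
    then show "Xq s (s * t) (s - s * t) 0 ^ n = s ^ (2 * n) * (2 * t * (1 - t)) ^ n"
      by (simp only: power_mult_distrib[of "s\<^sup>2"] power_mult)
  qed
  also have "I1 (\<lambda>t. s ^ (2 * n) * (2 * t * (1 - t)) ^ n) = ennreal (s ^ (2 * n)) * ennreal (h_seq n)"
    using s by (subst I1_cmult) (simp_all add: I1_h)
  also have "ennreal s * (ennreal (s ^ (2 * n)) * ennreal (h_seq n)) = ennreal (s * s ^ (2 * n)) * ennreal (h_seq n)"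
    using s by (subst ennreal_mult) (simp_all add: mult.assoc)
  also have "s * s ^ (2 * n) = s ^ (2 * n + 1)" by simp
  finally show ?thesis .
qed

lemma vertex_high_low:
  assumes s: "0 < s" "s \<le> 1"
  shows "(\<integral>\<^sup>+ p. \<integral>\<^sup>+ q. (if (s \<le> p \<and> p \<le> 1) \<and> (q < s \<and> 0 \<le> q) then ennreal (Xq s q (s - q) 0 ^ n) else 0) \<partial>lborel \<partial>lborel)
    = ennreal ((1 - s) * s ^ (2 * n + 1)) * ennreal (h_seq n)" (is "?L = _")
proof -
  have "?L = (\<integral>\<^sup>+ p. (if s \<le> p \<and> p \<le> 1 then \<integral>\<^sup>+ q. (if q < s \<and> 0 \<le> q then ennreal (Xq s q (s - q) 0 ^ n) else 0) \<partial>lborel else 0) \<partial>lborel)"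
    unfolding nn_integral_if_const[symmetric] by (intro nn_integral_cong) simp
  also have "\<dots> = ennreal (s ^ (2 * n + 1)) * ennreal (h_seq n) * ennreal (1 - s)"
    unfolding vertex_edge[OF s] using s by (intro nn_integral_interval)
  also have "\<dots> = ennreal ((1 - s) * s ^ (2 * n + 1)) * ennreal (h_seq n)"
  proof -
    have "ennreal ((1 - s) * s ^ (2 * n + 1)) = ennreal (1 - s) * ennreal (s ^ (2 * n + 1))"
      using s by (intro ennreal_mult) auto
    then show ?thesis by (simp only: mult_ac)
  qed
  finally show ?thesis .
qed

text \<open>Four cases by whether the lower bounds \<open>s - q\<close> and \<open>s - p\<close> are
  positive. With exactly one positive, the vertex runs over an edge and one parameter is free over
  length \<open>1 - s\<close>; the two cases are mirror images. With neither, it is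
  \<open>(s, 0, 0)\<close>, where \<open>Xq\<close> vanishes, so that \<open>1 \<le> n\<close> gives
  zero.\<close>

lemma vertex_total:
  assumes n: "1 \<le> n" and s: "0 < s" "s \<le> 1"
  shows "(\<integral>\<^sup>+ p. \<integral>\<^sup>+ q. (if tail_cond s p q then ennreal (Xq s (s - max 0 (s - q) - max 0 (s - p)) (max 0 (s - q)) (max 0 (s - p)) ^ n) else 0) \<partial>lborel \<partial>lborel)
    = ennreal (s ^ (2 * n + 2)) * ennreal (f_seq n) +
      (ennreal ((1 - s) * s ^ (2 * n + 1)) * ennreal (h_seq n) + ennreal ((1 - s) * s ^ (2 * n + 1)) * ennreal (h_seq n))" (is "?L = _")
proof -
  let ?a = "\<lambda>p q. if p < s \<and> q < s \<and> 0 \<le> p \<and> 0 \<le> q \<and> s \<le> p + q then ennreal (Xq s (p + q - s) (s - q) (s - p) ^ n) else 0"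
  let ?b = "\<lambda>p q. if (s \<le> p \<and> p \<le> 1) \<and> (q < s \<and> 0 \<le> q) then ennreal (Xq s q (s - q) 0 ^ n) else 0"
  have "?L = (\<integral>\<^sup>+ p. \<integral>\<^sup>+ q. ?a p q + (?b p q + ?b q p) \<partial>lborel \<partial>lborel)"
  proof (rule nn_integral_cong, rule nn_integral_cong)
    fix p q :: real
    consider "p < s" "q < s" | "s \<le> p" "q < s" | "p < s" "s \<le> q" | "s \<le> p" "s \<le> q" by linarith
    then show "(if tail_cond s p q then ennreal (Xq s (s - max 0 (s - q) - max 0 (s - p)) (max 0 (s - q)) (max 0 (s - p)) ^ n) else 0) = ?a p q + (?b p q + ?b q p)"
    proof cases
      case 1
      have m: "max 0 (s - q) = s - q" "max 0 (s - p) = s - p" using 1 by simp_all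
      have e: "s - (s - q) - (s - p) = p + q - s" by simp
      have t: "tail_cond s p q \<longleftrightarrow> 0 \<le> p \<and> 0 \<le> q \<and> s \<le> p + q"
        unfolding tail_cond_def using 1 s by (intro iffI conjI; linarith)
      show ?thesis unfolding m e t using 1 by simp
    next
      case 2
      have "max 0 (s - q) = s - q" "max 0 (s - p) = 0" "s - (s - q) - 0 = q" using 2 by simp_all
      moreover have "tail_cond s p q \<longleftrightarrow> p \<le> 1 \<and> 0 \<le> q"
        unfolding tail_cond_def using 2 s by (intro iffI conjI; linarith)
      ultimately show ?thesis using 2 by simp
    next
      case 3
      have "max 0 (s - q) = 0" "max 0 (s - p) = s - p" "s - 0 - (s - p) = p" using 3 by simp_all
      moreover have "tail_cond s p q \<longleftrightarrow> q \<le> 1 \<and> 0 \<le> p"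
        unfolding tail_cond_def using 3 s by (intro iffI conjI; linarith)
      moreover have "Xq s p 0 (s - p) = Xq s p (s - p) 0" by (simp add: Xq_def)
      ultimately show ?thesis using 3 by simp
    next
      case 4
      have "max 0 (s - q) = 0" "max 0 (s - p) = 0" using 4 by simp_all
      moreover have "Xq s s 0 0 ^ n = 0" using n by (simp add: Xq_def)
      ultimately show ?thesis using 4 by simp
    qed
  qed
  also have "\<dots> = (\<integral>\<^sup>+ p. \<integral>\<^sup>+ q. ?a p q \<partial>lborel \<partial>lborel) + ((\<integral>\<^sup>+ p. \<integral>\<^sup>+ q. ?b p q \<partial>lborel \<partial>lborel) + (\<integral>\<^sup>+ p. \<integral>\<^sup>+ q. ?b q p \<partial>lborel \<partial>lborel))"
    by (subst nn_integral_add[symmetric], measurable, subst nn_integral_add[symmetric], measurable,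
        subst nn_integral_add[symmetric], measurable, subst nn_integral_add[symmetric], measurable)
  also have "(\<integral>\<^sup>+ p. \<integral>\<^sup>+ q. ?b q p \<partial>lborel \<partial>lborel) = (\<integral>\<^sup>+ p. \<integral>\<^sup>+ q. ?b p q \<partial>lborel \<partial>lborel)"
    by (rule lborel_pair.Fubini') measurable
  finally show ?thesis by (simp only: vertex_low_low[OF s] vertex_high_low[OF s])
qed

lemma nn_integral_lin3:
  assumes [measurable]: "f \<in> borel_measurable M" "g \<in> borel_measurable M" "h \<in> borel_measurable M"
  shows "(\<integral>\<^sup>+ x. f x * a + (g x * b + h x * c) \<partial>M) = (\<integral>\<^sup>+ x. f x \<partial>M) * a + ((\<integral>\<^sup>+ x. g x \<partial>M) * b + (\<integral>\<^sup>+ x. h x \<partial>M) * c)"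
  by (simp add: nn_integral_add nn_integral_multc)

lemma ennreal_lin3:
  assumes "0 \<le> x" "0 \<le> y" "0 \<le> z" "0 \<le> a" "0 \<le> b" "0 \<le> c"
  shows "ennreal x * ennreal a + (ennreal y * ennreal b + ennreal z * ennreal c) = ennreal (x * a + (y * b + z * c))"
  using assms by (simp add: ennreal_mult)

lemma nn_integral_add3:
  fixes f g h :: "real \<Rightarrow> real \<Rightarrow> ennreal"
  assumes m: "(\<lambda>(p, q). f p q) \<in> borel_measurable (lborel \<Otimes>\<^sub>M lborel)" "(\<lambda>(p, q). g p q) \<in> borel_measurable (lborel \<Otimes>\<^sub>M lborel)"
    "(\<lambda>(p, q). h p q) \<in> borel_measurable (lborel \<Otimes>\<^sub>M lborel)"
  shows "(\<integral>\<^sup>+ p. \<integral>\<^sup>+ q. f p q + (g p q + h p q) \<partial>lborel \<partial>lborel) =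
    (\<integral>\<^sup>+ p. \<integral>\<^sup>+ q. f p q \<partial>lborel \<partial>lborel) + ((\<integral>\<^sup>+ p. \<integral>\<^sup>+ q. g p q \<partial>lborel \<partial>lborel) + (\<integral>\<^sup>+ p. \<integral>\<^sup>+ q. h p q \<partial>lborel \<partial>lborel))"
proof -
  note [measurable] = m
  have [measurable]: "f p \<in> borel_measurable lborel" "g p \<in> borel_measurable lborel" "h p \<in> borel_measurable lborel" for p
    using measurable_compose[OF measurable_Pair1' m(1), of p] measurable_compose[OF measurable_Pair1' m(2), of p] measurable_compose[OF measurable_Pair1' m(3), of p]
    by simp_all
  show ?thesis by (simp add: nn_integral_add)
qed

lemma tail_slice:
  assumes n: "1 \<le> n" and s: "0 < s" "s \<le> 1"
  shows "(\<integral>\<^sup>+ p. \<integral>\<^sup>+ q. (if tail_cond s p q then hull_tail n s (max 0 (p + q - 1)) (max 0 (s - q)) (max 0 (s - p)) else 0) \<partial>lborel \<partial>lborel)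
    = ennreal ((1 - s)\<^sup>2 / 2 * s ^ (2 * n)) * I2 (Gp n 1)
      + ((ennreal ((1 - s) * s ^ (2 * n + 1)) * I2 (Ep n 1) + ennreal ((1 - s)\<^sup>2 / 2 * s ^ (2 * n)) * I1 (\<lambda>t. Ep n 1 t (1 - t) 0))
      + (ennreal (s ^ (2 * n + 2)) * ennreal (f_seq n) +
      (ennreal ((1 - s) * s ^ (2 * n + 1)) * ennreal (h_seq n) + ennreal ((1 - s) * s ^ (2 * n + 1)) * ennreal (h_seq n))))" (is "?L = _")
proof -
  let ?F = "\<lambda>p q. if tail_cond s p q then \<integral>\<^sup>+ u. \<integral>\<^sup>+ v. (if max 0 (p + q - 1) \<le> u \<and> max 0 (s - q) \<le> v \<and> u + v \<le> s - max 0 (s - p)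
        then ennreal (Gp n s u v (s - u - v)) else 0) \<partial>lborel \<partial>lborel else 0"
  let ?E = "\<lambda>p q. if tail_cond s p q then \<integral>\<^sup>+ u. (if max 0 (p + q - 1) \<le> u \<and> u \<le> s - max 0 (s - q) - max 0 (s - p)
        then ennreal (Ep n s u (s - u - max 0 (s - p)) (max 0 (s - p))) else 0) \<partial>lborel else 0"
  let ?V = "\<lambda>p q. if tail_cond s p q then ennreal (Xq s (s - max 0 (s - q) - max 0 (s - p)) (max 0 (s - q)) (max 0 (s - p)) ^ n) else 0"
  have m: "(\<lambda>(p, q). ?F p q) \<in> borel_measurable (lborel \<Otimes>\<^sub>M lborel)" "(\<lambda>(p, q). ?E p q) \<in> borel_measurable (lborel \<Otimes>\<^sub>M lborel)"
    "(\<lambda>(p, q). ?V p q) \<in> borel_measurable (lborel \<Otimes>\<^sub>M lborel)"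
    unfolding tail_cond_def by measurable
  have "?L = (\<integral>\<^sup>+ p. \<integral>\<^sup>+ q. ?F p q + (?E p q + ?V p q) \<partial>lborel \<partial>lborel)"
    unfolding hull_tail_def
  proof (rule nn_integral_cong, rule nn_integral_cong)
    have "(if P then x + (y + z) else 0) = (if P then x else 0) + ((if P then y else 0) + (if P then z else (0::ennreal)))" for P x y z
      by simp
    then show "(if tail_cond s p q then
        (\<integral>\<^sup>+ u. \<integral>\<^sup>+ v. (if max 0 (p + q - 1) \<le> u \<and> max 0 (s - q) \<le> v \<and> u + v \<le> s - max 0 (s - p)
        then ennreal (Gp n s u v (s - u - v)) else 0) \<partial>lborel \<partial>lborel) +
        ((\<integral>\<^sup>+ u. (if max 0 (p + q - 1) \<le> u \<and> u \<le> s - max 0 (s - q) - max 0 (s - p)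
        then ennreal (Ep n s u (s - u - max 0 (s - p)) (max 0 (s - p))) else 0) \<partial>lborel) +
        ennreal (Xq s (s - max 0 (s - q) - max 0 (s - p)) (max 0 (s - q)) (max 0 (s - p)) ^ n)) else 0) = ?F p q + (?E p q + ?V p q)" for p q .
  qed
  also have "\<dots> = (\<integral>\<^sup>+ p. \<integral>\<^sup>+ q. ?F p q \<partial>lborel \<partial>lborel) + ((\<integral>\<^sup>+ p. \<integral>\<^sup>+ q. ?E p q \<partial>lborel \<partial>lborel) + (\<integral>\<^sup>+ p. \<integral>\<^sup>+ q. ?V p q \<partial>lborel \<partial>lborel))"
    by (rule nn_integral_add3[OF m])
  finally show ?thesis
    unfolding facet_total[OF assms] edge_total[OF assms] vertex_total[OF assms] .
qed

text \<open>Grouped by Beta weight: the denominators are those of \<open>beta2\<close> at exponent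
  \<open>2 * n\<close>, \<open>beta1\<close> at \<open>2 * n + 1\<close> and \<open>beta0\<close> at
  \<open>2 * n + 2\<close>.\<close>

definition tail_const :: "nat \<Rightarrow> real" where
  "tail_const n = (2 / 3 * real n * real (n - 1) * f_seq (n - 1) + real n * h_seq (n - 1)) / ((2 * real n + 1) * (2 * real n + 2) * (2 * real n + 3))
     + (2 / 3 * real n * f_seq (n - 1) + 2 * h_seq n) / ((2 * real n + 2) * (2 * real n + 3)) + f_seq n / (2 * real n + 3)"

lemma regroup:
  fixes x y z a b c f h :: "'a::comm_semiring"
  shows "x * a + ((y * b + x * c) + (z * f + (y * h + y * h))) = x * (a + c) + (y * (b + (h + h)) + z * f)"
  by (simp add: algebra_simps)

lemma if_lin3:
  fixes a b c x y z :: ennreal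
  shows "(if P then (if P then a else 0) * x + ((if P then b else 0) * y + (if P then c else 0) * z) else 0) =
    (if P then a else 0) * x + ((if P then b else 0) * y + (if P then c else 0) * z)"
  by simp

text \<open>The slice \<open>s = 1\<close>, where the sum of \<open>y\<close> is 2, is counted with
  the region where the cut is void. The slice \<open>s = 0\<close> is dropped as a null set for the
  evaluation, since scaling by \<open>s\<close> requires \<open>0 < s\<close>. Both ends are
  restored before the Beta integrals are applied.\<close>

lemma tail_total:
  assumes n: "1 \<le> n"
  shows "(\<integral>\<^sup>+ s. \<integral>\<^sup>+ p. \<integral>\<^sup>+ q. (if (0 \<le> s \<and> s < 1) \<and> tail_cond s p q then hull_tail n s (max 0 (p + q - 1)) (max 0 (s - q)) (max 0 (s - p)) else 0) \<partial>lborel \<partial>lborel \<partial>lborel)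
    = ennreal (tail_const n)" (is "?L = _")
proof -
  define J where "J = (\<lambda>s. \<integral>\<^sup>+ p. \<integral>\<^sup>+ q. (if tail_cond s p q then hull_tail n s (max 0 (p + q - 1)) (max 0 (s - q)) (max 0 (s - p)) else 0) \<partial>lborel \<partial>lborel)"
  define A where "A = 2 / 3 * real n * real (n - 1) * f_seq (n - 1)"
  define B where "B = 2 / 3 * real n * f_seq (n - 1)"
  define C where "C = real n * h_seq (n - 1)"
  have nonneg: "0 \<le> A" "0 \<le> B" "0 \<le> C" by (simp_all add: A_def B_def C_def)
  let ?b0 = "\<lambda>s::real. if 0 \<le> s \<and> s \<le> 1 then ennreal (s ^ (2 * n + 2)) else 0"
  let ?b1 = "\<lambda>s::real. if 0 \<le> s \<and> s \<le> 1 then ennreal ((1 - s) * s ^ (2 * n + 1)) else 0"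
  let ?b2 = "\<lambda>s::real. if 0 \<le> s \<and> s \<le> 1 then ennreal ((1 - s)\<^sup>2 / 2 * s ^ (2 * n)) else 0"
  let ?K = "\<lambda>s. ?b2 s * ennreal (A + C) + (?b1 s * ennreal (B + 2 * h_seq n) + ?b0 s * ennreal (f_seq n))"
  have JK: "J s = ?K s" if s: "0 < s" "s \<le> 1" for s
  proof -
    have k: "ennreal (A + C) = ennreal A + ennreal C" "ennreal (B + 2 * h_seq n) = ennreal B + (ennreal (h_seq n) + ennreal (h_seq n))"
    proof -
      show "ennreal (A + C) = ennreal A + ennreal C" by (rule ennreal_plus[OF nonneg(1,3)])
      have "B + 2 * h_seq n = B + (h_seq n + h_seq n)" by simp
      then show "ennreal (B + 2 * h_seq n) = ennreal B + (ennreal (h_seq n) + ennreal (h_seq n))"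
        using nonneg by (simp only: ennreal_plus seq_nonneg add_nonneg_nonneg)
    qed
    have if_eq: "(if 0 \<le> s \<and> s \<le> 1 then x else 0) = (x::ennreal)" for x using s by simp
    have "J s = ennreal ((1 - s)\<^sup>2 / 2 * s ^ (2 * n)) * ennreal A
      + ((ennreal ((1 - s) * s ^ (2 * n + 1)) * ennreal B + ennreal ((1 - s)\<^sup>2 / 2 * s ^ (2 * n)) * ennreal C)
      + (ennreal (s ^ (2 * n + 2)) * ennreal (f_seq n) +
      (ennreal ((1 - s) * s ^ (2 * n + 1)) * ennreal (h_seq n) + ennreal ((1 - s) * s ^ (2 * n + 1)) * ennreal (h_seq n))))"
      unfolding J_def A_def B_def C_def I2_Gp[OF n, symmetric] I2_Ep[OF n, symmetric] I1_Ep[symmetric] by (rule tail_slice[OF n s])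
    also have "\<dots> = ?K s"
      unfolding if_eq k by (rule regroup)
    finally show ?thesis .
  qed
  have "?L = (\<integral>\<^sup>+ s. (if 0 \<le> s \<and> s < 1 then J s else 0) \<partial>lborel)"
  proof -
    have "(if X \<and> Y then z else 0) = (if X then if Y then z else 0 else (0::ennreal))" for X Y z by simp
    then show ?thesis unfolding J_def nn_integral_if_const[symmetric] by (intro nn_integral_cong)
  qed
  also have "\<dots> = (\<integral>\<^sup>+ s. (if 0 < s \<and> s < 1 then J s else 0) \<partial>lborel)"
    by (rule nn_integral_positive[symmetric])
  also have "\<dots> = (\<integral>\<^sup>+ s. (if 0 < s \<and> s < 1 then ?K s else 0) \<partial>lborel)"
  proof (rule nn_integral_cong)
    fix s :: real
    show "(if 0 < s \<and> s < 1 then J s else 0) = (if 0 < s \<and> s < 1 then ?K s else 0)"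
    proof (rule if_cong[OF refl _ refl])
      assume "0 < s \<and> s < 1"
      then show "J s = ?K s" by (intro JK) auto
    qed
  qed
  also have "\<dots> = (\<integral>\<^sup>+ s. (if 0 \<le> s \<and> s < 1 then ?K s else 0) \<partial>lborel)"
    by (rule nn_integral_positive)
  also have "\<dots> = (\<integral>\<^sup>+ s. (if 0 \<le> s \<and> s \<le> 1 then ?K s else 0) \<partial>lborel)"
    by (rule nn_integral_half_open)
  also have "\<dots> = (\<integral>\<^sup>+ s. ?K s \<partial>lborel)"
    by (intro nn_integral_cong if_lin3)
  also have "\<dots> = (\<integral>\<^sup>+ s. ?b2 s \<partial>lborel) * ennreal (A + C) + ((\<integral>\<^sup>+ s. ?b1 s \<partial>lborel) * ennreal (B + 2 * h_seq n) + (\<integral>\<^sup>+ s. ?b0 s \<partial>lborel) * ennreal (f_seq n))"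
    by (rule nn_integral_lin3) measurable
  also have "\<dots> = ennreal (tail_const n)"
  proof -
    have e: "real (2 * n) + 1 = 2 * real n + 1" "real (2 * n) + 2 = 2 * real n + 2" "real (2 * n) + 3 = 2 * real n + 3"
      "real (2 * n + 1) + 1 = 2 * real n + 2" "real (2 * n + 1) + 2 = 2 * real n + 3" "real (2 * n + 2) + 1 = 2 * real n + 3" by simp_all
    have "ennreal (1 / ((2 * real n + 1) * (2 * real n + 2) * (2 * real n + 3))) * ennreal (A + C) + (ennreal (1 / ((2 * real n + 2) * (2 * real n + 3))) * ennreal (B + 2 * h_seq n) + ennreal (1 / (2 * real n + 3)) * ennreal (f_seq n))
      = ennreal (1 / ((2 * real n + 1) * (2 * real n + 2) * (2 * real n + 3)) * (A + C) + (1 / ((2 * real n + 2) * (2 * real n + 3)) * (B + 2 * h_seq n) + 1 / (2 * real n + 3) * f_seq n))"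
      using nonneg by (intro ennreal_lin3) simp_all
    also have "1 / ((2 * real n + 1) * (2 * real n + 2) * (2 * real n + 3)) * (A + C) + (1 / ((2 * real n + 2) * (2 * real n + 3)) * (B + 2 * h_seq n) + 1 / (2 * real n + 3) * f_seq n) = tail_const n"
      unfolding tail_const_def A_def B_def C_def by simp
    finally show ?thesis unfolding beta0 beta1 beta2 e .
  qed
  finally show ?thesis .
qed

section \<open>Both volumes as integrals over y\<close>

lemma col_component: "j \<in> {1..n} \<Longrightarrow> (\<lambda>p. fst p j) \<in> measurable (col_measure n \<Otimes>\<^sub>M lborel3) (lborel \<Otimes>\<^sub>M lborel)"
  unfolding col_measure_def
  by (intro measurable_compose[OF measurable_fst] measurable_component_singleton)

definition col_cells :: "nat \<Rightarrow> (nat \<Rightarrow> real \<times> real) \<Rightarrow> real \<Rightarrow> real \<Rightarrow> real \<Rightarrow> bool" where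
  "col_cells n c y1 y2 y3 \<longleftrightarrow> (\<forall>j\<in>{1..n}. c j \<in> cell 0 0 0 y1 y2 y3)"

lemma pred_cell_ineqs:
  fixes u v y1 y2 y3 :: "'a \<Rightarrow> real"
  assumes [measurable]: "u \<in> borel_measurable M" "v \<in> borel_measurable M" "y1 \<in> borel_measurable M" "y2 \<in> borel_measurable M" "y3 \<in> borel_measurable M"
  shows "Measurable.pred M (\<lambda>p. 0 \<le> u p \<and> u p \<le> y1 p \<and> 0 \<le> v p \<and> v p \<le> y2 p \<and> 0 \<le> 1 - u p - v p \<and> 1 - u p - v p \<le> y3 p)"
  by measurable

lemma pred_cut:
  fixes u1 u2 u3 v3 y1 y2 y3 :: "'a \<Rightarrow> real"
  assumes [measurable]: "u1 \<in> borel_measurable M" "u2 \<in> borel_measurable M" "u3 \<in> borel_measurable M" "v3 \<in> borel_measurable M"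
    "y1 \<in> borel_measurable M" "y2 \<in> borel_measurable M" "y3 \<in> borel_measurable M"
  shows "Measurable.pred M (\<lambda>p. 2 \<le> u1 p + u2 p + (1 - u3 p - v3 p) + (y1 p + y2 p + y3 p))"
  by measurable

lemma col_coordinates:
  assumes "j \<in> {1..n}"
  shows "(\<lambda>p. fst (fst p j)) \<in> borel_measurable (col_measure n \<Otimes>\<^sub>M lborel3)" "(\<lambda>p. snd (fst p j)) \<in> borel_measurable (col_measure n \<Otimes>\<^sub>M lborel3)"
  using measurable_compose[OF col_component[OF assms] measurable_fst] measurable_compose[OF col_component[OF assms] measurable_snd]
  by simp_all

lemma pred_col_cells: "Measurable.pred (col_measure n \<Otimes>\<^sub>M lborel3) (\<lambda>p. col_cells n (fst p) (fst (snd p)) (fst (snd (snd p))) (snd (snd (snd p))))"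
  unfolding col_cells_def mem_cell col_third_def
  by (intro pred_intros_finite pred_cell_ineqs col_coordinates finite_atLeastAtMost) measurable

lemma pred_hull_slice: "Measurable.pred (col_measure n \<Otimes>\<^sub>M lborel3) (\<lambda>p. hull_slice n (fst p) (fst (snd p)) (fst (snd (snd p))) (snd (snd (snd p))))"
  unfolding hull_slice_def col_cells_def[symmetric] col_third_def
  by (intro pred_intros_logic(3) pred_col_cells pred_intros_finite pred_cut col_coordinates finite_atLeastAtMost) measurable

lemma Vol_int_hull:
  assumes n: "1 \<le> n"
  shows "Vol 3 n (int_hull 3 n) = enn2real (\<integral>\<^sup>+ y1. \<integral>\<^sup>+ y2. \<integral>\<^sup>+ y3.
    emeasure (col_measure n) {c \<in> space (col_measure n). (y1 \<le> 1 \<and> y2 \<le> 1 \<and> y3 \<le> 1) \<and> hull_slice n c y1 y2 y3} \<partial>lborel \<partial>lborel \<partial>lborel)"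
proof -
  let ?\<Phi> = "\<lambda>c y1 y2 y3. (y1 \<le> 1 \<and> y2 \<le> 1 \<and> y3 \<le> (1::real)) \<and> hull_slice n c y1 y2 y3"
  have "int_hull 3 n = {(x, y) \<in> D_aff 3 n. ?\<Phi> (\<lambda>j\<in>{1..n}. (x 1 j, x 2 j)) (y 1) (y 2) (y 3)}"
    unfolding int_hull_eq_ineq[OF n]
  proof (rule set_eqI, clarify)
    fix x y
    have D: "(x, y) \<in> D_aff 3 n \<longleftrightarrow> (x, y) \<in> ambient 3 n \<and> (\<forall>j\<in>{1..n}. x 1 j + x 2 j + x 3 j = 1)"
      unfolding D_aff_def mem_Collect_eq case_prod_conv sum_three by blast
    show "(x, y) \<in> hull_ineq n \<longleftrightarrow> (x, y) \<in> {(x, y) \<in> D_aff 3 n. ?\<Phi> (\<lambda>j\<in>{1..n}. (x 1 j, x 2 j)) (y 1) (y 2) (y 3)}"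
    proof (cases "(x, y) \<in> D_aff 3 n")
      case False
      then have "(x, y) \<notin> hull_ineq n" unfolding D hull_ineq_iff by blast
      then show ?thesis using False by simp
    next
      case True
      have third: "col_third (x 1 j, x 2 j) = x 3 j" if j: "j \<in> {1..n}" for j
      proof -
        have "x 1 j + x 2 j + x 3 j = 1" using True j unfolding D by blast
        then have e: "x 3 j = 1 - x 1 j - x 2 j" by linarith
        show ?thesis unfolding col_third_def e by simp
      qed
      have "hull_slice n (\<lambda>j\<in>{1..n}. (x 1 j, x 2 j)) (y 1) (y 2) (y 3) \<longleftrightarrow>
         (\<forall>j\<in>{1..n}. 0 \<le> x 1 j \<and> x 1 j \<le> y 1 \<and> 0 \<le> x 2 j \<and> x 2 j \<le> y 2 \<and> 0 \<le> x 3 j \<and> x 3 j \<le> y 3) \<and>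
         (\<forall>j1\<in>{1..n}. \<forall>j2\<in>{1..n}. \<forall>j3\<in>{1..n}. 2 \<le> x 1 j1 + x 2 j2 + x 3 j3 + (y 1 + y 2 + y 3))"
        unfolding hull_slice_def mem_cell by (simp only: third restrict_apply if_True fst_conv snd_conv cong: ball_cong)
      then show ?thesis
        using True unfolding D hull_ineq_iff by (simp only: mem_Collect_eq case_prod_conv D) blast
    qed
  qed
  also have "Vol 3 n \<dots> = enn2real (\<integral>\<^sup>+ y1. \<integral>\<^sup>+ y2. \<integral>\<^sup>+ y3. emeasure (col_measure n) {c \<in> space (col_measure n). ?\<Phi> c y1 y2 y3} \<partial>lborel \<partial>lborel \<partial>lborel)"
  proof (rule Vol_eq_iterated)
    have "Measurable.pred (col_measure n \<Otimes>\<^sub>M lborel3) (\<lambda>p. (fst (snd p) \<le> 1 \<and> fst (snd (snd p)) \<le> 1 \<and> snd (snd (snd p)) \<le> 1) \<and>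
        hull_slice n (fst p) (fst (snd p)) (fst (snd (snd p))) (snd (snd (snd p))))"
      using pred_hull_slice by measurable
    then show "{p \<in> space (col_measure n \<Otimes>\<^sub>M lborel3). case p of (c, y1, y2, y3) \<Rightarrow> ?\<Phi> c y1 y2 y3} \<in> sets (col_measure n \<Otimes>\<^sub>M lborel3)"
      unfolding pred_def case_prod_unfold .
  qed
  finally show ?thesis .
qed

lemma Vol_P_poly:
  shows "Vol 3 n (P_poly 3 n \<inter> D_aff 3 n) = enn2real (\<integral>\<^sup>+ y1. \<integral>\<^sup>+ y2. \<integral>\<^sup>+ y3.
    emeasure (col_measure n) {c \<in> space (col_measure n). (y1 \<le> 1 \<and> y2 \<le> 1 \<and> y3 \<le> 1) \<and> col_cells n c y1 y2 y3} \<partial>lborel \<partial>lborel \<partial>lborel)"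
proof -
  let ?\<Phi> = "\<lambda>c y1 y2 y3. (y1 \<le> 1 \<and> y2 \<le> 1 \<and> y3 \<le> (1::real)) \<and> col_cells n c y1 y2 y3"
  have "P_poly 3 n \<inter> D_aff 3 n = {(x, y) \<in> D_aff 3 n. ?\<Phi> (\<lambda>j\<in>{1..n}. (x 1 j, x 2 j)) (y 1) (y 2) (y 3)}"
  proof (rule set_eqI, clarify)
    fix x y
    have D: "(x, y) \<in> D_aff 3 n \<longleftrightarrow> (x, y) \<in> ambient 3 n \<and> (\<forall>j\<in>{1..n}. x 1 j + x 2 j + x 3 j = 1)"
      unfolding D_aff_def mem_Collect_eq case_prod_conv sum_three by blast
    have P: "(x, y) \<in> P_poly 3 n \<longleftrightarrow> (x, y) \<in> ambient 3 n \<and>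
        (\<forall>j\<in>{1..n}. 0 \<le> x 1 j \<and> x 1 j \<le> y 1 \<and> 0 \<le> x 2 j \<and> x 2 j \<le> y 2 \<and> 0 \<le> x 3 j \<and> x 3 j \<le> y 3) \<and> (y 1 \<le> 1 \<and> y 2 \<le> 1 \<and> y 3 \<le> 1)"
      unfolding P_poly_def mem_Collect_eq case_prod_conv ball_three by blast
    show "(x, y) \<in> P_poly 3 n \<inter> D_aff 3 n \<longleftrightarrow> (x, y) \<in> {(x, y) \<in> D_aff 3 n. ?\<Phi> (\<lambda>j\<in>{1..n}. (x 1 j, x 2 j)) (y 1) (y 2) (y 3)}"
    proof (cases "(x, y) \<in> D_aff 3 n")
      case False
      then show ?thesis by simp
    next
      case True
      have third: "col_third (x 1 j, x 2 j) = x 3 j" if j: "j \<in> {1..n}" for j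
      proof -
        have "x 1 j + x 2 j + x 3 j = 1" using True j unfolding D by blast
        then have e: "x 3 j = 1 - x 1 j - x 2 j" by linarith
        show ?thesis unfolding col_third_def e by simp
      qed
      have "col_cells n (\<lambda>j\<in>{1..n}. (x 1 j, x 2 j)) (y 1) (y 2) (y 3) \<longleftrightarrow>
         (\<forall>j\<in>{1..n}. 0 \<le> x 1 j \<and> x 1 j \<le> y 1 \<and> 0 \<le> x 2 j \<and> x 2 j \<le> y 2 \<and> 0 \<le> x 3 j \<and> x 3 j \<le> y 3)"
        unfolding col_cells_def mem_cell by (simp only: third restrict_apply if_True fst_conv snd_conv cong: ball_cong)
      then show ?thesis
        using True unfolding Int_iff P D by (simp only: mem_Collect_eq case_prod_conv D) blast
    qed
  qed
  also have "Vol 3 n \<dots> = enn2real (\<integral>\<^sup>+ y1. \<integral>\<^sup>+ y2. \<integral>\<^sup>+ y3. emeasure (col_measure n) {c \<in> space (col_measure n). ?\<Phi> c y1 y2 y3} \<partial>lborel \<partial>lborel \<partial>lborel)"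
  proof (rule Vol_eq_iterated)
    have "Measurable.pred (col_measure n \<Otimes>\<^sub>M lborel3) (\<lambda>p. (fst (snd p) \<le> 1 \<and> fst (snd (snd p)) \<le> 1 \<and> snd (snd (snd p)) \<le> 1) \<and>
        col_cells n (fst p) (fst (snd p)) (fst (snd (snd p))) (snd (snd (snd p))))"
      using pred_col_cells by measurable
    then show "{p \<in> space (col_measure n \<Otimes>\<^sub>M lborel3). case p of (c, y1, y2, y3) \<Rightarrow> ?\<Phi> c y1 y2 y3} \<in> sets (col_measure n \<Otimes>\<^sub>M lborel3)"
      unfolding pred_def case_prod_unfold .
  qed
  finally show ?thesis .
qed

lemma col_cells_bounds:
  assumes "1 \<le> n" "col_cells n c y1 y2 y3"
  shows "0 \<le> y1" "0 \<le> y2" "0 \<le> y3" "1 \<le> y1 + y2 + y3"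
proof -
  have "c 1 \<in> cell 0 0 0 y1 y2 y3" using assms unfolding col_cells_def by simp
  then have "0 \<le> fst (c 1)" "fst (c 1) \<le> y1" "0 \<le> snd (c 1)" "snd (c 1) \<le> y2" "0 \<le> col_third (c 1)" "col_third (c 1) \<le> y3"
    unfolding mem_cell by blast+
  then show "0 \<le> y1" "0 \<le> y2" "0 \<le> y3" "1 \<le> y1 + y2 + y3"
    by (simp_all add: col_third_def)
qed

lemma cell_area_large:
  assumes "y1 \<le> 1" "y2 \<le> 1" "y3 \<le> 1" "2 \<le> y1 + y2 + y3"
  shows "cell_area 0 0 0 y1 y2 y3 = Xq 1 (1 - y1) (1 - y2) (1 - y3)"
proof -
  have "posq (1 - 0 - 0 - 0) = 1" "posq (1 - y1 - 0 - 0) = (1 - y1)\<^sup>2" "posq (1 - 0 - y2 - 0) = (1 - y2)\<^sup>2" "posq (1 - 0 - 0 - y3) = (1 - y3)\<^sup>2"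
    "posq (1 - y1 - y2 - 0) = 0" "posq (1 - y1 - 0 - y3) = 0" "posq (1 - 0 - y2 - y3) = 0" "posq (1 - y1 - y2 - y3) = 0"
    using assms by (simp_all add: posq_def)
  then show ?thesis unfolding cell_area_def Xq_def by simp
qed

text \<open>Columns sum to 1 and stay below \<open>y\<close>, so nothing lies over
  \<open>y1 + y2 + y3 < 1\<close>. From 2 on, nonnegative entries satisfy every cut, and the fibre
  is that of the relaxation, with three disjoint corners cut off the unit triangle. In between,
  \<open>emeasure_hull_slice\<close> applies.\<close>

lemma hull_slice_measure:
  assumes n: "1 \<le> n"
  shows "2 ^ n * emeasure (col_measure n) {c \<in> space (col_measure n). (y1 \<le> 1 \<and> y2 \<le> 1 \<and> y3 \<le> 1) \<and> hull_slice n c y1 y2 y3} =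
    (if (y1 \<le> 1 \<and> y2 \<le> 1 \<and> y3 \<le> 1) \<and> 2 \<le> y1 + y2 + y3 then ennreal (Xq 1 (1 - y1) (1 - y2) (1 - y3) ^ n) else 0)
    + (if (0 \<le> y1 \<and> 0 \<le> y2 \<and> 0 \<le> y3 \<and> y1 \<le> 1 \<and> y2 \<le> 1 \<and> y3 \<le> 1) \<and> (1 \<le> y1 + y2 + y3 \<and> y1 + y2 + y3 < 2)
       then hull_tail n (y1 + y2 + y3 - 1) (max 0 (y1 + y2 + y3 - 1 - y1)) (max 0 (y1 + y2 + y3 - 1 - y2)) (max 0 (y1 + y2 + y3 - 1 - y3)) else 0)"
    (is "2 ^ n * emeasure _ ?S = (if ?P2 then ?x else 0) + (if ?P1 then ?t else 0)")
proof (cases "?P2")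
  case True
  have slice: "hull_slice n c y1 y2 y3 \<longleftrightarrow> (\<forall>j\<in>{1..n}. c j \<in> cell 0 0 0 y1 y2 y3)" for c
  proof
    assume *: "\<forall>j\<in>{1..n}. c j \<in> cell 0 0 0 y1 y2 y3"
    have "2 \<le> fst (c j1) + snd (c j2) + col_third (c j3) + (y1 + y2 + y3)"
      if j: "j1 \<in> {1..n}" "j2 \<in> {1..n}" "j3 \<in> {1..n}" for j1 j2 j3
    proof -
      have "0 \<le> fst (c j1)" "0 \<le> snd (c j2)" "0 \<le> col_third (c j3)"
        using bspec[OF * j(1)] bspec[OF * j(2)] bspec[OF * j(3)] unfolding mem_cell by blast+
      then show ?thesis using True by linarith
    qed
    then show "hull_slice n c y1 y2 y3" unfolding hull_slice_def using * by blast
  qed (simp add: hull_slice_def)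
  have y0: "0 \<le> y1" "0 \<le> y2" "0 \<le> y3" using True by linarith+
  have y1: "y1 \<le> 1" "y2 \<le> 1" "y3 \<le> 1" "2 \<le> y1 + y2 + y3" using True by blast+
  have "?S = {c \<in> space (col_measure n). \<forall>j\<in>{1..n}. c j \<in> cell 0 0 0 y1 y2 y3}"
    unfolding slice using True by blast
  then have "2 ^ n * emeasure (col_measure n) ?S = ?x"
    using emeasure_col_cells[OF y0, of n] unfolding cell_area_large[OF y1] by (simp only:)
  moreover have nP1: "\<not> ?P1" using True by linarith
  ultimately show ?thesis unfolding if_P[OF True] if_not_P[OF nP1] add_0_right by blast
next
  case nP2: False
  show ?thesis
  proof (cases "?P1")
    case True
    then have y: "0 \<le> y1" "0 \<le> y2" "0 \<le> y3" "y1 \<le> 1" "y2 \<le> 1" "y3 \<le> 1" and s: "0 \<le> y1 + y2 + y3 - 1" "y1 + y2 + y3 - 1 \<le> 1"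
      by auto
    have "?S = {c \<in> space (col_measure n). hull_slice n c y1 y2 y3}" using y by blast
    moreover have "2 ^ n * emeasure (col_measure n) {c \<in> space (col_measure n). hull_slice n c y1 y2 y3} = ?t"
      by (rule emeasure_hull_slice[OF n y _ s]) simp
    ultimately show ?thesis unfolding if_P[OF True] if_not_P[OF nP2] add_0_left by (simp only:)
  next
    case False
    have "\<not> ((y1 \<le> 1 \<and> y2 \<le> 1 \<and> y3 \<le> 1) \<and> hull_slice n c y1 y2 y3)" for c
    proof
      assume *: "(y1 \<le> 1 \<and> y2 \<le> 1 \<and> y3 \<le> 1) \<and> hull_slice n c y1 y2 y3"
      then have "col_cells n c y1 y2 y3" unfolding hull_slice_def col_cells_def by blast
      from col_cells_bounds[OF n this] show False using * nP2 False by linarith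
    qed
    then have "?S = {}" by blast
    then show ?thesis unfolding if_not_P[OF False] if_not_P[OF nP2] add_0_left by (simp only: emeasure_empty mult_zero_right)
  qed
qed

lemma nn_integral3_add:
  fixes f g :: "real \<Rightarrow> real \<Rightarrow> real \<Rightarrow> ennreal"
  assumes "(\<lambda>(x, y, z). f x y z) \<in> borel_measurable lborel3" "(\<lambda>(x, y, z). g x y z) \<in> borel_measurable lborel3"
  shows "(\<integral>\<^sup>+ x. \<integral>\<^sup>+ y. \<integral>\<^sup>+ z. f x y z + g x y z \<partial>lborel \<partial>lborel \<partial>lborel) =
     (\<integral>\<^sup>+ x. \<integral>\<^sup>+ y. \<integral>\<^sup>+ z. f x y z \<partial>lborel \<partial>lborel \<partial>lborel) + (\<integral>\<^sup>+ x. \<integral>\<^sup>+ y. \<integral>\<^sup>+ z. g x y z \<partial>lborel \<partial>lborel \<partial>lborel)"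
proof -
  note [measurable] = triple_comp[OF assms(1)] triple_comp[OF assms(2)]
  show ?thesis
    by (subst nn_integral_add[symmetric], measurable, subst nn_integral_add[symmetric], measurable, subst nn_integral_add[symmetric], measurable)
qed

lemma nn_integral3_cmult:
  fixes g :: "real \<Rightarrow> real \<Rightarrow> real \<Rightarrow> ennreal"
  assumes "(\<lambda>(x, y, z). g x y z) \<in> borel_measurable lborel3"
  shows "(\<integral>\<^sup>+ x. \<integral>\<^sup>+ y. \<integral>\<^sup>+ z. c * g x y z \<partial>lborel \<partial>lborel \<partial>lborel) = c * (\<integral>\<^sup>+ x. \<integral>\<^sup>+ y. \<integral>\<^sup>+ z. g x y z \<partial>lborel \<partial>lborel \<partial>lborel)"
proof -
  note [measurable] = triple_comp[OF assms]
  show ?thesis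
    by (subst nn_integral_cmult[symmetric], measurable, subst nn_integral_cmult[symmetric], measurable, subst nn_integral_cmult[symmetric], measurable)
qed

text \<open>The fibre identities hold pointwise with the factor \<open>2 ^ n\<close> inside the
  integral; this moves it outside of \<open>enn2real\<close>.\<close>

lemma scaled_volume:
  fixes e g :: "real \<Rightarrow> real \<Rightarrow> real \<Rightarrow> ennreal"
  assumes m: "(\<lambda>(x, y, z). g x y z) \<in> borel_measurable lborel3"
    and eq: "\<And>x y z. 2 ^ n * e x y z = g x y z"
    and g: "(\<integral>\<^sup>+ x. \<integral>\<^sup>+ y. \<integral>\<^sup>+ z. g x y z \<partial>lborel \<partial>lborel \<partial>lborel) = ennreal r" and r: "0 \<le> r"
  shows "2 ^ n * enn2real (\<integral>\<^sup>+ x. \<integral>\<^sup>+ y. \<integral>\<^sup>+ z. e x y z \<partial>lborel \<partial>lborel \<partial>lborel) = r"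
proof -
  have "ennreal 2 ^ n = ennreal (2 ^ n)" by (rule ennreal_power) simp
  then have two: "(2::ennreal) ^ n = ennreal (2 ^ n)" by (simp only: ennreal_numeral)
  have "ennreal (1 / 2 ^ n) * 2 ^ n = ennreal (1 / 2 ^ n * 2 ^ n)"
    unfolding two by (rule ennreal_mult[symmetric]) simp_all
  then have inv: "ennreal (1 / 2 ^ n) * 2 ^ n = 1" by simp
  have "e x y z = ennreal (1 / 2 ^ n) * g x y z" for x y z
    unfolding eq[symmetric] mult.assoc[symmetric] inv by simp
  then have "(\<integral>\<^sup>+ x. \<integral>\<^sup>+ y. \<integral>\<^sup>+ z. e x y z \<partial>lborel \<partial>lborel \<partial>lborel) = (\<integral>\<^sup>+ x. \<integral>\<^sup>+ y. \<integral>\<^sup>+ z. ennreal (1 / 2 ^ n) * g x y z \<partial>lborel \<partial>lborel \<partial>lborel)"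
    by (simp only:)
  also have "\<dots> = ennreal (1 / 2 ^ n) * ennreal r"
    unfolding nn_integral3_cmult[OF m] g by (rule refl)
  also have "\<dots> = ennreal (1 / 2 ^ n * r)" by (rule ennreal_mult[symmetric]) (use r in simp_all)
  finally show ?thesis using r by simp
qed

definition hull_large :: "nat \<Rightarrow> real \<Rightarrow> real \<Rightarrow> real \<Rightarrow> ennreal" where
  "hull_large n y1 y2 y3 = (if (y1 \<le> 1 \<and> y2 \<le> 1 \<and> y3 \<le> 1) \<and> 2 \<le> y1 + y2 + y3 then ennreal (Xq 1 (1 - y1) (1 - y2) (1 - y3) ^ n) else 0)"

definition hull_small :: "nat \<Rightarrow> real \<Rightarrow> real \<Rightarrow> real \<Rightarrow> ennreal" where
  "hull_small n y1 y2 y3 = (if (0 \<le> y1 \<and> 0 \<le> y2 \<and> 0 \<le> y3 \<and> y1 \<le> 1 \<and> y2 \<le> 1 \<and> y3 \<le> 1) \<and> (1 \<le> y1 + y2 + y3 \<and> y1 + y2 + y3 < 2)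
       then hull_tail n (y1 + y2 + y3 - 1) (max 0 (y1 + y2 + y3 - 1 - y1)) (max 0 (y1 + y2 + y3 - 1 - y2)) (max 0 (y1 + y2 + y3 - 1 - y3)) else 0)"

lemma hull_large_measurable: "(\<lambda>(y1, y2, y3). hull_large n y1 y2 y3) \<in> borel_measurable lborel3"
  unfolding hull_large_def by measurable

lemma hull_small_measurable: "(\<lambda>(y1, y2, y3). hull_small n y1 y2 y3) \<in> borel_measurable lborel3"
  unfolding hull_small_def hull_tail_def by measurable

text \<open>Reflecting \<open>y\<close> to \<open>1 - y\<close> carries the corner of the cube where
  the cut is void to the solid unit simplex.\<close>

lemma hull_large_total:
  "(\<integral>\<^sup>+ y1. \<integral>\<^sup>+ y2. \<integral>\<^sup>+ y3. hull_large n y1 y2 y3 \<partial>lborel \<partial>lborel \<partial>lborel) = ennreal (d3_seq n)"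
proof -
  note [measurable] = triple_comp[OF hull_large_measurable]
  have "(\<integral>\<^sup>+ y1. \<integral>\<^sup>+ y2. \<integral>\<^sup>+ y3. hull_large n y1 y2 y3 \<partial>lborel \<partial>lborel \<partial>lborel) = (\<integral>\<^sup>+ y1. \<integral>\<^sup>+ y2. \<integral>\<^sup>+ y3. hull_large n (1 - y1) y2 y3 \<partial>lborel \<partial>lborel \<partial>lborel)"
    by (rule nn_integral_reflect) measurable
  also have "\<dots> = (\<integral>\<^sup>+ y1. \<integral>\<^sup>+ y2. \<integral>\<^sup>+ y3. hull_large n (1 - y1) (1 - y2) y3 \<partial>lborel \<partial>lborel \<partial>lborel)"
    by (rule nn_integral_cong, rule nn_integral_reflect) measurable
  also have "\<dots> = (\<integral>\<^sup>+ y1. \<integral>\<^sup>+ y2. \<integral>\<^sup>+ y3. hull_large n (1 - y1) (1 - y2) (1 - y3) \<partial>lborel \<partial>lborel \<partial>lborel)"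
    by (rule nn_integral_cong, rule nn_integral_cong, rule nn_integral_reflect) measurable
  also have "\<dots> = I3 (\<lambda>u v w. Xq 1 u v w ^ n)"
    unfolding I3_def
  proof (intro nn_integral_cong)
    fix u v w :: real
    have iff: "((1 - u \<le> 1 \<and> 1 - v \<le> 1 \<and> 1 - w \<le> 1) \<and> 2 \<le> 1 - u + (1 - v) + (1 - w)) \<longleftrightarrow> (0 \<le> u \<and> 0 \<le> v \<and> 0 \<le> w \<and> u + v + w \<le> 1)"
      by auto
    show "hull_large n (1 - u) (1 - v) (1 - w) = (if 0 \<le> u \<and> 0 \<le> v \<and> 0 \<le> w \<and> u + v + w \<le> 1 then ennreal (Xq 1 u v w ^ n) else 0)"
      unfolding hull_large_def iff by simp
  qed
  finally show ?thesis by (simp only: I3_d)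
qed

lemma hull_small_total:
  assumes n: "1 \<le> n"
  shows "(\<integral>\<^sup>+ y1. \<integral>\<^sup>+ y2. \<integral>\<^sup>+ y3. hull_small n y1 y2 y3 \<partial>lborel \<partial>lborel \<partial>lborel) = ennreal (tail_const n)"
proof -
  have "(\<integral>\<^sup>+ y1. \<integral>\<^sup>+ y2. \<integral>\<^sup>+ y3. hull_small n y1 y2 y3 \<partial>lborel \<partial>lborel \<partial>lborel) = (\<integral>\<^sup>+ s. \<integral>\<^sup>+ p. \<integral>\<^sup>+ q. hull_small n (1 + s - p - q) q p \<partial>lborel \<partial>lborel \<partial>lborel)"
    by (rule nn_integral_slice_sum[OF hull_small_measurable])
  also have "\<dots> = (\<integral>\<^sup>+ s. \<integral>\<^sup>+ p. \<integral>\<^sup>+ q. (if (0 \<le> s \<and> s < 1) \<and> tail_cond s p q then hull_tail n s (max 0 (p + q - 1)) (max 0 (s - q)) (max 0 (s - p)) else 0) \<partial>lborel \<partial>lborel \<partial>lborel)"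
  proof (rule nn_integral_cong, rule nn_integral_cong, rule nn_integral_cong)
    fix s p q :: real
    have e: "1 + s - p - q + q + p = 1 + s" "1 + s - 1 = s" "s - (1 + s - p - q) = p + q - 1" by simp_all
    have iff: "((0 \<le> 1 + s - p - q \<and> 0 \<le> q \<and> 0 \<le> p \<and> 1 + s - p - q \<le> 1 \<and> q \<le> 1 \<and> p \<le> 1) \<and> (1 \<le> 1 + s \<and> 1 + s < 2)) \<longleftrightarrow>
       ((0 \<le> s \<and> s < 1) \<and> tail_cond s p q)"
      unfolding tail_cond_def by auto
    show "hull_small n (1 + s - p - q) q p = (if (0 \<le> s \<and> s < 1) \<and> tail_cond s p q then hull_tail n s (max 0 (p + q - 1)) (max 0 (s - q)) (max 0 (s - p)) else 0)"
      unfolding hull_small_def e(1) unfolding iff unfolding e(2) unfolding e(3) by (rule refl)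
  qed
  also have "\<dots> = ennreal (tail_const n)" by (rule tail_total[OF n])
  finally show ?thesis .
qed

lemma a_seq_formula:
  assumes n: "1 \<le> n"
  shows "a_seq n = d3_seq n + tail_const n"
  unfolding a_seq_def Vol_int_hull[OF n]
proof (rule scaled_volume)
  let ?g = "\<lambda>y1 y2 y3. hull_large n y1 y2 y3 + hull_small n y1 y2 y3"
  show "(\<lambda>(y1, y2, y3). ?g y1 y2 y3) \<in> borel_measurable lborel3"
    using borel_measurable_add[OF hull_large_measurable hull_small_measurable] by (simp only: case_prod_unfold)
  show "2 ^ n * emeasure (col_measure n) {c \<in> space (col_measure n). (y1 \<le> 1 \<and> y2 \<le> 1 \<and> y3 \<le> 1) \<and> hull_slice n c y1 y2 y3} = ?g y1 y2 y3" for y1 y2 y3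
    unfolding hull_large_def hull_small_def by (rule hull_slice_measure[OF n])
  show nn: "0 \<le> d3_seq n + tail_const n" unfolding tail_const_def by simp
  have "0 \<le> tail_const n" unfolding tail_const_def by simp
  then show "(\<integral>\<^sup>+ y1. \<integral>\<^sup>+ y2. \<integral>\<^sup>+ y3. ?g y1 y2 y3 \<partial>lborel \<partial>lborel \<partial>lborel) = ennreal (d3_seq n + tail_const n)"
    unfolding nn_integral3_add[OF hull_large_measurable hull_small_measurable] hull_large_total hull_small_total[OF n]
    by (simp only: ennreal_plus seq_nonneg)
qed

section \<open>The volume of the relaxation\<close>

lemma nn_integral3_swap12:
  fixes f :: "real \<Rightarrow> real \<Rightarrow> real \<Rightarrow> ennreal"
  assumes "(\<lambda>(x, y, z). f x y z) \<in> borel_measurable lborel3"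
  shows "(\<integral>\<^sup>+ x. \<integral>\<^sup>+ y. \<integral>\<^sup>+ z. f y x z \<partial>lborel \<partial>lborel \<partial>lborel) = (\<integral>\<^sup>+ x. \<integral>\<^sup>+ y. \<integral>\<^sup>+ z. f x y z \<partial>lborel \<partial>lborel \<partial>lborel)"
proof -
  note [measurable] = triple_comp[OF assms]
  show ?thesis by (rule lborel_pair.Fubini') measurable
qed

lemma nn_integral3_swap23:
  fixes f :: "real \<Rightarrow> real \<Rightarrow> real \<Rightarrow> ennreal"
  assumes "(\<lambda>(x, y, z). f x y z) \<in> borel_measurable lborel3"
  shows "(\<integral>\<^sup>+ x. \<integral>\<^sup>+ y. \<integral>\<^sup>+ z. f x z y \<partial>lborel \<partial>lborel \<partial>lborel) = (\<integral>\<^sup>+ x. \<integral>\<^sup>+ y. \<integral>\<^sup>+ z. f x y z \<partial>lborel \<partial>lborel \<partial>lborel)"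
proof -
  note [measurable] = triple_comp[OF assms]
  show ?thesis by (rule nn_integral_cong, rule lborel_pair.Fubini') measurable
qed

text \<open>Away from coinciding coordinates, a null set, exactly one of the six orderings holds,
  and a symmetric integrand contributes equally to each.\<close>

lemma nn_integral3_sorted:
  fixes g :: "real \<Rightarrow> real \<Rightarrow> real \<Rightarrow> ennreal"
  assumes g: "(\<lambda>(x, y, z). g x y z) \<in> borel_measurable lborel3"
    and sym: "\<And>x y z. g y x z = g x y z" "\<And>x y z. g x z y = g x y z"
  shows "(\<integral>\<^sup>+ x. \<integral>\<^sup>+ y. \<integral>\<^sup>+ z. g x y z \<partial>lborel \<partial>lborel \<partial>lborel) =
    6 * (\<integral>\<^sup>+ x. \<integral>\<^sup>+ y. \<integral>\<^sup>+ z. (if z \<le> y \<and> y \<le> x then g x y z else 0) \<partial>lborel \<partial>lborel \<partial>lborel)"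
proof -
  define S where "S = (\<lambda>x y z. if z \<le> y \<and> y \<le> x then g x y z else 0)"
  note [measurable] = triple_comp[OF g]
  have Sm: "(\<lambda>(x, y, z). S x y z) \<in> borel_measurable lborel3" unfolding S_def by measurable
  note Sc [measurable] = triple_comp[OF Sm]
  let ?J = "\<lambda>f :: real \<Rightarrow> real \<Rightarrow> real \<Rightarrow> ennreal. \<integral>\<^sup>+ x. \<integral>\<^sup>+ y. \<integral>\<^sup>+ z. f x y z \<partial>lborel \<partial>lborel \<partial>lborel"
  have m: "(\<lambda>(x, y, z). S y x z) \<in> borel_measurable lborel3" "(\<lambda>(x, y, z). S x z y) \<in> borel_measurable lborel3"
    "(\<lambda>(x, y, z). S z x y) \<in> borel_measurable lborel3" "(\<lambda>(x, y, z). S y z x) \<in> borel_measurable lborel3" "(\<lambda>(x, y, z). S z y x) \<in> borel_measurable lborel3"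
    by measurable
  have J12: "?J (\<lambda>x y z. S y x z) = ?J S" by (rule nn_integral3_swap12[OF Sm])
  have J23: "?J (\<lambda>x y z. S x z y) = ?J S" by (rule nn_integral3_swap23[OF Sm])
  have J231: "?J (\<lambda>x y z. S y z x) = ?J S"
    using nn_integral3_swap12[OF m(2)] J23 by simp
  have J312: "?J (\<lambda>x y z. S z x y) = ?J S"
    using nn_integral3_swap23[OF m(1)] J12 by simp
  have J321: "?J (\<lambda>x y z. S z y x) = ?J S"
    using nn_integral3_swap12[OF m(3)] J312 by simp
  have "?J g = ?J (\<lambda>x y z. ((S x y z + S y x z) + (S x z y + S z x y)) + (S y z x + S z y x))"
  proof (rule nn_integral_cong)
    fix x :: real
    show "(\<integral>\<^sup>+ y. \<integral>\<^sup>+ z. g x y z \<partial>lborel \<partial>lborel) = (\<integral>\<^sup>+ y. \<integral>\<^sup>+ z. ((S x y z + S y x z) + (S x z y + S z x y)) + (S y z x + S z y x) \<partial>lborel \<partial>lborel)"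
    proof (rule nn_integral_cong_AE, use AE_lborel_singleton[of x] in eventually_elim)
      case (elim y)
      show "(\<integral>\<^sup>+ z. g x y z \<partial>lborel) = (\<integral>\<^sup>+ z. ((S x y z + S y x z) + (S x z y + S z x y)) + (S y z x + S z y x) \<partial>lborel)"
      proof (rule nn_integral_cong_AE, use AE_lborel_singleton[of x] AE_lborel_singleton[of y] in eventually_elim)
        case (elim z)
        have gs: "g y x z = g x y z" "g x z y = g x y z" "g z x y = g x y z" "g y z x = g x y z" "g z y x = g x y z"
          using sym by metis+
        consider "z < y" "y < x" | "z < x" "x < y" | "y < z" "z < x" | "y < x" "x < z" | "x < z" "z < y" | "x < y" "y < z"
          using elim \<open>y \<noteq> x\<close> by linarith
        then show ?case unfolding S_def gs by cases auto
      qed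
    qed
  qed
  also have "\<dots> = 6 * ?J S"
  proof -
    have m1: "(\<lambda>(x, y, z). S x y z + S y x z) \<in> borel_measurable lborel3" "(\<lambda>(x, y, z). S x z y + S z x y) \<in> borel_measurable lborel3"
      "(\<lambda>(x, y, z). S y z x + S z y x) \<in> borel_measurable lborel3" "(\<lambda>(x, y, z). (S x y z + S y x z) + (S x z y + S z x y)) \<in> borel_measurable lborel3"
      by measurable
    have "(j + j) + (j + j) + (j + j) = 6 * j" for j :: ennreal
    proof -
      have "(j + j) + (j + j) + (j + j) = (1 + 1 + (1 + 1) + (1 + 1)) * j" by (simp only: distrib_right mult_1_left)
      then show ?thesis by simp
    qed
    then show ?thesis
      unfolding nn_integral3_add[OF m1(4,3)] nn_integral3_add[OF m1(1,2)] nn_integral3_add[OF Sm m(1)] nn_integral3_add[OF m(2,3)] nn_integral3_add[OF m(4,5)]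
        J12 J23 J231 J312 J321 .
  qed
  finally show ?thesis unfolding S_def .
qed

text \<open>The radius is \<open>r = x + y\<close> and the angle is the ratio
  \<open>t = y / r\<close>, so a triangle with apex at the origin becomes a rectangle and
  homogeneous forms split off a power of \<open>r\<close>. The Jacobian is \<open>r\<close>.\<close>

lemma nn_integral2_polar:
  fixes f :: "real \<Rightarrow> real \<Rightarrow> ennreal"
  assumes f: "(\<lambda>(x, y). f x y) \<in> borel_measurable (lborel \<Otimes>\<^sub>M lborel)"
    and zero: "\<And>x y. \<not> (0 \<le> x \<and> 0 \<le> y) \<Longrightarrow> f x y = 0"
  shows "(\<integral>\<^sup>+ x. \<integral>\<^sup>+ y. f x y \<partial>lborel \<partial>lborel) =
    (\<integral>\<^sup>+ r. (if 0 \<le> r then ennreal r * (\<integral>\<^sup>+ t. f (r * (1 - t)) (r * t) \<partial>lborel) else 0) \<partial>lborel)"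
proof -
  note [measurable] = meas2_comp[OF f]
  have "(\<integral>\<^sup>+ x. \<integral>\<^sup>+ y. f x y \<partial>lborel \<partial>lborel) = (\<integral>\<^sup>+ y. \<integral>\<^sup>+ x. f x y \<partial>lborel \<partial>lborel)"
    by (rule lborel_pair.Fubini'[symmetric]) measurable
  also have "\<dots> = (\<integral>\<^sup>+ y. \<integral>\<^sup>+ r. f (r - y) y \<partial>lborel \<partial>lborel)"
  proof (rule nn_integral_cong)
    fix y :: real
    have "(\<integral>\<^sup>+ x. f x y \<partial>lborel) = ennreal \<bar>1\<bar> * (\<integral>\<^sup>+ r. f (- y + 1 * r) y \<partial>lborel)"
      by (rule nn_integral_real_affine) auto
    then show "(\<integral>\<^sup>+ x. f x y \<partial>lborel) = (\<integral>\<^sup>+ r. f (r - y) y \<partial>lborel)" by simp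
  qed
  also have "\<dots> = (\<integral>\<^sup>+ r. \<integral>\<^sup>+ y. f (r - y) y \<partial>lborel \<partial>lborel)"
    by (rule lborel_pair.Fubini'[symmetric]) measurable
  also have "\<dots> = (\<integral>\<^sup>+ r. (if 0 \<le> r then ennreal r * (\<integral>\<^sup>+ t. f (r * (1 - t)) (r * t) \<partial>lborel) else 0) \<partial>lborel)"
  proof (rule nn_integral_cong_AE, use AE_lborel_singleton[of 0] in eventually_elim)
    case (elim r)
    show ?case
    proof (cases "0 \<le> r")
      case True
      then have r: "0 < r" using elim by simp
      have "(\<integral>\<^sup>+ y. f (r - y) y \<partial>lborel) = ennreal \<bar>r\<bar> * (\<integral>\<^sup>+ t. f (r - (0 + r * t)) (0 + r * t) \<partial>lborel)"
        using r by (intro nn_integral_real_affine[of "\<lambda>y. f (r - y) y" r 0]) auto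
      also have "(\<lambda>t. f (r - (0 + r * t)) (0 + r * t)) = (\<lambda>t. f (r * (1 - t)) (r * t))"
        by (simp add: algebra_simps)
      finally show ?thesis using r by simp
    next
      case False
      have "f (r - y) y = 0" for y
        by (rule zero) (use False in linarith)
      then show ?thesis using False by simp
    qed
  qed
  finally show ?thesis .
qed

text \<open>A point is \<open>r\<close> times a point of the plane \<open>x + y = 1\<close>;
  rescaling the third coordinate as well contributes the second factor \<open>r\<close>.\<close>

lemma nn_integral3_polar:
  fixes f :: "real \<Rightarrow> real \<Rightarrow> real \<Rightarrow> ennreal"
  assumes f: "(\<lambda>(x, y, z). f x y z) \<in> borel_measurable lborel3"
    and zero: "\<And>x y z. \<not> (0 \<le> x \<and> 0 \<le> y) \<Longrightarrow> f x y z = 0"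
  shows "(\<integral>\<^sup>+ x. \<integral>\<^sup>+ y. \<integral>\<^sup>+ z. f x y z \<partial>lborel \<partial>lborel \<partial>lborel) =
    (\<integral>\<^sup>+ r. (if 0 \<le> r then ennreal (r\<^sup>2) * (\<integral>\<^sup>+ t. \<integral>\<^sup>+ z. f (r * (1 - t)) (r * t) (r * z) \<partial>lborel \<partial>lborel) else 0) \<partial>lborel)"
proof -
  note [measurable] = triple_comp[OF f]
  have "(\<integral>\<^sup>+ x. \<integral>\<^sup>+ y. \<integral>\<^sup>+ z. f x y z \<partial>lborel \<partial>lborel \<partial>lborel) =
    (\<integral>\<^sup>+ r. (if 0 \<le> r then ennreal r * (\<integral>\<^sup>+ t. \<integral>\<^sup>+ z. f (r * (1 - t)) (r * t) z \<partial>lborel \<partial>lborel) else 0) \<partial>lborel)"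
    by (rule nn_integral2_polar) (measurable, simp add: zero)
  also have "\<dots> = (\<integral>\<^sup>+ r. (if 0 \<le> r then ennreal (r\<^sup>2) * (\<integral>\<^sup>+ t. \<integral>\<^sup>+ z. f (r * (1 - t)) (r * t) (r * z) \<partial>lborel \<partial>lborel) else 0) \<partial>lborel)"
  proof (rule nn_integral_cong_AE, use AE_lborel_singleton[of 0] in eventually_elim)
    case (elim r)
    show ?case
    proof (rule if_cong[OF refl _ refl])
      assume "0 \<le> r"
      then have r: "0 < r" using elim by simp
      have inner: "(\<integral>\<^sup>+ z. f (r * (1 - t)) (r * t) z \<partial>lborel) = ennreal r * (\<integral>\<^sup>+ z. f (r * (1 - t)) (r * t) (r * z) \<partial>lborel)" for t
      proof -
        have "(\<integral>\<^sup>+ z. f (r * (1 - t)) (r * t) z \<partial>lborel) = ennreal \<bar>r\<bar> * (\<integral>\<^sup>+ z. f (r * (1 - t)) (r * t) (0 + r * z) \<partial>lborel)"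
          using r by (intro nn_integral_real_affine) auto
        then show ?thesis using r by simp
      qed
      have "ennreal r * (\<integral>\<^sup>+ t. \<integral>\<^sup>+ z. f (r * (1 - t)) (r * t) z \<partial>lborel \<partial>lborel) =
         ennreal r * (ennreal r * (\<integral>\<^sup>+ t. \<integral>\<^sup>+ z. f (r * (1 - t)) (r * t) (r * z) \<partial>lborel \<partial>lborel))"
        unfolding inner by (subst nn_integral_cmult) measurable
      also have "\<dots> = ennreal (r\<^sup>2) * (\<integral>\<^sup>+ t. \<integral>\<^sup>+ z. f (r * (1 - t)) (r * t) (r * z) \<partial>lborel \<partial>lborel)"
        using r by (simp add: power2_eq_square ennreal_mult mult.assoc)
      finally show "ennreal r * (\<integral>\<^sup>+ t. \<integral>\<^sup>+ z. f (r * (1 - t)) (r * t) z \<partial>lborel \<partial>lborel) =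
        ennreal (r\<^sup>2) * (\<integral>\<^sup>+ t. \<integral>\<^sup>+ z. f (r * (1 - t)) (r * t) (r * z) \<partial>lborel \<partial>lborel)" .
    qed
  qed
  finally show ?thesis .
qed

section \<open>Moments over a cross-section of the sorted cone\<close>

definition wedge :: "real \<Rightarrow> real \<Rightarrow> bool" where
  "wedge t z \<longleftrightarrow> 0 \<le> z \<and> z \<le> t \<and> t \<le> 1 / 2"

text \<open>\<open>Xq 1\<close> at the point \<open>(1 - t, t, z)\<close> of the plane
  \<open>z1 + z2 = 1\<close>. There the conditions \<open>0 \<le> z3 \<le> z2 \<le> z1\<close>
  become \<open>wedge t z\<close>.\<close>

definition Wq :: "real \<Rightarrow> real \<Rightarrow> real" where
  "Wq t z = 2 * t * (1 - t) - z\<^sup>2"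

text \<open>\<open>Wq\<close> on the side \<open>z = t\<close> of the wedge, rescaled to the unit
  interval: \<open>Pq t = Wq (t / 2) (t / 2)\<close>.\<close>

definition Pq :: "real \<Rightarrow> real" where
  "Pq t = t * (4 - 3 * t) / 4"

definition IW :: "(real \<Rightarrow> real \<Rightarrow> ennreal) \<Rightarrow> ennreal" where
  "IW h = (\<integral>\<^sup>+ t. \<integral>\<^sup>+ z. (if wedge t z then h t z else 0) \<partial>lborel \<partial>lborel)"

lemma wedge_measurable [measurable]:
  assumes [measurable]: "f \<in> borel_measurable M" "g \<in> borel_measurable M"
  shows "Measurable.pred M (\<lambda>x. wedge (f x) (g x))"
  unfolding wedge_def by measurable

lemma Wq_measurable [measurable]:
  assumes [measurable]: "f \<in> borel_measurable M" "g \<in> borel_measurable M"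
  shows "(\<lambda>x. Wq (f x) (g x)) \<in> borel_measurable M"
  unfolding Wq_def by measurable

lemma IW_cong: "(\<And>t z. wedge t z \<Longrightarrow> g t z = h t z) \<Longrightarrow> IW g = IW h"
  unfolding IW_def by (intro nn_integral_cong if_cong refl)

lemma IW_add:
  assumes "meas2 g" "meas2 h"
  shows "IW (\<lambda>t z. g t z + h t z) = IW g + IW h"
proof -
  note [measurable] = meas2_comp[OF assms(1)] meas2_comp[OF assms(2)]
  show ?thesis
    unfolding IW_def
    by (subst nn_integral_add[symmetric], measurable, subst nn_integral_add[symmetric], measurable)
       (intro nn_integral_cong, simp)
qed

lemma IW_cmult:
  assumes "meas2 h"
  shows "IW (\<lambda>t z. c * h t z) = c * IW h"
proof -
  note [measurable] = meas2_comp[OF assms]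
  show ?thesis
    unfolding IW_def
    by (subst nn_integral_cmult[symmetric], measurable, subst nn_integral_cmult[symmetric], measurable)
       (intro nn_integral_cong, simp)
qed

lemma IW_le_1:
  assumes "\<And>t z. wedge t z \<Longrightarrow> h t z \<le> 1"
  shows "IW h \<le> 1"
  unfolding IW_def
proof (rule nn_integral_Icc_le_1)
  fix t :: real
  show "(\<integral>\<^sup>+ z. (if wedge t z then h t z else 0) \<partial>lborel) \<le> 1"
    by (rule nn_integral_Icc_le_1) (use assms in \<open>auto simp: wedge_def\<close>)
next
  fix t :: real assume t: "\<not> (0 \<le> t \<and> t \<le> 1)"
  have "\<not> wedge t z" for z using t unfolding wedge_def by linarith
  then show "(\<integral>\<^sup>+ z. (if wedge t z then h t z else 0) \<partial>lborel) = 0" by simp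
qed

lemma Wq_bounds:
  assumes "wedge t z"
  shows "0 \<le> Wq t z" "Wq t z \<le> 1"
proof -
  have *: "0 \<le> z" "z \<le> t" "t \<le> 1 / 2" using assms unfolding wedge_def by blast+
  then have "z\<^sup>2 \<le> t\<^sup>2" by (intro power_mono)
  moreover have "0 \<le> t * (2 - 3 * t)" using * by (intro mult_nonneg_nonneg) linarith+
  ultimately show "0 \<le> Wq t z" unfolding Wq_def by (simp add: power2_eq_square algebra_simps)
  have "2 * t * (1 - t) \<le> 1" using * by (intro edge_quad_bounds) linarith+
  then show "Wq t z \<le> 1" unfolding Wq_def using zero_le_power2[of z] by linarith
qed

lemma Pq_bounds:
  assumes "0 \<le> t" "t \<le> 1"
  shows "0 \<le> Pq t" "Pq t \<le> 1"
proof -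
  show "0 \<le> Pq t" unfolding Pq_def using assms by simp
  have "0 \<le> (2 - 3 * t)\<^sup>2 / 12 + 2 / 3" by simp
  then show "Pq t \<le> 1" unfolding Pq_def by (simp add: power2_eq_square field_simps)
qed

definition c_seq :: "nat \<Rightarrow> real" where
  "c_seq n = enn2real (IW (\<lambda>t z. ennreal (Wq t z ^ n)))"

definition e_seq :: "nat \<Rightarrow> real" where
  "e_seq n = enn2real (I1 (\<lambda>t. Pq t ^ n))"

text \<open>The integral of \<open>Xq 1 ^ n\<close> along the ray from the origin to a wedge point
  where \<open>Xq 1\<close> has the value \<open>q\<close>; at ratio \<open>r\<close> the form
  equals \<open>1 - r^2 * (1 - q)\<close>, and \<open>r^2\<close> is the Jacobian.\<close>

definition cone_int :: "nat \<Rightarrow> real \<Rightarrow> ennreal" where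
  "cone_int n q = I1 (\<lambda>r. r\<^sup>2 * (1 - r\<^sup>2 * (1 - q)) ^ n)"

definition k_seq :: "nat \<Rightarrow> real" where
  "k_seq n = enn2real (IW (\<lambda>t z. cone_int n (Wq t z)))"

lemma ennreal_enn2real_le_1: "x \<le> 1 \<Longrightarrow> ennreal (enn2real x) = x"
  using ennreal_one_less_top le_less_trans by (blast intro: ennreal_enn2real)

lemma IW_c: "IW (\<lambda>t z. ennreal (Wq t z ^ n)) = ennreal (c_seq n)"
proof -
  have "IW (\<lambda>t z. ennreal (Wq t z ^ n)) \<le> 1"
    by (intro IW_le_1) (simp add: power_le_one Wq_bounds)
  then show ?thesis unfolding c_seq_def by (simp add: ennreal_enn2real_le_1)
qed

lemma I1_e: "I1 (\<lambda>t. Pq t ^ n) = ennreal (e_seq n)"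
proof -
  have "I1 (\<lambda>t. Pq t ^ n) \<le> 1"
    by (intro I1_le_1 power_le_one Pq_bounds)
  then show ?thesis unfolding e_seq_def by (simp add: ennreal_enn2real_le_1)
qed

lemma cone_quad_bounds:
  fixes r :: real
  assumes "0 \<le> q" "q \<le> 1" "0 \<le> r" "r \<le> 1"
  shows "0 \<le> 1 - r\<^sup>2 * (1 - q)" "1 - r\<^sup>2 * (1 - q) \<le> 1"
proof -
  have "r\<^sup>2 * (1 - q) \<le> 1 * 1" using assms by (intro mult_mono power_le_one) auto
  then show "0 \<le> 1 - r\<^sup>2 * (1 - q)" by simp
  show "1 - r\<^sup>2 * (1 - q) \<le> 1" using assms by simp
qed

lemma cone_int_le_1:
  assumes "0 \<le> q" "q \<le> 1"
  shows "cone_int n q \<le> 1"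
  unfolding cone_int_def
proof (rule I1_le_1)
  fix r :: real assume "0 \<le> r" "r \<le> 1"
  then have "r\<^sup>2 * (1 - r\<^sup>2 * (1 - q)) ^ n \<le> 1 * 1"
    using cone_quad_bounds[OF assms] by (intro mult_mono power_le_one) auto
  then show "r\<^sup>2 * (1 - r\<^sup>2 * (1 - q)) ^ n \<le> 1" by simp
qed

lemma IW_k: "IW (\<lambda>t z. cone_int n (Wq t z)) = ennreal (k_seq n)"
proof -
  have "IW (\<lambda>t z. cone_int n (Wq t z)) \<le> 1"
    by (intro IW_le_1 cone_int_le_1 Wq_bounds)
  then show ?thesis unfolding k_seq_def by (simp add: ennreal_enn2real_le_1)
qed

lemma b_parts_nonneg [simp]: "0 \<le> c_seq n" "0 \<le> e_seq n" "0 \<le> k_seq n"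
  by (simp_all add: c_seq_def e_seq_def k_seq_def)

lemma ennreal_balance:
  assumes "ennreal a * ennreal x + ennreal b = ennreal c * ennreal y + ennreal d" "0 \<le> a" "0 \<le> x" "0 \<le> b" "0 \<le> c" "0 \<le> y" "0 \<le> d"
  shows "a * x + b = c * y + d"
proof -
  have "ennreal (a * x + b) = ennreal (c * y + d)"
    using assms by (simp add: ennreal_mult ennreal_plus)
  then show ?thesis using assms by (subst (asm) ennreal_inj) auto
qed

text \<open>With \<open>Y = 1 - r^2 * (1 - q)\<close> one has \<open>r * Y' = 2 * Y - 2\<close>, so
  the derivative of \<open>r^3 * Y ^ (n + 1)\<close> again has the form of the integrand at two
  consecutive exponents. The end \<open>r = 1\<close> gives \<open>q ^ (n + 1)\<close>, whose
  integral over the wedge is a moment of \<open>Wq\<close>.\<close>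

lemma cone_int_rec:
  assumes q: "0 \<le> q" "q \<le> 1"
  shows "ennreal (2 * real n + 5) * cone_int (Suc n) q = ennreal (2 * (real n + 1)) * cone_int n q + ennreal (q ^ Suc n)"
proof -
  let ?Y = "\<lambda>r::real. 1 - r\<^sup>2 * (1 - q)"
  let ?g1 = "\<lambda>r. (2 * real n + 5) * (r\<^sup>2 * ?Y r ^ Suc n)" and ?g2 = "\<lambda>r. (2 * (real n + 1)) * (r\<^sup>2 * ?Y r ^ n)"
  have "(\<integral>\<^sup>+ r. (if 0 \<le> r \<and> r \<le> 1 then ennreal (?g1 r) else 0) \<partial>lborel) + ennreal (0 ^ 3 * ?Y 0 ^ Suc n) =
    (\<integral>\<^sup>+ r. (if 0 \<le> r \<and> r \<le> 1 then ennreal (?g2 r) else 0) \<partial>lborel) + ennreal (1 ^ 3 * ?Y 1 ^ Suc n)"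
  proof (rule nn_integral_FTC_balance[where F = "\<lambda>r. r ^ 3 * ?Y r ^ Suc n"])
    fix r :: real
    have "((\<lambda>r. r ^ 3 * ?Y r ^ Suc n) has_field_derivative 3 * r\<^sup>2 * ?Y r ^ Suc n + (real (Suc n) * ?Y r ^ n * (- (2 * r * (1 - q)))) * r ^ 3) (at r)"
      by (rule derivative_eq_intros refl | simp)+
    also have "3 * r\<^sup>2 * ?Y r ^ Suc n + (real (Suc n) * ?Y r ^ n * (- (2 * r * (1 - q)))) * r ^ 3 = ?g1 r - ?g2 r"
      by (simp add: power2_eq_square power3_eq_cube algebra_simps)
    finally show "((\<lambda>r. r ^ 3 * ?Y r ^ Suc n) has_field_derivative ?g1 r - ?g2 r) (at r)" .
  next
    show "continuous_on {0..1} ?g1" "continuous_on {0..1} ?g2" by (intro continuous_intros)+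
    show "0 \<le> ?g1 r" "0 \<le> ?g2 r" if "0 \<le> r" "r \<le> 1" for r
      using zero_le_power[OF cone_quad_bounds(1)[OF q that], of n] zero_le_power[OF cone_quad_bounds(1)[OF q that], of "Suc n"]
      by (simp_all only: mult_nonneg_nonneg zero_le_power2 add_nonneg_nonneg of_nat_0_le_iff zero_le_numeral zero_le_one)
  qed (use q in simp_all)
  then have "I1 ?g1 = I1 ?g2 + ennreal (q ^ Suc n)"
    unfolding I1_def by simp
  moreover have "I1 ?g1 = ennreal (2 * real n + 5) * cone_int (Suc n) q" "I1 ?g2 = ennreal (2 * (real n + 1)) * cone_int n q"
    unfolding cone_int_def by (rule I1_cmult; simp)+
  ultimately show ?thesis by simp
qed

lemma cone_int_measurable [measurable]:
  assumes [measurable]: "f \<in> borel_measurable M"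
  shows "(\<lambda>x. cone_int n (f x)) \<in> borel_measurable M"
  unfolding cone_int_def I1_def by measurable

lemma k_rec: "(2 * real n + 5) * k_seq (Suc n) = 2 * (real n + 1) * k_seq n + c_seq (Suc n)"
proof -
  have m: "meas2 (\<lambda>t z. cone_int n (Wq t z))" "meas2 (\<lambda>t z. cone_int (Suc n) (Wq t z))" "meas2 (\<lambda>t z. ennreal (Wq t z ^ Suc n))"
    "meas2 (\<lambda>t z. ennreal (2 * (real n + 1)) * cone_int n (Wq t z))"
    by measurable
  have "IW (\<lambda>t z. ennreal (2 * real n + 5) * cone_int (Suc n) (Wq t z)) =
     IW (\<lambda>t z. ennreal (2 * (real n + 1)) * cone_int n (Wq t z) + ennreal (Wq t z ^ Suc n))"
    by (rule IW_cong, rule cone_int_rec) (rule Wq_bounds, assumption)+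
  then have "ennreal (2 * real n + 5) * ennreal (k_seq (Suc n)) = ennreal (2 * (real n + 1)) * ennreal (k_seq n) + ennreal (c_seq (Suc n))"
    unfolding IW_add[OF m(4,3)] IW_cmult[OF m(1)] IW_cmult[OF m(2)] IW_k IW_c .
  then have "(2 * real n + 5) * k_seq (Suc n) + 0 = 2 * (real n + 1) * k_seq n + c_seq (Suc n)"
    by (intro ennreal_balance) simp_all
  then show ?thesis by simp
qed

text \<open>Rays start at 2/3, the maximum of \<open>Pq\<close>. At 0 the form vanishes, but at 1 it
  is 1/4: this is the origin of the powers of 1/4 and of the extra order in the second
  recurrence.\<close>

lemma e_rec: "(2 * real n + 3) * e_seq (Suc n) = 2 * (real n + 1) / 3 * e_seq n + 1 / 3 * (1 / 4) ^ Suc n"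
proof -
  let ?g1 = "\<lambda>t. (2 * real n + 3) * Pq t ^ Suc n + 0" and ?g2 = "\<lambda>t. 2 * (real n + 1) / 3 * Pq t ^ n"
  have cont: "continuous_on S Pq" for S unfolding Pq_def by (intro continuous_intros) simp
  let ?F = "\<lambda>t. (t - 2 / 3) * Pq t ^ Suc n"
  have "(\<integral>\<^sup>+ t. (if 0 \<le> t \<and> t \<le> 1 then ennreal (?g1 t) else 0) \<partial>lborel) + ennreal (?F 0) =
    (\<integral>\<^sup>+ t. (if 0 \<le> t \<and> t \<le> 1 then ennreal (?g2 t) else 0) \<partial>lborel) + ennreal (?F 1)"
  proof (rule nn_integral_FTC_balance)
    fix t :: real
    have P: "(Pq has_field_derivative - (3 / 2) * (t - 2 / 3)) (at t)"
      unfolding Pq_def by (auto intro!: derivative_eq_intros simp: field_simps)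
    have "(?F has_field_derivative Pq t ^ Suc n + (real (Suc n) * Pq t ^ n * (- (3 / 2) * (t - 2 / 3))) * (t - 2 / 3)) (at t)"
      by (rule derivative_eq_intros P refl | simp)+
    also have "Pq t ^ Suc n + (real (Suc n) * Pq t ^ n * (- (3 / 2) * (t - 2 / 3))) * (t - 2 / 3) =
       Pq t ^ Suc n - 3 / 2 * real (Suc n) * Pq t ^ n * ((t - 2 / 3) * (t - 2 / 3))"
      by (simp only: mult_ac minus_mult_left[symmetric] minus_mult_right[symmetric] diff_conv_add_uminus)
    also have "(t - 2 / 3) * (t - 2 / 3) = 4 / 9 - 4 / 3 * Pq t"
      unfolding Pq_def by (simp add: field_simps)
    also have "Pq t ^ Suc n - 3 / 2 * real (Suc n) * Pq t ^ n * (4 / 9 - 4 / 3 * Pq t) = ?g1 t - ?g2 t"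
      by (simp add: field_simps)
    finally show "(?F has_field_derivative ?g1 t - ?g2 t) (at t)" .
  next
    show "continuous_on {0..1} ?g1" "continuous_on {0..1} ?g2" by (intro continuous_intros cont)+
    show "0 \<le> ?g1 t" "0 \<le> ?g2 t" if "0 \<le> t" "t \<le> 1" for t
      using Pq_bounds(1)[OF that] by simp_all
  qed (simp_all add: Pq_def)
  then have "I1 ?g1 = I1 ?g2 + ennreal (1 / 3 * (1 / 4) ^ Suc n)"
    unfolding I1_def by (simp add: Pq_def)
  moreover have [measurable]: "Pq \<in> borel_measurable borel" unfolding Pq_def by measurable
  have "I1 ?g1 = ennreal (2 * real n + 3) * ennreal (e_seq (Suc n))" "I1 ?g2 = ennreal (2 * (real n + 1) / 3) * ennreal (e_seq n)"
    unfolding I1_e[symmetric] add_0_right by (rule I1_cmult; simp)+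
  ultimately have "ennreal (2 * real n + 3) * ennreal (e_seq (Suc n)) + ennreal 0 = ennreal (2 * (real n + 1) / 3) * ennreal (e_seq n) + ennreal (1 / 3 * (1 / 4) ^ Suc n)"
    by simp
  then have "(2 * real n + 3) * e_seq (Suc n) + 0 = 2 * (real n + 1) / 3 * e_seq n + 1 / 3 * (1 / 4) ^ Suc n"
    by (rule ennreal_balance) simp_all
  then show ?thesis by simp
qed

text \<open>The integral of \<open>Wq ^ n\<close> along a ray from the corner
  \<open>(1/2, 0)\<close> of the wedge, where \<open>Wq = 1/2\<close>, to the opposite side
  \<open>z = t\<close>, reached at \<open>r = 1/2\<close>, where \<open>Wq\<close> has the value
  \<open>q\<close>; the factor \<open>r\<close> is the Jacobian.\<close>

definition disc_int :: "nat \<Rightarrow> real \<Rightarrow> ennreal" where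
  "disc_int n q = (\<integral>\<^sup>+ r. (if 0 \<le> r \<and> r \<le> 1 / 2 then ennreal (r * (1 / 2 - r\<^sup>2 * (2 - 4 * q)) ^ n) else 0) \<partial>lborel)"

lemma disc_quad_nonneg:
  fixes r :: real
  assumes "0 \<le> q" "0 \<le> r" "r \<le> 1 / 2"
  shows "0 \<le> 1 / 2 - r\<^sup>2 * (2 - 4 * q)"
proof -
  have "r\<^sup>2 \<le> (1 / 2)\<^sup>2" using assms by (intro power_mono)
  then have "r\<^sup>2 \<le> 1 / 4" by (simp add: power2_eq_square)
  moreover have "0 \<le> r\<^sup>2 * q" using assms by simp
  ultimately show ?thesis by (simp add: algebra_simps)
qed

text \<open>The corner \<open>(1/2, 0)\<close> is the critical point of \<open>Wq\<close>, so along
  the ray \<open>r * Y' = 2 * Y - 1\<close> and the derivative of \<open>r^2 * Y ^ (n + 1)\<close>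
  closes up. Averaged over the rays, the end value at \<open>r = 1/2\<close> becomes a quarter of
  \<open>e_seq\<close>.\<close>

lemma disc_int_rec:
  assumes q: "0 \<le> q"
  shows "ennreal (2 * real n + 4) * disc_int (Suc n) q = ennreal (real n + 1) * disc_int n q + ennreal (1 / 4 * q ^ Suc n)"
proof -
  let ?Y = "\<lambda>r::real. 1 / 2 - r\<^sup>2 * (2 - 4 * q)"
  let ?g1 = "\<lambda>r. (2 * real n + 4) * (r * ?Y r ^ Suc n)" and ?g2 = "\<lambda>r. (real n + 1) * (r * ?Y r ^ n)"
  have bal: "(\<integral>\<^sup>+ r. (if 0 \<le> r \<and> r \<le> 1 / 2 then ennreal (?g1 r) else 0) \<partial>lborel) + ennreal (0\<^sup>2 * ?Y 0 ^ Suc n) =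
    (\<integral>\<^sup>+ r. (if 0 \<le> r \<and> r \<le> 1 / 2 then ennreal (?g2 r) else 0) \<partial>lborel) + ennreal ((1 / 2)\<^sup>2 * ?Y (1 / 2) ^ Suc n)"
  proof (rule nn_integral_FTC_balance[where F = "\<lambda>r. r\<^sup>2 * ?Y r ^ Suc n"])
    fix r :: real
    have "((\<lambda>r. r\<^sup>2 * ?Y r ^ Suc n) has_field_derivative 2 * r * ?Y r ^ Suc n + (real (Suc n) * ?Y r ^ n * (- (2 * r * (2 - 4 * q)))) * r\<^sup>2) (at r)"
      by (rule derivative_eq_intros refl | simp)+
    also have "2 * r * ?Y r ^ Suc n + (real (Suc n) * ?Y r ^ n * (- (2 * r * (2 - 4 * q)))) * r\<^sup>2 = ?g1 r - ?g2 r"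
      by (simp add: power2_eq_square algebra_simps)
    finally show "((\<lambda>r. r\<^sup>2 * ?Y r ^ Suc n) has_field_derivative ?g1 r - ?g2 r) (at r)" .
  next
    show "continuous_on {0..1 / 2} ?g1" "continuous_on {0..1 / 2} ?g2" by (intro continuous_intros)+
    show "0 \<le> ?g1 r" "0 \<le> ?g2 r" if "0 \<le> r" "r \<le> 1 / 2" for r
      using zero_le_power[OF disc_quad_nonneg[OF q that], of n] zero_le_power[OF disc_quad_nonneg[OF q that], of "Suc n"] that
      by (simp_all only: mult_nonneg_nonneg add_nonneg_nonneg of_nat_0_le_iff zero_le_numeral zero_le_one)
    show "0 \<le> (1 / 2)\<^sup>2 * ?Y (1 / 2) ^ Suc n"
      using disc_quad_nonneg[OF q, of "1 / 2"] by (intro mult_nonneg_nonneg zero_le_power; simp)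
  qed simp_all
  have boundary: "(1 / 2)\<^sup>2 * ?Y (1 / 2) ^ Suc n = 1 / 4 * q ^ Suc n"
  proof -
    have "?Y (1 / 2) = q" by (simp add: power2_eq_square field_simps)
    then show ?thesis by (simp add: power2_eq_square)
  qed
  have "(\<integral>\<^sup>+ r. (if 0 \<le> r \<and> r \<le> 1 / 2 then ennreal (?g1 r) else 0) \<partial>lborel) =
    (\<integral>\<^sup>+ r. (if 0 \<le> r \<and> r \<le> 1 / 2 then ennreal (?g2 r) else 0) \<partial>lborel) + ennreal (1 / 4 * q ^ Suc n)"
    using bal unfolding boundary by simp
  moreover have "(\<integral>\<^sup>+ r. (if 0 \<le> r \<and> r \<le> 1 / 2 then ennreal (c * (r * ?Y r ^ k)) else 0) \<partial>lborel) = ennreal c * disc_int k q"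
    if "0 \<le> c" for c k
    unfolding disc_int_def
    by (subst nn_integral_cmult[symmetric], measurable) (intro nn_integral_cong, simp add: ennreal_mult'[OF that])
  ultimately show ?thesis by simp
qed

lemma disc_int_measurable [measurable]:
  assumes [measurable]: "f \<in> borel_measurable M"
  shows "(\<lambda>x. disc_int n (f x)) \<in> borel_measurable M"
  unfolding disc_int_def by measurable

definition I1e :: "(real \<Rightarrow> ennreal) \<Rightarrow> ennreal" where
  "I1e h = (\<integral>\<^sup>+ t. (if 0 \<le> t \<and> t \<le> 1 then h t else 0) \<partial>lborel)"

text \<open>Polar coordinates \<open>1 / 2 - t = r (1 - \<tau>)\<close>, \<open>z = r \<tau>\<close> centred at the corner \<open>(1 / 2, 0)\<close> of the wedge.\<close>

lemma c_seq_polar: "ennreal (c_seq n) = I1e (\<lambda>\<tau>. disc_int n (Pq \<tau>))"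
proof -
  define f where "f x y = (if 0 \<le> x \<and> 0 \<le> y \<and> x + y \<le> 1 / 2 then ennreal ((1 / 2 - 2 * x\<^sup>2 - y\<^sup>2) ^ n) else 0)" for x y :: real
  have f [measurable]: "(\<lambda>(x, y). f x y) \<in> borel_measurable (lborel \<Otimes>\<^sub>M lborel)" unfolding f_def by measurable
  have "ennreal (c_seq n) = (\<integral>\<^sup>+ t. \<integral>\<^sup>+ z. (if wedge t z then ennreal (Wq t z ^ n) else 0) \<partial>lborel \<partial>lborel)"
    unfolding IW_c[symmetric] IW_def by (rule refl)
  also have "\<dots> = (\<integral>\<^sup>+ x. \<integral>\<^sup>+ z. (if wedge (1 / 2 - x) z then ennreal (Wq (1 / 2 - x) z ^ n) else 0) \<partial>lborel \<partial>lborel)"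
    by (rule nn_integral_reflect) measurable
  also have "\<dots> = (\<integral>\<^sup>+ x. \<integral>\<^sup>+ y. f x y \<partial>lborel \<partial>lborel)"
  proof (intro nn_integral_cong)
    fix x y :: real
    have "wedge (1 / 2 - x) y \<longleftrightarrow> 0 \<le> x \<and> 0 \<le> y \<and> x + y \<le> 1 / 2" unfolding wedge_def by linarith
    moreover have "Wq (1 / 2 - x) y = 1 / 2 - 2 * x\<^sup>2 - y\<^sup>2" unfolding Wq_def by (simp add: power2_eq_square algebra_simps)
    ultimately show "(if wedge (1 / 2 - x) y then ennreal (Wq (1 / 2 - x) y ^ n) else 0) = f x y" unfolding f_def by simp
  qed
  also have "\<dots> = (\<integral>\<^sup>+ r. (if 0 \<le> r then ennreal r * (\<integral>\<^sup>+ t. f (r * (1 - t)) (r * t) \<partial>lborel) else 0) \<partial>lborel)"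
    by (rule nn_integral2_polar[OF f]) (metis f_def)
  also have "\<dots> = (\<integral>\<^sup>+ r. \<integral>\<^sup>+ t. (if 0 \<le> t \<and> t \<le> 1 then (if 0 \<le> r \<and> r \<le> 1 / 2 then ennreal (r * (1 / 2 - r\<^sup>2 * (2 - 4 * Pq t)) ^ n) else 0) else 0) \<partial>lborel \<partial>lborel)"
  proof (rule nn_integral_cong_AE, use AE_lborel_singleton[of 0] in eventually_elim)
    case (elim r)
    show ?case
    proof (cases "0 \<le> r")
      case True
      then have r: "0 < r" using elim by simp
      have "ennreal r * f (r * (1 - t)) (r * t) = (if 0 \<le> t \<and> t \<le> 1 then (if 0 \<le> r \<and> r \<le> 1 / 2 then ennreal (r * (1 / 2 - r\<^sup>2 * (2 - 4 * Pq t)) ^ n) else 0) else 0)" for t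
      proof -
        have iff: "(0 \<le> r * (1 - t) \<and> 0 \<le> r * t \<and> r * (1 - t) + r * t \<le> 1 / 2) \<longleftrightarrow> (0 \<le> t \<and> t \<le> 1) \<and> r \<le> 1 / 2"
        proof -
          have "r * (1 - t) + r * t = r" by (simp add: algebra_simps)
          then show ?thesis using r by (auto simp: zero_le_mult_iff)
        qed
        have q: "1 / 2 - 2 * (r * (1 - t))\<^sup>2 - (r * t)\<^sup>2 = 1 / 2 - r\<^sup>2 * (2 - 4 * Pq t)"
          unfolding Pq_def by (simp add: power2_eq_square field_simps)
        show ?thesis unfolding f_def iff q using r by (simp add: ennreal_mult')
      qed
      then show ?thesis using r by (subst nn_integral_cmult[symmetric]) simp_all
    next
      case False
      then have "(if 0 \<le> t \<and> t \<le> 1 then (if 0 \<le> r \<and> r \<le> 1 / 2 then ennreal (r * (1 / 2 - r\<^sup>2 * (2 - 4 * Pq t)) ^ n) else 0) else 0) = 0" for t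
        by auto
      then show ?thesis using False by simp
    qed
  qed
  also have "\<dots> = (\<integral>\<^sup>+ t. \<integral>\<^sup>+ r. (if 0 \<le> t \<and> t \<le> 1 then (if 0 \<le> r \<and> r \<le> 1 / 2 then ennreal (r * (1 / 2 - r\<^sup>2 * (2 - 4 * Pq t)) ^ n) else 0) else 0) \<partial>lborel \<partial>lborel)"
    unfolding Pq_def by (rule lborel_pair.Fubini') measurable
  also have "\<dots> = I1e (\<lambda>\<tau>. disc_int n (Pq \<tau>))"
    unfolding I1e_def disc_int_def nn_integral_if_const by (rule refl)
  finally show ?thesis .
qed

lemma c_rec: "(2 * real n + 4) * c_seq (Suc n) = (real n + 1) * c_seq n + e_seq (Suc n) / 4"
proof -
  have P [measurable]: "(\<lambda>x. Pq (f x)) \<in> borel_measurable M" if [measurable]: "f \<in> borel_measurable M" for f :: "'z \<Rightarrow> real" and M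
    unfolding Pq_def by measurable
  have cm: "I1e (\<lambda>t. c * h t) = c * I1e h" if [measurable]: "h \<in> borel_measurable borel" for c h
    unfolding I1e_def by (subst nn_integral_cmult[symmetric], measurable) (intro nn_integral_cong, simp)
  have ad: "I1e (\<lambda>t. g t + h t) = I1e g + I1e h" if [measurable]: "g \<in> borel_measurable borel" "h \<in> borel_measurable borel" for g h
    unfolding I1e_def by (subst nn_integral_add[symmetric], measurable) (intro nn_integral_cong, simp)
  have "I1e (\<lambda>t. ennreal (2 * real n + 4) * disc_int (Suc n) (Pq t)) = I1e (\<lambda>t. ennreal (real n + 1) * disc_int n (Pq t) + ennreal (1 / 4 * Pq t ^ Suc n))"
    unfolding I1e_def by (intro nn_integral_cong if_cong refl disc_int_rec) (simp add: Pq_bounds)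
  also have "\<dots> = ennreal (real n + 1) * I1e (\<lambda>t. disc_int n (Pq t)) + I1e (\<lambda>t. ennreal (1 / 4 * Pq t ^ Suc n))"
    by (subst ad) (measurable, subst cm, measurable)
  also have "I1e (\<lambda>t. ennreal (1 / 4 * Pq t ^ Suc n)) = I1 (\<lambda>t. 1 / 4 * Pq t ^ Suc n)"
    unfolding I1e_def I1_def by (rule refl)
  also have "\<dots> = ennreal (1 / 4) * ennreal (e_seq (Suc n))"
    unfolding I1_e[symmetric] by (rule I1_cmult) simp_all
  also have "\<dots> = ennreal (1 / 4 * e_seq (Suc n))" by (rule ennreal_mult[symmetric]) simp_all
  also have "I1e (\<lambda>t. ennreal (2 * real n + 4) * disc_int (Suc n) (Pq t)) = ennreal (2 * real n + 4) * ennreal (c_seq (Suc n))"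
    unfolding c_seq_polar by (rule cm) measurable
  finally have "ennreal (2 * real n + 4) * ennreal (c_seq (Suc n)) + ennreal 0 = ennreal (real n + 1) * ennreal (c_seq n) + ennreal (1 / 4 * e_seq (Suc n))"
    unfolding c_seq_polar by simp
  then have "(2 * real n + 4) * c_seq (Suc n) + 0 = (real n + 1) * c_seq n + 1 / 4 * e_seq (Suc n)"
    by (rule ennreal_balance) simp_all
  then show ?thesis by simp
qed

section \<open>The four regions of the sorted cube\<close>

lemma nn_integral3_swap13:
  fixes f :: "real \<Rightarrow> real \<Rightarrow> real \<Rightarrow> ennreal"
  assumes f: "(\<lambda>(x, y, z). f x y z) \<in> borel_measurable lborel3"
  shows "(\<integral>\<^sup>+ x. \<integral>\<^sup>+ y. \<integral>\<^sup>+ z. f z y x \<partial>lborel \<partial>lborel \<partial>lborel) = (\<integral>\<^sup>+ x. \<integral>\<^sup>+ y. \<integral>\<^sup>+ z. f x y z \<partial>lborel \<partial>lborel \<partial>lborel)"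
proof -
  note [measurable] = triple_comp[OF f]
  have m: "(\<lambda>(x, y, z). f x z y) \<in> borel_measurable lborel3" "(\<lambda>(x, y, z). f z x y) \<in> borel_measurable lborel3"
    "(\<lambda>(x, y, z). f y x z) \<in> borel_measurable lborel3"
    by measurable
  show ?thesis
    using nn_integral3_swap12[OF m(2)] nn_integral3_swap23[OF m(3)] nn_integral3_swap12[OF f] by simp
qed

lemma nn_integral3_reflect1:
  fixes f :: "real \<Rightarrow> real \<Rightarrow> real \<Rightarrow> ennreal"
  assumes f: "(\<lambda>(x, y, z). f x y z) \<in> borel_measurable lborel3"
  shows "(\<integral>\<^sup>+ x. \<integral>\<^sup>+ y. \<integral>\<^sup>+ z. f (1 - x) y z \<partial>lborel \<partial>lborel \<partial>lborel) = (\<integral>\<^sup>+ x. \<integral>\<^sup>+ y. \<integral>\<^sup>+ z. f x y z \<partial>lborel \<partial>lborel \<partial>lborel)"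
proof -
  note [measurable] = triple_comp[OF f]
  show ?thesis by (rule nn_integral_reflect[symmetric]) measurable
qed

lemma nn_integral3_reflect2:
  fixes f :: "real \<Rightarrow> real \<Rightarrow> real \<Rightarrow> ennreal"
  assumes f: "(\<lambda>(x, y, z). f x y z) \<in> borel_measurable lborel3"
  shows "(\<integral>\<^sup>+ x. \<integral>\<^sup>+ y. \<integral>\<^sup>+ z. f (1 - x) (1 - y) z \<partial>lborel \<partial>lborel \<partial>lborel) = (\<integral>\<^sup>+ x. \<integral>\<^sup>+ y. \<integral>\<^sup>+ z. f x y z \<partial>lborel \<partial>lborel \<partial>lborel)"
proof -
  note [measurable] = triple_comp[OF f]
  show ?thesis
    unfolding nn_integral3_reflect1[OF f, symmetric]
    by (rule nn_integral_cong, rule nn_integral_reflect[symmetric]) measurable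
qed

lemma nn_integral3_reflect3:
  fixes f :: "real \<Rightarrow> real \<Rightarrow> real \<Rightarrow> ennreal"
  assumes f: "(\<lambda>(x, y, z). f x y z) \<in> borel_measurable lborel3"
  shows "(\<integral>\<^sup>+ x. \<integral>\<^sup>+ y. \<integral>\<^sup>+ z. f (1 - x) (1 - y) (1 - z) \<partial>lborel \<partial>lborel \<partial>lborel) = (\<integral>\<^sup>+ x. \<integral>\<^sup>+ y. \<integral>\<^sup>+ z. f x y z \<partial>lborel \<partial>lborel \<partial>lborel)"
proof -
  note [measurable] = triple_comp[OF f]
  show ?thesis
    unfolding nn_integral3_reflect2[OF f, symmetric]
    by (rule nn_integral_cong, rule nn_integral_cong, rule nn_integral_reflect[symmetric]) measurable
qed

text \<open>The region is the cone over the wedge with apex at the origin. The slice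
  \<open>r = 1\<close> is null, and leaving it out lets regions with strict and with weak outer
  boundary use the same formula.\<close>

lemma nn_integral3_cone:
  fixes f :: "real \<Rightarrow> real \<Rightarrow> real \<Rightarrow> ennreal"
  assumes f: "(\<lambda>(x, y, z). f x y z) \<in> borel_measurable lborel3"
    and zero: "\<And>x y z. \<not> (0 \<le> x \<and> 0 \<le> y) \<Longrightarrow> f x y z = 0"
    and eq: "\<And>r t z. 0 < r \<Longrightarrow> r \<noteq> 1 \<Longrightarrow> f (r * (1 - t)) (r * t) (r * z) = (if wedge t z \<and> r \<le> 1 then h r t z else 0)"
  shows "(\<integral>\<^sup>+ x. \<integral>\<^sup>+ y. \<integral>\<^sup>+ z. f x y z \<partial>lborel \<partial>lborel \<partial>lborel) =
    (\<integral>\<^sup>+ r. (if 0 \<le> r \<and> r \<le> 1 then ennreal (r\<^sup>2) * IW (h r) else 0) \<partial>lborel)"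
proof -
  have "(\<integral>\<^sup>+ x. \<integral>\<^sup>+ y. \<integral>\<^sup>+ z. f x y z \<partial>lborel \<partial>lborel \<partial>lborel) =
    (\<integral>\<^sup>+ r. (if 0 \<le> r then ennreal (r\<^sup>2) * (\<integral>\<^sup>+ t. \<integral>\<^sup>+ z. f (r * (1 - t)) (r * t) (r * z) \<partial>lborel \<partial>lborel) else 0) \<partial>lborel)"
    by (rule nn_integral3_polar[OF f zero])
  also have "\<dots> = (\<integral>\<^sup>+ r. (if 0 \<le> r \<and> r \<le> 1 then ennreal (r\<^sup>2) * IW (h r) else 0) \<partial>lborel)"
  proof (rule nn_integral_cong_AE, use AE_lborel_singleton[of 0] AE_lborel_singleton[of 1] in eventually_elim)
    case (elim r)
    consider "r < 0" | "0 < r" "r \<le> 1" | "1 < r" using elim by linarith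
    then show ?case
    proof cases
      case 2
      have "f (r * (1 - t)) (r * t) (r * z) = (if wedge t z then h r t z else 0)" for t z
        using eq[of r t z] 2 elim by simp
      then have K: "(\<integral>\<^sup>+ t. \<integral>\<^sup>+ z. f (r * (1 - t)) (r * t) (r * z) \<partial>lborel \<partial>lborel) = IW (h r)"
        unfolding IW_def by (simp only:)
      have r: "0 \<le> r" "0 \<le> r \<and> r \<le> 1" using 2 by simp_all
      show ?thesis unfolding if_P[OF r(1)] if_P[OF r(2)] K by (rule refl)
    next
      case 3
      have "f (r * (1 - t)) (r * t) (r * z) = 0" for t z
        using eq[of r t z] 3 elim by simp
      then show ?thesis using 3 by simp
    qed simp
  qed
  finally show ?thesis .
qed

lemma wedge_scale:
  "0 < r \<Longrightarrow> (0 \<le> r * z \<and> r * z \<le> r * t \<and> r * t \<le> r * (1 - t)) \<longleftrightarrow> wedge t z"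
  unfolding wedge_def by (simp add: zero_le_mult_iff) linarith

lemma scale_sum: "r * (1 - t) + r * t = (r :: real)"
  by (simp add: algebra_simps)

text \<open>The parts of the cube with \<open>z3 \<le> z2 \<le> z1\<close> on which none, one, two or three of the sums
  \<open>z1 + z2\<close>, \<open>z1 + z3\<close>, \<open>z2 + z3\<close> exceed 1; some arguments are \<open>yi = 1 - zi\<close>.\<close>

definition b_center :: "nat \<Rightarrow> real \<Rightarrow> real \<Rightarrow> real \<Rightarrow> ennreal" where
  "b_center n z1 z2 z3 = (if (0 \<le> z3 \<and> z3 \<le> z2 \<and> z2 \<le> z1) \<and> z1 + z2 \<le> 1 then ennreal (Xq 1 z1 z2 z3 ^ n) else 0)"

definition b_one :: "nat \<Rightarrow> real \<Rightarrow> real \<Rightarrow> real \<Rightarrow> ennreal" where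
  "b_one n y2 y1 z3 = (if (0 \<le> z3 \<and> z3 \<le> y1 \<and> y1 \<le> y2) \<and> y2 + y1 < 1 then ennreal ((2 * y1 * y2 - z3\<^sup>2) ^ n) else 0)"

definition b_two :: "nat \<Rightarrow> real \<Rightarrow> real \<Rightarrow> real \<Rightarrow> ennreal" where
  "b_two n y z2 z3 = (if 0 \<le> y \<and> y < z3 \<and> z3 \<le> z2 \<and> z2 + z3 \<le> 1 then ennreal ((y * (y + 2 * (1 - z2 - z3))) ^ n) else 0)"

definition b_three :: "nat \<Rightarrow> real \<Rightarrow> real \<Rightarrow> real \<Rightarrow> ennreal" where
  "b_three n y1 y2 y3 = (if 0 \<le> y1 \<and> y1 \<le> y2 \<and> y2 \<le> y3 \<and> y2 + y3 < 1 \<and> 1 \<le> y1 + y2 + y3 then ennreal ((y1 + y2 + y3 - 1) ^ (2 * n)) else 0)"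

lemma b_parts_measurable:
  "(\<lambda>(x, y, z). b_center n x y z) \<in> borel_measurable lborel3" "(\<lambda>(x, y, z). b_one n x y z) \<in> borel_measurable lborel3"
  "(\<lambda>(x, y, z). b_two n x y z) \<in> borel_measurable lborel3" "(\<lambda>(x, y, z). b_three n x y z) \<in> borel_measurable lborel3"
  unfolding b_center_def b_one_def b_two_def b_three_def by measurable

text \<open>The form is \<open>Xq 1\<close>, which is not homogeneous, so the radial integral does
  not factor out and is kept as \<open>cone_int\<close>.\<close>

lemma b_center_total: "(\<integral>\<^sup>+ x. \<integral>\<^sup>+ y. \<integral>\<^sup>+ z. b_center n x y z \<partial>lborel \<partial>lborel \<partial>lborel) = ennreal (k_seq n)"
proof -
  \<comment> \<open>Both the wedge and the radial condition go into one integrand, so that Tonelli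
    can move the radial integral innermost.\<close>
  define F where "F r t z = (if wedge t z then (if 0 \<le> r \<and> r \<le> 1 then ennreal (r\<^sup>2 * (1 - r\<^sup>2 * (1 - Wq t z)) ^ n) else 0) else 0)" for r t z :: real
  have F: "(\<lambda>(r, t, z). F r t z) \<in> borel_measurable lborel3" unfolding F_def by measurable
  note [measurable] = triple_comp[OF F]
  have F': "(\<lambda>(t, r, z). F r t z) \<in> borel_measurable lborel3" by measurable
  have "(\<integral>\<^sup>+ x. \<integral>\<^sup>+ y. \<integral>\<^sup>+ z. b_center n x y z \<partial>lborel \<partial>lborel \<partial>lborel) =
     (\<integral>\<^sup>+ r. (if 0 \<le> r \<and> r \<le> 1 then ennreal (r\<^sup>2) * IW (\<lambda>t z. ennreal ((1 - r\<^sup>2 * (1 - Wq t z)) ^ n)) else 0) \<partial>lborel)"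
  proof (rule nn_integral3_cone[OF b_parts_measurable(1)])
    fix x y z :: real assume *: "\<not> (0 \<le> x \<and> 0 \<le> y)"
    have "\<not> ((0 \<le> z \<and> z \<le> y \<and> y \<le> x) \<and> x + y \<le> 1)" using * by linarith
    then show "b_center n x y z = 0" unfolding b_center_def by (rule if_not_P)
  next
    fix r t z :: real assume r: "0 < r" "r \<noteq> 1"
    have "Xq 1 (r * (1 - t)) (r * t) (r * z) = 1 - r\<^sup>2 * (1 - Wq t z)"
      unfolding Xq_def Wq_def by (simp add: power2_eq_square algebra_simps)
    then show "b_center n (r * (1 - t)) (r * t) (r * z) = (if wedge t z \<and> r \<le> 1 then ennreal ((1 - r\<^sup>2 * (1 - Wq t z)) ^ n) else 0)"
      unfolding b_center_def wedge_scale[OF r(1)] scale_sum by (simp only:)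
  qed
  also have "\<dots> = (\<integral>\<^sup>+ r. \<integral>\<^sup>+ t. \<integral>\<^sup>+ z. F r t z \<partial>lborel \<partial>lborel \<partial>lborel)"
  proof (rule nn_integral_cong)
    fix r :: real
    show "(if 0 \<le> r \<and> r \<le> 1 then ennreal (r\<^sup>2) * IW (\<lambda>t z. ennreal ((1 - r\<^sup>2 * (1 - Wq t z)) ^ n)) else 0) = (\<integral>\<^sup>+ t. \<integral>\<^sup>+ z. F r t z \<partial>lborel \<partial>lborel)"
    proof (cases "0 \<le> r \<and> r \<le> 1")
      case True
      have m: "meas2 (\<lambda>t z. ennreal ((1 - r\<^sup>2 * (1 - Wq t z)) ^ n))" by measurable
      have "F r t z = (if wedge t z then ennreal (r\<^sup>2) * ennreal ((1 - r\<^sup>2 * (1 - Wq t z)) ^ n) else 0)" for t z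
        unfolding F_def if_P[OF True] ennreal_mult'[OF zero_le_power2] by (rule refl)
      then have "(\<integral>\<^sup>+ t. \<integral>\<^sup>+ z. F r t z \<partial>lborel \<partial>lborel) = IW (\<lambda>t z. ennreal (r\<^sup>2) * ennreal ((1 - r\<^sup>2 * (1 - Wq t z)) ^ n))"
        unfolding IW_def by (simp only:)
      then show ?thesis unfolding if_P[OF True] IW_cmult[OF m] by (rule sym)
    next
      case False
      have "F r t z = 0" for t z unfolding F_def if_not_P[OF False] by simp
      then show ?thesis unfolding if_not_P[OF False] by simp
    qed
  qed
  also have "\<dots> = (\<integral>\<^sup>+ t. \<integral>\<^sup>+ r. \<integral>\<^sup>+ z. F r t z \<partial>lborel \<partial>lborel \<partial>lborel)"
    by (rule nn_integral3_swap12[OF F, symmetric])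
  also have "\<dots> = (\<integral>\<^sup>+ t. \<integral>\<^sup>+ z. \<integral>\<^sup>+ r. F r t z \<partial>lborel \<partial>lborel \<partial>lborel)"
    by (rule nn_integral3_swap23[OF F', symmetric])
  also have "\<dots> = IW (\<lambda>t z. cone_int n (Wq t z))"
    unfolding F_def IW_def cone_int_def I1_def nn_integral_if_const by (rule refl)
  finally show ?thesis unfolding IW_k .
qed

text \<open>In \<open>1 - z2\<close>, \<open>1 - z1\<close>, \<open>z3\<close> the form is
  homogeneous: it is \<open>r^2\<close> times \<open>Wq\<close>. The radius separates and
  contributes the integral of \<open>r ^ (2 * n + 2)\<close>.\<close>

lemma b_one_total: "(\<integral>\<^sup>+ x. \<integral>\<^sup>+ y. \<integral>\<^sup>+ z. b_one n x y z \<partial>lborel \<partial>lborel \<partial>lborel) = ennreal (c_seq n / (2 * real n + 3))"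
proof -
  have "(\<integral>\<^sup>+ x. \<integral>\<^sup>+ y. \<integral>\<^sup>+ z. b_one n x y z \<partial>lborel \<partial>lborel \<partial>lborel) =
     (\<integral>\<^sup>+ r. (if 0 \<le> r \<and> r \<le> 1 then ennreal (r\<^sup>2) * IW (\<lambda>t z. ennreal (r ^ (2 * n)) * ennreal (Wq t z ^ n)) else 0) \<partial>lborel)"
  proof (rule nn_integral3_cone[OF b_parts_measurable(2)])
    fix x y z :: real assume *: "\<not> (0 \<le> x \<and> 0 \<le> y)"
    have "\<not> ((0 \<le> z \<and> z \<le> y \<and> y \<le> x) \<and> x + y < 1)" using * by linarith
    then show "b_one n x y z = 0" unfolding b_one_def by (rule if_not_P)
  next
    fix r t z :: real assume r: "0 < r" "r \<noteq> 1"
    have "2 * (r * t) * (r * (1 - t)) - (r * z)\<^sup>2 = r\<^sup>2 * Wq t z"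
      unfolding Wq_def by (simp add: power2_eq_square algebra_simps)
    then have "ennreal ((2 * (r * t) * (r * (1 - t)) - (r * z)\<^sup>2) ^ n) = ennreal (r ^ (2 * n)) * ennreal (Wq t z ^ n)"
      using r by (simp add: power_mult_distrib power_mult ennreal_mult')
    moreover have "r < 1 \<longleftrightarrow> r \<le> 1" using r by linarith
    ultimately show "b_one n (r * (1 - t)) (r * t) (r * z) = (if wedge t z \<and> r \<le> 1 then ennreal (r ^ (2 * n)) * ennreal (Wq t z ^ n) else 0)"
      unfolding b_one_def wedge_scale[OF r(1)] scale_sum by (simp only:)
  qed
  also have "\<dots> = (\<integral>\<^sup>+ r. ennreal (c_seq n) * (if 0 \<le> r \<and> r \<le> 1 then ennreal (r ^ (2 * n + 2)) else 0) \<partial>lborel)"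
  proof (rule nn_integral_cong)
    fix r :: real
    have m: "meas2 (\<lambda>t z. ennreal (Wq t z ^ n))" by measurable
    have "ennreal (r\<^sup>2) * (ennreal (r ^ (2 * n)) * ennreal (c_seq n)) = ennreal (c_seq n) * ennreal (r ^ (2 * n + 2))"
      unfolding power_add by (simp add: ennreal_mult' mult_ac)
    then show "(if 0 \<le> r \<and> r \<le> 1 then ennreal (r\<^sup>2) * IW (\<lambda>t z. ennreal (r ^ (2 * n)) * ennreal (Wq t z ^ n)) else 0) =
      ennreal (c_seq n) * (if 0 \<le> r \<and> r \<le> 1 then ennreal (r ^ (2 * n + 2)) else 0)"
      unfolding IW_cmult[OF m] IW_c by simp
  qed
  also have "\<dots> = ennreal (c_seq n) * ennreal (1 / (real (2 * n + 2) + 1))"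
    unfolding beta0[symmetric] by (rule nn_integral_cmult) measurable
  also have "\<dots> = ennreal (c_seq n * (1 / (real (2 * n + 2) + 1)))"
    by (rule ennreal_mult[symmetric]) simp_all
  also have "c_seq n * (1 / (real (2 * n + 2) + 1)) = c_seq n / (2 * real n + 3)"
    by (simp add: add.commute)
  finally show ?thesis .
qed

text \<open>The integrand depends on \<open>z2\<close>, \<open>z3\<close> only through
  \<open>u = 1 - z2 - z3\<close>. For fixed \<open>y\<close> and \<open>u\<close> the free variable
  \<open>z3\<close> ranges from \<open>y\<close> to \<open>(1 - u) / 2\<close>, and the length of
  this interval becomes the extra factor.\<close>

lemma b_two_slice:
  "(\<integral>\<^sup>+ z2. \<integral>\<^sup>+ z3. b_two n y z2 z3 \<partial>lborel \<partial>lborel) =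
    (\<integral>\<^sup>+ u. (if 0 \<le> y \<and> 0 \<le> u \<and> u + 2 * y \<le> 1 then ennreal ((y * (y + 2 * u)) ^ n * ((1 - u) / 2 - y)) else 0) \<partial>lborel)"
proof -
  note [measurable] = triple_comp[OF b_parts_measurable(3)]
  have "(\<integral>\<^sup>+ z2. \<integral>\<^sup>+ z3. b_two n y z2 z3 \<partial>lborel \<partial>lborel) = (\<integral>\<^sup>+ z3. \<integral>\<^sup>+ z2. b_two n y z2 z3 \<partial>lborel \<partial>lborel)"
    by (rule lborel_pair.Fubini') measurable
  also have "\<dots> = (\<integral>\<^sup>+ z3. \<integral>\<^sup>+ u. b_two n y (1 - z3 - u) z3 \<partial>lborel \<partial>lborel)"
    by (rule nn_integral_cong, rule nn_integral_reflect) measurable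
  also have "\<dots> = (\<integral>\<^sup>+ u. \<integral>\<^sup>+ z3. b_two n y (1 - z3 - u) z3 \<partial>lborel \<partial>lborel)"
    by (rule lborel_pair.Fubini') measurable
  also have "\<dots> = (\<integral>\<^sup>+ u. (if 0 \<le> y \<and> 0 \<le> u \<and> u + 2 * y \<le> 1 then ennreal ((y * (y + 2 * u)) ^ n * ((1 - u) / 2 - y)) else 0) \<partial>lborel)"
  proof (rule nn_integral_cong)
    fix u :: real
    let ?v = "ennreal ((y * (y + 2 * u)) ^ n)"
    have "(\<integral>\<^sup>+ z3. b_two n y (1 - z3 - u) z3 \<partial>lborel) = (\<integral>\<^sup>+ z. (if 0 \<le> y \<and> 0 \<le> u then (if y \<le> z \<and> z \<le> (1 - u) / 2 then ?v else 0) else 0) \<partial>lborel)"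
    proof (rule nn_integral_cong_AE, use AE_lborel_singleton[of y] in eventually_elim)
      case (elim z)
      have e: "1 - (1 - z - u) - z = u" by simp
      have "(0 \<le> y \<and> y < z \<and> z \<le> 1 - z - u \<and> 1 - z - u + z \<le> 1) \<longleftrightarrow> (0 \<le> y \<and> 0 \<le> u) \<and> (y \<le> z \<and> z \<le> (1 - u) / 2)"
        using elim by (simp add: field_simps) linarith
      then show ?case unfolding b_two_def e by simp
    qed
    also have "\<dots> = (if 0 \<le> y \<and> 0 \<le> u then (\<integral>\<^sup>+ z. (if y \<le> z \<and> z \<le> (1 - u) / 2 then ?v else 0) \<partial>lborel) else 0)"
      by (rule nn_integral_if_const)
    also have "\<dots> = (if 0 \<le> y \<and> 0 \<le> u \<and> u + 2 * y \<le> 1 then ennreal ((y * (y + 2 * u)) ^ n * ((1 - u) / 2 - y)) else 0)"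
    proof (cases "u + 2 * y \<le> 1")
      case True
      then have "y \<le> (1 - u) / 2" by simp
      from nn_integral_interval[OF this, of ?v]
      have i: "(\<integral>\<^sup>+ z. (if y \<le> z \<and> z \<le> (1 - u) / 2 then ?v else 0) \<partial>lborel) = ?v * ennreal ((1 - u) / 2 - y)" .
      have "?v * ennreal ((1 - u) / 2 - y) = ennreal ((y * (y + 2 * u)) ^ n * ((1 - u) / 2 - y))" if "0 \<le> y" "0 \<le> u"
        using that True by (intro ennreal_mult[symmetric]) simp_all
      then show ?thesis unfolding i using True by auto
    next
      case False
      then have none: "(if y \<le> z \<and> z \<le> (1 - u) / 2 then ?v else 0) = 0" for z by auto
      show ?thesis unfolding none using False by simp
    qed
    finally show "(\<integral>\<^sup>+ z3. b_two n y (1 - z3 - u) z3 \<partial>lborel) =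
      (if 0 \<le> y \<and> 0 \<le> u \<and> u + 2 * y \<le> 1 then ennreal ((y * (y + 2 * u)) ^ n * ((1 - u) / 2 - y)) else 0)" .
  qed
  finally show ?thesis .
qed

text \<open>Doubling \<open>y\<close> turns the region into the unit triangle in
  \<open>(u, x)\<close> with \<open>x = 2 * y\<close>, on which the form is
  \<open>r^2 * Pq t\<close> in polar coordinates. The interval length becomes
  \<open>(1 - r) / 2\<close>, so the radius gives \<open>beta1\<close>; the two halves make the 4 in
  the denominator.\<close>

lemma b_two_total:
  "(\<integral>\<^sup>+ x. \<integral>\<^sup>+ y. \<integral>\<^sup>+ z. b_two n x y z \<partial>lborel \<partial>lborel \<partial>lborel) = ennreal (e_seq n / (4 * (2 * real n + 2) * (2 * real n + 3)))"
proof -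
  define f where "f u x = (if 0 \<le> u \<and> 0 \<le> x \<and> u + x \<le> 1 then ennreal ((x / 2 * (x / 2 + 2 * u)) ^ n * ((1 - u - x) / 2)) else 0)" for u x :: real
  have f [measurable]: "(\<lambda>(u, x). f u x) \<in> borel_measurable (lborel \<Otimes>\<^sub>M lborel)" unfolding f_def by measurable
  have half: "ennreal (1 / 2) * ennreal (1 / 2) = ennreal (1 / 4)" by (subst ennreal_mult[symmetric]) simp_all
  let ?G = "\<lambda>y. \<integral>\<^sup>+ u. (if 0 \<le> y \<and> 0 \<le> u \<and> u + 2 * y \<le> 1 then ennreal ((y * (y + 2 * u)) ^ n * ((1 - u) / 2 - y)) else 0) \<partial>lborel"
  have "(\<integral>\<^sup>+ x. \<integral>\<^sup>+ y. \<integral>\<^sup>+ z. b_two n x y z \<partial>lborel \<partial>lborel \<partial>lborel) = (\<integral>\<^sup>+ y. ?G y \<partial>lborel)"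
    unfolding b_two_slice by (rule refl)
  also have "\<dots> = ennreal \<bar>1 / 2\<bar> * (\<integral>\<^sup>+ x. ?G (0 + 1 / 2 * x) \<partial>lborel)"
    by (rule nn_integral_real_affine) auto
  also have "(\<integral>\<^sup>+ x. ?G (0 + 1 / 2 * x) \<partial>lborel) = (\<integral>\<^sup>+ x. \<integral>\<^sup>+ u. f u x \<partial>lborel \<partial>lborel)"
  proof (intro nn_integral_cong)
    fix x u :: real
    have "(0 \<le> 0 + 1 / 2 * x \<and> 0 \<le> u \<and> u + 2 * (0 + 1 / 2 * x) \<le> 1) \<longleftrightarrow> (0 \<le> u \<and> 0 \<le> x \<and> u + x \<le> 1)" by auto
    moreover have "0 + 1 / 2 * x = x / 2" "(1 - u) / 2 - x / 2 = (1 - u - x) / 2" by (simp_all add: diff_divide_distrib)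
    ultimately show "(if 0 \<le> 0 + 1 / 2 * x \<and> 0 \<le> u \<and> u + 2 * (0 + 1 / 2 * x) \<le> 1
        then ennreal (((0 + 1 / 2 * x) * (0 + 1 / 2 * x + 2 * u)) ^ n * ((1 - u) / 2 - (0 + 1 / 2 * x))) else 0) = f u x"
      unfolding f_def by (simp only:)
  qed
  also have "\<dots> = (\<integral>\<^sup>+ u. \<integral>\<^sup>+ x. f u x \<partial>lborel \<partial>lborel)"
    by (rule lborel_pair.Fubini') measurable
  also have "\<dots> = (\<integral>\<^sup>+ r. (if 0 \<le> r then ennreal r * (\<integral>\<^sup>+ t. f (r * (1 - t)) (r * t) \<partial>lborel) else 0) \<partial>lborel)"
    by (rule nn_integral2_polar[OF f]) (metis f_def)
  also have "\<dots> = (\<integral>\<^sup>+ r. ennreal (1 / 2) * ennreal (e_seq n) * (if 0 \<le> r \<and> r \<le> 1 then ennreal ((1 - r) * r ^ (2 * n + 1)) else 0) \<partial>lborel)"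
  proof (rule nn_integral_cong_AE, use AE_lborel_singleton[of 0] in eventually_elim)
    case (elim r)
    consider "r < 0" | "0 < r" "r \<le> 1" | "1 < r" using elim by linarith
    then show ?case
    proof cases
      case 2
      have eq: "f (r * (1 - t)) (r * t) = ennreal (r ^ (2 * n) * ((1 - r) / 2)) * (if 0 \<le> t \<and> t \<le> 1 then ennreal (Pq t ^ n) else 0)" for t
      proof -
        have iff: "(0 \<le> r * (1 - t) \<and> 0 \<le> r * t \<and> r * (1 - t) + r * t \<le> 1) \<longleftrightarrow> 0 \<le> t \<and> t \<le> 1"
          unfolding scale_sum using 2 by (auto simp: zero_le_mult_iff)
        have "1 - r * (1 - t) - r * t = 1 - r" "r * t / 2 * (r * t / 2 + 2 * (r * (1 - t))) = r\<^sup>2 * Pq t"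
          unfolding Pq_def by (simp_all add: power2_eq_square field_simps)
        moreover have "(r\<^sup>2 * Pq t) ^ n * ((1 - r) / 2) = (r ^ (2 * n) * ((1 - r) / 2)) * Pq t ^ n"
          by (simp add: power_mult_distrib power_mult)
        moreover have "0 \<le> r ^ (2 * n) * ((1 - r) / 2)" using 2 by simp
        ultimately show ?thesis unfolding f_def iff by (simp only: ennreal_mult' mult_zero_right if_distrib[where f = "\<lambda>x. _ * x"])
      qed
      have [measurable]: "Pq \<in> borel_measurable borel" unfolding Pq_def by measurable
      have "(\<integral>\<^sup>+ t. f (r * (1 - t)) (r * t) \<partial>lborel) = ennreal (r ^ (2 * n) * ((1 - r) / 2)) * ennreal (e_seq n)"
        unfolding eq I1_e[symmetric] I1_def by (rule nn_integral_cmult) measurable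
      moreover have "ennreal r * (ennreal (r ^ (2 * n) * ((1 - r) / 2)) * ennreal (e_seq n)) = ennreal (1 / 2) * ennreal (e_seq n) * ennreal ((1 - r) * r ^ (2 * n + 1))"
      proof -
        have nn: "0 \<le> r" "0 \<le> r ^ (2 * n) * ((1 - r) / 2)" using 2 by simp_all
        have "ennreal r * (ennreal (r ^ (2 * n) * ((1 - r) / 2)) * ennreal (e_seq n)) = ennreal (r * ((r ^ (2 * n) * ((1 - r) / 2)) * e_seq n))"
          using nn by (simp only: ennreal_mult b_parts_nonneg mult_nonneg_nonneg)
        also have "r * ((r ^ (2 * n) * ((1 - r) / 2)) * e_seq n) = 1 / 2 * e_seq n * ((1 - r) * r ^ (2 * n + 1))" by simp
        also have "ennreal \<dots> = ennreal (1 / 2) * ennreal (e_seq n) * ennreal ((1 - r) * r ^ (2 * n + 1))"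
          using 2 by (simp only: ennreal_mult mult_nonneg_nonneg zero_le_power b_parts_nonneg diff_ge_0_iff_ge zero_le_divide_1_iff zero_le_numeral less_imp_le)
        finally show ?thesis .
      qed
      ultimately show ?thesis using 2 by simp
    next
      case 3
      have "f (r * (1 - t)) (r * t) = 0" for t unfolding f_def scale_sum using 3 by auto
      then show ?thesis using 3 by simp
    qed simp
  qed
  also have "\<dots> = ennreal (1 / 2) * ennreal (e_seq n) * ennreal (1 / ((real (2 * n + 1) + 1) * (real (2 * n + 1) + 2)))"
    unfolding beta1[symmetric] by (rule nn_integral_cmult) measurable
  also have "ennreal \<bar>1 / 2\<bar> * \<dots> = ennreal (1 / 4) * ennreal (e_seq n) * ennreal (1 / ((real (2 * n + 1) + 1) * (real (2 * n + 1) + 2)))"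
    unfolding half[symmetric] by (simp add: mult.assoc)
  also have "\<dots> = ennreal (1 / 4 * e_seq n * (1 / ((real (2 * n + 1) + 1) * (real (2 * n + 1) + 2))))"
    by (subst ennreal_mult[symmetric], simp, simp, subst ennreal_mult[symmetric], simp, simp, rule refl)
  also have "1 / 4 * e_seq n * (1 / ((real (2 * n + 1) + 1) * (real (2 * n + 1) + 2))) = e_seq n / (4 * (2 * real n + 2) * (2 * real n + 3))"
    by (simp add: algebra_simps)
  finally show ?thesis .
qed

text \<open>The form depends only on \<open>s\<close>, the excess of the sum of the three arguments
  over 1. With smallest argument \<open>p\<close>, the condition that the other two add up to less
  than 1 becomes \<open>s < p\<close>, and the middle one ranges from \<open>p\<close> to
  \<open>(1 + s - p) / 2\<close>.\<close>

lemma b_three_slice: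
  "(\<integral>\<^sup>+ q. b_three n p q (1 + s - p - q) \<partial>lborel) =
    (if 0 \<le> s \<and> s < p \<and> 3 * p \<le> 1 + s then ennreal (s ^ (2 * n) * ((1 + s - 3 * p) / 2)) else 0)"
proof -
  let ?v = "ennreal (s ^ (2 * n))"
  have "(\<integral>\<^sup>+ q. b_three n p q (1 + s - p - q) \<partial>lborel) = (\<integral>\<^sup>+ q. (if 0 \<le> s \<and> s < p then (if p \<le> q \<and> q \<le> (1 + s - p) / 2 then ?v else 0) else 0) \<partial>lborel)"
  proof (rule nn_integral_cong)
    fix q :: real
    have e: "p + q + (1 + s - p - q) - 1 = s" by simp
    have "(0 \<le> p \<and> p \<le> q \<and> q \<le> 1 + s - p - q \<and> q + (1 + s - p - q) < 1 \<and> 1 \<le> p + q + (1 + s - p - q)) \<longleftrightarrow>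
      (0 \<le> s \<and> s < p) \<and> (p \<le> q \<and> q \<le> (1 + s - p) / 2)"
      by (simp add: field_simps) linarith
    then show "b_three n p q (1 + s - p - q) = (if 0 \<le> s \<and> s < p then (if p \<le> q \<and> q \<le> (1 + s - p) / 2 then ?v else 0) else 0)"
      unfolding b_three_def e by simp
  qed
  also have "\<dots> = (if 0 \<le> s \<and> s < p then (\<integral>\<^sup>+ q. (if p \<le> q \<and> q \<le> (1 + s - p) / 2 then ?v else 0) \<partial>lborel) else 0)"
    by (rule nn_integral_if_const)
  also have "\<dots> = (if 0 \<le> s \<and> s < p \<and> 3 * p \<le> 1 + s then ennreal (s ^ (2 * n) * ((1 + s - 3 * p) / 2)) else 0)"
  proof (cases "3 * p \<le> 1 + s")
    case True
    then have "p \<le> (1 + s - p) / 2" by simp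
    from nn_integral_interval[OF this, of ?v]
    have i: "(\<integral>\<^sup>+ q. (if p \<le> q \<and> q \<le> (1 + s - p) / 2 then ?v else 0) \<partial>lborel) = ?v * ennreal ((1 + s - p) / 2 - p)" .
    have l: "(1 + s - p) / 2 - p = (1 + s - 3 * p) / 2" by (simp add: field_simps)
    have "?v * ennreal ((1 + s - 3 * p) / 2) = ennreal (s ^ (2 * n) * ((1 + s - 3 * p) / 2))" if "0 \<le> s"
      using that True by (intro ennreal_mult[symmetric]) simp_all
    then show ?thesis unfolding i l using True by auto
  next
    case False
    then have none: "(if p \<le> q \<and> q \<le> (1 + s - p) / 2 then ?v else 0) = 0" for q by auto
    show ?thesis unfolding none using False by simp
  qed
  finally show ?thesis .
qed

text \<open>The smallest argument lies between \<open>s\<close> and a third of the sum,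
  \<open>(1 + s) / 3\<close>; these bounds are compatible exactly for
  \<open>s \<le> 1/2\<close>.\<close>

lemma b_three_slice2:
  "(\<integral>\<^sup>+ p. (if 0 \<le> s \<and> s < p \<and> 3 * p \<le> 1 + s then ennreal (s ^ (2 * n) * ((1 + s - 3 * p) / 2)) else 0) \<partial>lborel) =
    (if 0 \<le> s \<and> s \<le> 1 / 2 then ennreal (s ^ (2 * n) * ((1 - 2 * s)\<^sup>2 / 12)) else 0)"
proof (cases "0 \<le> s \<and> s \<le> 1 / 2")
  case True
  then have le: "s \<le> (1 + s) / 3" by simp
  let ?h = "\<lambda>p. s ^ (2 * n) * ((1 + s - 3 * p) / 2)" and ?H = "\<lambda>p. s ^ (2 * n) * ((1 + s - 3 * p)\<^sup>2 / 12)"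
  have "(\<integral>\<^sup>+ p. (if 0 \<le> s \<and> s < p \<and> 3 * p \<le> 1 + s then ennreal (?h p) else 0) \<partial>lborel) = (\<integral>\<^sup>+ p. (if s \<le> p \<and> p \<le> (1 + s) / 3 then ennreal (?h p) else 0) \<partial>lborel)"
  proof (rule nn_integral_cong_AE, use AE_lborel_singleton[of s] in eventually_elim)
    case (elim p)
    have "(0 \<le> s \<and> s < p \<and> 3 * p \<le> 1 + s) \<longleftrightarrow> (s \<le> p \<and> p \<le> (1 + s) / 3)"
      using True elim by (simp add: field_simps) linarith
    then show ?case by (rule if_cong) (rule refl)+
  qed
  also have "\<dots> = ennreal (?H s - ?H ((1 + s) / 3))"
  proof (rule nn_integral_FTC_neg(1)[OF le])
    fix p :: real assume "s \<le> p" "p \<le> (1 + s) / 3"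
    have "(?H has_field_derivative s ^ (2 * n) * ((2 * (1 + s - 3 * p) * (- 3)) / 12)) (at p)"
      by (rule derivative_eq_intros refl | simp)+
    moreover have "s ^ (2 * n) * ((2 * (1 + s - 3 * p) * (- 3)) / 12) = - ?h p" by (simp add: field_simps)
    ultimately show "(?H has_field_derivative - ?h p) (at p)" by (simp only:)
    show "0 \<le> ?h p" using \<open>p \<le> (1 + s) / 3\<close> True by (intro mult_nonneg_nonneg) simp_all
  qed measurable
  also have "?H s - ?H ((1 + s) / 3) = s ^ (2 * n) * ((1 - 2 * s)\<^sup>2 / 12)" by simp
  finally show ?thesis unfolding if_P[OF True] .
next
  case False
  have none: "(if 0 \<le> s \<and> s < p \<and> 3 * p \<le> 1 + s then ennreal (s ^ (2 * n) * ((1 + s - 3 * p) / 2)) else 0) = 0" for p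
  proof -
    have "\<not> (0 \<le> s \<and> s < p \<and> 3 * p \<le> 1 + s)" using False by linarith
    then show ?thesis by (rule if_not_P)
  qed
  show ?thesis unfolding none if_not_P[OF False] by simp
qed

text \<open>Substituting \<open>s = t / 2\<close> gives \<open>beta2\<close> and turns
  \<open>s ^ (2 * n)\<close> into \<open>(1 / 4) ^ n * t ^ (2 * n)\<close>. The outer arguments are
  exchanged beforehand so that the eliminated one is the largest.\<close>

lemma b_three_total:
  "(\<integral>\<^sup>+ x. \<integral>\<^sup>+ y. \<integral>\<^sup>+ z. b_three n x y z \<partial>lborel \<partial>lborel \<partial>lborel) =
    ennreal ((1 / 4) ^ n / (12 * (2 * real n + 1) * (2 * real n + 2) * (2 * real n + 3)))"
proof -
  note [measurable] = triple_comp[OF b_parts_measurable(4)]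
  have m: "(\<lambda>(x, y, z). b_three n z y x) \<in> borel_measurable lborel3" by measurable
  let ?c = "(1 / 4) ^ n / 6 :: real"
  have "(\<integral>\<^sup>+ x. \<integral>\<^sup>+ y. \<integral>\<^sup>+ z. b_three n x y z \<partial>lborel \<partial>lborel \<partial>lborel) = (\<integral>\<^sup>+ s. \<integral>\<^sup>+ p. \<integral>\<^sup>+ q. b_three n p q (1 + s - p - q) \<partial>lborel \<partial>lborel \<partial>lborel)"
    unfolding nn_integral_slice_sum[OF m, symmetric] by (rule nn_integral3_swap13[OF b_parts_measurable(4), symmetric])
  also have "\<dots> = (\<integral>\<^sup>+ s. (if 0 \<le> s \<and> s \<le> 1 / 2 then ennreal (s ^ (2 * n) * ((1 - 2 * s)\<^sup>2 / 12)) else 0) \<partial>lborel)"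
    unfolding b_three_slice b_three_slice2 by (rule refl)
  also have "\<dots> = ennreal (1 / 2) * (\<integral>\<^sup>+ t. (if 0 \<le> t \<and> t \<le> 1 then ennreal ((1 / 2 * t) ^ (2 * n) * ((1 - 2 * (1 / 2 * t))\<^sup>2 / 12)) else 0) \<partial>lborel)"
    by (rule nn_integral_scale1) simp_all
  also have "(\<integral>\<^sup>+ t. (if 0 \<le> t \<and> t \<le> 1 then ennreal ((1 / 2 * t) ^ (2 * n) * ((1 - 2 * (1 / 2 * t))\<^sup>2 / 12)) else 0) \<partial>lborel) =
     (\<integral>\<^sup>+ t. ennreal ?c * (if 0 \<le> t \<and> t \<le> 1 then ennreal ((1 - t)\<^sup>2 / 2 * t ^ (2 * n)) else 0) \<partial>lborel)"
  proof (rule nn_integral_cong)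
    fix t :: real
    have "(1 / 2 * t) ^ (2 * n) * ((1 - 2 * (1 / 2 * t))\<^sup>2 / 12) = ?c * ((1 - t)\<^sup>2 / 2 * t ^ (2 * n))"
    proof -
      have "(1 / 2 * t)\<^sup>2 = 1 / 4 * t\<^sup>2" "1 - 2 * (1 / 2 * t) = 1 - t" by (simp_all add: power2_eq_square)
      then show ?thesis unfolding power_mult by (simp only: power_mult_distrib) simp
    qed
    moreover have "ennreal (?c * ((1 - t)\<^sup>2 / 2 * t ^ (2 * n))) = ennreal ?c * ennreal ((1 - t)\<^sup>2 / 2 * t ^ (2 * n))"
      by (rule ennreal_mult') simp
    ultimately show "(if 0 \<le> t \<and> t \<le> 1 then ennreal ((1 / 2 * t) ^ (2 * n) * ((1 - 2 * (1 / 2 * t))\<^sup>2 / 12)) else 0) =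
      ennreal ?c * (if 0 \<le> t \<and> t \<le> 1 then ennreal ((1 - t)\<^sup>2 / 2 * t ^ (2 * n)) else 0)"
      by (simp only: if_distrib[where f = "\<lambda>x. _ * x"] mult_zero_right)
  qed
  also have "\<dots> = ennreal ?c * ennreal (1 / ((real (2 * n) + 1) * (real (2 * n) + 2) * (real (2 * n) + 3)))"
    unfolding beta2[symmetric] by (rule nn_integral_cmult) measurable
  also have "ennreal (1 / 2) * \<dots> = ennreal (1 / 2 * (?c * (1 / ((real (2 * n) + 1) * (real (2 * n) + 2) * (real (2 * n) + 3)))))"
    by (subst ennreal_mult[symmetric], simp, simp, subst ennreal_mult[symmetric], simp, simp, rule refl)
  also have "1 / 2 * (?c * (1 / ((real (2 * n) + 1) * (real (2 * n) + 2) * (real (2 * n) + 3)))) = (1 / 4) ^ n / (12 * (2 * real n + 1) * (2 * real n + 2) * (2 * real n + 3))"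
    by (simp add: field_simps)
  finally show ?thesis .
qed

section \<open>Assembling the relaxation from its regions\<close>

lemma posq_pos: "0 \<le> x \<Longrightarrow> posq x = x\<^sup>2" and posq_neg: "x \<le> 0 \<Longrightarrow> posq x = 0"
  by (simp_all add: posq_def)

text \<open>In \<open>z = 1 - y\<close> the inclusion-exclusion is symmetric, and which terms are
  active is decided by the pair sums against 1 and the total against 2.\<close>

lemma cell_area_reflected:
  "cell_area 0 0 0 (1 - z1) (1 - z2) (1 - z3) =
    1 - posq z1 - posq z2 - posq z3 + posq (z1 + z2 - 1) + posq (z1 + z3 - 1) + posq (z2 + z3 - 1) - posq (z1 + z2 + z3 - 2)"
proof -
  have e: "1 - 0 - 0 - 0 = (1 :: real)" "1 - (1 - z1) - 0 - 0 = z1" "1 - 0 - (1 - z2) - 0 = z2" "1 - 0 - 0 - (1 - z3) = z3"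
    "1 - (1 - z1) - (1 - z2) - 0 = z1 + z2 - 1" "1 - (1 - z1) - 0 - (1 - z3) = z1 + z3 - 1" "1 - 0 - (1 - z2) - (1 - z3) = z2 + z3 - 1"
    "1 - (1 - z1) - (1 - z2) - (1 - z3) = z1 + z2 + z3 - 2"
    by simp_all
  have one: "posq 1 = 1" by (simp add: posq_def)
  show ?thesis unfolding cell_area_def e one by (rule refl)
qed

definition b_cube :: "nat \<Rightarrow> real \<Rightarrow> real \<Rightarrow> real \<Rightarrow> ennreal" where
  "b_cube n z1 z2 z3 = (if (0 \<le> z1 \<and> z1 \<le> 1) \<and> (0 \<le> z2 \<and> z2 \<le> 1) \<and> (0 \<le> z3 \<and> z3 \<le> 1)
     then ennreal (cell_area 0 0 0 (1 - z1) (1 - z2) (1 - z3) ^ n) else 0)"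

lemma b_cube_measurable: "(\<lambda>(x, y, z). b_cube n x y z) \<in> borel_measurable lborel3"
  unfolding b_cube_def cell_area_reflected posq_def by measurable

lemma b_cube_symmetric: "b_cube n z2 z1 z3 = b_cube n z1 z2 z3" "b_cube n z1 z3 z2 = b_cube n z1 z2 z3"
proof -
  have "cell_area 0 0 0 (1 - z2) (1 - z1) (1 - z3) = cell_area 0 0 0 (1 - z1) (1 - z2) (1 - z3)"
    "cell_area 0 0 0 (1 - z1) (1 - z3) (1 - z2) = cell_area 0 0 0 (1 - z1) (1 - z2) (1 - z3)"
    unfolding cell_area_reflected by (simp_all add: add_ac)
  then show "b_cube n z2 z1 z3 = b_cube n z1 z2 z3" "b_cube n z1 z3 z2 = b_cube n z1 z2 z3"
    unfolding b_cube_def by (simp_all only: conj_ac)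
qed

text \<open>For sorted \<open>z\<close> the pair sums are sorted too,
  \<open>z2 + z3 \<le> z1 + z3 \<le> z1 + z2\<close>, so the number of them above 1 determines which
  squares survive. In each region the surviving terms combine to the form named in the corresponding
  definition.\<close>

lemma b_cube_sorted:
  assumes n: "1 \<le> n"
  shows "(if z3 \<le> z2 \<and> z2 \<le> z1 then b_cube n z1 z2 z3 else 0) =
    (b_center n z1 z2 z3 + b_one n (1 - z2) (1 - z1) z3) + (b_two n (1 - z1) z2 z3 + b_three n (1 - z1) (1 - z2) (1 - z3))"
    (is "?L = _")
proof -
  let ?S = "0 \<le> z3 \<and> z3 \<le> z2 \<and> z2 \<le> z1 \<and> z1 \<le> 1"
  let ?A = "cell_area 0 0 0 (1 - z1) (1 - z2) (1 - z3)"
  have L: "?L = (if ?S then ennreal (?A ^ n) else 0)"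
  proof (cases ?S)
    case True
    then have s: "z3 \<le> z2 \<and> z2 \<le> z1" "(0 \<le> z1 \<and> z1 \<le> 1) \<and> (0 \<le> z2 \<and> z2 \<le> 1) \<and> (0 \<le> z3 \<and> z3 \<le> 1)" by linarith+
    show ?thesis unfolding b_cube_def if_P[OF s(1)] if_P[OF s(2)] if_P[OF True] by (rule refl)
  next
    case False
    then show ?thesis unfolding b_cube_def by auto
  qed
  have c0: "((0 \<le> z3 \<and> z3 \<le> z2 \<and> z2 \<le> z1) \<and> z1 + z2 \<le> 1) \<longleftrightarrow> ?S \<and> z1 + z2 \<le> 1" by linarith
  have c1: "((0 \<le> z3 \<and> z3 \<le> 1 - z1 \<and> 1 - z1 \<le> 1 - z2) \<and> (1 - z2) + (1 - z1) < 1) \<longleftrightarrow> ?S \<and> 1 < z1 + z2 \<and> z1 + z3 \<le> 1" by linarith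
  have c2: "(0 \<le> 1 - z1 \<and> 1 - z1 < z3 \<and> z3 \<le> z2 \<and> z2 + z3 \<le> 1) \<longleftrightarrow> ?S \<and> 1 < z1 + z3 \<and> z2 + z3 \<le> 1" by linarith
  have c3: "(0 \<le> 1 - z1 \<and> 1 - z1 \<le> 1 - z2 \<and> 1 - z2 \<le> 1 - z3 \<and> (1 - z2) + (1 - z3) < 1 \<and> 1 \<le> (1 - z1) + (1 - z2) + (1 - z3)) \<longleftrightarrow>
     ?S \<and> 1 < z2 + z3 \<and> z1 + z2 + z3 \<le> 2" by linarith
  note R = b_center_def[of n z1 z2 z3, unfolded c0] b_one_def[of n "1 - z2" "1 - z1" z3, unfolded c1]
    b_two_def[of n "1 - z1" z2 z3, unfolded c2] b_three_def[of n "1 - z1" "1 - z2" "1 - z3", unfolded c3]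
  show ?thesis
  proof (cases ?S)
    case False
    then have nS: "\<not> (?S \<and> P)" for P by blast
    show ?thesis unfolding L R if_not_P[OF False] if_not_P[OF nS] by simp
  next
    case S: True
    have sq: "posq z1 = z1\<^sup>2" "posq z2 = z2\<^sup>2" "posq z3 = z3\<^sup>2" by (rule posq_pos, use S in linarith)+
    consider "z1 + z2 \<le> 1" | "1 < z1 + z2" "z1 + z3 \<le> 1" | "1 < z1 + z3" "z2 + z3 \<le> 1" | "1 < z2 + z3" "z1 + z2 + z3 \<le> 2" | "2 < z1 + z2 + z3"
      by linarith
    then show ?thesis
    proof cases
      case 1
      then have f: "?S \<and> z1 + z2 \<le> 1" "\<not> (?S \<and> 1 < z1 + z2 \<and> z1 + z3 \<le> 1)" "\<not> (?S \<and> 1 < z1 + z3 \<and> z2 + z3 \<le> 1)" "\<not> (?S \<and> 1 < z2 + z3 \<and> z1 + z2 + z3 \<le> 2)"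
        using S by linarith+
      have p: "posq (z1 + z2 - 1) = 0" "posq (z1 + z3 - 1) = 0" "posq (z2 + z3 - 1) = 0" "posq (z1 + z2 + z3 - 2) = 0"
        by (rule posq_neg, use S 1 in linarith)+
      have "?A = Xq 1 z1 z2 z3" unfolding cell_area_reflected sq p Xq_def by simp
      then show ?thesis unfolding L R if_P[OF S] if_P[OF f(1)] if_not_P[OF f(2)] if_not_P[OF f(3)] if_not_P[OF f(4)] by simp
    next
      case 2
      then have f: "\<not> (?S \<and> z1 + z2 \<le> 1)" "?S \<and> 1 < z1 + z2 \<and> z1 + z3 \<le> 1" "\<not> (?S \<and> 1 < z1 + z3 \<and> z2 + z3 \<le> 1)" "\<not> (?S \<and> 1 < z2 + z3 \<and> z1 + z2 + z3 \<le> 2)"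
        using S by linarith+
      have p: "posq (z1 + z2 - 1) = (z1 + z2 - 1)\<^sup>2" "posq (z1 + z3 - 1) = 0" "posq (z2 + z3 - 1) = 0" "posq (z1 + z2 + z3 - 2) = 0"
        by (rule posq_pos, use S 2 in linarith) (rule posq_neg, use S 2 in linarith)+
      have "?A = 2 * (1 - z1) * (1 - z2) - z3\<^sup>2" unfolding cell_area_reflected sq p by (simp add: power2_eq_square algebra_simps)
      then show ?thesis unfolding L R if_P[OF S] if_not_P[OF f(1)] if_P[OF f(2)] if_not_P[OF f(3)] if_not_P[OF f(4)] by simp
    next
      case 3
      then have f: "\<not> (?S \<and> z1 + z2 \<le> 1)" "\<not> (?S \<and> 1 < z1 + z2 \<and> z1 + z3 \<le> 1)" "?S \<and> 1 < z1 + z3 \<and> z2 + z3 \<le> 1" "\<not> (?S \<and> 1 < z2 + z3 \<and> z1 + z2 + z3 \<le> 2)"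
        using S by linarith+
      have p: "posq (z1 + z2 - 1) = (z1 + z2 - 1)\<^sup>2" "posq (z1 + z3 - 1) = (z1 + z3 - 1)\<^sup>2" "posq (z2 + z3 - 1) = 0" "posq (z1 + z2 + z3 - 2) = 0"
        by ((rule posq_pos, use S 3 in linarith) | (rule posq_neg, use S 3 in linarith))+
      have "?A = (1 - z1) * (1 - z1 + 2 * (1 - z2 - z3))" unfolding cell_area_reflected sq p by (simp add: power2_eq_square algebra_simps)
      then show ?thesis unfolding L R if_P[OF S] if_not_P[OF f(1)] if_not_P[OF f(2)] if_P[OF f(3)] if_not_P[OF f(4)] by simp
    next
      case 4
      then have f: "\<not> (?S \<and> z1 + z2 \<le> 1)" "\<not> (?S \<and> 1 < z1 + z2 \<and> z1 + z3 \<le> 1)" "\<not> (?S \<and> 1 < z1 + z3 \<and> z2 + z3 \<le> 1)" "?S \<and> 1 < z2 + z3 \<and> z1 + z2 + z3 \<le> 2"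
        using S by linarith+
      have p: "posq (z1 + z2 - 1) = (z1 + z2 - 1)\<^sup>2" "posq (z1 + z3 - 1) = (z1 + z3 - 1)\<^sup>2" "posq (z2 + z3 - 1) = (z2 + z3 - 1)\<^sup>2" "posq (z1 + z2 + z3 - 2) = 0"
        by ((rule posq_pos, use S 4 in linarith) | (rule posq_neg, use S 4 in linarith))+
      have "?A = ((1 - z1) + (1 - z2) + (1 - z3) - 1)\<^sup>2" unfolding cell_area_reflected sq p by (simp add: power2_eq_square algebra_simps)
      then have "?A ^ n = ((1 - z1) + (1 - z2) + (1 - z3) - 1) ^ (2 * n)" by (simp only: power_mult)
      then show ?thesis unfolding L R if_P[OF S] if_not_P[OF f(1)] if_not_P[OF f(2)] if_not_P[OF f(3)] if_P[OF f(4)] by simp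
    next
      \<comment> \<open>Here \<open>y1 + y2 + y3 < 1\<close> and no column fits: all squares cancel,
        and \<open>1 \<le> n\<close> makes the power zero.\<close>
      case 5
      then have f: "\<not> (?S \<and> z1 + z2 \<le> 1)" "\<not> (?S \<and> 1 < z1 + z2 \<and> z1 + z3 \<le> 1)" "\<not> (?S \<and> 1 < z1 + z3 \<and> z2 + z3 \<le> 1)" "\<not> (?S \<and> 1 < z2 + z3 \<and> z1 + z2 + z3 \<le> 2)"
        using S by linarith+
      have p: "posq (z1 + z2 - 1) = (z1 + z2 - 1)\<^sup>2" "posq (z1 + z3 - 1) = (z1 + z3 - 1)\<^sup>2" "posq (z2 + z3 - 1) = (z2 + z3 - 1)\<^sup>2" "posq (z1 + z2 + z3 - 2) = (z1 + z2 + z3 - 2)\<^sup>2"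
        by (rule posq_pos, use S 5 in linarith)+
      have "?A = 0" unfolding cell_area_reflected sq p by (simp add: power2_eq_square algebra_simps)
      then have "?A ^ n = 0" using n by simp
      then show ?thesis unfolding L R if_P[OF S] if_not_P[OF f(1)] if_not_P[OF f(2)] if_not_P[OF f(3)] if_not_P[OF f(4)] by simp
    qed
  qed
qed

definition b_closed :: "nat \<Rightarrow> real" where
  "b_closed n = 6 * ((k_seq n + c_seq n / (2 * real n + 3))
     + (e_seq n / (4 * (2 * real n + 2) * (2 * real n + 3)) + (1 / 4) ^ n / (12 * (2 * real n + 1) * (2 * real n + 2) * (2 * real n + 3))))"

lemma b_cube_total:
  assumes n: "1 \<le> n"
  shows "(\<integral>\<^sup>+ x. \<integral>\<^sup>+ y. \<integral>\<^sup>+ z. b_cube n x y z \<partial>lborel \<partial>lborel \<partial>lborel) = ennreal (b_closed n)"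
proof -
  note [measurable] = triple_comp[OF b_parts_measurable(1)] triple_comp[OF b_parts_measurable(2)]
    triple_comp[OF b_parts_measurable(3)] triple_comp[OF b_parts_measurable(4)]
  let ?J = "\<lambda>f :: real \<Rightarrow> real \<Rightarrow> real \<Rightarrow> ennreal. \<integral>\<^sup>+ x. \<integral>\<^sup>+ y. \<integral>\<^sup>+ z. f x y z \<partial>lborel \<partial>lborel \<partial>lborel"
  let ?one = "\<lambda>x y z. b_one n (1 - y) (1 - x) z" and ?two = "\<lambda>x y z. b_two n (1 - x) y z" and ?three = "\<lambda>x y z. b_three n (1 - x) (1 - y) (1 - z)"
  have m: "(\<lambda>(x, y, z). ?one x y z) \<in> borel_measurable lborel3" "(\<lambda>(x, y, z). ?two x y z) \<in> borel_measurable lborel3"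
    "(\<lambda>(x, y, z). ?three x y z) \<in> borel_measurable lborel3" "(\<lambda>(x, y, z). b_one n y x z) \<in> borel_measurable lborel3"
    "(\<lambda>(x, y, z). b_center n x y z + ?one x y z) \<in> borel_measurable lborel3" "(\<lambda>(x, y, z). ?two x y z + ?three x y z) \<in> borel_measurable lborel3"
    by measurable
  have one: "?J ?one = ennreal (c_seq n / (2 * real n + 3))"
    unfolding b_one_total[symmetric] nn_integral3_swap12[OF b_parts_measurable(2), symmetric] by (rule nn_integral3_reflect2[OF m(4)])
  have two: "?J ?two = ennreal (e_seq n / (4 * (2 * real n + 2) * (2 * real n + 3)))"
    unfolding b_two_total[symmetric] by (rule nn_integral3_reflect1[OF b_parts_measurable(3)])
  have three: "?J ?three = ennreal ((1 / 4) ^ n / (12 * (2 * real n + 1) * (2 * real n + 2) * (2 * real n + 3)))"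
    unfolding b_three_total[symmetric] by (rule nn_integral3_reflect3[OF b_parts_measurable(4)])
  have "?J (b_cube n) = 6 * ?J (\<lambda>x y z. (b_center n x y z + ?one x y z) + (?two x y z + ?three x y z))"
    unfolding nn_integral3_sorted[OF b_cube_measurable b_cube_symmetric] b_cube_sorted[OF n] by (rule refl)
  also have "\<dots> = 6 * ((ennreal (k_seq n) + ennreal (c_seq n / (2 * real n + 3)))
      + (ennreal (e_seq n / (4 * (2 * real n + 2) * (2 * real n + 3))) + ennreal ((1 / 4) ^ n / (12 * (2 * real n + 1) * (2 * real n + 2) * (2 * real n + 3)))))"
    unfolding nn_integral3_add[OF m(5,6)] nn_integral3_add[OF b_parts_measurable(1) m(1)] nn_integral3_add[OF m(2,3)] b_center_total one two three by (rule refl)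
  also have "\<dots> = ennreal (b_closed n)"
  proof -
    have "6 * ((ennreal a + ennreal b) + (ennreal c + ennreal d)) = ennreal (6 * ((a + b) + (c + d)))" if "0 \<le> a" "0 \<le> b" "0 \<le> c" "0 \<le> d" for a b c d :: real
      using that by (simp add: ennreal_mult)
    then show ?thesis unfolding b_closed_def by simp
  qed
  finally show ?thesis .
qed

lemma b_seq_formula:
  assumes n: "1 \<le> n"
  shows "b_seq n = b_closed n"
  unfolding b_seq_def Vol_P_poly
proof (rule scaled_volume)
  let ?g = "\<lambda>y1 y2 y3. b_cube n (1 - y1) (1 - y2) (1 - y3)"
  note [measurable] = triple_comp[OF b_cube_measurable]
  show "(\<lambda>(y1, y2, y3). ?g y1 y2 y3) \<in> borel_measurable lborel3" by measurable
  show "(\<integral>\<^sup>+ x. \<integral>\<^sup>+ y. \<integral>\<^sup>+ z. ?g x y z \<partial>lborel \<partial>lborel \<partial>lborel) = ennreal (b_closed n)"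
    unfolding nn_integral3_reflect3[OF b_cube_measurable] by (rule b_cube_total[OF n])
  show "0 \<le> b_closed n" unfolding b_closed_def by simp
  fix y1 y2 y3 :: real
  let ?S = "{c \<in> space (col_measure n). (y1 \<le> 1 \<and> y2 \<le> 1 \<and> y3 \<le> 1) \<and> col_cells n c y1 y2 y3}"
  let ?P = "(0 \<le> 1 - y1 \<and> 1 - y1 \<le> 1) \<and> (0 \<le> 1 - y2 \<and> 1 - y2 \<le> 1) \<and> (0 \<le> 1 - y3 \<and> 1 - y3 \<le> 1)"
  have e: "1 - (1 - y1) = y1" "1 - (1 - y2) = y2" "1 - (1 - y3) = y3" by simp_all
  show "2 ^ n * emeasure (col_measure n) ?S = ?g y1 y2 y3"
  proof (cases ?P)
    case True
    then have y0: "0 \<le> y1" "0 \<le> y2" "0 \<le> y3" and y: "y1 \<le> 1 \<and> y2 \<le> 1 \<and> y3 \<le> 1" by linarith+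
    have "?S = {c \<in> space (col_measure n). \<forall>j\<in>{1..n}. c j \<in> cell 0 0 0 y1 y2 y3}"
      unfolding col_cells_def using y by blast
    then show ?thesis
      using emeasure_col_cells[OF y0, of n] unfolding b_cube_def if_P[OF True] e by (simp only:)
  next
    case False
    have "\<not> ((y1 \<le> 1 \<and> y2 \<le> 1 \<and> y3 \<le> 1) \<and> col_cells n c y1 y2 y3)" for c
    proof
      assume *: "(y1 \<le> 1 \<and> y2 \<le> 1 \<and> y3 \<le> 1) \<and> col_cells n c y1 y2 y3"
      then have "col_cells n c y1 y2 y3" by blast
      from col_cells_bounds[OF n this] show False using * False by linarith
    qed
    then have "?S = {}" by blast
    then show ?thesis unfolding b_cube_def if_not_P[OF False] by (simp only: emeasure_empty mult_zero_right)
  qed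
qed

section \<open>The recurrences\<close>

text \<open>Here \<open>x\<close> is \<open>real n\<close>. The hypotheses are the recurrences of
  the three moments at consecutive indices and the linear forms for the tails. They express every
  term through \<open>d0\<close>, \<open>f0\<close> and \<open>h0\<close>, after which the claim is
  a polynomial identity.\<close>

lemma hull_algebra:
  fixes x :: real
  assumes x: "0 \<le> x"
    and h: "(2 * x + 3) * h1 = (x + 1) * h0" "(2 * x + 5) * h2 = (x + 2) * h1" "(2 * x + 7) * h3 = (x + 3) * h2"
    and f: "(x + 2) * f1 = h1 / 2 + 2 * (x + 1) / 3 * f0" "(x + 3) * f2 = h2 / 2 + 2 * (x + 2) / 3 * f1" "(x + 4) * f3 = h3 / 2 + 2 * (x + 3) / 3 * f2"
    and d: "(2 * x + 5) * d1 = f1 + 2 * (x + 1) * d0" "(2 * x + 7) * d2 = f2 + 2 * (x + 2) * d1" "(2 * x + 9) * d3 = f3 + 2 * (x + 3) * d2"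
    and t: "(2 * x + 1) * (2 * x + 2) * (2 * x + 3) * t0 = (7 * x + 2) * (x + 1) * f0 + (9 * x / 2 + 3) * h0"
      "(2 * x + 3) * (2 * x + 4) * (2 * x + 5) * t1 = (7 * x + 9) * (x + 2) * f1 + (9 * (x + 1) / 2 + 3) * h1"
      "(2 * x + 5) * (2 * x + 6) * (2 * x + 7) * t2 = (7 * x + 16) * (x + 3) * f2 + (9 * (x + 2) / 2 + 3) * h2"
      "(2 * x + 7) * (2 * x + 8) * (2 * x + 9) * t3 = (7 * x + 23) * (x + 4) * f3 + (9 * (x + 3) / 2 + 3) * h3"
  shows "- 4 * (x + 1)^2 * (x + 2) * (2 * x + 1) * (x^2 - x - 7) * (d0 + t0)
        + 2 * (x + 2)^2 * (2 * x + 5) * (9 * x^3 - 90 * x - 77) * (d1 + t1)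
        - (x + 3) * (2 * x + 5) * (2 * x + 7) * (13 * x^3 + 2 * x^2 - 164 * x - 169) * (d2 + t2)
        + 3 * (x + 4) * (2 * x + 5) * (2 * x + 7) * (2 * x + 9) * (x^2 - 3 * x - 5) * (d3 + t3) = 0"
    (is "?T = 0")
proof -
  define q0 q1 q2 q3 where q: "q0 = x^2 - x - 7" "q1 = 9 * x^3 - 90 * x - 77" "q2 = 13 * x^3 + 2 * x^2 - 164 * x - 169" "q3 = x^2 - 3 * x - 5"
  define F0 F1 F2 F3 where F: "F0 = (x + 1) * f0" "F1 = (x + 2) * f1" "F2 = (x + 3) * f2" "F3 = (x + 4) * f3"
  \<comment> \<open>All \<open>h\<close> values are rational multiples of \<open>h0\<close>; the
    product of three linear factors clears their denominators. In \<open>54 = 2 * 3^3\<close>, the 2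
    pays for the term \<open>h / 2\<close> and the cube for three steps with the factor 2/3.\<close>
  define \<kappa> where "\<kappa> = h0 / (54 * ((2 * x + 3) * (2 * x + 5) * (2 * x + 7)))"
  define H0 H1 H2 H3 where H: "H0 = (2 * x + 3) * (2 * x + 5) * (2 * x + 7) * \<kappa>" "H1 = (x + 1) * (2 * x + 5) * (2 * x + 7) * \<kappa>"
    "H2 = (x + 1) * (x + 2) * (2 * x + 7) * \<kappa>" "H3 = (x + 1) * (x + 2) * (x + 3) * \<kappa>"
  have nz: "2 * x + 3 \<noteq> 0" "2 * x + 5 \<noteq> 0" "2 * x + 7 \<noteq> 0" using x by simp_all
  then have h0: "h0 = 54 * H0" by (simp add: \<kappa>_def H)
  have "(2 * x + 3) * h1 = (2 * x + 3) * (54 * H1)" using h(1) h0 unfolding H by algebra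
  then have h1: "h1 = 54 * H1" by (rule mult_left_cancel[OF nz(1), THEN iffD1])
  have "(2 * x + 5) * h2 = (2 * x + 5) * (54 * H2)" using h(2) h1 unfolding H by algebra
  then have h2: "h2 = 54 * H2" by (rule mult_left_cancel[OF nz(2), THEN iffD1])
  have "(2 * x + 7) * h3 = (2 * x + 7) * (54 * H3)" using h(3) h2 unfolding H by algebra
  then have h3: "h3 = 54 * H3" by (rule mult_left_cancel[OF nz(3), THEN iffD1])
  define \<phi> where "\<phi> = F0 / 54"
  have F0: "F0 = 54 * \<phi>" by (simp add: \<phi>_def)
  have F1: "F1 = 27 * H1 + 36 * \<phi>" proof -
    have "F1 = h1 / 2 + 2 / 3 * F0" unfolding F f(1) by simp
    then show ?thesis unfolding F0 h1 by simp
  qed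
  have F2: "F2 = 27 * H2 + 18 * H1 + 24 * \<phi>" proof -
    have "F2 = h2 / 2 + 2 / 3 * F1" unfolding F f(2) by simp
    then show ?thesis unfolding F1 h2 by simp
  qed
  have F3: "F3 = 27 * H3 + 18 * H2 + 12 * H1 + 16 * \<phi>" proof -
    have "F3 = h3 / 2 + 2 / 3 * F2" unfolding F f(3) by simp
    then show ?thesis unfolding F2 h3 by simp
  qed
  \<comment> \<open>Each coefficient of the recurrence already contains the denominators that the
    chain from \<open>d0\<close> accumulates, so \<open>D1\<close> to \<open>D3\<close> are free of
    division.\<close>
  have D1: "2 * (x + 2)^2 * (2 * x + 5) * q1 * d1 = 2 * (x + 2) * q1 * (F1 + 2 * (x + 1) * (x + 2) * d0)"
    using d(1) F(2) by algebra
  have D2: "(x + 3) * (2 * x + 5) * (2 * x + 7) * q2 * d2 = q2 * ((2 * x + 5) * F2 + 2 * (x + 3) * F1 + 4 * (x + 1) * (x + 2) * (x + 3) * d0)"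
    using d(1,2) F(2,3) by algebra
  have D3: "3 * (x + 4) * (2 * x + 5) * (2 * x + 7) * (2 * x + 9) * q3 * d3 =
      3 * q3 * ((2 * x + 5) * (2 * x + 7) * F3 + 2 * (x + 4) * (2 * x + 5) * F2 + 4 * (x + 3) * (x + 4) * F1 + 8 * (x + 1) * (x + 2) * (x + 3) * (x + 4) * d0)"
    using d F(2-4) by algebra
  have T0: "(2 * x + 3) * (4 * (x + 1)^2 * (x + 2) * (2 * x + 1) * q0 * t0) = (x + 1) * (x + 2) * q0 * (2 * ((7 * x + 2) * F0) + (9 * x + 6) * h0)"
    using t(1) F(1) by algebra
  have T1: "2 * ((2 * x + 3) * (2 * (x + 2)^2 * (2 * x + 5) * q1 * t1)) = (x + 2) * q1 * (2 * ((7 * x + 9) * F1) + (9 * x + 15) * h1)"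
    using t(2) F(2) by algebra
  have T2: "4 * ((x + 3) * (2 * x + 5) * (2 * x + 7) * q2 * t2) = q2 * (2 * ((7 * x + 16) * F2) + (9 * x + 24) * h2)"
    using t(3) F(3) by algebra
  have T3: "4 * (3 * (x + 4) * (2 * x + 5) * (2 * x + 7) * (2 * x + 9) * q3 * t3) = 3 * (2 * x + 5) * q3 * (2 * ((7 * x + 23) * F3) + (9 * x + 33) * h3)"
    using t(4) F(4) by algebra
  \<comment> \<open>The tails at the first two indices still have the denominator
    \<open>2 * x + 3\<close>, which the coefficients lack; the 4 clears the remaining
    halves.\<close>
  have "4 * (2 * x + 3) * ?T =
     - 4 * (2 * x + 3) * (4 * (x + 1)^2 * (x + 2) * (2 * x + 1) * q0 * d0) - 4 * ((2 * x + 3) * (4 * (x + 1)^2 * (x + 2) * (2 * x + 1) * q0 * t0))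
     + 4 * (2 * x + 3) * (2 * (x + 2)^2 * (2 * x + 5) * q1 * d1) + 2 * (2 * ((2 * x + 3) * (2 * (x + 2)^2 * (2 * x + 5) * q1 * t1)))
     - 4 * (2 * x + 3) * ((x + 3) * (2 * x + 5) * (2 * x + 7) * q2 * d2) - (2 * x + 3) * (4 * ((x + 3) * (2 * x + 5) * (2 * x + 7) * q2 * t2))
     + 4 * (2 * x + 3) * (3 * (x + 4) * (2 * x + 5) * (2 * x + 7) * (2 * x + 9) * q3 * d3) + (2 * x + 3) * (4 * (3 * (x + 4) * (2 * x + 5) * (2 * x + 7) * (2 * x + 9) * q3 * t3))"
    unfolding q[symmetric] by algebra
  also have "\<dots> = 0"
    unfolding D1 D2 D3 T0 T1 T2 T3 unfolding F0 F1 F2 F3 h0 h1 h2 h3 unfolding H q by algebra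
  finally show ?thesis using nz(1) by simp
qed

text \<open>The chain now has four members: \<open>k\<close> is driven by \<open>c\<close>,
  \<open>c\<close> by \<open>e\<close>, and \<open>e\<close> by the powers of 1/4. Everything is
  reduced to \<open>k0\<close>, \<open>c0\<close>, \<open>e0\<close>, \<open>w0\<close>, and a
  polynomial identity remains.\<close>

lemma relaxation_algebra:
  fixes x :: real
  assumes x: "0 \<le> x"
    and w: "w1 = w0 / 4" "w2 = w0 / 16" "w3 = w0 / 64" "w4 = w0 / 256"
    and e: "(2 * x + 3) * e1 = 2 * (x + 1) / 3 * e0 + w1 / 3" "(2 * x + 5) * e2 = 2 * (x + 2) / 3 * e1 + w2 / 3"
      "(2 * x + 7) * e3 = 2 * (x + 3) / 3 * e2 + w3 / 3" "(2 * x + 9) * e4 = 2 * (x + 4) / 3 * e3 + w4 / 3"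
    and c: "(2 * x + 4) * c1 = (x + 1) * c0 + e1 / 4" "(2 * x + 6) * c2 = (x + 2) * c1 + e2 / 4"
      "(2 * x + 8) * c3 = (x + 3) * c2 + e3 / 4" "(2 * x + 10) * c4 = (x + 4) * c3 + e4 / 4"
    and k: "(2 * x + 5) * k1 = 2 * (x + 1) * k0 + c1" "(2 * x + 7) * k2 = 2 * (x + 2) * k1 + c2"
      "(2 * x + 9) * k3 = 2 * (x + 3) * k2 + c3" "(2 * x + 11) * k4 = 2 * (x + 4) * k3 + c4"
    and b: "12 * (2 * x + 1) * (2 * x + 2) * (2 * x + 3) * (b0 / 6 - k0) = 12 * (2 * x + 1) * (2 * x + 2) * c0 + 3 * (2 * x + 1) * e0 + w0"
      "12 * (2 * x + 3) * (2 * x + 4) * (2 * x + 5) * (b1 / 6 - k1) = 12 * (2 * x + 3) * (2 * x + 4) * c1 + 3 * (2 * x + 3) * e1 + w1"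
      "12 * (2 * x + 5) * (2 * x + 6) * (2 * x + 7) * (b2 / 6 - k2) = 12 * (2 * x + 5) * (2 * x + 6) * c2 + 3 * (2 * x + 5) * e2 + w2"
      "12 * (2 * x + 7) * (2 * x + 8) * (2 * x + 9) * (b3 / 6 - k3) = 12 * (2 * x + 7) * (2 * x + 8) * c3 + 3 * (2 * x + 7) * e3 + w3"
      "12 * (2 * x + 9) * (2 * x + 10) * (2 * x + 11) * (b4 / 6 - k4) = 12 * (2 * x + 9) * (2 * x + 10) * c4 + 3 * (2 * x + 9) * e4 + w4"
  shows "4 * (x + 1)^2 * (x + 2) * (2 * x + 1) * (2 * x + 3) * b0
        - 20 * (x + 2)^2 * (2 * x + 3) * (2 * x + 5)^2 * b1
        + 5 * (x + 3) * (2 * x + 5)^2 * (2 * x + 7) * (14 * x + 43) * b2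
        - 2 * (x + 4) * (2 * x + 5) * (2 * x + 7) * (2 * x + 9) * (50 * x + 181) * b3
        + 24 * (x + 5) * (2 * x + 5) * (2 * x + 7) * (2 * x + 9) * (2 * x + 11) * b4 = 0"
    (is "?T = 0")
proof -
  define M where "M = (2 * x + 3) * (2 * x + 5) * (2 * x + 7) * (2 * x + 9)"
  \<comment> \<open>\<open>M\<close> clears the denominators of the chain for \<open>e\<close>. Both
    2592 and 165888 contain \<open>3^4\<close> for its four divisions by 3, and powers of 2 that
    keep the coefficients below integral; 16 pays for the four halvings in the chain for
    \<open>(x + 1) * c0\<close>.\<close>
  define \<epsilon> \<omega> \<gamma> where "\<epsilon> = e0 / (2592 * M)" and "\<omega> = w0 / (165888 * M)" and "\<gamma> = (x + 1) * c0 / 16"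
  define E1 where E1: "E1 = (x + 1) * \<epsilon> + 8 * \<omega>"
  define E2 where E2: "E2 = (x + 2) * E1 + 3 * (2 * x + 3) * \<omega>"
  define E3 where E3: "E3 = 8 * (x + 3) * E2 + 9 * (2 * x + 3) * (2 * x + 5) * \<omega>"
  define E4 where E4: "E4 = 8 * (x + 4) * E3 + 27 * (2 * x + 3) * (2 * x + 5) * (2 * x + 7) * \<omega>"
  have nz: "2 * x + 3 \<noteq> 0" "2 * x + 5 \<noteq> 0" "2 * x + 7 \<noteq> 0" "2 * x + 9 \<noteq> 0" using x by simp_all
  then have e0: "e0 = 2592 * M * \<epsilon>" and w0: "w0 = 165888 * M * \<omega>" by (simp_all add: \<epsilon>_def \<omega>_def M_def)
  have w: "w1 = 41472 * M * \<omega>" "w2 = 10368 * M * \<omega>" "w3 = 2592 * M * \<omega>" "w4 = 648 * M * \<omega>" unfolding w w0 by simp_all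
  have "(2 * x + 3) * e1 = (2 * x + 3) * (1728 * (2 * x + 5) * (2 * x + 7) * (2 * x + 9) * E1)"
    unfolding e(1) w e0 E1 M_def by (simp add: field_simps)
  then have e1: "e1 = 1728 * (2 * x + 5) * (2 * x + 7) * (2 * x + 9) * E1" by (rule mult_left_cancel[OF nz(1), THEN iffD1])
  have "(2 * x + 5) * e2 = (2 * x + 5) * (1152 * (2 * x + 7) * (2 * x + 9) * E2)"
    unfolding e(2) w e1 E2 M_def by (simp add: field_simps)
  then have e2: "e2 = 1152 * (2 * x + 7) * (2 * x + 9) * E2" by (rule mult_left_cancel[OF nz(2), THEN iffD1])
  have "(2 * x + 7) * e3 = (2 * x + 7) * (96 * (2 * x + 9) * E3)"
    unfolding e(3) w e2 E3 M_def by (simp add: field_simps)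
  then have e3: "e3 = 96 * (2 * x + 9) * E3" by (rule mult_left_cancel[OF nz(3), THEN iffD1])
  have "(2 * x + 9) * e4 = (2 * x + 9) * (8 * E4)"
    unfolding e(4) w e3 E4 M_def by (simp add: field_simps)
  then have e4: "e4 = 8 * E4" by (rule mult_left_cancel[OF nz(4), THEN iffD1])
  \<comment> \<open>Multiplying \<open>c\<close> by the shifted index turns its recurrence into one
    with constant coefficients: halve, then add an eighth of \<open>e\<close>.\<close>
  define C0 C1 C2 C3 C4 where C: "C0 = (x + 1) * c0" "C1 = (x + 2) * c1" "C2 = (x + 3) * c2" "C3 = (x + 4) * c3" "C4 = (x + 5) * c4"
  have C0: "C0 = 16 * \<gamma>" by (simp add: C \<gamma>_def)
  have "C1 = C0 / 2 + e1 / 8" "C2 = C1 / 2 + e2 / 8" "C3 = C2 / 2 + e3 / 8" "C4 = C3 / 2 + e4 / 8"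
    using c unfolding C by (simp_all add: field_simps)
  then have C1: "C1 = 8 * \<gamma> + 216 * (2 * x + 5) * (2 * x + 7) * (2 * x + 9) * E1"
    and C2: "C2 = 4 * \<gamma> + 108 * (2 * x + 5) * (2 * x + 7) * (2 * x + 9) * E1 + 144 * (2 * x + 7) * (2 * x + 9) * E2"
    and C3: "C3 = 2 * \<gamma> + 54 * (2 * x + 5) * (2 * x + 7) * (2 * x + 9) * E1 + 72 * (2 * x + 7) * (2 * x + 9) * E2 + 12 * (2 * x + 9) * E3"
    and C4: "C4 = \<gamma> + 27 * (2 * x + 5) * (2 * x + 7) * (2 * x + 9) * E1 + 36 * (2 * x + 7) * (2 * x + 9) * E2 + 6 * (2 * x + 9) * E3 + E4"
    unfolding C0 e1 e2 e3 e4 by (simp_all add: field_simps)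
  have K1: "(x + 2) * (2 * x + 5) * k1 = 2 * (x + 1) * (x + 2) * k0 + C1"
    using k(1) C(2) by algebra
  have K2: "(x + 3) * (2 * x + 5) * (2 * x + 7) * k2 = 4 * (x + 1) * (x + 2) * (x + 3) * k0 + 2 * (x + 3) * C1 + (2 * x + 5) * C2"
    using k(2) K1 C(3) by algebra
  have K3: "(x + 4) * (2 * x + 5) * (2 * x + 7) * (2 * x + 9) * k3 =
      8 * (x + 1) * (x + 2) * (x + 3) * (x + 4) * k0 + 4 * (x + 3) * (x + 4) * C1 + 2 * (x + 4) * (2 * x + 5) * C2 + (2 * x + 5) * (2 * x + 7) * C3"
    using k(3) K2 C(4) by algebra
  have K4: "(x + 5) * (2 * x + 5) * (2 * x + 7) * (2 * x + 9) * (2 * x + 11) * k4 =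
      16 * (x + 1) * (x + 2) * (x + 3) * (x + 4) * (x + 5) * k0 + 8 * (x + 3) * (x + 4) * (x + 5) * C1 + 4 * (x + 4) * (x + 5) * (2 * x + 5) * C2
      + 2 * (x + 5) * (2 * x + 5) * (2 * x + 7) * C3 + (2 * x + 5) * (2 * x + 7) * (2 * x + 9) * C4"
    using k(4) K3 C(5) by algebra
  have B0: "4 * (x + 1) * (2 * x + 1) * (2 * x + 3) * b0 = 24 * (x + 1) * (2 * x + 1) * (2 * x + 3) * k0 + 24 * (2 * x + 1) * C0 + 3 * (2 * x + 1) * e0 + w0"
    using b(1) unfolding C by algebra
  have B1: "4 * (x + 2) * (2 * x + 3) * (2 * x + 5) * b1 = 24 * (2 * x + 3) * ((x + 2) * (2 * x + 5) * k1) + 24 * (2 * x + 3) * C1 + 3 * (2 * x + 3) * e1 + w1"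
    using b(2) unfolding C by algebra
  have B2: "4 * (x + 3) * (2 * x + 5) * (2 * x + 7) * b2 = 24 * ((x + 3) * (2 * x + 5) * (2 * x + 7) * k2) + 24 * (2 * x + 5) * C2 + 3 * (2 * x + 5) * e2 + w2"
    using b(3) unfolding C by algebra
  have B3: "4 * (x + 4) * (2 * x + 5) * (2 * x + 7) * (2 * x + 9) * b3 = 24 * ((x + 4) * (2 * x + 5) * (2 * x + 7) * (2 * x + 9) * k3)
      + (2 * x + 5) * (24 * (2 * x + 7) * C3 + 3 * (2 * x + 7) * e3 + w3)"
    using b(4) unfolding C by algebra
  have B4: "4 * (x + 5) * (2 * x + 5) * (2 * x + 7) * (2 * x + 9) * (2 * x + 11) * b4 = 24 * ((x + 5) * (2 * x + 5) * (2 * x + 7) * (2 * x + 9) * (2 * x + 11) * k4)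
      + (2 * x + 5) * (2 * x + 7) * (24 * (2 * x + 9) * C4 + 3 * (2 * x + 9) * e4 + w4)"
    using b(5) unfolding C by algebra
  \<comment> \<open>Each summand is regrouped so that a left-hand side of \<open>B0\<close> to
    \<open>B4\<close> appears.\<close>
  have "4 * ?T = 4 * (x + 1) * (x + 2) * (4 * (x + 1) * (2 * x + 1) * (2 * x + 3) * b0)
     - 20 * (x + 2) * (2 * x + 5) * (4 * (x + 2) * (2 * x + 3) * (2 * x + 5) * b1)
     + 5 * (2 * x + 5) * (14 * x + 43) * (4 * (x + 3) * (2 * x + 5) * (2 * x + 7) * b2)
     - 2 * (50 * x + 181) * (4 * (x + 4) * (2 * x + 5) * (2 * x + 7) * (2 * x + 9) * b3)
     + 24 * (4 * (x + 5) * (2 * x + 5) * (2 * x + 7) * (2 * x + 9) * (2 * x + 11) * b4)"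
    by algebra
  also have "\<dots> = 0"
    unfolding B0 B1 B2 B3 B4 K1 K2 K3 K4 unfolding C4 C3 C2 C1 C0 w e4 e3 e2 e1 e0 w0 unfolding M_def E4 E3 E2 E1 by algebra
  finally show ?thesis by simp
qed

text \<open>\<open>tail_const\<close> mixes the indices \<open>n - 1\<close> and \<open>n\<close>.
  The recurrences \<open>h_rec\<close> and \<open>f_rec\<close>, read backwards, move everything to
  index \<open>n\<close>; this is the form that can be shifted uniformly.\<close>

lemma tail_const_eq:
  assumes "1 \<le> n"
  shows "(2 * real n + 1) * (2 * real n + 2) * (2 * real n + 3) * tail_const n =
    (7 * real n + 2) * (real n + 1) * f_seq n + (9 * real n / 2 + 3) * h_seq n"
proof -
  obtain m where n: "n = Suc m" using assms by (cases n) auto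
  define x where "x = real n"
  have x: "real m = x - 1" "real (n - 1) = x - 1" "1 \<le> x" unfolding x_def n by simp_all
  have h: "x * h_seq m = (2 * x + 1) * h_seq n" using h_rec[of m] unfolding n[symmetric] x by (simp add: algebra_simps)
  have "(x + 1) * f_seq n = h_seq n / 2 + 2 * x / 3 * f_seq m" using f_rec[of m] unfolding n[symmetric] x by (simp add: algebra_simps)
  then have f: "2 / 3 * x * f_seq m = (x + 1) * f_seq n - h_seq n / 2" by simp
  have "p * q * r * (A / (p * q * r) + B / (q * r) + C / r) = A + p * B + p * q * C"
    if "p \<noteq> 0" "q \<noteq> 0" "r \<noteq> 0" for p q r A B C :: real
    using that by (simp add: field_simps)
  from this[of "2 * x + 1" "2 * x + 2" "2 * x + 3"]
  have "(2 * x + 1) * (2 * x + 2) * (2 * x + 3) * (A / ((2 * x + 1) * (2 * x + 2) * (2 * x + 3)) + B / ((2 * x + 2) * (2 * x + 3)) + C / (2 * x + 3)) =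
      A + (2 * x + 1) * B + (2 * x + 1) * (2 * x + 2) * C" for A B C
    using x(3) by simp
  then have "(2 * x + 1) * (2 * x + 2) * (2 * x + 3) * tail_const n =
     (2 / 3 * x * (x - 1) * f_seq m + x * h_seq m) + (2 * x + 1) * (2 / 3 * x * f_seq m + 2 * h_seq n) + (2 * x + 1) * (2 * x + 2) * f_seq n"
    unfolding tail_const_def x_def[symmetric] x(2) by (simp only: n diff_Suc_1)
  also have "2 / 3 * x * (x - 1) * f_seq m = (x - 1) * (2 / 3 * x * f_seq m)" by simp
  finally show ?thesis unfolding f h x_def[symmetric] by (simp add: field_simps)
qed

text \<open>The closed form with its denominators cleared, so that it can be used for elimination at
  five consecutive indices; the term \<open>k_seq\<close> is kept on the left because it has no
  denominator.\<close>

lemma b_seq_eq: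
  assumes "1 \<le> n"
  shows "12 * (2 * real n + 1) * (2 * real n + 2) * (2 * real n + 3) * (b_seq n / 6 - k_seq n) =
    12 * (2 * real n + 1) * (2 * real n + 2) * c_seq n + 3 * (2 * real n + 1) * e_seq n + (1 / 4) ^ n"
proof -
  have "12 * p * q * r * (6 * ((k + c / r) + (e / (4 * q * r) + w / (12 * p * q * r))) / 6 - k) = 12 * p * q * c + 3 * p * e + w"
    if "p \<noteq> 0" "q \<noteq> 0" "r \<noteq> 0" for p q r k c e w :: real
    using that by (simp add: field_simps)
  from this[of "2 * real n + 1" "2 * real n + 2" "2 * real n + 3"]
  have "12 * (2 * real n + 1) * (2 * real n + 2) * (2 * real n + 3) * (b_closed n / 6 - k_seq n) =
    12 * (2 * real n + 1) * (2 * real n + 2) * c_seq n + 3 * (2 * real n + 1) * e_seq n + (1 / 4) ^ n"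
    unfolding b_closed_def by simp
  then show ?thesis unfolding b_seq_formula[OF assms] .
qed

lemma a_seq_rec:
  assumes n: "1 \<le> n"
  shows "- 4 * (real n + 1)^2 * (real n + 2) * (2 * real n + 1) * ((real n)^2 - real n - 7) * a_seq n
        + 2 * (real n + 2)^2 * (2 * real n + 5) * (9 * (real n)^3 - 90 * real n - 77) * a_seq (n + 1)
        - (real n + 3) * (2 * real n + 5) * (2 * real n + 7)
            * (13 * (real n)^3 + 2 * (real n)^2 - 164 * real n - 169) * a_seq (n + 2)
        + 3 * (real n + 4) * (2 * real n + 5) * (2 * real n + 7) * (2 * real n + 9)
            * ((real n)^2 - 3 * real n - 5) * a_seq (n + 3) = 0"
proof -
  have a: "a_seq k = d3_seq k + tail_const k" if "n \<le> k" for k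
    using a_seq_formula that n by simp
  have "n \<le> n + 1" "n \<le> n + 2" "n \<le> n + 3" by simp_all
  note a = a[OF order_refl] a[OF this(1)] a[OF this(2)] a[OF this(3)]
  show ?thesis
    unfolding a
  proof (rule hull_algebra)
    show "(2 * real n + 3) * h_seq (n + 1) = (real n + 1) * h_seq n" using h_rec[of n] by simp
    show "(2 * real n + 5) * h_seq (n + 2) = (real n + 2) * h_seq (n + 1)" using h_rec[of "n + 1"] by (simp add: algebra_simps)
    show "(2 * real n + 7) * h_seq (n + 3) = (real n + 3) * h_seq (n + 2)" using h_rec[of "n + 2"] by (simp add: algebra_simps eval_nat_numeral)
    show "(real n + 2) * f_seq (n + 1) = h_seq (n + 1) / 2 + 2 * (real n + 1) / 3 * f_seq n" using f_rec[of n] by simp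
    show "(real n + 3) * f_seq (n + 2) = h_seq (n + 2) / 2 + 2 * (real n + 2) / 3 * f_seq (n + 1)" using f_rec[of "n + 1"] by (simp add: algebra_simps)
    show "(real n + 4) * f_seq (n + 3) = h_seq (n + 3) / 2 + 2 * (real n + 3) / 3 * f_seq (n + 2)" using f_rec[of "n + 2"] by (simp add: algebra_simps eval_nat_numeral)
    show "(2 * real n + 5) * d3_seq (n + 1) = f_seq (n + 1) + 2 * (real n + 1) * d3_seq n" using d3_rec[of n] by simp
    show "(2 * real n + 7) * d3_seq (n + 2) = f_seq (n + 2) + 2 * (real n + 2) * d3_seq (n + 1)" using d3_rec[of "n + 1"] by (simp add: algebra_simps)
    show "(2 * real n + 9) * d3_seq (n + 3) = f_seq (n + 3) + 2 * (real n + 3) * d3_seq (n + 2)" using d3_rec[of "n + 2"] by (simp add: algebra_simps eval_nat_numeral)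
    show "(2 * real n + 1) * (2 * real n + 2) * (2 * real n + 3) * tail_const n = (7 * real n + 2) * (real n + 1) * f_seq n + (9 * real n / 2 + 3) * h_seq n"
      by (rule tail_const_eq[OF n])
    have x: "2 * real (n + 1) + 1 = 2 * real n + 3" "2 * real (n + 1) + 2 = 2 * real n + 4" "2 * real (n + 1) + 3 = 2 * real n + 5"
      "7 * real (n + 1) + 2 = 7 * real n + 9" "real (n + 1) + 1 = real n + 2" "real (n + 1) = real n + 1"
      "2 * real (n + 2) + 1 = 2 * real n + 5" "2 * real (n + 2) + 2 = 2 * real n + 6" "2 * real (n + 2) + 3 = 2 * real n + 7"
      "7 * real (n + 2) + 2 = 7 * real n + 16" "real (n + 2) + 1 = real n + 3" "real (n + 2) = real n + 2"
      "2 * real (n + 3) + 1 = 2 * real n + 7" "2 * real (n + 3) + 2 = 2 * real n + 8" "2 * real (n + 3) + 3 = 2 * real n + 9"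
      "7 * real (n + 3) + 2 = 7 * real n + 23" "real (n + 3) + 1 = real n + 4" "real (n + 3) = real n + 3"
      by simp_all
    show "(2 * real n + 3) * (2 * real n + 4) * (2 * real n + 5) * tail_const (n + 1) = (7 * real n + 9) * (real n + 2) * f_seq (n + 1) + (9 * (real n + 1) / 2 + 3) * h_seq (n + 1)"
      using tail_const_eq[of "n + 1"] unfolding x(1-5) unfolding x(6) by simp
    show "(2 * real n + 5) * (2 * real n + 6) * (2 * real n + 7) * tail_const (n + 2) = (7 * real n + 16) * (real n + 3) * f_seq (n + 2) + (9 * (real n + 2) / 2 + 3) * h_seq (n + 2)"
      using tail_const_eq[of "n + 2"] unfolding x(7-11) unfolding x(12) by simp
    show "(2 * real n + 7) * (2 * real n + 8) * (2 * real n + 9) * tail_const (n + 3) = (7 * real n + 23) * (real n + 4) * f_seq (n + 3) + (9 * (real n + 3) / 2 + 3) * h_seq (n + 3)"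
      using tail_const_eq[of "n + 3"] unfolding x(13-17) unfolding x(18) by simp
  qed simp
qed

lemma b_seq_rec:
  assumes n: "1 \<le> n"
  shows "4 * (real n + 1)^2 * (real n + 2) * (2 * real n + 1) * (2 * real n + 3) * b_seq n
        - 20 * (real n + 2)^2 * (2 * real n + 3) * (2 * real n + 5)^2 * b_seq (n + 1)
        + 5 * (real n + 3) * (2 * real n + 5)^2 * (2 * real n + 7) * (14 * real n + 43) * b_seq (n + 2)
        - 2 * (real n + 4) * (2 * real n + 5) * (2 * real n + 7) * (2 * real n + 9)
            * (50 * real n + 181) * b_seq (n + 3)
        + 24 * (real n + 5) * (2 * real n + 5) * (2 * real n + 7) * (2 * real n + 9)
            * (2 * real n + 11) * b_seq (n + 4) = 0"
proof (rule relaxation_algebra)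
  show "0 \<le> real n" by simp
  show "(1 / 4) ^ (n + 1) = (1 / 4) ^ n / (4 :: real)" "(1 / 4) ^ (n + 2) = (1 / 4) ^ n / (16 :: real)"
    "(1 / 4) ^ (n + 3) = (1 / 4) ^ n / (64 :: real)" "(1 / 4) ^ (n + 4) = (1 / 4) ^ n / (256 :: real)"
    by (simp_all add: power_add power_divide)
  have x: "real n + 1 + 1 = real n + 2" "real n + 2 + 1 = real n + 3" "real n + 3 + 1 = real n + 4" by simp_all
  have r: "real (n + 1) = real n + 1" "real (n + 2) = real n + 2" "real (n + 3) = real n + 3" "real (n + 4) = real n + 4" by simp_all
  have s: "Suc n = n + 1" "Suc (n + 1) = n + 2" "Suc (n + 2) = n + 3" "Suc (n + 3) = n + 4" by simp_all
  have c: "2 * (real n + 1) + k = 2 * real n + (k + 2)" "2 * (real n + 2) + k = 2 * real n + (k + 4)"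
    "2 * (real n + 3) + k = 2 * real n + (k + 6)" "2 * (real n + 4) + k = 2 * real n + (k + 8)" for k
    by simp_all
  have e: "(2 * real k + 3) * e_seq (Suc k) = 2 * (real k + 1) / 3 * e_seq k + (1 / 4) ^ Suc k / 3" for k
    using e_rec[of k] by simp
  show "(2 * real n + 3) * e_seq (n + 1) = 2 * (real n + 1) / 3 * e_seq n + (1 / 4) ^ (n + 1) / 3"
    using e[of n] unfolding s .
  show "(2 * real n + 5) * e_seq (n + 2) = 2 * (real n + 2) / 3 * e_seq (n + 1) + (1 / 4) ^ (n + 2) / 3"
    using e[of "n + 1"] unfolding s r x c by simp
  show "(2 * real n + 7) * e_seq (n + 3) = 2 * (real n + 3) / 3 * e_seq (n + 2) + (1 / 4) ^ (n + 3) / 3"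
    using e[of "n + 2"] unfolding s r x c by simp
  show "(2 * real n + 9) * e_seq (n + 4) = 2 * (real n + 4) / 3 * e_seq (n + 3) + (1 / 4) ^ (n + 4) / 3"
    using e[of "n + 3"] unfolding s r x c by simp
  show "(2 * real n + 4) * c_seq (n + 1) = (real n + 1) * c_seq n + e_seq (n + 1) / 4"
    using c_rec[of n] unfolding s .
  show "(2 * real n + 6) * c_seq (n + 2) = (real n + 2) * c_seq (n + 1) + e_seq (n + 2) / 4"
    using c_rec[of "n + 1"] unfolding s r x c by simp
  show "(2 * real n + 8) * c_seq (n + 3) = (real n + 3) * c_seq (n + 2) + e_seq (n + 3) / 4"
    using c_rec[of "n + 2"] unfolding s r x c by simp
  show "(2 * real n + 10) * c_seq (n + 4) = (real n + 4) * c_seq (n + 3) + e_seq (n + 4) / 4"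
    using c_rec[of "n + 3"] unfolding s r x c by simp
  show "(2 * real n + 5) * k_seq (n + 1) = 2 * (real n + 1) * k_seq n + c_seq (n + 1)"
    using k_rec[of n] unfolding s .
  show "(2 * real n + 7) * k_seq (n + 2) = 2 * (real n + 2) * k_seq (n + 1) + c_seq (n + 2)"
    using k_rec[of "n + 1"] unfolding s r x c by simp
  show "(2 * real n + 9) * k_seq (n + 3) = 2 * (real n + 3) * k_seq (n + 2) + c_seq (n + 3)"
    using k_rec[of "n + 2"] unfolding s r x c by simp
  show "(2 * real n + 11) * k_seq (n + 4) = 2 * (real n + 4) * k_seq (n + 3) + c_seq (n + 4)"
    using k_rec[of "n + 3"] unfolding s r x c by simp
  show "12 * (2 * real n + 1) * (2 * real n + 2) * (2 * real n + 3) * (b_seq n / 6 - k_seq n) =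
    12 * (2 * real n + 1) * (2 * real n + 2) * c_seq n + 3 * (2 * real n + 1) * e_seq n + (1 / 4) ^ n"
    by (rule b_seq_eq[OF n])
  show "12 * (2 * real n + 3) * (2 * real n + 4) * (2 * real n + 5) * (b_seq (n + 1) / 6 - k_seq (n + 1)) =
    12 * (2 * real n + 3) * (2 * real n + 4) * c_seq (n + 1) + 3 * (2 * real n + 3) * e_seq (n + 1) + (1 / 4) ^ (n + 1)"
    using b_seq_eq[of "n + 1"] unfolding r c by simp
  show "12 * (2 * real n + 5) * (2 * real n + 6) * (2 * real n + 7) * (b_seq (n + 2) / 6 - k_seq (n + 2)) =
    12 * (2 * real n + 5) * (2 * real n + 6) * c_seq (n + 2) + 3 * (2 * real n + 5) * e_seq (n + 2) + (1 / 4) ^ (n + 2)"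
    using b_seq_eq[of "n + 2"] unfolding r c by simp
  show "12 * (2 * real n + 7) * (2 * real n + 8) * (2 * real n + 9) * (b_seq (n + 3) / 6 - k_seq (n + 3)) =
    12 * (2 * real n + 7) * (2 * real n + 8) * c_seq (n + 3) + 3 * (2 * real n + 7) * e_seq (n + 3) + (1 / 4) ^ (n + 3)"
    using b_seq_eq[of "n + 3"] unfolding r c by simp
  show "12 * (2 * real n + 9) * (2 * real n + 10) * (2 * real n + 11) * (b_seq (n + 4) / 6 - k_seq (n + 4)) =
    12 * (2 * real n + 9) * (2 * real n + 10) * c_seq (n + 4) + 3 * (2 * real n + 9) * e_seq (n + 4) + (1 / 4) ^ (n + 4)"
    using b_seq_eq[of "n + 4"] unfolding r c by simp
qed

theorem theorem21:
  shows
    "(\<forall>n\<ge>1.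
        - 4 * (real n + 1)^2 * (real n + 2) * (2 * real n + 1) * ((real n)^2 - real n - 7) * a_seq n
        + 2 * (real n + 2)^2 * (2 * real n + 5) * (9 * (real n)^3 - 90 * real n - 77) * a_seq (n + 1)
        - (real n + 3) * (2 * real n + 5) * (2 * real n + 7)
            * (13 * (real n)^3 + 2 * (real n)^2 - 164 * real n - 169) * a_seq (n + 2)
        + 3 * (real n + 4) * (2 * real n + 5) * (2 * real n + 7) * (2 * real n + 9)
            * ((real n)^2 - 3 * real n - 5) * a_seq (n + 3) = 0)
     \<and> (\<forall>n\<ge>1.
        4 * (real n + 1)^2 * (real n + 2) * (2 * real n + 1) * (2 * real n + 3) * b_seq n
        - 20 * (real n + 2)^2 * (2 * real n + 3) * (2 * real n + 5)^2 * b_seq (n + 1)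
        + 5 * (real n + 3) * (2 * real n + 5)^2 * (2 * real n + 7) * (14 * real n + 43) * b_seq (n + 2)
        - 2 * (real n + 4) * (2 * real n + 5) * (2 * real n + 7) * (2 * real n + 9)
            * (50 * real n + 181) * b_seq (n + 3)
        + 24 * (real n + 5) * (2 * real n + 5) * (2 * real n + 7) * (2 * real n + 9)
            * (2 * real n + 11) * b_seq (n + 4) = 0)"
  using a_seq_rec b_seq_rec by blast

end
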